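(* There exist a hyperelliptic surface with underlying smooth compact $4$-manifold $M$, a non-integrable almost complex structure $J$ on $M$, and a strictly locally conformally almost Kähler metric $\omega$ on $(M,J)$ such that $h^{1,1}_{BC}=b^-+1$.
   Context: A hyperelliptic surface is a compact complex surface which is not a complex torus and is a quotient of a product of two elliptic curves by a finite group acting freely, fibring over an elliptic curve with elliptic fibres; only its underlying smooth manifold is used. An almost Hermitian manifold $(M,J,g,\omega)$ of real dimension $2n$ is a manifold with an almost complex structure $J$, a Riemannian metric $g$ for which $J$ is an isometry, and the fundamental form $\omega(u,v)=g(Ju,v)$ (the metric is identified with $\omega$). The metric $\omega$ is strictly locally conformally almost Kähler if $d\omega=\theta\wedge\omega$ for a $1$-form $\theta$ which is $d$-closed but not $d$-exact. $A^{p,q}$ is the space of smooth complex $(p,q)$-forms with respect to $J$. The exterior differential decomposes on $A^{p,q}$ as $d=\mu+\partial+\bar\partial+\bar\mu$, with components of bidegree $(2,-1),(1,0),(0,1),(-1,2)$ respectively; $J$ is integrable if and only if $d=\partial+\bar\partial$. The volume form is $\mathrm{Vol}=\omega^n/n!$ (which fixes the orientation), and $*:A^{p,q}\to A^{n-q,n-p}$ is the $\mathbb{C}$-linear Hodge star, $\alpha\wedge *\bar\beta=\langle\alpha,\beta\rangle\mathrm{Vol}$, where $\langle\cdot,\cdot\rangle$ is the Hermitian inner product on forms induced by $g$. Set $\partial^*=-*\bar\partial*$ and $\bar\partial^*=-*\partial*$. The Bott-Chern Laplacian is $$\tilde\Delta_{BC}=\partial\bar\partial\bar\partial^*\partial^*+\bar\partial^*\partial^*\partial\bar\partial+\partial^*\bar\partial\bar\partial^*\partial+\bar\partial^*\partial\partial^*\bar\partial+\partial^*\partial+\bar\partial^*\bar\partial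 .$$ $\mathcal{H}^{p,q}_{BC}$ is the kernel of $\tilde\Delta_{BC}$ on $A^{p,q}$ and $h^{p,q}_{BC}=\dim_{\mathbb{C}}\mathcal{H}^{p,q}_{BC}$. For $2n=4$, $b^-$ is the real dimension of the space of real anti-self-dual harmonic 2-forms, $\{\alpha\in A^2:\Delta_d\alpha=0,\ *\alpha=-\alpha\}$, where $\Delta_d=dd^*+d^*d$ is the Hodge Laplacian, $d^*=-*d*$. *)

theory Defs
  imports
    "HOL-Analysis.Analysis"
    "HOL-Algebra.Bij"
    "HOL-Library.Function_Algebras"
begin

section \<open>Smooth and complex manifolds\<close>

text \<open>The functions below are only used on open sets \<open>S\<close>.\<close>

primrec C_k_on :: "nat \<Rightarrow> 'e::euclidean_space set \<Rightarrow> ('e \<Rightarrow> 'b::real_normed_vector) \<Rightarrow> bool" where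
  "C_k_on 0 S f \<longleftrightarrow> continuous_on S f"
| "C_k_on (Suc k) S f \<longleftrightarrow>
     (\<forall>x\<in>S. f differentiable (at x)) \<and>
     (\<forall>v. C_k_on k S (\<lambda>x. frechet_derivative f (at x) v))"

definition smooth_on :: "'e::euclidean_space set \<Rightarrow> ('e \<Rightarrow> 'b::real_normed_vector) \<Rightarrow> bool" where
  "smooth_on S f \<longleftrightarrow> (\<forall>k. C_k_on k S f)"

definition cholomorphic_on :: "(complex^'n) set \<Rightarrow> (complex^'n \<Rightarrow> complex^'m) \<Rightarrow> bool" where
  "cholomorphic_on S f \<longleftrightarrow>
     (\<forall>x\<in>S. \<exists>f'. (f has_derivative f') (at x) \<and> (\<forall>c v. f' (c *s v) = c *s f' v))"

text \<open>A chart \<open>(U, \<psi>)\<close> is given by its local parametrization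
  \<open>\<psi> : U \<rightarrow> M\<close>, that is, by the inverse of a coordinate map.\<close>

type_synonym ('a, 'e) chart = "'e set \<times> ('e \<Rightarrow> 'a)"

definition local_rep ::
    "('a, 'e) chart \<Rightarrow> ('b, 'f) chart \<Rightarrow> ('a \<Rightarrow> 'b) \<Rightarrow> 'e \<Rightarrow> 'f" where
  "local_rep c d f = (\<lambda>x. inv_into (fst d) (snd d) (f (snd c x)))"

definition local_dom ::
    "('a, 'e) chart \<Rightarrow> ('b, 'f) chart \<Rightarrow> ('a \<Rightarrow> 'b) \<Rightarrow> 'e set" where
  "local_dom c d f = {x \<in> fst c. f (snd c x) \<in> snd d ` fst d}"

definition topological_atlas ::
    "'a topology \<Rightarrow> ('a, 'e::euclidean_space) chart set \<Rightarrow> bool" where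
  "topological_atlas X A \<longleftrightarrow>
     (\<Union>c\<in>A. snd c ` fst c) = topspace X \<and>
     (\<forall>c\<in>A. open (fst c) \<and> openin X (snd c ` fst c) \<and>
        homeomorphic_map (top_of_set (fst c)) (subtopology X (snd c ` fst c)) (snd c))"

definition smooth_manifold ::
    "'a topology \<Rightarrow> ('a, 'e::euclidean_space) chart set \<Rightarrow> bool" where
  "smooth_manifold X A \<longleftrightarrow>
     Hausdorff_space X \<and> second_countable X \<and> topological_atlas X A \<and>
     (\<forall>c\<in>A. \<forall>d\<in>A. smooth_on (local_dom c d (\<lambda>p. p)) (local_rep c d (\<lambda>p. p)))"

definition complex_manifold ::
    "'a topology \<Rightarrow> ('a, complex^'n) chart set \<Rightarrow> bool" where
  "complex_manifold X A \<longleftrightarrow>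
     Hausdorff_space X \<and> second_countable X \<and> topological_atlas X A \<and>
     (\<forall>c\<in>A. \<forall>d\<in>A. cholomorphic_on (local_dom c d (\<lambda>p. p)) (local_rep c d (\<lambda>p. p)))"

definition holomorphic_map ::
    "'a topology \<Rightarrow> ('a, complex^'n) chart set \<Rightarrow> 'b topology \<Rightarrow> ('b, complex^'m) chart set
      \<Rightarrow> ('a \<Rightarrow> 'b) \<Rightarrow> bool" where
  "holomorphic_map X A Y B f \<longleftrightarrow>
     continuous_map X Y f \<and>
     (\<forall>c\<in>A. \<forall>d\<in>B. cholomorphic_on (local_dom c d f) (local_rep c d f))"

text \<open>Take \<open>P\<close> to be \<open>inj\<close>, \<open>surj\<close> or \<open>bij\<close>
  for immersions, submersions and local diffeomorphisms.\<close>

definition differential_everywhere ::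
    "(('e \<Rightarrow> 'f) \<Rightarrow> bool) \<Rightarrow> ('a, 'e::euclidean_space) chart set
      \<Rightarrow> ('b, 'f::euclidean_space) chart set \<Rightarrow> ('a \<Rightarrow> 'b) \<Rightarrow> bool" where
  "differential_everywhere P A B f \<longleftrightarrow>
     (\<forall>c\<in>A. \<forall>d\<in>B. \<forall>x\<in>local_dom c d f. P (frechet_derivative (local_rep c d f) (at x)))"

definition biholomorphic ::
    "'a topology \<Rightarrow> ('a, complex^'n) chart set \<Rightarrow> 'b topology \<Rightarrow> ('b, complex^'m) chart set \<Rightarrow> bool" where
  "biholomorphic X A Y B \<longleftrightarrow>
     (\<exists>f h. holomorphic_map X A Y B f \<and> holomorphic_map Y B X A h \<and>
        (\<forall>p\<in>topspace X. h (f p) = p) \<and> (\<forall>q\<in>topspace Y. f (h q) = q))"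


section \<open>Complex tori and hyperelliptic surfaces\<close>

definition full_lattice :: "'e::euclidean_space set \<Rightarrow> bool" where
  "full_lattice L \<longleftrightarrow>
     (\<exists>B. independent B \<and> span B = UNIV \<and>
        L = {(\<Sum>b\<in>B. of_int (k b) *\<^sub>R b) |k. (k :: 'e \<Rightarrow> int) \<in> UNIV})"

definition lattice_coset :: "'e::euclidean_space set \<Rightarrow> 'e \<Rightarrow> 'e set" where
  "lattice_coset L x = (\<lambda>l. x + l) ` L"

definition torus_topology :: "'e::euclidean_space set \<Rightarrow> 'e set topology" where
  "torus_topology L =
     topology (\<lambda>W. W \<subseteq> range (lattice_coset L) \<and> open {x. lattice_coset L x \<in> W})"

lemma openin_torus_topology:
  "openin (torus_topology L) W \<longleftrightarrow>
     W \<subseteq> range (lattice_coset L) \<and> open {x. lattice_coset L x \<in> W}"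
proof -
  let ?P = "\<lambda>W. W \<subseteq> range (lattice_coset L) \<and> open {x. lattice_coset L x \<in> W}"
  have "istopology ?P"
    unfolding istopology_def
  proof (intro conjI allI impI)
    fix S T assume "?P S" "?P T"
    then show "S \<inter> T \<subseteq> range (lattice_coset L)" by blast
    from \<open>?P S\<close> \<open>?P T\<close> have "open ({x. lattice_coset L x \<in> S} \<inter> {x. lattice_coset L x \<in> T})"
      by blast
    then show "open {x. lattice_coset L x \<in> S \<inter> T}" by (simp add: Int_def)
  next
    fix K assume K: "\<forall>S\<in>K. ?P S"
    then show "\<Union>K \<subseteq> range (lattice_coset L)" by blast
    have "open (\<Union>S\<in>K. {x. lattice_coset L x \<in> S})" using K by blast
    moreover have "(\<Union>S\<in>K. {x. lattice_coset L x \<in> S}) = {x. lattice_coset L x \<in> \<Union>K}" by blast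
    ultimately show "open {x. lattice_coset L x \<in> \<Union>K}" by simp
  qed
  then show ?thesis by (simp add: torus_topology_def topology_inverse')
qed

lemma topspace_torus_topology: "topspace (torus_topology L) = range (lattice_coset L)"
proof -
  have "openin (torus_topology L) (range (lattice_coset L))"
    by (simp add: openin_torus_topology)
  then show ?thesis
    by (metis openin_subset openin_topspace openin_torus_topology subset_antisym)
qed

definition torus_atlas :: "'e::euclidean_space set \<Rightarrow> ('e set, 'e) chart set" where
  "torus_atlas L = {(U, lattice_coset L) |U. open U \<and> inj_on (lattice_coset L) U}"

text \<open>An elliptic curve is \<open>\<complex>/\<Lambda>\<close>, with \<open>\<complex>\<close> written as
  \<^typ>\<open>complex^1\<close>. The product of \<open>\<complex>/\<Lambda>\<^sub>1\<close> and \<open>\<complex>/\<Lambda>\<^sub>2\<close> is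
  the torus \<open>\<complex>\<^sup>2/(\<Lambda>\<^sub>1 \<times> \<Lambda>\<^sub>2)\<close>.\<close>

definition product_lattice :: "(complex^1) set \<Rightarrow> (complex^1) set \<Rightarrow> (complex^2) set" where
  "product_lattice L1 L2 = {v. vec (v $ 1) \<in> L1 \<and> vec (v $ 2) \<in> L2}"

definition free_quotient_of_elliptic_product ::
    "'a topology \<Rightarrow> ('a, complex^2) chart set \<Rightarrow> bool" where
  "free_quotient_of_elliptic_product X A \<longleftrightarrow>
     (\<exists>L1 L2 T B G \<pi>. full_lattice L1 \<and> full_lattice L2 \<and>
        T = torus_topology (product_lattice L1 L2) \<and> B = torus_atlas (product_lattice L1 L2) \<and>
        subgroup G (BijGroup (topspace T)) \<and> finite G \<and>
        (\<forall>h\<in>G. holomorphic_map T B T B h) \<and>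
        (\<forall>h\<in>G. \<forall>t\<in>topspace T. h t = t \<longrightarrow> h = \<one>\<^bsub>BijGroup (topspace T)\<^esub>) \<and>
        holomorphic_map T B X A \<pi> \<and> differential_everywhere bij B A \<pi> \<and>
        \<pi> ` topspace T = topspace X \<and>
        (\<forall>s\<in>topspace T. \<forall>t\<in>topspace T. \<pi> s = \<pi> t \<longleftrightarrow> (\<exists>h\<in>G. h s = t)))"

definition elliptic_fibration_over_elliptic_curve ::
    "'a topology \<Rightarrow> ('a, complex^2) chart set \<Rightarrow> bool" where
  "elliptic_fibration_over_elliptic_curve X A \<longleftrightarrow>
     (\<exists>(L :: (complex^1) set) f. full_lattice L \<and>
        holomorphic_map X A (torus_topology L) (torus_atlas L) f \<and>
        differential_everywhere surj A (torus_atlas L) f \<and>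
        f ` topspace X = topspace (torus_topology L) \<and>
        (\<forall>q\<in>topspace (torus_topology L). \<exists>(K :: (complex^1) set) j. full_lattice K \<and>
           holomorphic_map (torus_topology K) (torus_atlas K) X A j \<and>
           differential_everywhere inj (torus_atlas K) A j \<and>
           inj_on j (topspace (torus_topology K)) \<and>
           j ` topspace (torus_topology K) = {p \<in> topspace X. f p = q}))"

definition hyperelliptic_surface :: "'a topology \<Rightarrow> ('a, complex^2) chart set \<Rightarrow> bool" where
  "hyperelliptic_surface X A \<longleftrightarrow>
     complex_manifold X A \<and> compact_space X \<and>
     \<not> (\<exists>L :: (complex^2) set. full_lattice L \<and>
          biholomorphic X A (torus_topology L) (torus_atlas L)) \<and>
     free_quotient_of_elliptic_product X A \<and>
     elliptic_fibration_over_elliptic_curve X A"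


section \<open>Exterior algebra of a real vector space with complex coefficients\<close>

text \<open>An element of the complexified exterior algebra (possibly of mixed degree) is represented
  by a function on lists of vectors; its restriction to lists of length \<open>k\<close> is its
  component of degree \<open>k\<close>.\<close>

type_synonym 'e covec = "'e list \<Rightarrow> complex"

definition exterior :: "('e::euclidean_space) covec set" where
  "exterior = {\<alpha>. \<forall>vs. (\<forall>i<length vs. linear (\<lambda>v. \<alpha> (vs[i := v]))) \<and>
                       (\<not> distinct vs \<longrightarrow> \<alpha> vs = 0)}"

definition has_degree :: "nat \<Rightarrow> 'e covec \<Rightarrow> bool" where
  "has_degree k \<alpha> \<longleftrightarrow> (\<forall>vs. length vs \<noteq> k \<longrightarrow> \<alpha> vs = 0)"

definition unit_covec :: "'e covec" where
  "unit_covec vs = (if vs = [] then 1 else 0)"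

text \<open>The wedge product as a sum over shuffles, so that
  \<open>(a \<and> b)(u,v) = a(u) b(v) - a(v) b(u)\<close> for covectors \<open>a\<close>, \<open>b\<close>.\<close>

definition wedge :: "'e covec \<Rightarrow> 'e covec \<Rightarrow> 'e covec" where
  "wedge \<alpha> \<beta> vs =
     (\<Sum>I\<in>Pow {..<length vs}.
        (-1) ^ card {(i, j). i \<in> I \<and> j \<in> {..<length vs} - I \<and> j < i} *
        \<alpha> (nths vs I) * \<beta> (nths vs (- I)))"

text \<open>\<open>of_bidegree J p q\<close> is the span of the products of \<open>p\<close> covectors of
  type \<open>(1,0)\<close> and \<open>q\<close> covectors of type \<open>(0,1)\<close>.\<close>

inductive of_bidegree :: "('e::euclidean_space \<Rightarrow> 'e) \<Rightarrow> nat \<Rightarrow> nat \<Rightarrow> 'e covec \<Rightarrow> bool"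
  for J where
  unit: "of_bidegree J 0 0 unit_covec"
| wedge10: "\<lbrakk>\<theta> \<in> exterior; has_degree 1 \<theta>; \<And>v. \<theta> [J v] = \<i> * \<theta> [v]; of_bidegree J p q \<alpha>\<rbrakk>
    \<Longrightarrow> of_bidegree J (Suc p) q (wedge \<theta> \<alpha>)"
| wedge01: "\<lbrakk>\<theta> \<in> exterior; has_degree 1 \<theta>; \<And>v. \<theta> [J v] = - \<i> * \<theta> [v]; of_bidegree J p q \<alpha>\<rbrakk>
    \<Longrightarrow> of_bidegree J p (Suc q) (wedge \<theta> \<alpha>)"
| zero: "of_bidegree J p q (\<lambda>vs. 0)"
| add: "\<lbrakk>of_bidegree J p q \<alpha>; of_bidegree J p q \<beta>\<rbrakk> \<Longrightarrow> of_bidegree J p q (\<lambda>vs. \<alpha> vs + \<beta> vs)"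
| scale: "of_bidegree J p q \<alpha> \<Longrightarrow> of_bidegree J p q (\<lambda>vs. z * \<alpha> vs)"

definition half_dim :: "'e::euclidean_space itself \<Rightarrow> nat" where
  "half_dim _ = DIM('e) div 2"

definition bidegree_part ::
    "('e::euclidean_space \<Rightarrow> 'e) \<Rightarrow> nat \<Rightarrow> nat \<Rightarrow> 'e covec \<Rightarrow> 'e covec" where
  "bidegree_part J p q \<alpha> =
     (THE \<beta>. \<exists>\<gamma>. (\<forall>r s. of_bidegree J r s (\<gamma> r s)) \<and> \<beta> = \<gamma> p q \<and>
        \<alpha> = (\<lambda>vs. \<Sum>r\<le>half_dim TYPE('e). \<Sum>s\<le>half_dim TYPE('e). \<gamma> r s vs))"

definition fundamental_covec ::
    "('e \<Rightarrow> 'e \<Rightarrow> real) \<Rightarrow> ('e \<Rightarrow> 'e) \<Rightarrow> 'e covec" where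
  "fundamental_covec g J vs = (if length vs = 2 then of_real (g (J (vs ! 0)) (vs ! 1)) else 0)"

definition volume_covec ::
    "('e::euclidean_space \<Rightarrow> 'e \<Rightarrow> real) \<Rightarrow> ('e \<Rightarrow> 'e) \<Rightarrow> 'e covec" where
  "volume_covec g J vs =
     (wedge (fundamental_covec g J) ^^ half_dim TYPE('e)) unit_covec vs / fact (half_dim TYPE('e))"

definition orthonormal_basis :: "('e::euclidean_space \<Rightarrow> 'e \<Rightarrow> real) \<Rightarrow> 'e set \<Rightarrow> bool" where
  "orthonormal_basis g B \<longleftrightarrow>
     finite B \<and> card B = DIM('e) \<and> (\<forall>u\<in>B. \<forall>v\<in>B. g u v = (if u = v then 1 else 0))"

text \<open>The Hermitian inner product for which distinct degrees are orthogonal and the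
  products \<open>e\<^sub>i\<^sub>1 \<and> \<dots> \<and> e\<^sub>i\<^sub>k\<close> with \<open>i\<^sub>1 < \<dots> < i\<^sub>k\<close>
  of an orthonormal coframe are orthonormal. It does not depend on the chosen basis.\<close>

definition inner_covec ::
    "('e::euclidean_space \<Rightarrow> 'e \<Rightarrow> real) \<Rightarrow> 'e covec \<Rightarrow> 'e covec \<Rightarrow> complex" where
  "inner_covec g \<alpha> \<beta> =
     (let B = (SOME B. orthonormal_basis g B) in
      \<Sum>k\<le>DIM('e). (1 / fact k) *
        (\<Sum>vs\<in>{vs. length vs = k \<and> set vs \<subseteq> B}. \<alpha> vs * cnj (\<beta> vs)))"

text \<open>Defined by \<open>\<alpha> \<and> *\<gamma> = \<langle>\<alpha>, cnj \<gamma>\<rangle> Vol\<close> in top degree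
  for all \<open>\<alpha>\<close>. As distinct degrees are orthogonal, this maps degree \<open>k\<close> to degree
  \<open>2n - k\<close> and agrees there with the usual star.\<close>

definition hodge_star ::
    "('e::euclidean_space \<Rightarrow> 'e \<Rightarrow> real) \<Rightarrow> ('e \<Rightarrow> 'e) \<Rightarrow> 'e covec \<Rightarrow> 'e covec" where
  "hodge_star g J \<gamma> =
     (THE \<eta>. \<eta> \<in> exterior \<and>
        (\<forall>\<alpha>\<in>exterior. \<forall>vs. length vs = DIM('e) \<longrightarrow>
           wedge \<alpha> \<eta> vs = inner_covec g \<alpha> (\<lambda>ws. cnj (\<gamma> ws)) * volume_covec g J vs))"


section \<open>Differential operators in a chart\<close>

type_synonym 'e lform = "'e \<Rightarrow> 'e covec"

definition ext_d :: "('e::euclidean_space) lform \<Rightarrow> 'e lform" where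
  "ext_d \<alpha> x vs =
     (\<Sum>i<length vs. (-1) ^ i *
        frechet_derivative (\<lambda>y. \<alpha> y (take i vs @ drop (Suc i) vs)) (at x) (vs ! i))"

definition del :: "('e::euclidean_space \<Rightarrow> 'e \<Rightarrow> 'e) \<Rightarrow> 'e lform \<Rightarrow> 'e lform" where
  "del J \<alpha> x vs =
     (\<Sum>p\<le>half_dim TYPE('e). \<Sum>q\<le>half_dim TYPE('e).
        bidegree_part (J x) (Suc p) q (ext_d (\<lambda>y. bidegree_part (J y) p q (\<alpha> y)) x) vs)"

definition delbar :: "('e::euclidean_space \<Rightarrow> 'e \<Rightarrow> 'e) \<Rightarrow> 'e lform \<Rightarrow> 'e lform" where
  "delbar J \<alpha> x vs =
     (\<Sum>p\<le>half_dim TYPE('e). \<Sum>q\<le>half_dim TYPE('e).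
        bidegree_part (J x) p (Suc q) (ext_d (\<lambda>y. bidegree_part (J y) p q (\<alpha> y)) x) vs)"

definition star ::
    "('e::euclidean_space \<Rightarrow> 'e \<Rightarrow> 'e \<Rightarrow> real) \<Rightarrow> ('e \<Rightarrow> 'e \<Rightarrow> 'e) \<Rightarrow> 'e lform \<Rightarrow> 'e lform" where
  "star g J \<alpha> x = hodge_star (g x) (J x) (\<alpha> x)"

definition d_adj ::
    "('e::euclidean_space \<Rightarrow> 'e \<Rightarrow> 'e \<Rightarrow> real) \<Rightarrow> ('e \<Rightarrow> 'e \<Rightarrow> 'e) \<Rightarrow> 'e lform \<Rightarrow> 'e lform" where
  "d_adj g J \<alpha> = - star g J (ext_d (star g J \<alpha>))"

definition del_adj ::
    "('e::euclidean_space \<Rightarrow> 'e \<Rightarrow> 'e \<Rightarrow> real) \<Rightarrow> ('e \<Rightarrow> 'e \<Rightarrow> 'e) \<Rightarrow> 'e lform \<Rightarrow> 'e lform" where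
  "del_adj g J \<alpha> = - star g J (delbar J (star g J \<alpha>))"

definition delbar_adj ::
    "('e::euclidean_space \<Rightarrow> 'e \<Rightarrow> 'e \<Rightarrow> real) \<Rightarrow> ('e \<Rightarrow> 'e \<Rightarrow> 'e) \<Rightarrow> 'e lform \<Rightarrow> 'e lform" where
  "delbar_adj g J \<alpha> = - star g J (del J (star g J \<alpha>))"

definition hodge_laplacian ::
    "('e::euclidean_space \<Rightarrow> 'e \<Rightarrow> 'e \<Rightarrow> real) \<Rightarrow> ('e \<Rightarrow> 'e \<Rightarrow> 'e) \<Rightarrow> 'e lform \<Rightarrow> 'e lform" where
  "hodge_laplacian g J \<alpha> = ext_d (d_adj g J \<alpha>) + d_adj g J (ext_d \<alpha>)"

definition bott_chern_laplacian ::
    "('e::euclidean_space \<Rightarrow> 'e \<Rightarrow> 'e \<Rightarrow> real) \<Rightarrow> ('e \<Rightarrow> 'e \<Rightarrow> 'e) \<Rightarrow> 'e lform \<Rightarrow> 'e lform" where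
  "bott_chern_laplacian g J \<alpha> =
     del J (delbar J (delbar_adj g J (del_adj g J \<alpha>))) +
     delbar_adj g J (del_adj g J (del J (delbar J \<alpha>))) +
     del_adj g J (delbar J (delbar_adj g J (del J \<alpha>))) +
     delbar_adj g J (del J (del_adj g J (delbar J \<alpha>))) +
     del_adj g J (del J \<alpha>) +
     delbar_adj g J (delbar J \<alpha>)"


section \<open>Forms, almost Hermitian structures and their invariants on a manifold\<close>

text \<open>A tensor field is a family of local expressions, one for each chart, which correspond to
  each other under the coordinate changes. Forms are extended by \<open>0\<close> outside the chart
  domains, so that equal forms are equal families.\<close>

type_synonym ('a, 'e) form = "('a, 'e) chart \<Rightarrow> 'e lform"
type_synonym ('a, 'e) endo_field = "('a, 'e) chart \<Rightarrow> 'e \<Rightarrow> 'e \<Rightarrow> 'e"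
type_synonym ('a, 'e) metric_field = "('a, 'e) chart \<Rightarrow> 'e \<Rightarrow> 'e \<Rightarrow> 'e \<Rightarrow> real"

abbreviation transition :: "('a, 'e) chart \<Rightarrow> ('a, 'e) chart \<Rightarrow> 'e \<Rightarrow> 'e" where
  "transition c d \<equiv> local_rep c d (\<lambda>p. p)"

abbreviation overlap :: "('a, 'e) chart \<Rightarrow> ('a, 'e) chart \<Rightarrow> 'e set" where
  "overlap c d \<equiv> local_dom c d (\<lambda>p. p)"

abbreviation Dtransition ::
    "('a, 'e::euclidean_space) chart \<Rightarrow> ('a, 'e) chart \<Rightarrow> 'e \<Rightarrow> 'e \<Rightarrow> 'e" where
  "Dtransition c d x \<equiv> frechet_derivative (transition c d) (at x)"

definition smooth_forms :: "('a, 'e::euclidean_space) chart set \<Rightarrow> ('a, 'e) form set" where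
  "smooth_forms A = {\<alpha>.
     (\<forall>c\<in>A. \<forall>x\<in>fst c. \<alpha> c x \<in> exterior) \<and>
     (\<forall>c\<in>A. \<forall>vs. smooth_on (fst c) (\<lambda>x. \<alpha> c x vs)) \<and>
     (\<forall>c\<in>A. \<forall>d\<in>A. \<forall>x\<in>overlap c d. \<forall>vs.
        \<alpha> c x vs = \<alpha> d (transition c d x) (map (Dtransition c d x) vs)) \<and>
     (\<forall>c x. \<not> (c \<in> A \<and> x \<in> fst c) \<longrightarrow> \<alpha> c x = 0)}"

definition real_k_forms :: "('a, 'e::euclidean_space) chart set \<Rightarrow> nat \<Rightarrow> ('a, 'e) form set" where
  "real_k_forms A k = {\<alpha> \<in> smooth_forms A. \<forall>c x. has_degree k (\<alpha> c x) \<and> range (\<alpha> c x) \<subseteq> \<real>}"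

definition pq_forms ::
    "('a, 'e::euclidean_space) chart set \<Rightarrow> ('a, 'e) endo_field \<Rightarrow> nat \<Rightarrow> nat \<Rightarrow> ('a, 'e) form set" where
  "pq_forms A J p q =
     {\<alpha> \<in> smooth_forms A. \<forall>c\<in>A. \<forall>x\<in>fst c. of_bidegree (J c x) p q (\<alpha> c x)}"

definition forms_eq ::
    "('a, 'e::euclidean_space) chart set \<Rightarrow> ('a, 'e) form \<Rightarrow> ('a, 'e) form \<Rightarrow> bool" where
  "forms_eq A \<alpha> \<beta> \<longleftrightarrow> (\<forall>c\<in>A. \<forall>x\<in>fst c. \<alpha> c x = \<beta> c x)"

definition almost_complex_structure ::
    "('a, 'e::euclidean_space) chart set \<Rightarrow> ('a, 'e) endo_field \<Rightarrow> bool" where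
  "almost_complex_structure A J \<longleftrightarrow>
     (\<forall>c\<in>A. \<forall>x\<in>fst c. linear (J c x) \<and> (\<forall>v. J c x (J c x v) = - v)) \<and>
     (\<forall>c\<in>A. \<forall>v. smooth_on (fst c) (\<lambda>x. J c x v)) \<and>
     (\<forall>c\<in>A. \<forall>d\<in>A. \<forall>x\<in>overlap c d. \<forall>v.
        Dtransition c d x (J c x v) = J d (transition c d x) (Dtransition c d x v))"

definition riemannian_metric ::
    "('a, 'e::euclidean_space) chart set \<Rightarrow> ('a, 'e) metric_field \<Rightarrow> bool" where
  "riemannian_metric A g \<longleftrightarrow>
     (\<forall>c\<in>A. \<forall>x\<in>fst c. bilinear (g c x) \<and>
        (\<forall>u v. g c x u v = g c x v u) \<and> (\<forall>v. v \<noteq> 0 \<longrightarrow> g c x v v > 0)) \<and>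
     (\<forall>c\<in>A. \<forall>u v. smooth_on (fst c) (\<lambda>x. g c x u v)) \<and>
     (\<forall>c\<in>A. \<forall>d\<in>A. \<forall>x\<in>overlap c d. \<forall>u v.
        g c x u v = g d (transition c d x) (Dtransition c d x u) (Dtransition c d x v))"

definition almost_hermitian ::
    "('a, 'e::euclidean_space) chart set \<Rightarrow> ('a, 'e) endo_field \<Rightarrow> ('a, 'e) metric_field \<Rightarrow> bool" where
  "almost_hermitian A J g \<longleftrightarrow>
     almost_complex_structure A J \<and> riemannian_metric A g \<and>
     (\<forall>c\<in>A. \<forall>x\<in>fst c. \<forall>u v. g c x (J c x u) (J c x v) = g c x u v)"

definition integrable_acs ::
    "('a, 'e::euclidean_space) chart set \<Rightarrow> ('a, 'e) endo_field \<Rightarrow> bool" where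
  "integrable_acs A J \<longleftrightarrow>
     (\<forall>\<alpha>\<in>smooth_forms A.
        forms_eq A (\<lambda>c. ext_d (\<alpha> c)) (\<lambda>c. del (J c) (\<alpha> c) + delbar (J c) (\<alpha> c)))"

definition fundamental_form ::
    "('a, 'e) metric_field \<Rightarrow> ('a, 'e) endo_field \<Rightarrow> ('a, 'e) form" where
  "fundamental_form g J c x = fundamental_covec (g c x) (J c x)"

definition strictly_lcaK ::
    "('a, 'e::euclidean_space) chart set \<Rightarrow> ('a, 'e) endo_field \<Rightarrow> ('a, 'e) metric_field \<Rightarrow> bool" where
  "strictly_lcaK A J g \<longleftrightarrow>
     almost_hermitian A J g \<and>
     (\<exists>\<theta>\<in>real_k_forms A 1.
        forms_eq A (\<lambda>c. ext_d (fundamental_form g J c))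
                   (\<lambda>c x. wedge (\<theta> c x) (fundamental_form g J c x)) \<and>
        forms_eq A (\<lambda>c. ext_d (\<theta> c)) 0 \<and>
        \<not> (\<exists>f\<in>real_k_forms A 0. forms_eq A (\<lambda>c. ext_d (f c)) \<theta>))"

definition bott_chern_harmonic ::
    "('a, 'e::euclidean_space) chart set \<Rightarrow> ('a, 'e) endo_field \<Rightarrow> ('a, 'e) metric_field
      \<Rightarrow> nat \<Rightarrow> nat \<Rightarrow> ('a, 'e) form set" where
  "bott_chern_harmonic A J g p q =
     {\<alpha> \<in> pq_forms A J p q. forms_eq A (\<lambda>c. bott_chern_laplacian (g c) (J c) (\<alpha> c)) 0}"

definition asd_harmonic ::
    "('a, 'e::euclidean_space) chart set \<Rightarrow> ('a, 'e) endo_field \<Rightarrow> ('a, 'e) metric_field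
      \<Rightarrow> ('a, 'e) form set" where
  "asd_harmonic A J g =
     {\<alpha> \<in> real_k_forms A 2.
        forms_eq A (\<lambda>c. hodge_laplacian (g c) (J c) (\<alpha> c)) 0 \<and>
        forms_eq A (\<lambda>c. star (g c) (J c) (\<alpha> c)) (- \<alpha>)}"

definition complex_scale :: "complex \<Rightarrow> ('a, 'e) form \<Rightarrow> ('a, 'e) form" where
  "complex_scale z \<alpha> = (\<lambda>c x vs. z * \<alpha> c x vs)"

definition real_scale :: "real \<Rightarrow> ('a, 'e) form \<Rightarrow> ('a, 'e) form" where
  "real_scale r \<alpha> = (\<lambda>c x vs. of_real r * \<alpha> c x vs)"

lemma vector_space_complex_scale: "vector_space complex_scale"
  by unfold_locales (auto simp: complex_scale_def fun_eq_iff algebra_simps)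

lemma vector_space_real_scale: "vector_space real_scale"
  by unfold_locales (auto simp: real_scale_def fun_eq_iff algebra_simps)

definition h_BC ::
    "('a, 'e::euclidean_space) chart set \<Rightarrow> ('a, 'e) endo_field \<Rightarrow> ('a, 'e) metric_field
      \<Rightarrow> nat \<Rightarrow> nat \<Rightarrow> nat" where
  "h_BC A J g p q = vector_space.dim complex_scale (bott_chern_harmonic A J g p q)"

definition b_minus ::
    "('a, 'e::euclidean_space) chart set \<Rightarrow> ('a, 'e) endo_field \<Rightarrow> ('a, 'e) metric_field \<Rightarrow> nat" where
  "b_minus A J g = vector_space.dim real_scale (asd_harmonic A J g)"

end

theory Submission imports Defs "HOL-Complex_Analysis.Complex_Analysis" "HOL-Combinatorics.Multiset_Permutations"
begin

text \<open>
  Write the points of \<open>\<complex>\<^sup>2\<close> as \<open>(w + \<i> z, x + \<i> y)\<close>. The surface is the quotient of the torus of periods \<open>2 \<pi>\<close>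
  by the free involution \<open>(w + \<i> z, x + \<i> y) \<mapsto> (w + \<pi> + \<i> z, - (x + \<i> y))\<close>. The metric is flat, and the almost complex
  structure sends \<open>dw\<close> to \<open>f1\<close> and \<open>f2\<close> to \<open>dz\<close>, where \<open>f1, f2\<close> is the frame \<open>dx, dy\<close> turned by the angle \<open>w\<close>. A half
  turn compensates the sign in the involution, so everything descends. The fundamental form
  \<open>\<omega> = dw \<and> f1 + f2 \<and> dz\<close> satisfies \<open>d\<omega> = - dz \<and> \<omega>\<close> (\<open>ext_d_omega\<close>); the Lee form \<open>- dz\<close> is closed and has a
  nonzero period. The structure is not integrable, because the (1,0)-covector \<open>dw + \<i> f1\<close> has a derivative with
  a nonzero (0,2)-component (\<open>not_integrable_X\<close>).

  Invariant forms on the universal cover replace forms on the surface, and integration over a period box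
  supplies the adjoints. Pairing the Bott-Chern Laplacian with a form \<open>\<alpha>\<close> shows that it vanishes only if \<open>\<partial>\<alpha>\<close>, \<open>\<partial>' \<alpha>\<close>
  and \<open>\<partial>'\<^sup>* \<partial>\<^sup>* \<alpha>\<close> vanish (\<open>bott_chern_kernel\<close>). A form of type (1,1) is \<open>f \<omega> + \<gamma>\<close> with \<open>\<gamma>\<close> anti-self-dual. The first two
  conditions say that it is closed, and then the third becomes \<open>\<Delta> f = \<partial> f / \<partial> z\<close> for the flat Laplacian
  (\<open>closed_11_double_adj\<close>). The drift term is skew-adjoint, so \<open>f\<close> is constant (\<open>laplace_drift_constant\<close>). The form
  \<open>2 dw \<and> f1\<close> is closed with \<open>f = 1\<close>; after subtracting a multiple of it, a closed anti-self-dual form remains. Its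
  coefficients are harmonic, hence constant (\<open>asd_closed_constant\<close>), and among the constant anti-self-dual forms the
  involution preserves just the multiples of \<open>dw \<and> dz - dx \<and> dy\<close>. Hence \<open>h\<^sup>1\<^sup>1 = 2\<close>, with one dimension for the
  constant \<open>f\<close> and \<open>b\<^sup>- = 1\<close> for the anti-self-dual part.

  A biholomorphism onto a torus \<open>\<complex>\<^sup>2 / L\<close> lifts locally, and the derivative of the lifts is a globally defined,
  doubly periodic function of each coordinate. Liouville's theorem makes its columns constant along their own
  coordinate lines, and the second column is constant altogether. The involution inverts the second coordinate,
  so this column equals its negative and the map is not injective (\<open>not_torus\<close>).

  Pointwise algebra is done in orthonormal frames: a form in dimension four is given by its values on sixteen
  increasing lists, the Hodge star is a signed permutation of them (\<open>hodge_star_table\<close>), and a bidegree is an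
  eigenvalue of the derivation induced by the almost complex structure (\<open>of_bidegree_iff\<close>).
\<close>

section \<open>Alternating multilinear functions on lists\<close>

text \<open>The axiom that a form vanishes on lists with a repeated entry is traded for antisymmetry under
  neighbouring swaps, which survives prefixing a vector and so suits induction on lists.\<close>

lemma exterior_iff:
  "\<alpha> \<in> exterior \<longleftrightarrow>
     (\<forall>xs ys. linear (\<lambda>v. \<alpha> (xs @ v # ys))) \<and>
     (\<forall>xs u v ys. \<alpha> (xs @ u # v # ys) = - \<alpha> (xs @ v # u # ys))"
  (is "?L \<longleftrightarrow> ?lin \<and> ?swap")
proof
  assume L: ?L
  have lin: ?lin
  proof (intro allI)
    fix xs ys :: "'a list"
    have "linear (\<lambda>v. \<alpha> ((xs @ 0 # ys)[length xs := v]))"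
      using L unfolding exterior_def mem_Collect_eq
      by (elim allE[of _ "xs @ 0 # ys"] conjE allE[of _ "length xs"]) simp
    then show "linear (\<lambda>v. \<alpha> (xs @ v # ys))" by simp
  qed
  have z: "\<alpha> (xs @ u # u # ys) = 0" for xs u ys
    using L unfolding exterior_def by simp
  have ?swap
  proof (intro allI)
    fix xs ys :: "'a list" and u v
    have l1: "\<alpha> (xs @ (a + b) # ys) = \<alpha> (xs @ a # ys) + \<alpha> (xs @ b # ys)" for xs ys a b
      by (rule linear_add[OF lin[rule_format]])
    have l2: "\<alpha> (xs @ c # (a + b) # ys) = \<alpha> (xs @ c # a # ys) + \<alpha> (xs @ c # b # ys)" for a b c
      using l1[of "xs @ [c]"] by simp
    have "0 = \<alpha> (xs @ (u + v) # (u + v) # ys)" by (simp add: z)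
    also have "\<dots> = \<alpha> (xs @ u # v # ys) + \<alpha> (xs @ v # u # ys)"
      by (simp only: l1 l2) (simp add: z)
    finally show "\<alpha> (xs @ u # v # ys) = - \<alpha> (xs @ v # u # ys)"
      by (simp add: eq_neg_iff_add_eq_0)
  qed
  with lin show "?lin \<and> ?swap" ..
next
  assume R: "?lin \<and> ?swap"
  have swap: "\<alpha> (xs @ u # v # ys) = - \<alpha> (xs @ v # u # ys)" for xs u v ys
    by (rule R[THEN conjunct2, rule_format])
  have zero: "\<alpha> (xs @ u # ys @ u # zs) = 0" for xs u ys zs
  proof (induction ys arbitrary: xs)
    case Nil
    then show ?case using swap[of xs u u zs] by simp
  next
    case (Cons y ys)
    have "\<alpha> (xs @ u # y # ys @ u # zs) = - \<alpha> ((xs @ [y]) @ u # ys @ u # zs)"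
      using swap[of xs u y] by simp
    also have "\<dots> = 0" using Cons[of "xs @ [y]"] by simp
    finally show ?case by simp
  qed
  have "\<alpha> vs = 0" if nd: "\<not> distinct vs" for vs
  proof -
    obtain xs ys zs u where "vs = xs @ [u] @ ys @ [u] @ zs" using not_distinct_decomp[OF nd] by blast
    then show ?thesis using zero[of xs u ys zs] by simp
  qed
  moreover have "linear (\<lambda>v. \<alpha> (vs[i := v]))" if "i < length vs" for vs i
    using conjunct1[OF R] that by (simp add: upd_conv_take_nth_drop)
  ultimately show ?L unfolding exterior_def by blast
qed

lemma exterior_linear: "\<alpha> \<in> exterior \<Longrightarrow> linear (\<lambda>v. \<alpha> (xs @ v # ys))"
  by (rule exterior_iff[THEN iffD1, THEN conjunct1, rule_format])

lemma exterior_swap: "\<alpha> \<in> exterior \<Longrightarrow> \<alpha> (xs @ u # v # ys) = - \<alpha> (xs @ v # u # ys)"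
  by (rule exterior_iff[THEN iffD1, THEN conjunct2, rule_format])

lemma exteriorI:
  assumes "\<And>xs ys. linear (\<lambda>v. \<alpha> (xs @ v # ys))"
    and "\<And>xs u v ys. \<alpha> (xs @ u # v # ys) = - \<alpha> (xs @ v # u # ys)"
  shows "\<alpha> \<in> exterior"
  by (rule exterior_iff[THEN iffD2]) (intro conjI allI assms)

lemma exterior_linear_hd: "\<alpha> \<in> exterior \<Longrightarrow> linear (\<lambda>v. \<alpha> (v # ys))"
  using exterior_linear[of \<alpha> "[]"] by simp

lemma exterior_swap_hd: "\<alpha> \<in> exterior \<Longrightarrow> \<alpha> (u # v # ys) = - \<alpha> (v # u # ys)"
  using exterior_swap[of \<alpha> "[]" u v ys] by simp

lemma exterior_nondistinct: "\<alpha> \<in> exterior \<Longrightarrow> \<not> distinct vs \<Longrightarrow> \<alpha> vs = 0"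
  by (simp add: exterior_def)

lemma exterior_Cons:
  assumes "\<alpha> \<in> exterior"
  shows "(\<lambda>us. \<alpha> (v # us)) \<in> exterior"
proof (rule exteriorI)
  fix xs ys :: "'a list" and u w
  show "linear (\<lambda>w. \<alpha> (v # xs @ w # ys))"
    using exterior_linear[OF assms, of "v # xs" ys] by simp
  show "\<alpha> (v # xs @ u # w # ys) = - \<alpha> (v # xs @ w # u # ys)"
    using exterior_swap[OF assms, of "v # xs" u w ys] by simp
qed

lemma exterior_zero [simp]: "(\<lambda>vs. 0) \<in> exterior" "0 \<in> exterior"
  by (auto intro!: exteriorI simp: linear_zero)

lemma exterior_add: "\<alpha> \<in> exterior \<Longrightarrow> \<beta> \<in> exterior \<Longrightarrow> (\<lambda>vs. \<alpha> vs + \<beta> vs) \<in> exterior"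
proof (rule exteriorI)
  fix xs ys :: "'a list" and u v
  assume a: "\<alpha> \<in> exterior" "\<beta> \<in> exterior"
  show "linear (\<lambda>v. \<alpha> (xs @ v # ys) + \<beta> (xs @ v # ys))"
    using a by (intro linear_compose_add exterior_linear)
  show "\<alpha> (xs @ u # v # ys) + \<beta> (xs @ u # v # ys) = - (\<alpha> (xs @ v # u # ys) + \<beta> (xs @ v # u # ys))"
    by (simp add: exterior_swap[OF a(1), of xs u v] exterior_swap[OF a(2), of xs u v])
qed

lemma linear_cmult: "linear f \<Longrightarrow> linear (\<lambda>v. (z::complex) * f v)"
  by (simp add: linear_iff algebra_simps)

lemma exterior_cmult_length:
  assumes "\<alpha> \<in> exterior"
  shows "(\<lambda>vs. k (length vs) * \<alpha> vs) \<in> exterior"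
proof (rule exteriorI)
  fix xs ys :: "'a list" and u v
  show "linear (\<lambda>v. k (length (xs @ v # ys)) * \<alpha> (xs @ v # ys))"
    using linear_cmult[OF exterior_linear[OF assms]] by simp
  show "k (length (xs @ u # v # ys)) * \<alpha> (xs @ u # v # ys) = - (k (length (xs @ v # u # ys)) * \<alpha> (xs @ v # u # ys))"
    by (simp add: exterior_swap[OF assms, of xs u v])
qed

lemma exterior_scale: "\<alpha> \<in> exterior \<Longrightarrow> (\<lambda>vs. z * \<alpha> vs) \<in> exterior"
  by (rule exterior_cmult_length)

lemma exterior_sum: "(\<And>i. i \<in> I \<Longrightarrow> \<alpha> i \<in> exterior) \<Longrightarrow> (\<lambda>vs. \<Sum>i\<in>I. \<alpha> i vs) \<in> exterior"
  by (induction I rule: infinite_finite_induct) (auto intro: exterior_add)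

lemma exterior_uminus: "\<alpha> \<in> exterior \<Longrightarrow> (\<lambda>vs. - \<alpha> vs) \<in> exterior"
  using exterior_scale[of \<alpha> "-1"] by simp

lemma exterior_diff: "\<alpha> \<in> exterior \<Longrightarrow> \<beta> \<in> exterior \<Longrightarrow> (\<lambda>vs. \<alpha> vs - \<beta> vs) \<in> exterior"
  using exterior_add[OF _ exterior_uminus, of \<alpha> \<beta>] by simp

lemma linear_cnj: "linear f \<Longrightarrow> linear (\<lambda>v. cnj (f v))"
  by (simp add: linear_iff)

lemma exterior_cnj: "\<alpha> \<in> exterior \<Longrightarrow> (\<lambda>vs. cnj (\<alpha> vs)) \<in> exterior"
  by (rule exteriorI) (rule linear_cnj[OF exterior_linear], assumption, metis exterior_swap complex_cnj_minus)

lemma exterior_move: "\<alpha> \<in> exterior \<Longrightarrow> \<alpha> (xs @ v # ys) = (-1) ^ length xs * \<alpha> (v # xs @ ys)"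
proof (induction xs arbitrary: \<alpha>)
  case (Cons x xs)
  have "\<alpha> (x # xs @ v # ys) = (-1) ^ length xs * \<alpha> (x # v # xs @ ys)"
    using Cons.IH[OF exterior_Cons[OF Cons.prems, of x]] by simp
  then show ?case using exterior_swap_hd[OF Cons.prems, of x v] by simp
qed simp

text \<open>The sign is chosen before the form, so that one sorting compares the values of several forms
  at once.\<close>

lemma exterior_perm:
  assumes "mset xs = mset ys"
  shows "\<exists>s::complex. (s = 1 \<or> s = -1) \<and> (\<forall>\<alpha>\<in>exterior. \<alpha> xs = s * \<alpha> ys)"
  using assms
proof (induction xs arbitrary: ys)
  case Nil
  then show ?case by (intro exI[of _ 1]) simp
next
  case (Cons v xs)
  from Cons.prems have "v \<in> set ys" by (metis list.set_intros(1) set_mset_mset)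
  then obtain as bs where ys: "ys = as @ v # bs" by (metis split_list)
  with Cons.prems have "mset xs = mset (as @ bs)" by simp
  from Cons.IH[OF this] obtain s :: complex where s: "s = 1 \<or> s = -1"
    and sp: "\<forall>\<alpha>\<in>exterior. \<alpha> xs = s * \<alpha> (as @ bs)" by blast
  have "\<alpha> (v # xs) = (s * (-1) ^ length as) * \<alpha> ys" if "\<alpha> \<in> exterior" for \<alpha>
  proof -
    have "\<alpha> (v # xs) = s * \<alpha> (v # as @ bs)" by (rule bspec[OF sp exterior_Cons[OF that, of v]])
    also have "\<alpha> (v # as @ bs) = (-1) ^ length as * \<alpha> ys"
      unfolding ys exterior_move[OF that] by (simp flip: mult.assoc power_mult_distrib)
    finally show ?thesis by simp
  qed
  moreover have "s * (-1) ^ length as = 1 \<or> s * (-1) ^ length as = -1"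
    using s by (cases "even (length as)") auto
  ultimately show ?case by blast
qed

lemma exterior_zero_on_spanning:
  assumes "\<alpha> \<in> exterior" "span B = UNIV" "\<And>vs. set vs \<subseteq> B \<Longrightarrow> \<alpha> vs = 0"
  shows "\<alpha> vs = 0"
  using assms(1,3)
proof (induction vs arbitrary: \<alpha>)
  case (Cons v vs)
  have "\<alpha> (b # vs) = 0" if "b \<in> B" for b
    using Cons.IH[OF exterior_Cons[OF Cons.prems(1), of b]] Cons.prems(2) that by simp
  then show ?case
    using linear_eq_0_on_span[where f = "\<lambda>v. \<alpha> (v # vs)" and b = B and x = v] exterior_linear_hd[OF Cons.prems(1), of vs]
    by (simp add: assms(2))
qed simp

section \<open>Wedge products\<close>

lemma wedge_Nil [simp]: "wedge \<alpha> \<beta> [] = \<alpha> [] * \<beta> []"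
  by (simp add: wedge_def)

text \<open>The subsets of positions split according to the factor which receives the first vector; if the
  second factor does, the vector passes all vectors of the first factor. This recursion replaces the sum
  over shuffles in every later induction.\<close>

lemma wedge_Cons:
  "wedge \<alpha> \<beta> (v # vs) =
     wedge (\<lambda>us. \<alpha> (v # us)) \<beta> vs + wedge (\<lambda>us. (-1) ^ length us * \<alpha> us) (\<lambda>us. \<beta> (v # us)) vs"
proof -
  let ?n = "length vs"
  let ?c = "\<lambda>n I. card {(i, j). i \<in> I \<and> j \<in> {..<n} - I \<and> j < i}"
  let ?f = "\<lambda>I. (-1) ^ ?c (Suc ?n) I * \<alpha> (nths (v # vs) I) * \<beta> (nths (v # vs) (- I))"
  have fin: "finite {(i, j). i \<in> I \<and> j \<in> {..<n} - I \<and> j < i}" if "I \<subseteq> {..<n}" for I and n :: nat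
    by (rule finite_subset[of _ "{..<n} \<times> {..<n}"]) (use that in auto)
  have Pow: "Pow {..<Suc ?n} = (`) Suc ` Pow {..<?n} \<union> (\<lambda>I. insert 0 (Suc ` I)) ` Pow {..<?n}"
    by (simp only: lessThan_Suc_eq_insert_0 Pow_insert image_Pow_surj[OF refl, symmetric] image_image)
  have disj: "(`) Suc ` Pow {..<?n} \<inter> (\<lambda>I. insert 0 (Suc ` I)) ` Pow {..<?n} = {}" by auto
  have inj1: "inj_on ((`) Suc) (Pow {..<?n})"
    by (simp add: inj_on_image inj_on_def inj_image_eq_iff)
  have inj2: "inj_on (\<lambda>I. insert 0 (Suc ` I)) (Pow {..<?n})"
  proof (rule inj_onI)
    fix I J assume "insert 0 (Suc ` I) = insert 0 (Suc ` J)"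
    then have "Suc ` I = Suc ` J" by (metis Diff_insert_absorb image_iff nat.distinct(1))
    then show "I = J" by (simp add: inj_image_eq_iff)
  qed
  have c1: "?c (Suc ?n) (insert 0 (Suc ` I)) = ?c ?n I" if "I \<subseteq> {..<?n}" for I
  proof -
    have "{(i, j). i \<in> insert 0 (Suc ` I) \<and> j \<in> {..<Suc ?n} - insert 0 (Suc ` I) \<and> j < i}
        = map_prod Suc Suc ` {(i, j). i \<in> I \<and> j \<in> {..<?n} - I \<and> j < i}" (is "?A = ?g ` ?B")
    proof
      show "?A \<subseteq> ?g ` ?B"
      proof
        fix p assume "p \<in> ?A"
        then obtain i j where p: "p = (i, j)" "i \<in> insert 0 (Suc ` I)" "j < Suc ?n"
          "j \<notin> insert 0 (Suc ` I)" "j < i" by auto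
        then obtain j' where "j = Suc j'" by (cases j) auto
        moreover from p obtain i' where "i = Suc i'" "i' \<in> I" by auto
        ultimately show "p \<in> ?g ` ?B" using p by (intro image_eqI[of _ _ "(i', j')"]) auto
      qed
    qed auto
    then show ?thesis by (simp add: card_image inj_on_def)
  qed
  have c0: "?c (Suc ?n) (Suc ` I) = ?c ?n I + card I" if "I \<subseteq> {..<?n}" for I
  proof -
    have "{(i, j). i \<in> Suc ` I \<and> j \<in> {..<Suc ?n} - Suc ` I \<and> j < i}
        = map_prod Suc Suc ` {(i, j). i \<in> I \<and> j \<in> {..<?n} - I \<and> j < i} \<union> (\<lambda>i. (Suc i, 0)) ` I"
      (is "?A = ?g ` ?B \<union> ?h ` I")
    proof
      show "?A \<subseteq> ?g ` ?B \<union> ?h ` I"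
      proof
        fix p assume "p \<in> ?A"
        then obtain i j where p: "p = (Suc i, j)" "i \<in> I" "j < Suc ?n" "j \<notin> Suc ` I" "j < Suc i"
          by auto
        then show "p \<in> ?g ` ?B \<union> ?h ` I" by (cases j) (auto simp: image_iff)
      qed
    qed auto
    moreover have "card (?g ` ?B \<union> ?h ` I) = card (?g ` ?B) + card (?h ` I)"
      by (rule card_Un_disjoint) (use fin[OF that] that finite_subset in auto)
    moreover have "card (?g ` ?B) = card ?B" "card (?h ` I) = card I"
      by (simp_all add: card_image inj_on_def)
    ultimately show ?thesis by simp
  qed
  have n1: "nths (v # vs) (insert 0 (Suc ` I)) = v # nths vs I"
    "nths (v # vs) (- insert 0 (Suc ` I)) = nths vs (- I)"
    "nths (v # vs) (Suc ` I) = nths vs I"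
    "nths (v # vs) (- (Suc ` I)) = v # nths vs (- I)" for I
    by (simp_all add: nths_Cons image_iff Compl_eq) (metis (mono_tags, lifting))+
  have ln: "length (nths vs I) = card I" if "I \<subseteq> {..<?n}" for I
  proof -
    have "{i. i < ?n \<and> i \<in> I} = I" using that by auto
    then show ?thesis by (simp add: length_nths)
  qed
  have "wedge \<alpha> \<beta> (v # vs) = (\<Sum>I\<in>Pow {..<Suc ?n}. ?f I)" by (simp add: wedge_def)
  also have "\<dots> = (\<Sum>I\<in>Pow {..<?n}. ?f (Suc ` I)) + (\<Sum>I\<in>Pow {..<?n}. ?f (insert 0 (Suc ` I)))"
    unfolding Pow
    by (subst sum.union_disjoint) (use disj in \<open>auto simp: sum.reindex[OF inj1] sum.reindex[OF inj2]\<close>)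
  also have "(\<Sum>I\<in>Pow {..<?n}. ?f (insert 0 (Suc ` I))) = wedge (\<lambda>us. \<alpha> (v # us)) \<beta> vs"
    unfolding wedge_def by (intro sum.cong refl) (simp only: PowD c1 n1)
  also have "(\<Sum>I\<in>Pow {..<?n}. ?f (Suc ` I))
      = wedge (\<lambda>us. (-1) ^ length us * \<alpha> us) (\<lambda>us. \<beta> (v # us)) vs"
    unfolding wedge_def by (intro sum.cong refl) (simp only: PowD c0 n1, simp add: ln power_add)
  finally show ?thesis by simp
qed

lemma wedge_add_left: "wedge (\<lambda>us. \<alpha> us + \<alpha>' us) \<beta> vs = wedge \<alpha> \<beta> vs + wedge \<alpha>' \<beta> vs"
  and wedge_add_right: "wedge \<alpha> (\<lambda>us. \<beta> us + \<beta>' us) vs = wedge \<alpha> \<beta> vs + wedge \<alpha> \<beta>' vs"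
  and wedge_scale_left: "wedge (\<lambda>us. z * \<alpha> us) \<beta> vs = z * wedge \<alpha> \<beta> vs"
  and wedge_scale_right: "wedge \<alpha> (\<lambda>us. z * \<beta> us) vs = z * wedge \<alpha> \<beta> vs"
  by (simp_all add: wedge_def algebra_simps sum.distrib sum_distrib_left)

lemma wedge_uminus_left: "wedge (\<lambda>us. - \<alpha> us) \<beta> vs = - wedge \<alpha> \<beta> vs"
  and wedge_uminus_right: "wedge \<alpha> (\<lambda>us. - \<beta> us) vs = - wedge \<alpha> \<beta> vs"
  by (simp_all add: wedge_def sum_negf)

lemma wedge_zero_left [simp]: "wedge (\<lambda>us. 0) \<beta> vs = 0"
  and wedge_zero_right [simp]: "wedge \<alpha> (\<lambda>us. 0) vs = 0"
  by (simp_all add: wedge_def)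

lemma exterior_sign: "\<alpha> \<in> exterior \<Longrightarrow> (\<lambda>us. (-1) ^ length us * \<alpha> us) \<in> exterior"
  by (rule exterior_cmult_length)

lemma exterior_wedge:
  assumes "\<alpha> \<in> exterior" "\<beta> \<in> exterior"
  shows "wedge \<alpha> \<beta> \<in> exterior"
proof -
  have lin: "linear (\<lambda>v. wedge \<alpha> \<beta> (xs @ v # ys))" if "\<alpha> \<in> exterior" "\<beta> \<in> exterior" for xs ys \<alpha> \<beta>
    using that
  proof (induction xs arbitrary: \<alpha> \<beta>)
    case Nil
    have a: "\<alpha> ((u + v) # us) = \<alpha> (u # us) + \<alpha> (v # us)"
      "\<beta> ((u + v) # us) = \<beta> (u # us) + \<beta> (v # us)"
      "\<alpha> ((c *\<^sub>R u) # us) = of_real c * \<alpha> (u # us)"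
      "\<beta> ((c *\<^sub>R u) # us) = of_real c * \<beta> (u # us)" for u v us c
      using exterior_linear_hd[OF Nil(1), of us] exterior_linear_hd[OF Nil(2), of us]
      by (auto simp: linear_iff scaleR_conv_of_real)
    show ?case
      by (rule linearI)
        (simp_all add: wedge_Cons a wedge_add_left wedge_add_right wedge_scale_left
          wedge_scale_right algebra_simps scaleR_conv_of_real)
  next
    case (Cons x xs)
    show ?case
      using Cons.IH[OF exterior_Cons[OF Cons.prems(1), of x] Cons.prems(2)]
        Cons.IH[OF exterior_sign[OF Cons.prems(1)] exterior_Cons[OF Cons.prems(2), of x]]
      by (simp add: wedge_Cons linear_compose_add)
  qed
  have swap: "wedge \<alpha> \<beta> (xs @ u # v # ys) = - wedge \<alpha> \<beta> (xs @ v # u # ys)"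
    if "\<alpha> \<in> exterior" "\<beta> \<in> exterior" for xs ys u v \<alpha> \<beta>
    using that
  proof (induction xs arbitrary: \<alpha> \<beta>)
    case Nil
    have a: "\<alpha> (u # v # us) = - \<alpha> (v # u # us)" "\<beta> (u # v # us) = - \<beta> (v # u # us)" for us
      by (simp_all add: exterior_swap_hd[OF Nil(1), of u v] exterior_swap_hd[OF Nil(2), of u v])
    show ?case
      by (simp add: wedge_Cons a wedge_uminus_left wedge_uminus_right)
  next
    case (Cons x xs)
    show ?case
      using Cons.IH[OF exterior_Cons[OF Cons.prems(1), of x] Cons.prems(2)]
        Cons.IH[OF exterior_sign[OF Cons.prems(1)] exterior_Cons[OF Cons.prems(2), of x]]
      by (simp add: wedge_Cons)
  qed
  show ?thesis by (rule exteriorI) (use lin swap assms in blast)+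
qed

lemma has_degree_Cons: "has_degree (Suc k) \<alpha> \<Longrightarrow> has_degree k (\<lambda>us. \<alpha> (v # us))"
  by (simp add: has_degree_def)

lemma wedge_degree_0: "has_degree 0 \<theta> \<Longrightarrow> wedge \<theta> \<beta> vs = \<theta> [] * \<beta> vs"
proof (induction vs arbitrary: \<theta> \<beta>)
  case (Cons v vs)
  have "(\<lambda>us. \<theta> (v # us)) = (\<lambda>us. 0)" using Cons.prems by (auto simp: has_degree_def)
  moreover have "has_degree 0 (\<lambda>us. (-1) ^ length us * \<theta> us)" using Cons.prems by (auto simp: has_degree_def)
  ultimately show ?case by (simp add: wedge_Cons Cons.IH)
qed simp

lemma wedge_degree_1_Cons:
  assumes "has_degree 1 \<theta>"
  shows "wedge \<theta> \<beta> (v # vs) = \<theta> [v] * \<beta> vs - wedge \<theta> (\<lambda>us. \<beta> (v # us)) vs"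
proof -
  have "has_degree 0 (\<lambda>us. \<theta> (v # us))" using assms has_degree_Cons[of 0 \<theta>] by simp
  moreover have "(-1) ^ length us * \<theta> us = - \<theta> us" for us
    using assms by (cases "length us = 1") (auto simp: has_degree_def)
  ultimately show ?thesis by (simp add: wedge_Cons wedge_degree_0 wedge_uminus_left)
qed

lemma has_degree_wedge_1: "has_degree 1 \<theta> \<Longrightarrow> has_degree k \<beta> \<Longrightarrow> has_degree (Suc k) (wedge \<theta> \<beta>)"
  unfolding has_degree_def[of "Suc k"]
proof safe
  fix vs :: "'a list"
  assume "has_degree 1 \<theta>" "has_degree k \<beta>" "length vs \<noteq> Suc k"
  then show "wedge \<theta> \<beta> vs = 0"
  proof (induction vs arbitrary: k \<beta>)
    case Nil
    then show ?case by (simp add: has_degree_def)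
  next
    case (Cons v vs)
    have "wedge \<theta> (\<lambda>us. \<beta> (v # us)) vs = 0"
    proof (cases k)
      case 0
      then have "(\<lambda>us. \<beta> (v # us)) = (\<lambda>us. 0)" using Cons.prems by (auto simp: has_degree_def)
      then show ?thesis by simp
    next
      case (Suc k')
      show ?thesis
        by (rule Cons.IH[of k']) (use Cons.prems Suc in \<open>auto simp: has_degree_def\<close>)
    qed
    moreover have "\<beta> vs = 0" using Cons.prems by (auto simp: has_degree_def)
    ultimately show ?case by (simp add: wedge_degree_1_Cons[OF Cons.prems(1)])
  qed
qed

lemma exterior_unit [simp]: "unit_covec \<in> exterior"
  by (rule exteriorI) (auto simp: unit_covec_def linear_zero)

lemma has_degree_unit [simp]: "has_degree 0 unit_covec"
  by (auto simp: has_degree_def unit_covec_def)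

section \<open>Covectors, alternation and the derivation induced by an endomorphism\<close>

definition cov :: "('e::euclidean_space \<Rightarrow> complex) \<Rightarrow> 'e covec" where
  "cov f vs = (if length vs = 1 then f (hd vs) else 0)"

lemma has_degree_cov [simp]: "has_degree 1 (cov f)" "has_degree (Suc 0) (cov f)"
  by (auto simp: has_degree_def cov_def)

lemma cov_single [simp]: "cov f [v] = f v" and cov_Nil [simp]: "cov f [] = 0"
  and cov_Cons2 [simp]: "cov f (u # v # vs) = 0"
  by (simp_all add: cov_def)

lemma exterior_cov: "linear f \<Longrightarrow> cov f \<in> exterior"
proof (rule exteriorI)
  fix xs ys :: "'a list" and u v
  assume "linear f"
  show "linear (\<lambda>v. cov f (xs @ v # ys))"
    by (cases "xs = [] \<and> ys = []") (auto simp: cov_def linear_zero \<open>linear f\<close>)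
  show "cov f (xs @ u # v # ys) = - cov f (xs @ v # u # ys)"
    by (simp add: cov_def)
qed

lemma wedge_cov_Cons [simp]:
  "wedge (cov f) \<beta> (v # vs) = f v * \<beta> vs - wedge (cov f) (\<lambda>us. \<beta> (v # us)) vs"
  using wedge_degree_1_Cons[of "cov f"] by simp

text \<open>Both the wedge product with a covector and the exterior derivative have this form, so that
  antisymmetry is proved only once.\<close>

definition alternation :: "('e \<Rightarrow> 'e covec) \<Rightarrow> 'e covec" where
  "alternation A vs = (\<Sum>i<length vs. (-1) ^ i * A (vs ! i) (take i vs @ drop (Suc i) vs))"

lemma alternation_Nil [simp]: "alternation A [] = 0"
  by (simp add: alternation_def)

lemma alternation_Cons [simp]:
  "alternation A (v # vs) = A v vs - alternation (\<lambda>u ws. A u (v # ws)) vs"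
  by (simp add: alternation_def sum.lessThan_Suc_shift sum_negf del: sum.lessThan_Suc)

lemma alternation_add: "alternation (\<lambda>v ws. A v ws + B v ws) vs = alternation A vs + alternation B vs"
  and alternation_scale: "alternation (\<lambda>v ws. z * A v ws) vs = z * alternation A vs"
  by (simp_all add: alternation_def algebra_simps sum.distrib sum_distrib_left)

lemma alternation_uminus: "alternation (\<lambda>v ws. - A v ws) vs = - alternation A vs"
  using alternation_scale[of "-1"] by simp

lemma exterior_alternation:
  assumes "\<And>v. A v \<in> exterior" "\<And>ws. linear (\<lambda>v. A v ws)"
  shows "alternation A \<in> exterior"
proof (rule exteriorI)
  fix xs ys :: "'a list" and u v
  show "linear (\<lambda>v. alternation A (xs @ v # ys))"
    using assms
  proof (induction xs arbitrary: A)
    case Nil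
    have a: "A w ((u + v) # us) = A w (u # us) + A w (v # us)"
      "A w ((r *\<^sub>R u) # us) = of_real r * A w (u # us)" for u v us r w
      using exterior_linear_hd[OF Nil(1)[of w], of us]
      by (auto simp: linear_iff scaleR_conv_of_real)
    have b: "A (u + v) us = A u us + A v us"  "A (r *\<^sub>R u) us = of_real r * A u us" for u v us r
      using Nil(2)[of us] by (auto simp: linear_iff scaleR_conv_of_real)
    show ?case
      by (rule linearI) (simp_all add: a b alternation_add alternation_scale algebra_simps scaleR_conv_of_real)
  next
    case (Cons x xs)
    have "linear (\<lambda>v. alternation (\<lambda>u ws. A u (x # ws)) (xs @ v # ys))"
      by (rule Cons.IH) (use Cons.prems in \<open>auto intro: exterior_Cons\<close>)
    then show ?case
      using exterior_linear[OF Cons.prems(1)[of x], of xs ys] by (simp add: linear_compose_sub)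
  qed
  show "alternation A (xs @ u # v # ys) = - alternation A (xs @ v # u # ys)"
    using assms
  proof (induction xs arbitrary: A)
    case Nil
    have "A w (u # v # us) = - A w (v # u # us)" for w us
      by (rule exterior_swap_hd[OF Nil(1)])
    then show ?case by (simp add: alternation_uminus)
  next
    case (Cons x xs)
    have "alternation (\<lambda>u ws. A u (x # ws)) (xs @ u # v # ys)
      = - alternation (\<lambda>u ws. A u (x # ws)) (xs @ v # u # ys)"
      by (rule Cons.IH) (use Cons.prems in \<open>auto intro: exterior_Cons\<close>)
    then show ?case by (simp add: exterior_swap[OF Cons.prems(1), of x xs u v ys])
  qed
qed

text \<open>The derivation of the algebra of forms which extends the transpose of \<open>J\<close>. On \<open>(p,q)\<close>-forms it
  is multiplication by \<open>\<i> (p - q)\<close>, which makes bidegrees accessible through eigenvalues.\<close>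

definition jder :: "('e \<Rightarrow> 'e) \<Rightarrow> 'e covec \<Rightarrow> 'e covec" where
  "jder J \<alpha> vs = (\<Sum>i<length vs. \<alpha> (vs[i := J (vs ! i)]))"

lemma jder_Nil [simp]: "jder J \<alpha> [] = 0"
  by (simp add: jder_def)

lemma jder_Cons [simp]: "jder J \<alpha> (v # vs) = \<alpha> (J v # vs) + jder J (\<lambda>us. \<alpha> (v # us)) vs"
  by (simp add: jder_def sum.lessThan_Suc_shift del: sum.lessThan_Suc)

lemma jder_add: "jder J (\<lambda>vs. \<alpha> vs + \<beta> vs) vs = jder J \<alpha> vs + jder J \<beta> vs"
  and jder_scale: "jder J (\<lambda>vs. z * \<alpha> vs) vs = z * jder J \<alpha> vs"
  and jder_diff: "jder J (\<lambda>vs. \<alpha> vs - \<beta> vs) vs = jder J \<alpha> vs - jder J \<beta> vs"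
  and jder_uminus: "jder J (\<lambda>vs. - \<alpha> vs) vs = - jder J \<alpha> vs"
  by (simp_all add: jder_def sum.distrib sum_distrib_left sum_subtractf sum_negf)

lemma jder_zero [simp]: "jder J (\<lambda>vs. 0) vs = 0"
  by (simp add: jder_def)

lemma jder_sum: "jder J (\<lambda>vs. \<Sum>i\<in>I. \<alpha> i vs) vs = (\<Sum>i\<in>I. jder J (\<alpha> i) vs)"
  unfolding jder_def by (rule sum.swap)

lemma has_degree_jder: "has_degree k \<alpha> \<Longrightarrow> has_degree k (jder J \<alpha>)"
  by (simp add: has_degree_def jder_def)

lemma exterior_jder:
  assumes "linear J" "\<alpha> \<in> exterior"
  shows "jder J \<alpha> \<in> exterior"
proof (rule exteriorI)
  fix xs ys :: "'a list" and u v
  show "linear (\<lambda>v. jder J \<alpha> (xs @ v # ys))"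
    using assms(2)
  proof (induction xs arbitrary: \<alpha>)
    case Nil
    have a: "\<alpha> ((u + v) # us) = \<alpha> (u # us) + \<alpha> (v # us)"
      "\<alpha> ((r *\<^sub>R u) # us) = of_real r * \<alpha> (u # us)" for u v us r
      using exterior_linear_hd[OF Nil, of us] by (auto simp: linear_iff scaleR_conv_of_real)
    show ?case
      by (rule linearI)
        (simp_all add: linear_add[OF assms(1)] linear_scale[OF assms(1)] a jder_add jder_scale
          algebra_simps scaleR_conv_of_real)
  next
    case (Cons x xs)
    show ?case
      using exterior_linear[OF Cons.prems, of "J x # xs" ys] Cons.IH[OF exterior_Cons[OF Cons.prems, of x]]
      by (simp add: linear_compose_add)
  qed
  show "jder J \<alpha> (xs @ u # v # ys) = - jder J \<alpha> (xs @ v # u # ys)"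
    using assms(2)
  proof (induction xs arbitrary: \<alpha>)
    case Nil
    have a: "\<alpha> (u # v # us) = - \<alpha> (v # u # us)" "\<alpha> (J u # v # us) = - \<alpha> (v # J u # us)"
      "\<alpha> (u # J v # us) = - \<alpha> (J v # u # us)" for us
      by (rule exterior_swap_hd[OF Nil])+
    show ?case by (simp add: a jder_uminus)
  next
    case (Cons x xs)
    show ?case
      using Cons.IH[OF exterior_Cons[OF Cons.prems, of x]]
      by (simp add: exterior_swap[OF Cons.prems, of "J x # xs" u v ys, simplified])
  qed
qed

text \<open>The Leibniz rule, with the action on the first factor already replaced by its eigenvalue.\<close>

lemma jder_wedge_eigen:
  assumes "has_degree 1 \<theta>" "\<And>v. \<theta> [J v] = z * \<theta> [v]"
  shows "jder J (wedge \<theta> \<beta>) vs = z * wedge \<theta> \<beta> vs + wedge \<theta> (jder J \<beta>) vs"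
proof (induction vs arbitrary: \<beta>)
  case Nil
  then show ?case using assms(1) by (simp add: has_degree_def)
next
  case (Cons v vs)
  note w = wedge_degree_1_Cons[OF assms(1)]
  have e: "jder J (wedge \<theta> (\<lambda>us. \<beta> (v # us))) vs
      = z * wedge \<theta> (\<lambda>us. \<beta> (v # us)) vs + wedge \<theta> (jder J (\<lambda>us. \<beta> (v # us))) vs"
    by (rule Cons.IH)
  show ?case
    by (simp add: w jder_diff jder_scale e assms(2) wedge_add_right) (simp add: algebra_simps)
qed

section \<open>Orthonormal frames of a four-dimensional space\<close>

locale oframe =
  fixes a b c d :: "'e::euclidean_space"
  assumes dim4: "DIM('e) = 4"
    and on: "a \<bullet> a = 1" "b \<bullet> b = 1" "c \<bullet> c = 1" "d \<bullet> d = 1"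
      "a \<bullet> b = 0" "a \<bullet> c = 0" "a \<bullet> d = 0" "b \<bullet> c = 0" "b \<bullet> d = 0" "c \<bullet> d = 0"
begin

lemma on' [simp]: "a \<bullet> a = 1" "b \<bullet> b = 1" "c \<bullet> c = 1" "d \<bullet> d = 1"
      "a \<bullet> b = 0" "a \<bullet> c = 0" "a \<bullet> d = 0" "b \<bullet> c = 0" "b \<bullet> d = 0" "c \<bullet> d = 0"
      "b \<bullet> a = 0" "c \<bullet> a = 0" "d \<bullet> a = 0" "c \<bullet> b = 0" "d \<bullet> b = 0" "d \<bullet> c = 0"
  using on by (simp_all add: inner_commute)

lemma neq [simp]: "a \<noteq> b" "a \<noteq> c" "a \<noteq> d" "b \<noteq> c" "b \<noteq> d" "c \<noteq> d"
  "b \<noteq> a" "c \<noteq> a" "d \<noteq> a" "c \<noteq> b" "d \<noteq> b" "d \<noteq> c"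
  using on' by (metis zero_neq_one)+

lemma orthonormal: "orthonormal_basis inner {a, b, c, d}"
  by (auto simp: orthonormal_basis_def dim4)

end

lemma orthonormal_basis_span:
  assumes "orthonormal_basis inner (B :: 'e::euclidean_space set)"
  shows "span B = UNIV" "v = (\<Sum>e\<in>B. (v \<bullet> e) *\<^sub>R e)"
proof -
  have fin: "finite B" and card: "card B = DIM('e)"
    and on: "\<And>u v. u \<in> B \<Longrightarrow> v \<in> B \<Longrightarrow> u \<bullet> v = (if u = v then 1 else 0)"
    using assms by (auto simp: orthonormal_basis_def)
  have "pairwise orthogonal B" "0 \<notin> B"
    using on by (auto simp: pairwise_def orthogonal_def) (metis inner_zero_left zero_neq_one)
  then have ind: "independent B" by (simp add: pairwise_orthogonal_independent)
  show sp: "span B = UNIV"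
    using card_ge_dim_independent[of B UNIV] ind card by auto
  have "(v - (\<Sum>e\<in>B. (v \<bullet> e) *\<^sub>R e)) \<bullet> u = 0" if "u \<in> B" for u
  proof -
    have "(\<Sum>e\<in>B. (v \<bullet> e) *\<^sub>R e) \<bullet> u = (\<Sum>e\<in>B. if e = u then v \<bullet> e else 0)"
      unfolding inner_sum_left by (intro sum.cong refl) (use on that in auto)
    then show ?thesis using fin that by (simp add: inner_diff_left)
  qed
  then have "orthogonal (v - (\<Sum>e\<in>B. (v \<bullet> e) *\<^sub>R e)) u" if "u \<in> B" for u
    using that by (simp add: orthogonal_def)
  then have "orthogonal (v - (\<Sum>e\<in>B. (v \<bullet> e) *\<^sub>R e)) (v - (\<Sum>e\<in>B. (v \<bullet> e) *\<^sub>R e))"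
    using orthogonal_to_span[of "v - (\<Sum>e\<in>B. (v \<bullet> e) *\<^sub>R e)" B] sp by simp
  then show "v = (\<Sum>e\<in>B. (v \<bullet> e) *\<^sub>R e)" by (simp add: orthogonal_self)
qed

definition lists_of :: "nat \<Rightarrow> 'e set \<Rightarrow> 'e list set" where
  "lists_of k B = {vs. length vs = k \<and> set vs \<subseteq> B}"

lemma sum_lists_of_Suc:
  assumes "finite B"
  shows "(\<Sum>vs\<in>lists_of (Suc k) B. f vs) = (\<Sum>v\<in>B. \<Sum>ws\<in>lists_of k B. f (v # ws))"
proof -
  have "lists_of (Suc k) B = (\<lambda>(v, ws). v # ws) ` (B \<times> lists_of k B)"
    by (auto simp: lists_of_def length_Suc_conv image_iff)
  moreover have "inj_on (\<lambda>(v, ws). v # ws) (B \<times> lists_of k B)" by (auto simp: inj_on_def)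
  ultimately show ?thesis
    by (simp add: sum.reindex sum.cartesian_product case_prod_unfold)
qed

lemma lists_of_0 [simp]: "lists_of 0 B = {[]}"
  by (auto simp: lists_of_def)

text \<open>The trace of a bilinear form does not depend on the orthonormal basis. Applied in every
  argument, this makes the inner product of forms independent of the basis chosen in its definition.\<close>

lemma trace_orthonormal:
  assumes "orthonormal_basis inner B" "orthonormal_basis inner E" "linear f" "linear (g :: _ \<Rightarrow> complex)"
  shows "(\<Sum>v\<in>B. f v * g v) = (\<Sum>v\<in>E. f v * g v)"
proof -
  have finB: "finite B" and finE: "finite E"
    and on: "\<And>u v. u \<in> E \<Longrightarrow> v \<in> E \<Longrightarrow> u \<bullet> v = (if u = v then 1 else 0)"
    using assms(1,2) by (auto simp: orthonormal_basis_def)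
  note ex = orthonormal_basis_span(2)[OF assms(1)]
  have "(\<Sum>v\<in>E. f v * g v) = (\<Sum>v\<in>E. f (\<Sum>e\<in>B. (v \<bullet> e) *\<^sub>R e) * g v)"
    using ex by simp
  also have "\<dots> = (\<Sum>v\<in>E. \<Sum>e\<in>B. f e * g ((v \<bullet> e) *\<^sub>R v))"
    by (simp add: linear_sum[OF assms(3)] linear_scale[OF assms(3)] linear_scale[OF assms(4)]
        sum_distrib_left sum_distrib_right scaleR_conv_of_real mult_ac)
  also have "\<dots> = (\<Sum>e\<in>B. f e * g (\<Sum>v\<in>E. (e \<bullet> v) *\<^sub>R v))"
    by (subst sum.swap) (simp add: linear_sum[OF assms(4)] sum_distrib_left inner_commute)
  also have "\<dots> = (\<Sum>v\<in>B. f v * g v)"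
    using orthonormal_basis_span(2)[OF assms(2)] by simp
  finally show ?thesis by simp
qed

lemma sum_lists_orthonormal:
  assumes "orthonormal_basis inner B" "orthonormal_basis inner E" "\<alpha> \<in> exterior" "\<beta> \<in> exterior"
  shows "(\<Sum>vs\<in>lists_of k B. \<alpha> vs * \<beta> vs) = (\<Sum>vs\<in>lists_of k E. \<alpha> vs * \<beta> vs)"
  using assms(3,4)
proof (induction k arbitrary: \<alpha> \<beta>)
  case (Suc k)
  have fin: "finite B" "finite E" using assms(1,2) by (auto simp: orthonormal_basis_def)
  have "(\<Sum>vs\<in>lists_of (Suc k) B. \<alpha> vs * \<beta> vs)
      = (\<Sum>v\<in>B. \<Sum>ws\<in>lists_of k E. \<alpha> (v # ws) * \<beta> (v # ws))"
    unfolding sum_lists_of_Suc[OF fin(1)]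
    by (intro sum.cong refl Suc.IH[OF exterior_Cons exterior_Cons] Suc.prems)
  also have "\<dots> = (\<Sum>ws\<in>lists_of k E. \<Sum>v\<in>B. \<alpha> (v # ws) * \<beta> (v # ws))" by (rule sum.swap)
  also have "\<dots> = (\<Sum>ws\<in>lists_of k E. \<Sum>v\<in>E. \<alpha> (v # ws) * \<beta> (v # ws))"
    by (intro sum.cong refl trace_orthonormal[OF assms(1,2)] exterior_linear_hd Suc.prems)
  also have "\<dots> = (\<Sum>v\<in>E. \<Sum>ws\<in>lists_of k E. \<alpha> (v # ws) * \<beta> (v # ws))" by (rule sum.swap)
  finally show ?case by (simp add: sum_lists_of_Suc[OF fin(2)])
qed simp

definition subframe :: "'e \<Rightarrow> 'e \<Rightarrow> 'e \<Rightarrow> 'e \<Rightarrow> 'e list set" where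
  "subframe a b c d = {[], [a], [b], [c], [d], [a,b], [a,c], [a,d], [b,c], [b,d], [c,d],
     [b,c,d], [a,c,d], [a,b,d], [a,b,c], [a,b,c,d]}"

context oframe
begin

lemma span_frame: "span {a, b, c, d} = UNIV"
  by (rule orthonormal_basis_span[OF orthonormal])

lemma frame_expand: "v = (v \<bullet> a) *\<^sub>R a + (v \<bullet> b) *\<^sub>R b + (v \<bullet> c) *\<^sub>R c + (v \<bullet> d) *\<^sub>R d"
  using orthonormal_basis_span(2)[OF orthonormal, of v] by (simp add: add.assoc)

definition arrange :: "'e set \<Rightarrow> 'e list" where
  "arrange S = filter (\<lambda>e. e \<in> S) [a, b, c, d]"

lemma arrange_subframe: "arrange S \<in> subframe a b c d"
  by (auto simp: arrange_def subframe_def)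

lemma set_arrange: "S \<subseteq> {a, b, c, d} \<Longrightarrow> set (arrange S) = S"
  by (auto simp: arrange_def)

lemma distinct_arrange: "distinct (arrange S)"
  unfolding arrange_def by (rule distinct_filter) simp

lemma arrange_subframe_set: "vs \<in> subframe a b c d \<Longrightarrow> arrange (set vs) = vs \<and> distinct vs \<and> set vs \<subseteq> {a,b,c,d}"
  unfolding subframe_def by (elim insertE emptyE; simp add: arrange_def)

lemma mset_arrange: "distinct vs \<Longrightarrow> set vs \<subseteq> {a, b, c, d} \<Longrightarrow> mset vs = mset (arrange (set vs))"
  by (simp add: set_eq_iff_mset_eq_distinct[symmetric] set_arrange distinct_arrange)

text \<open>Antisymmetry reorders any list of frame vectors increasingly, so sixteen values determine a
  form. Nearly all pointwise identities of forms below are checked on these sixteen lists.\<close>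

lemma exterior_eqI:
  assumes "\<alpha> \<in> exterior" "\<beta> \<in> exterior" "\<And>vs. vs \<in> subframe a b c d \<Longrightarrow> \<alpha> vs = \<beta> vs"
  shows "\<alpha> = \<beta>"
proof
  fix vs
  have "\<alpha> us - \<beta> us = 0" if us: "set us \<subseteq> {a, b, c, d}" for us
  proof (cases "distinct us")
    case True
    obtain s where s: "\<forall>\<gamma>\<in>exterior. \<gamma> us = s * \<gamma> (arrange (set us))"
      using exterior_perm[OF mset_arrange[OF True us]] by blast
    show ?thesis
      using bspec[OF s assms(1)] bspec[OF s assms(2)] assms(3)[OF arrange_subframe, of "set us"] by simp
  qed (simp add: exterior_nondistinct assms)
  then have "\<alpha> vs - \<beta> vs = 0"
    by (rule exterior_zero_on_spanning[OF exterior_diff[OF assms(1,2)] span_frame])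
  then show "\<alpha> vs = \<beta> vs" by simp
qed

definition monomial :: "'e list \<Rightarrow> 'e covec" where
  "monomial I = foldr (\<lambda>e \<beta>. wedge (cov (\<lambda>v. of_real (v \<bullet> e))) \<beta>) I unit_covec"

lemma linear_dual: "linear (\<lambda>v. complex_of_real (v \<bullet> e))"
  by (simp add: linear_iff inner_add_left scaleR_conv_of_real)

lemma exterior_monomial: "monomial I \<in> exterior"
  by (induction I) (auto simp: monomial_def intro!: exterior_wedge exterior_cov linear_dual)

definition prescribed :: "('e list \<Rightarrow> complex) \<Rightarrow> 'e covec" where
  "prescribed k vs = (\<Sum>I\<in>subframe a b c d. k I * monomial I vs)"

lemma exterior_prescribed: "prescribed k \<in> exterior"
  unfolding prescribed_def by (intro exterior_sum exterior_scale exterior_monomial)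

lemma monomial_subframe:
  "I \<in> subframe a b c d \<Longrightarrow> vs \<in> subframe a b c d \<Longrightarrow> monomial I vs = (if I = vs then 1 else 0)"
  unfolding subframe_def
  by (elim insertE emptyE; simp add: monomial_def unit_covec_def)

lemma finite_subframe [simp]: "finite (subframe a b c d)"
  by (simp add: subframe_def)

lemma prescribed_subframe: "vs \<in> subframe a b c d \<Longrightarrow> prescribed k vs = k vs"
  by (simp add: prescribed_def monomial_subframe if_distrib cong: if_cong)

lemma exterior_expand: "\<alpha> \<in> exterior \<Longrightarrow> \<alpha> = prescribed \<alpha>"
  by (rule exterior_eqI) (simp_all add: exterior_prescribed prescribed_subframe)

definition herm :: "'e covec \<Rightarrow> 'e covec \<Rightarrow> complex" where
  "herm \<alpha> \<beta> = (\<Sum>vs\<in>subframe a b c d. \<alpha> vs * cnj (\<beta> vs))"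

text \<open>Each increasing list stands for \<open>k!\<close> orderings of its entries, which contribute equally; this
  cancels the factorial in the definition of the inner product.\<close>

lemma inner_covec_eq:
  assumes "\<alpha> \<in> exterior" "\<beta> \<in> exterior"
  shows "inner_covec inner \<alpha> \<beta> = herm \<alpha> \<beta>"
proof -
  let ?E = "{a, b, c, d}"
  let ?F = "\<lambda>vs. \<alpha> vs * cnj (\<beta> vs)"
  define B where "B = (SOME B. orthonormal_basis inner (B :: 'e set))"
  have B: "orthonormal_basis inner B"
    unfolding B_def by (rule someI, rule orthonormal)
  let ?D = "{vs. distinct vs \<and> set vs \<subseteq> ?E}"
  have finL: "finite (lists_of k ?E)" for k
    using finite_lists_length_eq[of ?E k] by (simp add: lists_of_def conj_commute)
  have len: "length vs \<le> 4" if "vs \<in> ?D" for vs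
  proof -
    have "length vs = card (set vs)" using that distinct_card by force
    also have "\<dots> \<le> card ?E" using that by (intro card_mono) auto
    finally show ?thesis by simp
  qed
  have finD: "finite ?D"
    by (rule finite_subset[of _ "\<Union>k\<le>4. lists_of k ?E"]) (use len finL in \<open>auto simp: lists_of_def\<close>)
  have F: "?F vs = ?F (arrange (set vs))" if "vs \<in> ?D" for vs
  proof -
    have d: "distinct vs" "set vs \<subseteq> ?E" using that by simp_all
    obtain s where ss: "(s = 1 \<or> s = - 1) \<and> (\<forall>\<gamma>\<in>exterior. \<gamma> vs = s * \<gamma> (arrange (set vs)))"
      using exterior_perm[OF mset_arrange[OF d]] ..
    note s = conjunct1[OF ss] conjunct2[OF ss]
    have "\<alpha> vs = s * \<alpha> (arrange (set vs))" "\<beta> vs = s * \<beta> (arrange (set vs))"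
      by (rule bspec[OF s(2) assms(1)], rule bspec[OF s(2) assms(2)])
    then show ?thesis using s(1) by (elim disjE) simp_all
  qed
  have "inner_covec inner \<alpha> \<beta> = (\<Sum>k\<le>4. (1 / fact k) * (\<Sum>vs\<in>lists_of k B. ?F vs))"
    by (simp add: inner_covec_def Let_def B_def lists_of_def dim4)
  also have "\<dots> = (\<Sum>k\<le>4. (1 / fact k) * (\<Sum>vs\<in>lists_of k ?E. ?F vs))"
    by (simp only: sum_lists_orthonormal[OF B orthonormal assms(1) exterior_cnj[OF assms(2)]])
  also have "\<dots> = (\<Sum>k\<le>4. \<Sum>vs\<in>{vs \<in> ?D. length vs = k}. ?F vs / fact (length vs))"
  proof (rule sum.cong[OF refl])
    fix k
    have "(\<Sum>vs\<in>lists_of k ?E. ?F vs) = (\<Sum>vs\<in>{vs \<in> ?D. length vs = k}. ?F vs)"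
      by (rule sum.mono_neutral_right[OF finL])
        (use exterior_nondistinct[OF assms(1)] in \<open>auto simp: lists_of_def\<close>)
    then show "1 / fact k * (\<Sum>vs\<in>lists_of k ?E. ?F vs)
        = (\<Sum>vs\<in>{vs \<in> ?D. length vs = k}. ?F vs / fact (length vs))"
      by (simp add: sum_divide_distrib)
  qed
  also have "\<dots> = (\<Sum>vs\<in>?D. ?F vs / fact (length vs))"
    by (rule sum.group[OF finD]) (use len in auto)
  also have "\<dots> = (\<Sum>zs\<in>subframe a b c d. \<Sum>vs\<in>{vs \<in> ?D. arrange (set vs) = zs}. ?F vs / fact (length vs))"
    by (rule sum.group[symmetric, OF finD]) (auto simp: arrange_subframe)
  also have "\<dots> = (\<Sum>zs\<in>subframe a b c d. ?F zs)"
  proof (rule sum.cong[OF refl])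
    fix zs assume zs: "zs \<in> subframe a b c d"
    note z = arrange_subframe_set[OF zs]
    have eq: "{vs \<in> ?D. arrange (set vs) = zs} = permutations_of_set (set zs)"
      using z by (auto simp: permutations_of_set_def dest: set_arrange)
    have "(\<Sum>vs\<in>permutations_of_set (set zs). ?F vs / fact (length vs))
        = (\<Sum>vs\<in>permutations_of_set (set zs). ?F zs / fact (length zs))"
    proof (rule sum.cong[OF refl])
      fix vs assume vs: "vs \<in> permutations_of_set (set zs)"
      have "length vs = length zs"
        using length_finite_permutations_of_set[OF vs] distinct_card z by force
      moreover have "?F vs = ?F zs"
        using F[of vs] z vs by (auto simp: permutations_of_set_def)
      ultimately show "?F vs / fact (length vs) = ?F zs / fact (length zs)" by simp
    qed
    also have "\<dots> = ?F zs" using z distinct_card[of zs] by simp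
    finally show "(\<Sum>vs\<in>{vs \<in> ?D. arrange (set vs) = zs}. ?F vs / fact (length vs)) = ?F zs"
      unfolding eq .
  qed
  finally show ?thesis by (simp add: herm_def)
qed

lemma wedge_top:
  "wedge \<alpha> \<beta> [a, b, c, d] = \<alpha> [] * \<beta> [a,b,c,d]
    + \<alpha> [a] * \<beta> [b,c,d] - \<alpha> [b] * \<beta> [a,c,d] + \<alpha> [c] * \<beta> [a,b,d] - \<alpha> [d] * \<beta> [a,b,c]
    + \<alpha> [a,b] * \<beta> [c,d] - \<alpha> [a,c] * \<beta> [b,d] + \<alpha> [a,d] * \<beta> [b,c]
    + \<alpha> [b,c] * \<beta> [a,d] - \<alpha> [b,d] * \<beta> [a,c] + \<alpha> [c,d] * \<beta> [a,b]
    - \<alpha> [b,c,d] * \<beta> [a] + \<alpha> [a,c,d] * \<beta> [b] - \<alpha> [a,b,d] * \<beta> [c] + \<alpha> [a,b,c] * \<beta> [d]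
    + \<alpha> [a,b,c,d] * \<beta> []"
  by (simp add: wedge_Cons)

lemma sum_subframe:
  "(\<Sum>vs\<in>subframe a b c d. f vs) = f [] + f [a] + f [b] + f [c] + f [d]
    + f [a,b] + f [a,c] + f [a,d] + f [b,c] + f [b,d] + f [c,d]
    + f [b,c,d] + f [a,c,d] + f [a,b,d] + f [a,b,c] + f [a,b,c,d]"
  for f :: "_ \<Rightarrow> 'z::comm_monoid_add"
  by (simp add: subframe_def add.assoc)

text \<open>The Hodge star in an oriented orthonormal frame: the value on an increasing list is the value on
  the complementary list, up to the sign of the shuffle.\<close>

definition star_table :: "'e covec \<Rightarrow> 'e covec \<Rightarrow> bool" where
  "star_table \<gamma> \<eta> \<longleftrightarrow>
     \<eta> [] = \<gamma> [a,b,c,d] \<and> \<eta> [a] = - \<gamma> [b,c,d] \<and> \<eta> [b] = \<gamma> [a,c,d] \<and> \<eta> [c] = - \<gamma> [a,b,d] \<and>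
     \<eta> [d] = \<gamma> [a,b,c] \<and> \<eta> [a,b] = \<gamma> [c,d] \<and> \<eta> [a,c] = - \<gamma> [b,d] \<and> \<eta> [a,d] = \<gamma> [b,c] \<and>
     \<eta> [b,c] = \<gamma> [a,d] \<and> \<eta> [b,d] = - \<gamma> [a,c] \<and> \<eta> [c,d] = \<gamma> [a,b] \<and>
     \<eta> [b,c,d] = \<gamma> [a] \<and> \<eta> [a,c,d] = - \<gamma> [b] \<and> \<eta> [a,b,d] = \<gamma> [c] \<and> \<eta> [a,b,c] = - \<gamma> [d] \<and>
     \<eta> [a,b,c,d] = \<gamma> []"

lemma star_table_exists: "\<exists>\<eta>\<in>exterior. star_table \<gamma> \<eta>"
proof
  define k where "k = (\<lambda>vs. if vs = [] then \<gamma> [a,b,c,d] else if vs = [a] then - \<gamma> [b,c,d]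
     else if vs = [b] then \<gamma> [a,c,d] else if vs = [c] then - \<gamma> [a,b,d] else if vs = [d] then \<gamma> [a,b,c]
     else if vs = [a,b] then \<gamma> [c,d] else if vs = [a,c] then - \<gamma> [b,d] else if vs = [a,d] then \<gamma> [b,c]
     else if vs = [b,c] then \<gamma> [a,d] else if vs = [b,d] then - \<gamma> [a,c] else if vs = [c,d] then \<gamma> [a,b]
     else if vs = [b,c,d] then \<gamma> [a] else if vs = [a,c,d] then - \<gamma> [b] else if vs = [a,b,d] then \<gamma> [c]
     else if vs = [a,b,c] then - \<gamma> [d] else \<gamma> [])"
  have p: "prescribed k vs = k vs" if "vs \<in> subframe a b c d" for vs
    by (rule prescribed_subframe[OF that])
  show "star_table \<gamma> (prescribed k)"
    unfolding star_table_def
    by (intro conjI; subst p, (simp add: subframe_def; fail), simp add: k_def)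
qed (rule exterior_prescribed)

text \<open>For the dual form \<open>\<alpha>\<close> of a single increasing list, the defining equation of the Hodge star at the
  top list becomes one row of the table.\<close>

lemma star_table_iff:
  assumes "\<gamma> \<in> exterior" "\<eta> \<in> exterior"
  shows "star_table \<gamma> \<eta> \<longleftrightarrow>
     (\<forall>\<alpha>\<in>exterior. wedge \<alpha> \<eta> [a, b, c, d] = inner_covec inner \<alpha> (\<lambda>ws. cnj (\<gamma> ws)))"
proof
  assume "star_table \<gamma> \<eta>"
  then show "\<forall>\<alpha>\<in>exterior. wedge \<alpha> \<eta> [a, b, c, d] = inner_covec inner \<alpha> (\<lambda>ws. cnj (\<gamma> ws))"
    using assms
    by (simp add: inner_covec_eq exterior_cnj herm_def sum_subframe wedge_top star_table_def)
next
  assume R: "\<forall>\<alpha>\<in>exterior. wedge \<alpha> \<eta> [a, b, c, d] = inner_covec inner \<alpha> (\<lambda>ws. cnj (\<gamma> ws))"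
  have R': "wedge (monomial I) \<eta> [a, b, c, d] = \<gamma> I" if "I \<in> subframe a b c d" for I
    using R[rule_format, OF exterior_monomial, of I] that assms
    by (simp add: inner_covec_eq exterior_cnj exterior_monomial herm_def monomial_subframe
        if_distrib[of "\<lambda>x. x * _"] cong: if_cong)
  have m: "monomial I vs = (if I = vs then 1 else 0)"
    if "I \<in> subframe a b c d" "vs \<in> subframe a b c d" for I vs
    using monomial_subframe that .
  have s: "[] \<in> subframe a b c d" "[a] \<in> subframe a b c d" "[b] \<in> subframe a b c d"
    "[c] \<in> subframe a b c d" "[d] \<in> subframe a b c d" "[a,b] \<in> subframe a b c d"
    "[a,c] \<in> subframe a b c d" "[a,d] \<in> subframe a b c d" "[b,c] \<in> subframe a b c d"
    "[b,d] \<in> subframe a b c d" "[c,d] \<in> subframe a b c d" "[b,c,d] \<in> subframe a b c d"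
    "[a,c,d] \<in> subframe a b c d" "[a,b,d] \<in> subframe a b c d" "[a,b,c] \<in> subframe a b c d"
    "[a,b,c,d] \<in> subframe a b c d"
    by (simp_all add: subframe_def)
  show "star_table \<gamma> \<eta>"
    using s[THEN R'] by (simp add: wedge_top m s star_table_def) (intro conjI; metis minus_minus)
qed

text \<open>A 4-form is determined by its value on the frame, so the defining property of the Hodge star
  needs testing at one list only; the table then gives existence and uniqueness.\<close>

lemma hodge_star_table:
  assumes vol: "volume_covec inner J \<in> exterior" "volume_covec inner J [a, b, c, d] = 1"
    and "\<gamma> \<in> exterior"
  shows "hodge_star inner J \<gamma> \<in> exterior \<and> star_table \<gamma> (hodge_star inner J \<gamma>)"
proof -
  let ?P = "\<lambda>\<eta>. \<eta> \<in> exterior \<and>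
        (\<forall>\<alpha>\<in>exterior. \<forall>vs. length vs = DIM('e) \<longrightarrow>
           wedge \<alpha> \<eta> vs = inner_covec inner \<alpha> (\<lambda>ws. cnj (\<gamma> ws)) * volume_covec inner J vs)"
  have iff: "?P \<eta> \<longleftrightarrow> \<eta> \<in> exterior \<and> star_table \<gamma> \<eta>" for \<eta>
  proof (intro conj_cong refl)
    assume \<eta>: "\<eta> \<in> exterior"
    have "(\<forall>vs. length vs = DIM('e) \<longrightarrow> wedge \<alpha> \<eta> vs = z * volume_covec inner J vs)
        \<longleftrightarrow> wedge \<alpha> \<eta> [a, b, c, d] = z" (is "?l \<longleftrightarrow> ?r") if \<alpha>: "\<alpha> \<in> exterior" for \<alpha> z
    proof
      assume ?l then show ?r using vol(2) by (simp add: dim4)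
    next
      assume r: ?r
      let ?A = "\<lambda>vs. (if length vs = 4 then 1 else 0) * wedge \<alpha> \<eta> vs"
      let ?B = "\<lambda>vs. (if length vs = 4 then 1 else 0) * (z * volume_covec inner J vs)"
      have "?A = ?B"
        by (rule exterior_eqI)
          (use r vol(2) in \<open>auto intro!: exterior_cmult_length[where k = "\<lambda>n. if n = 4 then 1 else 0"]
             exterior_wedge exterior_scale vol(1) \<alpha> \<eta> simp: subframe_def\<close>)
      then have AB: "?A vs = ?B vs" for vs by (rule fun_cong)
      show ?l
      proof (intro allI impI)
        fix vs :: "'e list" assume "length vs = DIM('e)"
        then show "wedge \<alpha> \<eta> vs = z * volume_covec inner J vs" using AB[of vs] by (simp add: dim4)
      qed
    qed
    then show "(\<forall>\<alpha>\<in>exterior. \<forall>vs. length vs = DIM('e) \<longrightarrow>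
           wedge \<alpha> \<eta> vs = inner_covec inner \<alpha> (\<lambda>ws. cnj (\<gamma> ws)) * volume_covec inner J vs)
        \<longleftrightarrow> star_table \<gamma> \<eta>"
      by (simp add: star_table_iff[OF assms(3) \<eta>])
  qed
  obtain \<eta> where \<eta>: "\<eta> \<in> exterior" "star_table \<gamma> \<eta>" using star_table_exists by blast
  have uniq: "\<eta>' = \<eta>" if "\<eta>' \<in> exterior \<and> star_table \<gamma> \<eta>'" for \<eta>'
    by (rule exterior_eqI) (use that \<eta> in \<open>auto simp: subframe_def star_table_def\<close>)
  have "hodge_star inner J \<gamma> = \<eta>"
    unfolding hodge_star_def iff by (rule the_equality, rule conjI[OF \<eta>], rule uniq)
  then show ?thesis using \<eta> by simp
qed

end

lemma sum_le2: "(\<Sum>r\<le>2. f r) = f 0 + f 1 + f (2::nat)"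
  for f :: "_ \<Rightarrow> 'z::comm_monoid_add"
  by (simp add: numeral_2_eq_2)

lemma wedge_unit_right: "wedge \<alpha> unit_covec vs = \<alpha> vs"
proof (induction vs arbitrary: \<alpha>)
  case Nil
  then show ?case by (simp add: unit_covec_def)
next
  case (Cons v vs)
  have "(\<lambda>us. unit_covec (v # us)) = (\<lambda>us. 0)" by (simp add: unit_covec_def)
  then show ?case by (simp add: wedge_Cons Cons)
qed

section \<open>Bidegrees\<close>

text \<open>The inductive description of bidegrees by products of eigencovectors yields this eigenvalue
  equation, which is linear and easily checked in a frame. The two agree (\<open>of_bidegree_iff\<close> below).\<close>

definition eigen_bidegree :: "('e::euclidean_space \<Rightarrow> 'e) \<Rightarrow> nat \<Rightarrow> nat \<Rightarrow> 'e covec \<Rightarrow> bool" where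
  "eigen_bidegree J p q \<alpha> \<longleftrightarrow> \<alpha> \<in> exterior \<and> has_degree (p + q) \<alpha> \<and>
     (\<forall>vs. jder J \<alpha> vs = \<i> * (of_nat p - of_nat q) * \<alpha> vs)"

lemma eigen_bidegree_add:
  "eigen_bidegree J p q \<alpha> \<Longrightarrow> eigen_bidegree J p q \<beta> \<Longrightarrow> eigen_bidegree J p q (\<lambda>vs. \<alpha> vs + \<beta> vs)"
  by (simp add: eigen_bidegree_def exterior_add jder_add) (simp add: has_degree_def algebra_simps)

lemma eigen_bidegree_scale: "eigen_bidegree J p q \<alpha> \<Longrightarrow> eigen_bidegree J p q (\<lambda>vs. z * \<alpha> vs)"
  by (simp add: eigen_bidegree_def exterior_scale jder_scale) (simp add: has_degree_def)

lemma of_bidegree_eigen: "of_bidegree J p q \<alpha> \<Longrightarrow> eigen_bidegree J p q \<alpha>"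
proof (induction rule: of_bidegree.induct)
  case unit
  have "jder J unit_covec vs = 0" for vs by (auto simp: jder_def unit_covec_def)
  then show ?case by (simp add: eigen_bidegree_def)
next
  case (wedge10 \<theta> p q \<alpha>)
  have "jder J (wedge \<theta> \<alpha>) vs = \<i> * wedge \<theta> \<alpha> vs + wedge \<theta> (jder J \<alpha>) vs" for vs
    by (rule jder_wedge_eigen[OF wedge10(2,3)])
  moreover have "jder J \<alpha> = (\<lambda>vs. \<i> * (of_nat p - of_nat q) * \<alpha> vs)"
    using wedge10 by (auto simp: eigen_bidegree_def)
  ultimately show ?case using wedge10
    by (simp add: eigen_bidegree_def exterior_wedge has_degree_wedge_1 wedge_scale_right)
      (simp add: algebra_simps)
next
  case (wedge01 \<theta> p q \<alpha>)
  have "jder J (wedge \<theta> \<alpha>) vs = - \<i> * wedge \<theta> \<alpha> vs + wedge \<theta> (jder J \<alpha>) vs" for vs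
    by (rule jder_wedge_eigen[OF wedge01(2,3)])
  moreover have "jder J \<alpha> = (\<lambda>vs. \<i> * (of_nat p - of_nat q) * \<alpha> vs)"
    using wedge01 by (auto simp: eigen_bidegree_def)
  ultimately show ?case using wedge01
    by (simp add: eigen_bidegree_def exterior_wedge has_degree_wedge_1 wedge_scale_right)
      (simp add: algebra_simps)
next
  case (zero p q)
  then show ?case by (simp add: eigen_bidegree_def has_degree_def)
next
  case (add p q \<alpha> \<beta>)
  then show ?case by (intro eigen_bidegree_add)
next
  case (scale p q \<alpha> z)
  then show ?case by (intro eigen_bidegree_scale)
qed

context oframe
begin

lemma herm_add_left: "herm (\<lambda>vs. \<alpha> vs + \<alpha>' vs) \<beta> = herm \<alpha> \<beta> + herm \<alpha>' \<beta>"
  and herm_diff_left: "herm (\<lambda>vs. \<alpha> vs - \<alpha>' vs) \<beta> = herm \<alpha> \<beta> - herm \<alpha>' \<beta>"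
  and herm_scale_left: "herm (\<lambda>vs. z * \<alpha> vs) \<beta> = z * herm \<alpha> \<beta>"
  and herm_scale_right: "herm \<alpha> (\<lambda>vs. z * \<beta> vs) = cnj z * herm \<alpha> \<beta>"
  by (simp_all add: herm_def sum.distrib sum_subtractf sum_distrib_left algebra_simps sum_negf)

lemma herm_zero [simp]: "herm (\<lambda>vs. 0) \<beta> = 0" "herm \<alpha> (\<lambda>vs. 0) = 0"
  by (simp_all add: herm_def)

lemma herm_sum_left: "herm (\<lambda>vs. \<Sum>i\<in>I. \<alpha> i vs) \<beta> = (\<Sum>i\<in>I. herm (\<alpha> i) \<beta>)"
  unfolding herm_def sum_distrib_right by (rule sum.swap)

lemma herm_self: "herm \<alpha> \<alpha> = of_real (\<Sum>vs\<in>subframe a b c d. (cmod (\<alpha> vs))\<^sup>2)"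
  by (simp only: herm_def of_real_sum complex_norm_square)

lemma herm_definite:
  assumes "\<alpha> \<in> exterior" "herm \<alpha> \<alpha> = 0"
  shows "\<alpha> = (\<lambda>vs. 0)"
proof (rule exterior_eqI)
  fix vs assume "vs \<in> subframe a b c d"
  moreover have "(\<Sum>vs\<in>subframe a b c d. (cmod (\<alpha> vs))\<^sup>2) = 0"
    using assms(2) unfolding herm_self by (simp del: of_real_sum)
  ultimately show "\<alpha> vs = 0" by (simp add: sum_nonneg_eq_0_iff)
qed (use assms in auto)

end

locale hframe = oframe +
  fixes J :: "'a \<Rightarrow> 'a"
  assumes linJ: "linear J" and Ja: "J a = b" and Jb: "J b = - a" and Jc: "J c = d" and Jd: "J d = - c"
begin

lemma J_expand: "J v = (v \<bullet> a) *\<^sub>R b - (v \<bullet> b) *\<^sub>R a + (v \<bullet> c) *\<^sub>R d - (v \<bullet> d) *\<^sub>R c"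
  by (subst frame_expand[of v])
    (simp add: linear_add[OF linJ] linear_scale[OF linJ] Ja Jb Jc Jd)

lemma J_square: "J (J v) = - v"
  using frame_expand[of v]
  by (simp add: J_expand[of v] linear_add[OF linJ] linear_diff[OF linJ] linear_scale[OF linJ] Ja Jb Jc Jd)
    (simp add: algebra_simps)

lemma J_skew: "J u \<bullet> v = - (J v \<bullet> u)"
  by (simp add: J_expand[of u] J_expand[of v] inner_simps) (simp add: inner_commute algebra_simps)

lemma J_isometry: "J u \<bullet> J v = u \<bullet> v"
  using J_skew[of u "J v"] by (simp add: J_square inner_commute)

lemma exterior_fundamental: "fundamental_covec inner J \<in> exterior"
proof (rule exteriorI)
  fix xs ys :: "'a list" and u v
  have ln: "linear (\<lambda>v. complex_of_real (J v \<bullet> w))" "linear (\<lambda>v. complex_of_real (J w \<bullet> v))" for w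
    by (auto simp: linear_iff linear_add[OF linJ] linear_scale[OF linJ] inner_simps scaleR_conv_of_real)
  consider "xs = [] \<and> (\<exists>y. ys = [y])" | "(\<exists>x. xs = [x]) \<and> ys = []" | "length (xs @ v # ys) \<noteq> 2"
    by (cases xs; cases ys; cases "tl xs"; cases "tl ys") auto
  then show "linear (\<lambda>v. fundamental_covec inner J (xs @ v # ys))"
    by cases (auto simp: fundamental_covec_def linear_zero ln)
  show "fundamental_covec inner J (xs @ u # v # ys) = - fundamental_covec inner J (xs @ v # u # ys)"
    using J_skew[of u v] by (cases xs) (auto simp: fundamental_covec_def)
qed

lemma volume_eq: "volume_covec inner J vs
    = wedge (fundamental_covec inner J) (fundamental_covec inner J) vs / 2"
proof -
  have "wedge (fundamental_covec inner J) unit_covec = fundamental_covec inner J"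
    by (rule ext) (rule wedge_unit_right)
  moreover have "half_dim TYPE('a) = Suc (Suc 0)" by (simp add: half_dim_def dim4)
  ultimately show ?thesis by (simp add: volume_covec_def)
qed

lemma exterior_volume: "volume_covec inner J \<in> exterior"
proof -
  have "volume_covec inner J
      = (\<lambda>vs. (1/2) * wedge (fundamental_covec inner J) (fundamental_covec inner J) vs)"
    by (simp add: volume_eq fun_eq_iff)
  then show ?thesis
    by (simp only: exterior_scale[OF exterior_wedge[OF exterior_fundamental exterior_fundamental]])
qed

lemma volume_frame: "volume_covec inner J [a, b, c, d] = 1"
  by (simp add: volume_eq wedge_top fundamental_covec_def Ja Jb Jc Jd)

lemma jder_table:
  assumes "\<alpha> \<in> exterior"
  shows "jder J \<alpha> [a] = \<alpha> [b]" "jder J \<alpha> [b] = - \<alpha> [a]" "jder J \<alpha> [c] = \<alpha> [d]"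
    "jder J \<alpha> [d] = - \<alpha> [c]" "jder J \<alpha> [a,b] = 0" "jder J \<alpha> [a,c] = \<alpha> [b,c] + \<alpha> [a,d]"
    "jder J \<alpha> [a,d] = \<alpha> [b,d] - \<alpha> [a,c]" "jder J \<alpha> [b,c] = - \<alpha> [a,c] + \<alpha> [b,d]"
    "jder J \<alpha> [b,d] = - \<alpha> [a,d] - \<alpha> [b,c]" "jder J \<alpha> [c,d] = 0"
    "jder J \<alpha> [b,c,d] = - \<alpha> [a,c,d]" "jder J \<alpha> [a,c,d] = \<alpha> [b,c,d]"
    "jder J \<alpha> [a,b,d] = - \<alpha> [a,b,c]" "jder J \<alpha> [a,b,c] = \<alpha> [a,b,d]" "jder J \<alpha> [a,b,c,d] = 0"
proof -
  have n: "\<alpha> (- v # ys) = - \<alpha> (v # ys)" "\<alpha> (x # - v # ys) = - \<alpha> (x # v # ys)"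
    "\<alpha> (x # y # - v # ys) = - \<alpha> (x # y # v # ys)"
    "\<alpha> (x # y # z # - v # ys) = - \<alpha> (x # y # z # v # ys)" for v ys x y z
    using linear_neg[OF exterior_linear[OF assms, of "[]" ys], of v]
      linear_neg[OF exterior_linear[OF assms, of "[x]" ys], of v]
      linear_neg[OF exterior_linear[OF assms, of "[x,y]" ys], of v]
      linear_neg[OF exterior_linear[OF assms, of "[x,y,z]" ys], of v] by simp_all
  have z: "\<alpha> vs = 0" if "\<not> distinct vs" for vs
    by (rule exterior_nondistinct[OF assms that])
  show "jder J \<alpha> [a] = \<alpha> [b]" "jder J \<alpha> [b] = - \<alpha> [a]" "jder J \<alpha> [c] = \<alpha> [d]"
    "jder J \<alpha> [d] = - \<alpha> [c]" "jder J \<alpha> [a,b] = 0" "jder J \<alpha> [a,c] = \<alpha> [b,c] + \<alpha> [a,d]"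
    "jder J \<alpha> [a,d] = \<alpha> [b,d] - \<alpha> [a,c]" "jder J \<alpha> [b,c] = - \<alpha> [a,c] + \<alpha> [b,d]"
    "jder J \<alpha> [b,d] = - \<alpha> [a,d] - \<alpha> [b,c]" "jder J \<alpha> [c,d] = 0"
    "jder J \<alpha> [b,c,d] = - \<alpha> [a,c,d]" "jder J \<alpha> [a,c,d] = \<alpha> [b,c,d]"
    "jder J \<alpha> [a,b,d] = - \<alpha> [a,b,c]" "jder J \<alpha> [a,b,c] = \<alpha> [a,b,d]" "jder J \<alpha> [a,b,c,d] = 0"
    by (simp_all add: Ja Jb Jc Jd n z)
qed

lemma jder_skew:
  "\<alpha> \<in> exterior \<Longrightarrow> \<beta> \<in> exterior \<Longrightarrow> herm (jder J \<alpha>) \<beta> = - herm \<alpha> (jder J \<beta>)"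
  by (simp add: herm_def sum_subframe jder_table algebra_simps del: jder_Cons)

text \<open>Forms of different degrees have disjoint supports among the frame lists; in equal degree the
  eigenvalues \<open>\<i> (p - q)\<close> differ and the derivation is skew-adjoint.\<close>

lemma eigen_orthogonal:
  assumes "eigen_bidegree J p q \<alpha>" "eigen_bidegree J r s \<beta>" "(p, q) \<noteq> (r, s)"
  shows "herm \<alpha> \<beta> = 0"
proof (cases "p + q = r + s")
  case False
  then have "\<alpha> vs * cnj (\<beta> vs) = 0" for vs
    using assms by (cases "length vs = p + q") (auto simp: eigen_bidegree_def has_degree_def)
  then show ?thesis unfolding herm_def by (intro sum.neutral) blast
next
  case True
  let ?m = "complex_of_real (real p - real q)" and ?n = "complex_of_real (real r - real s)"
  have "jder J \<alpha> = (\<lambda>vs. (\<i> * ?m) * \<alpha> vs)" "jder J \<beta> = (\<lambda>vs. (\<i> * ?n) * \<beta> vs)"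
    using assms by (auto simp: eigen_bidegree_def)
  with jder_skew[of \<alpha> \<beta>] have "(\<i> * ?m) * herm \<alpha> \<beta> = - (cnj (\<i> * ?n) * herm \<alpha> \<beta>)"
    using assms by (simp only: herm_scale_left herm_scale_right eigen_bidegree_def simp_thms)
  then have "\<i> * (?m - ?n) * herm \<alpha> \<beta> = 0" by (simp add: algebra_simps)
  moreover have "?m - ?n \<noteq> 0"
  proof
    assume "?m - ?n = 0"
    then have "complex_of_real ((real p - real q) - (real r - real s)) = 0" by simp
    then have "real p + real s = real r + real q" by (simp only: of_real_eq_0_iff)
    then have "p + s = r + q" by linarith
    then show False using True assms(3) by auto
  qed
  ultimately show ?thesis by simp
qed

lemma eigen_vanish:
  assumes "eigen_bidegree J p q \<alpha>" "p > 2 \<or> q > 2"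
  shows "\<alpha> = (\<lambda>vs. 0)"
proof (rule exterior_eqI)
  have ext: "\<alpha> \<in> exterior" and deg: "\<And>vs. length vs \<noteq> p + q \<Longrightarrow> \<alpha> vs = 0"
    and eig: "\<And>vs. jder J \<alpha> vs = \<i> * (of_nat p - of_nat q) * \<alpha> vs"
    using assms by (auto simp: eigen_bidegree_def has_degree_def)
  show "\<alpha> \<in> exterior" by (rule ext)
  fix vs assume vs: "vs \<in> subframe a b c d"
  show "\<alpha> vs = 0"
  proof (cases "length vs = p + q")
    case True
    have "length vs \<le> 4" using vs by (auto simp: subframe_def)
    then consider "p = 3" "q = 0" | "p = 0" "q = 3" | "p + q = 4" "p \<noteq> q"
      using True assms(2) by linarith
    then show ?thesis
    proof cases
      case 3
      then have "vs = [a,b,c,d]" using vs True by (auto simp: subframe_def)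
      moreover have "complex_of_nat p - of_nat q \<noteq> 0" using 3 by simp
      ultimately show ?thesis using eig[of vs] by (simp add: jder_table[OF ext] del: jder_Cons)
    next
      case 1
      have "\<alpha> [a,c,d] = 0" "\<alpha> [b,c,d] = 0" "\<alpha> [a,b,c] = 0" "\<alpha> [a,b,d] = 0"
        using eig[of "[a,c,d]"] eig[of "[b,c,d]"] eig[of "[a,b,c]"] eig[of "[a,b,d]"]
        by (simp_all add: jder_table[OF ext] 1 complex_eq_iff del: jder_Cons)
      then show ?thesis using vs True 1 by (auto simp: subframe_def)
    next
      case 2
      have "\<alpha> [a,c,d] = 0" "\<alpha> [b,c,d] = 0" "\<alpha> [a,b,c] = 0" "\<alpha> [a,b,d] = 0"
        using eig[of "[a,c,d]"] eig[of "[b,c,d]"] eig[of "[a,b,c]"] eig[of "[a,b,d]"]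
        by (simp_all add: jder_table[OF ext] 2 complex_eq_iff del: jder_Cons)
      then show ?thesis using vs True 2 by (auto simp: subframe_def)
    qed
  qed (rule deg)
qed simp

lemma of_bidegree_vanish: "of_bidegree J p q \<alpha> \<Longrightarrow> p > 2 \<or> q > 2 \<Longrightarrow> \<alpha> = (\<lambda>vs. 0)"
  by (rule eigen_vanish[OF of_bidegree_eigen])

definition graded :: "'a covec \<Rightarrow> bool" where
  "graded \<alpha> \<longleftrightarrow> (\<exists>\<gamma>. (\<forall>r s. of_bidegree J r s (\<gamma> r s)) \<and> \<alpha> = (\<lambda>vs. \<Sum>r\<le>2. \<Sum>s\<le>2. \<gamma> r s vs))"

lemma gradedI: "(\<And>r s. of_bidegree J r s (\<gamma> r s)) \<Longrightarrow> (\<And>vs. \<alpha> vs = (\<Sum>r\<le>2. \<Sum>s\<le>2. \<gamma> r s vs)) \<Longrightarrow> graded \<alpha>"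
  unfolding graded_def by (intro exI[of _ \<gamma>]) auto

lemma graded_unit: "graded unit_covec"
  by (rule gradedI[of "\<lambda>r s. if r = 0 \<and> s = 0 then unit_covec else (\<lambda>vs. 0)"])
    (auto intro: of_bidegree.intros simp: sum_le2)

lemma graded_scale:
  assumes "graded \<alpha>"
  shows "graded (\<lambda>vs. z * \<alpha> vs)"
proof -
  obtain \<gamma> where "\<And>r s. of_bidegree J r s (\<gamma> r s)" "\<alpha> = (\<lambda>vs. \<Sum>r\<le>2. \<Sum>s\<le>2. \<gamma> r s vs)"
    using assms by (auto simp: graded_def)
  then show ?thesis
    by (intro gradedI[of "\<lambda>r s vs. z * \<gamma> r s vs"]) (auto intro: of_bidegree.intros simp: sum_distrib_left)
qed

lemma graded_add:
  assumes "graded \<alpha>" "graded \<beta>"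
  shows "graded (\<lambda>vs. \<alpha> vs + \<beta> vs)"
proof -
  obtain \<gamma> \<delta> where "\<And>r s. of_bidegree J r s (\<gamma> r s)" "\<alpha> = (\<lambda>vs. \<Sum>r\<le>2. \<Sum>s\<le>2. \<gamma> r s vs)"
    "\<And>r s. of_bidegree J r s (\<delta> r s)" "\<beta> = (\<lambda>vs. \<Sum>r\<le>2. \<Sum>s\<le>2. \<delta> r s vs)"
    using assms by (auto simp: graded_def)
  then show ?thesis
    by (intro gradedI[of "\<lambda>r s vs. \<gamma> r s vs + \<delta> r s vs"]) (auto intro: of_bidegree.intros simp: sum.distrib)
qed

lemma graded_zero: "graded (\<lambda>vs. 0)"
  by (rule gradedI[of "\<lambda>r s vs. 0"]) (auto intro: of_bidegree.intros)

lemma graded_sum: "(\<And>i. i \<in> I \<Longrightarrow> graded (\<alpha> i)) \<Longrightarrow> graded (\<lambda>vs. \<Sum>i\<in>I. \<alpha> i vs)"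
  by (induction I rule: infinite_finite_induct) (auto intro: graded_add graded_zero)

text \<open>A real covector is half the sum of an eigencovector for \<open>\<i>\<close> and one for \<open>- \<i>\<close>, so multiplying by it
  moves each bidegree to its two neighbours.\<close>

lemma graded_wedge:
  assumes "graded \<alpha>"
  shows "graded (wedge (cov (\<lambda>v. of_real (v \<bullet> e))) \<alpha>)"
proof -
  obtain \<gamma> where \<gamma>: "\<And>r s. of_bidegree J r s (\<gamma> r s)" and \<alpha>: "\<alpha> = (\<lambda>vs. \<Sum>r\<le>2. \<Sum>s\<le>2. \<gamma> r s vs)"
    using assms by (auto simp: graded_def)
  define \<theta> where "\<theta> = cov (\<lambda>v. complex_of_real (v \<bullet> e) / 2 - \<i> * of_real (J v \<bullet> e) / 2)"
  define \<theta>' where "\<theta>' = cov (\<lambda>v. complex_of_real (v \<bullet> e) / 2 + \<i> * of_real (J v \<bullet> e) / 2)"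
  have ext: "\<theta> \<in> exterior" "\<theta>' \<in> exterior"
    unfolding \<theta>_def \<theta>'_def
    by (rule exterior_cov; simp add: linear_iff linear_add[OF linJ] linear_scale[OF linJ] inner_simps
        scaleR_conv_of_real algebra_simps add_divide_distrib)+
  have J: "\<theta> [J v] = \<i> * \<theta> [v]" "\<theta>' [J v] = - \<i> * \<theta>' [v]" for v
    by (simp_all add: \<theta>_def \<theta>'_def J_square algebra_simps)
  have deg: "has_degree 1 \<theta>" "has_degree 1 \<theta>'"
    by (auto simp: \<theta>_def \<theta>'_def)
  have bi: "of_bidegree J (Suc r) s (wedge \<theta> (\<gamma> r s))" "of_bidegree J r (Suc s) (wedge \<theta>' (\<gamma> r s))" for r s
    by (intro wedge10 wedge01 ext deg J \<gamma>)+
  have z: "wedge \<theta> (\<gamma> 2 s) = (\<lambda>vs. 0)" "wedge \<theta>' (\<gamma> r 2) = (\<lambda>vs. 0)" for r s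
    using of_bidegree_vanish[OF bi(1)[of 2 s]] of_bidegree_vanish[OF bi(2)[of r 2]] by simp_all
  have split: "cov (\<lambda>v. of_real (v \<bullet> e)) = (\<lambda>vs. \<theta> vs + \<theta>' vs)"
    by (auto simp: \<theta>_def \<theta>'_def cov_def)
  define \<delta> where "\<delta> = (\<lambda>r s vs. (if r = 0 then 0 else wedge \<theta> (\<gamma> (r - 1) s) vs) +
    (if s = 0 then 0 else wedge \<theta>' (\<gamma> r (s - 1)) vs))"
  show ?thesis
  proof (rule gradedI[of \<delta>])
    fix r s
    have "of_bidegree J r s (\<lambda>vs. if r = 0 then 0 else wedge \<theta> (\<gamma> (r - 1) s) vs)"
      using bi(1)[of "r - 1" s] by (cases r) (auto intro: of_bidegree.zero)
    moreover have "of_bidegree J r s (\<lambda>vs. if s = 0 then 0 else wedge \<theta>' (\<gamma> r (s - 1)) vs)"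
      using bi(2)[of r "s - 1"] by (cases s) (auto intro: of_bidegree.zero)
    ultimately show "of_bidegree J r s (\<delta> r s)" unfolding \<delta>_def by (rule of_bidegree.add)
    show "wedge (cov (\<lambda>v. of_real (v \<bullet> e))) \<alpha> vs = (\<Sum>r\<le>2. \<Sum>s\<le>2. \<delta> r s vs)" for vs
      unfolding split \<alpha>
      by (simp add: sum_le2 wedge_add_left wedge_add_right \<delta>_def z)
  qed
qed

lemma graded_exterior: "\<alpha> \<in> exterior \<Longrightarrow> graded \<alpha>"
proof -
  assume "\<alpha> \<in> exterior"
  moreover have "graded (monomial I)" for I
    by (induction I) (simp_all add: monomial_def graded_unit graded_wedge)
  then have "graded (prescribed \<alpha>)"
    unfolding prescribed_def by (intro graded_sum graded_scale)
  ultimately show ?thesis using exterior_expand by metis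
qed

end

text \<open>In each degree \<open>p + q\<close> at most three bidegrees occur, with eigenvalues \<open>\<i> (r - s)\<close>; a polynomial of
  degree two separates one of them from the others.\<close>

lemma interpolation_coefficients:
  fixes p q :: nat
  assumes "p \<le> 2" "q \<le> 2"
  shows "\<exists>u v w. \<forall>r s. r \<le> 2 \<longrightarrow> s \<le> 2 \<longrightarrow> r + s = p + q \<longrightarrow>
        u + v * (\<i> * (of_nat r - of_nat s)) + w * (\<i> * (of_nat r - of_nat s))\<^sup>2 = (if r = p then 1 else 0 :: complex)"
proof -
  have nn: "p = 0 \<or> p = 1 \<or> p = 2" "q = 0 \<or> q = 1 \<or> q = 2" using assms by auto
  show ?thesis
  proof -
    have fin: "\<forall>r s. r \<le> 2 \<longrightarrow> s \<le> 2 \<longrightarrow> Q r s"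
      if "Q 0 0" "Q 0 1" "Q 0 2" "Q 1 0" "Q 1 1" "Q 1 2" "Q 2 0" "Q 2 1" "Q 2 2"
      for Q :: "nat \<Rightarrow> nat \<Rightarrow> bool"
    proof (intro allI impI)
      fix r s :: nat assume "r \<le> 2" "s \<le> 2"
      then have "r = 0 \<or> r = 1 \<or> r = 2" "s = 0 \<or> s = 1 \<or> s = 2" by auto
      then show "Q r s" using that by (elim disjE) simp_all
    qed
    consider "p = q" "p + q \<noteq> 2" | "p = 1" "q = 1" | "p = 2" "q = 0" | "p = 0" "q = 2"
      | "p = Suc q" | "q = Suc p" using nn by auto
    then show ?thesis
    proof cases
      case 1
      then have "p = 0 \<and> q = 0 \<or> p = 2 \<and> q = 2" using nn by auto
      then show ?thesis
        by - ((rule exI[of _ "1"], rule exI[of _ "0"], rule exI[of _ "0"]), ((erule disjE); (rule fin; simp)))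
    next
      case 2
      then show ?thesis
        by - ((rule exI[of _ "1"], rule exI[of _ "0"], rule exI[of _ "1/4"]), (rule fin; simp add: power2_eq_square))
    next
      case 3
      then show ?thesis
        by - ((rule exI[of _ "0"], rule exI[of _ "- \<i> / 4"], rule exI[of _ "-1/8"]), (rule fin; simp add: power2_eq_square))
    next
      case 4
      then show ?thesis
        by - ((rule exI[of _ "0"], rule exI[of _ "\<i> / 4"], rule exI[of _ "-1/8"]), (rule fin; simp add: power2_eq_square))
    next
      case 5
      then have "p = 1 \<and> q = 0 \<or> p = 2 \<and> q = 1" using nn by auto
      then show ?thesis
        by - ((rule exI[of _ "1/2"], rule exI[of _ "- \<i> / 2"], rule exI[of _ "0"]), ((erule disjE); (rule fin; simp)))
    next
      case 6
      then have "p = 0 \<and> q = 1 \<or> p = 1 \<and> q = 2" using nn by auto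
      then show ?thesis
        by - ((rule exI[of _ "1/2"], rule exI[of _ "\<i> / 2"], rule exI[of _ "0"]), ((erule disjE); (rule fin; simp)))
    qed
  qed
qed

context hframe
begin

lemma graded_component_herm:
  assumes \<gamma>: "\<And>r s. of_bidegree J r s (\<gamma> r s)" and \<beta>: "eigen_bidegree J p q \<beta>" and pq: "p \<le> 2" "q \<le> 2"
  shows "herm (\<lambda>vs. \<Sum>r\<le>2. \<Sum>s\<le>2. \<gamma> r s vs) \<beta> = herm (\<gamma> p q) \<beta>"
proof -
  have z: "herm (\<gamma> r s) \<beta> = 0" if "(r, s) \<noteq> (p, q)" for r s
    by (rule eigen_orthogonal[OF of_bidegree_eigen[OF \<gamma>] \<beta> that])
  have "herm (\<lambda>vs. \<Sum>r\<le>2. \<Sum>s\<le>2. \<gamma> r s vs) \<beta> = (\<Sum>r\<le>2. \<Sum>s\<le>2. herm (\<gamma> r s) \<beta>)"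
    by (simp only: herm_sum_left)
  also have "\<dots> = (\<Sum>r\<le>2. \<Sum>s\<le>2. if r = p \<and> s = q then herm (\<gamma> p q) \<beta> else 0)"
    by (intro sum.cong refl) (use z in auto)
  also have "\<dots> = (\<Sum>r\<le>2. if r = p then herm (\<gamma> p q) \<beta> else 0)"
    by (intro sum.cong refl) (use pq in \<open>auto simp: sum.delta\<close>)
  also have "\<dots> = herm (\<gamma> p q) \<beta>" using pq by (simp add: sum.delta)
  finally show ?thesis .
qed

lemma graded_unique:
  assumes \<gamma>: "\<And>r s. of_bidegree J r s (\<gamma> r s)" and \<gamma>': "\<And>r s. of_bidegree J r s (\<gamma>' r s)"
    and eq: "(\<lambda>vs. \<Sum>r\<le>2. \<Sum>s\<le>2. \<gamma> r s vs) = (\<lambda>vs. \<Sum>r\<le>2. \<Sum>s\<le>2. \<gamma>' r s vs)"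
  shows "\<gamma> p q = \<gamma>' p q"
proof (cases "p \<le> 2 \<and> q \<le> 2")
  case True
  let ?\<delta> = "\<lambda>vs. \<gamma> p q vs - \<gamma>' p q vs"
  have "of_bidegree J p q (\<lambda>vs. \<gamma> p q vs + (-1) * \<gamma>' p q vs)"
    by (intro of_bidegree.add of_bidegree.scale \<gamma> \<gamma>')
  then have \<delta>: "eigen_bidegree J p q ?\<delta>" by (intro of_bidegree_eigen) simp
  then have "herm (\<gamma> p q) ?\<delta> = herm (\<gamma>' p q) ?\<delta>"
    using graded_component_herm[OF \<gamma> \<delta>] graded_component_herm[OF \<gamma>' \<delta>] eq True by simp
  then have "?\<delta> = (\<lambda>vs. 0)"
    using \<delta> by (intro herm_definite) (auto simp: eigen_bidegree_def herm_diff_left)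
  then show ?thesis by (simp add: fun_eq_iff)
next
  case False
  then show ?thesis using of_bidegree_vanish[OF \<gamma>, of p q] of_bidegree_vanish[OF \<gamma>', of p q] by auto
qed

lemma half_dim2: "half_dim TYPE('a) = 2"
  by (simp add: half_dim_def dim4)

lemma bidegree_part_eqI:
  assumes \<gamma>: "\<And>r s. of_bidegree J r s (\<gamma> r s)" and \<alpha>: "\<alpha> = (\<lambda>vs. \<Sum>r\<le>2. \<Sum>s\<le>2. \<gamma> r s vs)"
  shows "bidegree_part J p q \<alpha> = \<gamma> p q"
  unfolding bidegree_part_def half_dim2
proof (rule the_equality)
  show "\<exists>\<delta>. (\<forall>r s. of_bidegree J r s (\<delta> r s)) \<and> \<gamma> p q = \<delta> p q
      \<and> \<alpha> = (\<lambda>vs. \<Sum>r\<le>2. \<Sum>s\<le>2. \<delta> r s vs)"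
    using \<gamma> \<alpha> by (intro exI[of _ \<gamma>]) auto
next
  fix \<beta>
  assume "\<exists>\<delta>. (\<forall>r s. of_bidegree J r s (\<delta> r s)) \<and> \<beta> = \<delta> p q
      \<and> \<alpha> = (\<lambda>vs. \<Sum>r\<le>2. \<Sum>s\<le>2. \<delta> r s vs)"
  then obtain \<delta> where "\<And>r s. of_bidegree J r s (\<delta> r s)" "\<beta> = \<delta> p q"
    "\<alpha> = (\<lambda>vs. \<Sum>r\<le>2. \<Sum>s\<le>2. \<delta> r s vs)" by blast
  then show "\<beta> = \<gamma> p q" using graded_unique[of \<delta> \<gamma> p q] \<gamma> \<alpha> by simp
qed

lemma
  assumes "\<alpha> \<in> exterior"
  shows of_bidegree_part: "of_bidegree J p q (bidegree_part J p q \<alpha>)"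
    and sum_bidegree_part: "\<alpha> = (\<lambda>vs. \<Sum>r\<le>2. \<Sum>s\<le>2. bidegree_part J r s \<alpha> vs)"
proof -
  obtain \<gamma> where \<gamma>: "\<And>r s. of_bidegree J r s (\<gamma> r s)" and \<alpha>: "\<alpha> = (\<lambda>vs. \<Sum>r\<le>2. \<Sum>s\<le>2. \<gamma> r s vs)"
    using graded_exterior[OF assms] by (auto simp: graded_def)
  have "bidegree_part J r s \<alpha> = \<gamma> r s" for r s by (rule bidegree_part_eqI[OF \<gamma> \<alpha>])
  then show "of_bidegree J p q (bidegree_part J p q \<alpha>)"
    "\<alpha> = (\<lambda>vs. \<Sum>r\<le>2. \<Sum>s\<le>2. bidegree_part J r s \<alpha> vs)"
    using \<gamma> \<alpha> by simp_all
qed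

lemma exterior_bidegree_part: "\<alpha> \<in> exterior \<Longrightarrow> bidegree_part J p q \<alpha> \<in> exterior"
  using of_bidegree_eigen[OF of_bidegree_part] by (simp add: eigen_bidegree_def)

lemma bidegree_part_vanish: "\<alpha> \<in> exterior \<Longrightarrow> p > 2 \<or> q > 2 \<Longrightarrow> bidegree_part J p q \<alpha> = (\<lambda>vs. 0)"
  by (rule of_bidegree_vanish[OF of_bidegree_part])

lemma bidegree_part_of_bidegree:
  assumes "of_bidegree J p q \<alpha>" "p \<le> 2" "q \<le> 2"
  shows "bidegree_part J r s \<alpha> = (if r = p \<and> s = q then \<alpha> else (\<lambda>vs. 0))"
proof (rule bidegree_part_eqI)
  show "of_bidegree J r s (if r = p \<and> s = q then \<alpha> else (\<lambda>vs. 0))" for r s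
    using assms by (auto intro: of_bidegree.zero)
  have "(\<Sum>r\<le>2. \<Sum>s\<le>2. (if r = p \<and> s = q then \<alpha> else (\<lambda>vs. 0)) vs) = \<alpha> vs" for vs
  proof -
    have "(\<Sum>r\<le>2. \<Sum>s\<le>2. (if r = p \<and> s = q then \<alpha> else (\<lambda>vs. 0)) vs)
      = (\<Sum>r\<le>2. if r = p then \<alpha> vs else 0)"
      by (intro sum.cong refl) (use assms in \<open>auto simp: sum.delta if_distrib[of "\<lambda>f. f vs"] cong: if_cong\<close>)
    then show ?thesis using assms by (simp add: sum.delta)
  qed
  then show "\<alpha> = (\<lambda>vs. \<Sum>r\<le>2. \<Sum>s\<le>2. (if r = p \<and> s = q then \<alpha> else (\<lambda>vs. 0)) vs)" by simp
qed

text \<open>An eigenform is orthogonal to all its other components, so subtracting the component of bidegree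
  \<open>(p,q)\<close> leaves a form orthogonal to itself.\<close>

lemma of_bidegree_iff:
  assumes "p \<le> 2" "q \<le> 2"
  shows "of_bidegree J p q \<alpha> \<longleftrightarrow> eigen_bidegree J p q \<alpha>"
proof
  assume e: "eigen_bidegree J p q \<alpha>"
  then have ext: "\<alpha> \<in> exterior" by (simp add: eigen_bidegree_def)
  let ?\<beta> = "bidegree_part J p q \<alpha>" and ?\<delta> = "\<lambda>vs. \<alpha> vs + (-1) * bidegree_part J p q \<alpha> vs"
  have \<beta>: "eigen_bidegree J p q ?\<beta>" by (rule of_bidegree_eigen[OF of_bidegree_part[OF ext]])
  have \<delta>: "eigen_bidegree J p q ?\<delta>"
    by (intro eigen_bidegree_add eigen_bidegree_scale e \<beta>)
  have "herm \<alpha> ?\<delta> = herm ?\<beta> ?\<delta>"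
    by (subst sum_bidegree_part[OF ext])
      (rule graded_component_herm[OF of_bidegree_part[OF ext] \<delta> assms])
  then have "herm ?\<delta> ?\<delta> = 0" by (simp only: herm_add_left herm_scale_left) simp
  then have "?\<delta> = (\<lambda>vs. 0)"
    using \<delta> by (intro herm_definite) (auto simp: eigen_bidegree_def)
  then have "\<alpha> = ?\<beta>" by (simp add: fun_eq_iff)
  then show "of_bidegree J p q \<alpha>" using of_bidegree_part[OF ext] by metis
qed (rule of_bidegree_eigen)

text \<open>Being mutually orthogonal, the projections to the bidegrees are self-adjoint.\<close>

lemma bidegree_part_selfadjoint:
  assumes "\<alpha> \<in> exterior" "\<beta> \<in> exterior"
  shows "herm (bidegree_part J p q \<alpha>) \<beta> = herm \<alpha> (bidegree_part J p q \<beta>)"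
proof (cases "p \<le> 2 \<and> q \<le> 2")
  case True
  have cnj: "herm x y = cnj (herm y x)" for x y
    by (simp add: herm_def mult.commute)
  have e: "eigen_bidegree J p q (bidegree_part J p q \<gamma>)" if "\<gamma> \<in> exterior" for \<gamma>
    by (rule of_bidegree_eigen[OF of_bidegree_part[OF that]])
  have "herm \<gamma> (bidegree_part J p q \<delta>) = herm (bidegree_part J p q \<gamma>) (bidegree_part J p q \<delta>)"
    if "\<gamma> \<in> exterior" "\<delta> \<in> exterior" for \<gamma> \<delta>
    by (subst sum_bidegree_part[OF that(1)])
      (rule graded_component_herm[OF of_bidegree_part[OF that(1)] e[OF that(2)]], use True in auto)
  from this[OF assms] this[OF assms(2,1)] show ?thesis
    using cnj by metis
next
  case False
  then show ?thesis using assms by (auto simp: bidegree_part_vanish not_le)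
qed

text \<open>The projections are Lagrange interpolation polynomials in the derivation induced by the
  complex structure, hence depend smoothly on it.\<close>

lemma bidegree_part_polynomial:
  assumes assms: "p \<le> 2" "q \<le> 2"
    and c: "\<And>r s. r \<le> 2 \<Longrightarrow> s \<le> 2 \<Longrightarrow> r + s = p + q \<Longrightarrow>
        u + v * (\<i> * (of_nat r - of_nat s)) + w * (\<i> * (of_nat r - of_nat s))\<^sup>2 = (if r = p then 1 else 0)"
    and ext: "\<alpha> \<in> exterior"
  shows "bidegree_part J p q \<alpha> vs =
      (if length vs = p + q then u * \<alpha> vs + v * jder J \<alpha> vs + w * jder J (jder J \<alpha>) vs else 0)"
proof -
  let ?g = "\<lambda>r s. bidegree_part J r s \<alpha>"
  have e: "eigen_bidegree J r s (?g r s)" for r s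
    by (rule of_bidegree_eigen[OF of_bidegree_part[OF ext]])
  have j: "jder J (?g r s) us = \<i> * (of_nat r - of_nat s) * ?g r s us" for r s us
    using e by (simp add: eigen_bidegree_def)
  have d: "?g r s us = 0" if "length us \<noteq> r + s" for r s us
    using e that by (auto simp: eigen_bidegree_def has_degree_def)
  have A: "\<alpha> = (\<lambda>us. \<Sum>r\<le>2. \<Sum>s\<le>2. ?g r s us)" by (rule sum_bidegree_part[OF ext])
  have A1: "jder J \<alpha> = (\<lambda>us. \<Sum>r\<le>2. \<Sum>s\<le>2. \<i> * (of_nat r - of_nat s) * ?g r s us)"
    by (rule HOL.ext, subst A) (simp only: jder_sum j)
  have A2: "jder J (jder J \<alpha>) = (\<lambda>us. \<Sum>r\<le>2. \<Sum>s\<le>2. (\<i> * (of_nat r - of_nat s))\<^sup>2 * ?g r s us)"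
    unfolding A1 by (rule HOL.ext) (simp only: jder_sum jder_scale j power2_eq_square mult.assoc)
  show ?thesis
  proof (cases "length vs = p + q")
    case True
    have "u * \<alpha> vs + v * jder J \<alpha> vs + w * jder J (jder J \<alpha>) vs
      = (\<Sum>r\<le>2. \<Sum>s\<le>2. (u + v * (\<i> * (of_nat r - of_nat s)) + w * (\<i> * (of_nat r - of_nat s))\<^sup>2) * ?g r s vs)"
      unfolding fun_cong[OF A2, of vs] fun_cong[OF A1, of vs] fun_cong[OF A, of vs]
      by (simp add: sum_distrib_left flip: sum.distrib) (simp add: algebra_simps)
    also have "\<dots> = (\<Sum>r\<le>2. \<Sum>s\<le>2. if r = p \<and> s = q then ?g p q vs else 0)"
    proof (intro sum.cong refl)
      fix r s :: nat assume "r \<in> {..2}" "s \<in> {..2}"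
      then show "(u + v * (\<i> * (of_nat r - of_nat s)) + w * (\<i> * (of_nat r - of_nat s))\<^sup>2) * ?g r s vs
          = (if r = p \<and> s = q then ?g p q vs else 0)"
        using d[of vs r s] c[of r s] True by (cases "r + s = p + q") auto
    qed
    also have "\<dots> = (\<Sum>r\<le>2. if r = p then ?g p q vs else 0)"
      by (intro sum.cong refl) (use assms in \<open>auto simp: sum.delta\<close>)
    also have "\<dots> = ?g p q vs" using assms by (simp add: sum.delta)
    finally show ?thesis using True by simp
  qed (simp add: d)
qed

section \<open>The Hodge star and the bidegrees\<close>

abbreviation (input) st :: "'a covec \<Rightarrow> 'a covec" where "st \<equiv> hodge_star inner J"

lemma exterior_star: "\<gamma> \<in> exterior \<Longrightarrow> st \<gamma> \<in> exterior"
  and star_table_star: "\<gamma> \<in> exterior \<Longrightarrow> star_table \<gamma> (st \<gamma>)"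
  using hodge_star_table[OF exterior_volume volume_frame] by auto

lemma star_eqI: "\<gamma> \<in> exterior \<Longrightarrow> \<eta> \<in> exterior \<Longrightarrow> star_table \<gamma> \<eta> \<Longrightarrow> st \<gamma> = \<eta>"
  by (rule exterior_eqI[OF exterior_star])
    (use star_table_star[of \<gamma>] in \<open>auto simp: subframe_def star_table_def\<close>)

lemma star_add: "\<alpha> \<in> exterior \<Longrightarrow> \<beta> \<in> exterior \<Longrightarrow> st (\<lambda>vs. \<alpha> vs + \<beta> vs) = (\<lambda>vs. st \<alpha> vs + st \<beta> vs)"
  by (rule star_eqI)
    (use star_table_star[of \<alpha>] star_table_star[of \<beta>] in
      \<open>auto simp: star_table_def intro!: exterior_add exterior_star\<close>)

lemma star_scale: "\<alpha> \<in> exterior \<Longrightarrow> st (\<lambda>vs. z * \<alpha> vs) = (\<lambda>vs. z * st \<alpha> vs)"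
  by (rule star_eqI)
    (use star_table_star[of \<alpha>] in \<open>auto simp: star_table_def intro!: exterior_scale exterior_star\<close>)

lemma star_zero: "st (\<lambda>vs. 0) = (\<lambda>vs. 0)"
  using star_scale[OF exterior_zero(1), of 0] by simp

lemma star_sum: "(\<And>i. i \<in> I \<Longrightarrow> \<alpha> i \<in> exterior) \<Longrightarrow> st (\<lambda>vs. \<Sum>i\<in>I. \<alpha> i vs) = (\<lambda>vs. \<Sum>i\<in>I. st (\<alpha> i) vs)"
  by (induction I rule: infinite_finite_induct) (auto simp: star_zero star_add exterior_sum)

lemma star_jder: "\<alpha> \<in> exterior \<Longrightarrow> st (jder J \<alpha>) = jder J (st \<alpha>)"
  by (rule star_eqI)
    (use star_table_star[of \<alpha>] in
      \<open>auto simp: star_table_def jder_table exterior_star intro!: exterior_jder linJ exterior_star simp del: jder_Cons\<close>)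

lemma star_table_degree:
  assumes "star_table \<gamma> \<eta>" "has_degree k \<gamma>" "k \<le> 4" "vs \<in> subframe a b c d" "length vs \<noteq> 4 - k"
  shows "\<eta> vs = 0"
proof -
  have "length vs \<le> 4" using assms(4) by (auto simp: subframe_def)
  then have D: "\<gamma> ws = 0" if "length ws + length vs = 4" for ws
    using assms(2,3,5) that by (auto simp: has_degree_def)
  show ?thesis
    using assms(1,4) D unfolding star_table_def subframe_def
    by (elim conjE insertE emptyE) simp_all
qed

text \<open>The star commutes with the derivation, which preserves the eigenvalue \<open>p - q = (2 - q) - (2 - p)\<close>,
  and turns the degree \<open>p + q\<close> into \<open>4 - p - q\<close>; these two numbers determine the bidegree.\<close>

lemma star_of_bidegree:
  assumes "of_bidegree J p q \<alpha>" "p \<le> 2" "q \<le> 2"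
  shows "of_bidegree J (2 - q) (2 - p) (st \<alpha>)"
proof -
  have e: "eigen_bidegree J p q \<alpha>" by (rule of_bidegree_eigen[OF assms(1)])
  then have ext: "\<alpha> \<in> exterior" and deg: "\<And>vs. length vs \<noteq> p + q \<Longrightarrow> \<alpha> vs = 0"
    and jd: "jder J \<alpha> = (\<lambda>vs. \<i> * (of_nat p - of_nat q) * \<alpha> vs)"
    by (auto simp: eigen_bidegree_def has_degree_def)
  let ?k = "2 - q + (2 - p)"
  have "(\<lambda>vs. (if length vs = ?k then 1 else 0) * st \<alpha> vs) = st \<alpha>"
  proof (rule exterior_eqI)
    show "(\<lambda>vs. (if length vs = ?k then 1 else 0) * st \<alpha> vs) \<in> exterior"
      by (rule exterior_cmult_length[where k = "\<lambda>n. if n = ?k then 1 else 0", OF exterior_star[OF ext]])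
    fix vs assume "vs \<in> subframe a b c d"
    then have "st \<alpha> vs = 0" if "length vs \<noteq> ?k"
      using star_table_degree[OF star_table_star[OF ext], of "p + q" vs] that assms(2,3) deg
      by (simp add: has_degree_def)
    then show "(if length vs = ?k then 1 else 0) * st \<alpha> vs = st \<alpha> vs" by auto
  qed (rule exterior_star[OF ext])
  then have "(if length vs = ?k then 1 else 0) * st \<alpha> vs = st \<alpha> vs" for vs by (rule fun_cong)
  then have "st \<alpha> vs = 0" if "length vs \<noteq> ?k" for vs using that by (metis mult_zero_left)
  then have "has_degree ?k (st \<alpha>)" by (simp add: has_degree_def)
  moreover have "jder J (st \<alpha>) vs = \<i> * (of_nat (2 - q) - of_nat (2 - p)) * st \<alpha> vs" for vs
    using assms(2,3) by (simp add: star_jder[OF ext, symmetric] jd star_scale[OF ext] of_nat_diff)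
  ultimately show ?thesis
    by (simp add: of_bidegree_iff eigen_bidegree_def exterior_star ext)
qed

lemma star_bidegree_part:
  assumes "\<alpha> \<in> exterior" "p \<le> 2" "q \<le> 2"
  shows "st (bidegree_part J p q \<alpha>) = bidegree_part J (2 - q) (2 - p) (st \<alpha>)"
proof -
  let ?\<gamma> = "\<lambda>r s. if r \<le> 2 \<and> s \<le> 2 then st (bidegree_part J (2 - s) (2 - r) \<alpha>) else (\<lambda>vs. 0)"
  have "bidegree_part J (2 - q) (2 - p) (st \<alpha>) = ?\<gamma> (2 - q) (2 - p)"
  proof (rule bidegree_part_eqI)
    fix r s
    show "of_bidegree J r s (?\<gamma> r s)"
      using star_of_bidegree[OF of_bidegree_part[OF assms(1)], of "2 - s" "2 - r"]
      by (auto intro: of_bidegree.zero)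
  next
    have "st \<alpha> = (\<lambda>vs. \<Sum>r\<le>2. \<Sum>s\<le>2. st (bidegree_part J r s \<alpha>) vs)"
      by (subst sum_bidegree_part[OF assms(1)])
        (simp only: star_sum exterior_sum exterior_bidegree_part[OF assms(1)])
    then show "st \<alpha> = (\<lambda>vs. \<Sum>r\<le>2. \<Sum>s\<le>2. ?\<gamma> r s vs)"
      by (simp add: sum_le2 fun_eq_iff)
  qed
  then show ?thesis using assms(2,3) by simp
qed

end

section \<open>Smooth functions\<close>

lemma C_k_on_cong:
  assumes "open S" "\<And>x. x \<in> S \<Longrightarrow> f x = g x" "C_k_on k S f"
  shows "C_k_on k S g"
  using assms(2,3)
proof (induction k arbitrary: f g)
  case 0
  then show ?case using continuous_on_cong[of S S f g] by simp
next
  case (Suc k)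
  have d: "f differentiable at x" if "x \<in> S" for x using Suc.prems that by simp
  have eq: "frechet_derivative f (at x) = frechet_derivative g (at x)" if "x \<in> S" for x
    by (rule frechet_derivative_transform_within_open[OF d assms(1)]) (use that Suc.prems in auto)
  have "g differentiable at x" if "x \<in> S" for x
  proof -
    obtain D where D: "(f has_derivative D) (at x)" using d[OF \<open>x \<in> S\<close>] by (auto simp: differentiable_def)
    have "(g has_derivative D) (at x)"
      by (rule has_derivative_transform_within_open[OF D assms(1) \<open>x \<in> S\<close> Suc.prems(1)])
    then show ?thesis by (auto simp: differentiable_def)
  qed
  moreover have "C_k_on k S (\<lambda>x. frechet_derivative g (at x) v)" for v
    by (rule Suc.IH[of "\<lambda>x. frechet_derivative f (at x) v"]) (use eq Suc.prems in auto)
  ultimately show ?case by simp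
qed

lemma C_k_on_SucI:
  assumes "open S" "\<And>x. x \<in> S \<Longrightarrow> (f has_derivative f' x) (at x)" "\<And>v. C_k_on k S (\<lambda>x. f' x v)"
  shows "C_k_on (Suc k) S f"
proof -
  have "C_k_on k S (\<lambda>x. frechet_derivative f (at x) v)" for v
    by (rule C_k_on_cong[OF assms(1) _ assms(3)[of v]])
      (use frechet_derivative_at[OF assms(2)] in auto)
  then show ?thesis using assms(2) by (auto simp: differentiable_def)
qed

lemma C_k_on_const: "open S \<Longrightarrow> C_k_on k S (\<lambda>x. c)"
proof (induction k arbitrary: c)
  case (Suc k)
  then show ?case by (intro C_k_on_SucI[where f' = "\<lambda>x v. 0"]) auto
qed simp

lemma C_k_on_has_derivative:
  "C_k_on (Suc k) S f \<Longrightarrow> x \<in> S \<Longrightarrow> (f has_derivative frechet_derivative f (at x)) (at x)"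
  by (simp add: frechet_derivative_works)

lemma C_k_on_add:
  "open S \<Longrightarrow> C_k_on k S f \<Longrightarrow> C_k_on k S g \<Longrightarrow> C_k_on k S (\<lambda>x. f x + g x)"
proof (induction k arbitrary: f g)
  case (Suc k)
  show ?case
  proof (rule C_k_on_SucI[OF Suc.prems(1)])
    fix x assume "x \<in> S"
    then show "((\<lambda>x. f x + g x) has_derivative
        (\<lambda>v. frechet_derivative f (at x) v + frechet_derivative g (at x) v)) (at x)"
      using Suc.prems by (intro has_derivative_add C_k_on_has_derivative)
  qed (use Suc in auto)
qed (simp add: continuous_on_add)

lemma C_k_on_linear:
  assumes "bounded_linear L"
  shows "open S \<Longrightarrow> C_k_on k S f \<Longrightarrow> C_k_on k S (\<lambda>x. L (f x))"
proof (induction k arbitrary: f)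
  case 0
  then show ?case using bounded_linear.continuous_on[OF assms] by simp
next
  case (Suc k)
  show ?case
  proof (rule C_k_on_SucI[OF Suc.prems(1)])
    fix x assume "x \<in> S"
    then show "((\<lambda>x. L (f x)) has_derivative (\<lambda>v. L (frechet_derivative f (at x) v))) (at x)"
      using Suc.prems by (intro bounded_linear.has_derivative[OF assms] C_k_on_has_derivative)
  qed (use Suc in auto)
qed

lemma C_k_on_Suc_imp: "C_k_on (Suc k) S f \<Longrightarrow> C_k_on k S f"
proof (induction k arbitrary: f)
  case 0
  then show ?case
    by (auto intro!: continuous_at_imp_continuous_on differentiable_imp_continuous_within)
qed simp

lemma C_k_on_mult:
  fixes f g :: "'e::euclidean_space \<Rightarrow> complex"
  shows "open S \<Longrightarrow> C_k_on k S f \<Longrightarrow> C_k_on k S g \<Longrightarrow> C_k_on k S (\<lambda>x. f x * g x)"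
proof (induction k arbitrary: f g)
  case (Suc k)
  show ?case
  proof (rule C_k_on_SucI[OF Suc.prems(1)])
    fix x assume "x \<in> S"
    then show "((\<lambda>x. f x * g x) has_derivative
        (\<lambda>v. f x * frechet_derivative g (at x) v + frechet_derivative f (at x) v * g x)) (at x)"
      using Suc.prems by (intro has_derivative_mult C_k_on_has_derivative)
  next
    fix v
    show "C_k_on k S (\<lambda>x. f x * frechet_derivative g (at x) v + frechet_derivative f (at x) v * g x)"
      using Suc.prems C_k_on_Suc_imp[OF Suc.prems(2)] C_k_on_Suc_imp[OF Suc.prems(3)]
      by (intro C_k_on_add Suc.IH) auto
  qed
qed (simp add: continuous_on_mult)

lemma C_k_on_subset: "C_k_on k S f \<Longrightarrow> T \<subseteq> S \<Longrightarrow> C_k_on k T f"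
  by (induction k arbitrary: f) (auto intro: continuous_on_subset)

lemma C_k_on_local:
  assumes "open S" "\<And>x. x \<in> S \<Longrightarrow> \<exists>U. open U \<and> x \<in> U \<and> C_k_on k U f"
  shows "C_k_on k S f"
  using assms(2)
proof (induction k arbitrary: f)
  case 0
  have "continuous (at x) f" if xS: "x \<in> S" for x
  proof -
    obtain U where "open U" "x \<in> U" "continuous_on U f" using 0[OF xS] by auto
    then show ?thesis using continuous_on_eq_continuous_at by blast
  qed
  then show ?case by (simp add: continuous_at_imp_continuous_on)
next
  case (Suc k)
  have "f differentiable at x" if "x \<in> S" for x using Suc.prems[OF that] by auto
  moreover have "C_k_on k S (\<lambda>x. frechet_derivative f (at x) v)" for v
    by (rule Suc.IH) (use Suc.prems in fastforce)
  ultimately show ?case by simp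
qed

lemma smooth_on_cong: "open S \<Longrightarrow> (\<And>x. x \<in> S \<Longrightarrow> f x = g x) \<Longrightarrow> smooth_on S f \<Longrightarrow> smooth_on S g"
  unfolding smooth_on_def using C_k_on_cong by blast

lemma smooth_on_local:
  "open S \<Longrightarrow> (\<And>x. x \<in> S \<Longrightarrow> \<exists>U. open U \<and> x \<in> U \<and> smooth_on U f) \<Longrightarrow> smooth_on S f"
  unfolding smooth_on_def by (intro allI C_k_on_local) blast+

lemma smooth_on_subset: "smooth_on S f \<Longrightarrow> T \<subseteq> S \<Longrightarrow> smooth_on T f"
  unfolding smooth_on_def using C_k_on_subset by blast

lemma smooth_on_const: "open S \<Longrightarrow> smooth_on S (\<lambda>x. c)"
  by (simp add: smooth_on_def C_k_on_const)

lemma smooth_on_add: "open S \<Longrightarrow> smooth_on S f \<Longrightarrow> smooth_on S g \<Longrightarrow> smooth_on S (\<lambda>x. f x + g x)"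
  by (simp add: smooth_on_def C_k_on_add)

lemma smooth_on_linear: "bounded_linear L \<Longrightarrow> open S \<Longrightarrow> smooth_on S f \<Longrightarrow> smooth_on S (\<lambda>x. L (f x))"
  by (simp add: smooth_on_def C_k_on_linear)

lemma smooth_on_mult:
  "open S \<Longrightarrow> smooth_on S f \<Longrightarrow> smooth_on S g \<Longrightarrow> smooth_on S (\<lambda>x. f x * g x :: complex)"
  by (simp add: smooth_on_def C_k_on_mult)

lemma smooth_on_uminus: "open S \<Longrightarrow> smooth_on S f \<Longrightarrow> smooth_on S (\<lambda>x. - f x)"
  by (rule smooth_on_linear[OF bounded_linear_minus[OF bounded_linear_ident]])

lemma smooth_on_diff: "open S \<Longrightarrow> smooth_on S f \<Longrightarrow> smooth_on S g \<Longrightarrow> smooth_on S (\<lambda>x. f x - g x)"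
  using smooth_on_add[OF _ _ smooth_on_uminus, of S f g] by simp

lemma smooth_on_cnj: "open S \<Longrightarrow> smooth_on S f \<Longrightarrow> smooth_on S (\<lambda>x. cnj (f x))"
  by (rule smooth_on_linear[OF bounded_linear_cnj])

lemma smooth_on_sum:
  "open S \<Longrightarrow> (\<And>i. i \<in> I \<Longrightarrow> smooth_on S (f i)) \<Longrightarrow> smooth_on S (\<lambda>x. \<Sum>i\<in>I. f i x)"
  by (induction I rule: infinite_finite_induct) (auto intro: smooth_on_const smooth_on_add)

lemma smooth_on_affine:
  assumes "open S" "bounded_linear A"
  shows "smooth_on S (\<lambda>x. A x + b)"
proof -
  have "C_k_on k S (\<lambda>x. A x + b)" for k
  proof (cases k)
    case 0
    then show ?thesis
      using bounded_linear.continuous_on[OF assms(2) continuous_on_id, of S] by (simp add: continuous_on_add)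
  next
    case (Suc j)
    have "((\<lambda>x. A x + b) has_derivative A) (at x)" for x
      using has_derivative_add_const bounded_linear_imp_has_derivative[OF assms(2)] by blast
    then show ?thesis unfolding Suc
      by (intro C_k_on_SucI[OF assms(1), where f' = "\<lambda>x. A"] C_k_on_const[OF assms(1)])
  qed
  then show ?thesis by (simp add: smooth_on_def)
qed

lemma smooth_on_trig:
  assumes "open S"
  shows "smooth_on S (\<lambda>x. complex_of_real (cos (x \<bullet> e)))" "smooth_on S (\<lambda>x. complex_of_real (sin (x \<bullet> e)))"
proof -
  have "C_k_on k S (\<lambda>x. complex_of_real (cos (x \<bullet> e))) \<and> C_k_on k S (\<lambda>x. complex_of_real (sin (x \<bullet> e)))" for k
  proof (induction k)
    case 0
    then show ?case by (auto intro!: continuous_intros)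
  next
    case (Suc k)
    have "C_k_on k S (\<lambda>x. complex_of_real (- (v \<bullet> e)) * complex_of_real (sin (x \<bullet> e)))"
      "C_k_on k S (\<lambda>x. complex_of_real (v \<bullet> e) * complex_of_real (cos (x \<bullet> e)))" for v
      by (rule C_k_on_mult[OF assms C_k_on_const[OF assms] conjunct2[OF Suc]],
          rule C_k_on_mult[OF assms C_k_on_const[OF assms] conjunct1[OF Suc]])
    note c = this
    have d: "((\<lambda>x. complex_of_real (cos (x \<bullet> e))) has_derivative
        (\<lambda>v. complex_of_real (- (v \<bullet> e)) * complex_of_real (sin (x \<bullet> e)))) (at x)"
      "((\<lambda>x. complex_of_real (sin (x \<bullet> e))) has_derivative
        (\<lambda>v. complex_of_real (v \<bullet> e) * complex_of_real (cos (x \<bullet> e)))) (at x)" for x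
      by (auto intro!: derivative_eq_intros)
    show ?case
      by (rule conjI; rule C_k_on_SucI[OF assms]; (rule d c)+)
  qed
  then show "smooth_on S (\<lambda>x. complex_of_real (cos (x \<bullet> e)))" "smooth_on S (\<lambda>x. complex_of_real (sin (x \<bullet> e)))"
    by (simp_all add: smooth_on_def)
qed

definition dd :: "'e::euclidean_space \<Rightarrow> ('e \<Rightarrow> 'b::real_normed_vector) \<Rightarrow> 'e \<Rightarrow> 'b" where
  "dd v f x = frechet_derivative f (at x) v"

lemma smooth_on_dd: "smooth_on S f \<Longrightarrow> smooth_on S (dd v f)"
  unfolding smooth_on_def dd_def[abs_def] by (metis C_k_on.simps(2))

lemma smooth_on_has_derivative:
  "smooth_on S f \<Longrightarrow> x \<in> S \<Longrightarrow> (f has_derivative (\<lambda>v. dd v f x)) (at x)"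
  unfolding smooth_on_def dd_def using C_k_on_has_derivative[of 0 S f x] by auto

lemma smooth_on_continuous: "smooth_on S f \<Longrightarrow> continuous_on S f"
  unfolding smooth_on_def by (metis C_k_on.simps(1))

lemma dd_eq: "(f has_derivative f') (at x) \<Longrightarrow> dd v f x = f' v"
  unfolding dd_def using frechet_derivative_at by metis

lemma dd_const [simp]: "dd v (\<lambda>x. c) x = 0"
  by (rule dd_eq) auto

lemma linear_dd: "smooth_on S f \<Longrightarrow> x \<in> S \<Longrightarrow> linear (\<lambda>v. dd v f x)"
  using has_derivative_bounded_linear[OF smooth_on_has_derivative] bounded_linear.linear by blast

lemma dd_add: "smooth_on S f \<Longrightarrow> smooth_on S g \<Longrightarrow> x \<in> S \<Longrightarrow> dd v (\<lambda>x. f x + g x) x = dd v f x + dd v g x"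
  by (rule dd_eq, rule has_derivative_add; rule smooth_on_has_derivative)

lemma dd_linear: "bounded_linear L \<Longrightarrow> smooth_on S f \<Longrightarrow> x \<in> S \<Longrightarrow> dd v (\<lambda>x. L (f x)) x = L (dd v f x)"
  by (rule dd_eq, rule bounded_linear.has_derivative, assumption, rule smooth_on_has_derivative)

lemma dd_mult:
  "smooth_on S f \<Longrightarrow> smooth_on S g \<Longrightarrow> x \<in> S \<Longrightarrow>
    dd v (\<lambda>x. f x * g x :: complex) x = f x * dd v g x + dd v f x * g x"
  by (rule dd_eq, rule has_derivative_mult; rule smooth_on_has_derivative)

lemma dd_uminus: "smooth_on S f \<Longrightarrow> x \<in> S \<Longrightarrow> dd v (\<lambda>x. - f x) x = - dd v f x"
  by (rule dd_linear[OF bounded_linear_minus[OF bounded_linear_ident]])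

lemma dd_cnj: "smooth_on S f \<Longrightarrow> x \<in> S \<Longrightarrow> dd v (\<lambda>x. cnj (f x)) x = cnj (dd v f x)"
  by (rule dd_linear[OF bounded_linear_cnj])

lemma dd_cmult: "smooth_on S f \<Longrightarrow> x \<in> S \<Longrightarrow> dd v (\<lambda>x. (c::complex) * f x) x = c * dd v f x"
  by (rule dd_linear[OF bounded_linear_mult_right])

lemma dd_diff: "smooth_on S f \<Longrightarrow> smooth_on S g \<Longrightarrow> x \<in> S \<Longrightarrow> dd v (\<lambda>x. f x - g x) x = dd v f x - dd v g x"
  by (rule dd_eq, rule has_derivative_diff; rule smooth_on_has_derivative)

lemma dd_trig:
  "dd v (\<lambda>x. complex_of_real (cos (x \<bullet> e))) x = - of_real (v \<bullet> e) * of_real (sin (x \<bullet> e))"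
  "dd v (\<lambda>x. complex_of_real (sin (x \<bullet> e))) x = of_real (v \<bullet> e) * of_real (cos (x \<bullet> e))"
  by (rule dd_eq, auto intro!: derivative_eq_intros)+

lemma dd_cong: "open S \<Longrightarrow> x \<in> S \<Longrightarrow> (\<And>y. y \<in> S \<Longrightarrow> f y = g y) \<Longrightarrow> dd v f x = dd v g x"
proof -
  assume S: "open S" "x \<in> S" "\<And>y. y \<in> S \<Longrightarrow> f y = g y"
  have "(f has_derivative f') (at x) = (g has_derivative f') (at x)" for f'
  proof
    show "(g has_derivative f') (at x)" if "(f has_derivative f') (at x)"
      by (rule has_derivative_transform_within_open[OF that S])
    show "(f has_derivative f') (at x)" if "(g has_derivative f') (at x)"
      by (rule has_derivative_transform_within_open[OF that S(1,2) S(3)[symmetric]])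
  qed
  then show ?thesis by (simp add: dd_def frechet_derivative_def)
qed

lemma dd_line:
  assumes "smooth_on UNIV f"
  shows "((\<lambda>t. f (x + t *\<^sub>R v)) has_vector_derivative dd v f (x + t *\<^sub>R v)) (at t within T)"
proof -
  have "((\<lambda>t. x + t *\<^sub>R v) has_derivative (\<lambda>h. h *\<^sub>R v)) (at t within T)"
    by (auto intro!: derivative_eq_intros)
  from has_derivative_compose[OF this, of f "\<lambda>u. dd u f (x + t *\<^sub>R v)"]
  have "((\<lambda>t. f (x + t *\<^sub>R v)) has_derivative (\<lambda>h. dd (h *\<^sub>R v) f (x + t *\<^sub>R v))) (at t within T)"
    using smooth_on_has_derivative[OF assms] by simp
  then show ?thesis
    unfolding has_vector_derivative_def using linear_scale[OF linear_dd[OF assms]] by simp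
qed

text \<open>Symmetry of second derivatives: differentiate
  \<open>f (x + s u + t v) - f (x + s u) = \<integral> dd v f (x + s u + r v) dr\<close> under the integral sign in
  \<open>s\<close>, then in \<open>t\<close>.\<close>

lemma dd_commute:
  fixes f :: "'e::euclidean_space \<Rightarrow> complex"
  assumes f: "smooth_on UNIV f"
  shows "dd u (dd v f) x = dd v (dd u f) x"
proof -
  let ?g = "\<lambda>s r. dd v f (x + s *\<^sub>R u + r *\<^sub>R v)"
  have g: "smooth_on UNIV (dd v f)" "smooth_on UNIV (dd u f)" "smooth_on UNIV (dd u (dd v f))"
    by (intro smooth_on_dd f)+
  note c = smooth_on_continuous[OF g(3), THEN continuous_on_compose2]
  have A: "integral {0..t} (\<lambda>r. dd u (dd v f) (x + r *\<^sub>R v)) = dd u f (x + t *\<^sub>R v) - dd u f x"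
    if "0 \<le> t" for t
  proof -
    have i: "(?g s has_integral (f (x + s *\<^sub>R u + t *\<^sub>R v) - f (x + s *\<^sub>R u))) {0..t}" for s
      using fundamental_theorem_of_calculus[OF that, of "\<lambda>r. f (x + s *\<^sub>R u + r *\<^sub>R v)" "?g s"] dd_line[OF f]
      by simp
    have "((\<lambda>s. integral (cbox 0 t) (?g s)) has_vector_derivative
        integral (cbox 0 t) (\<lambda>r. dd u (dd v f) (x + 0 *\<^sub>R u + r *\<^sub>R v))) (at 0 within UNIV)"
    proof (rule leibniz_rule_vector_derivative)
      show "((\<lambda>s. ?g s r) has_vector_derivative dd u (dd v f) (x + s *\<^sub>R u + r *\<^sub>R v)) (at s within UNIV)" for s r
        using dd_line[OF g(1), of "x + r *\<^sub>R v" u s UNIV] by (simp add: add_ac)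
      show "?g s integrable_on cbox 0 t" for s using i[of s] by (auto simp: integrable_on_def)
      show "continuous_on (UNIV \<times> cbox 0 t) (\<lambda>(s, r). dd u (dd v f) (x + s *\<^sub>R u + r *\<^sub>R v))"
        unfolding split_def by (rule c) (auto intro!: continuous_intros)
    qed auto
    moreover have "integral (cbox 0 t) (?g s) = f (x + t *\<^sub>R v + s *\<^sub>R u) - f (x + s *\<^sub>R u)" for s
      using integral_unique[OF i[of s]] by (simp add: add_ac)
    moreover have "((\<lambda>s. f (x + t *\<^sub>R v + s *\<^sub>R u) - f (x + s *\<^sub>R u)) has_vector_derivative
        dd u f (x + t *\<^sub>R v + 0 *\<^sub>R u) - dd u f (x + 0 *\<^sub>R u)) (at 0 within UNIV)"
      by (intro has_vector_derivative_diff dd_line f)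
    ultimately show ?thesis using vector_derivative_unique_at by fastforce
  qed
  have "((\<lambda>t. integral {0..t} (\<lambda>r. dd u (dd v f) (x + r *\<^sub>R v))) has_vector_derivative
      dd u (dd v f) (x + 0 *\<^sub>R v)) (at 0 within {0..1})"
    by (rule integral_has_vector_derivative) (auto intro!: c continuous_intros)
  moreover have B: "((\<lambda>t. dd u f (x + t *\<^sub>R v) - dd u f x) has_vector_derivative
      dd v (dd u f) (x + 0 *\<^sub>R v) - 0) (at 0 within {0..1})"
    by (intro has_vector_derivative_diff dd_line g has_vector_derivative_const)
  have "((\<lambda>t. integral {0..t} (\<lambda>r. dd u (dd v f) (x + r *\<^sub>R v))) has_vector_derivative
      dd v (dd u f) (x + 0 *\<^sub>R v) - 0) (at 0 within {0..1})"
    by (rule has_vector_derivative_transform[OF _ _ B]) (use A in auto)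
  ultimately show ?thesis
    using vector_derivative_unique_within_closed_interval[of 0 1 0] by fastforce
qed

section \<open>Periodic functions and integration over a period\<close>

definition periodic :: "('e::euclidean_space \<Rightarrow> 'b) \<Rightarrow> bool" where
  "periodic f \<longleftrightarrow> (\<forall>i\<in>Basis. \<forall>x. f (x + (2 * pi) *\<^sub>R i) = f x)"

definition period_box :: "'e::euclidean_space set" where
  "period_box = cbox 0 (\<Sum>i\<in>Basis. (2 * pi) *\<^sub>R i)"

lemma mem_period_box: "x \<in> period_box \<longleftrightarrow> (\<forall>i\<in>Basis. 0 \<le> x \<bullet> i \<and> x \<bullet> i \<le> 2 * pi)"
  by (simp add: period_box_def mem_box)

text \<open>Cutting the box at height \<open>2 \<pi> - t\<close>, the part which is pushed out at the top re-enters at the bottom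
  by periodicity.\<close>

lemma integral_translate_periodic:
  fixes f :: "'e::euclidean_space \<Rightarrow> complex"
  assumes c: "continuous_on UNIV f" and p: "periodic f" and i: "i \<in> Basis" and t: "0 \<le> t" "t \<le> 2 * pi"
  shows "integral period_box (\<lambda>x. f (x + t *\<^sub>R i)) = integral period_box f"
proof -
  let ?B = "\<Sum>i\<in>Basis. (2 * pi) *\<^sub>R i :: 'e"
  have int: "f integrable_on cbox u v" for u v
    by (rule integrable_continuous) (rule continuous_on_subset[OF c], simp)
  have Bj: "?B \<bullet> j = 2 * pi" if "j \<in> Basis" for j using that by simp
  have split: "(\<forall>j\<in>Basis. Q j) \<longleftrightarrow> Q i \<and> (\<forall>j\<in>Basis - {i}. Q j)" for Q
    using i by auto
  have ij: "i \<bullet> i = 1" "\<And>j. j \<in> Basis \<Longrightarrow> j \<noteq> i \<Longrightarrow> i \<bullet> j = 0"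
    using i by (auto simp: inner_Basis)
  have "integral period_box (\<lambda>x. f (x + t *\<^sub>R i)) = integral (cbox (t *\<^sub>R i) (?B + t *\<^sub>R i)) f"
    using integral_shift_cbox[of "t *\<^sub>R i" "t *\<^sub>R i" "?B + t *\<^sub>R i" f] by (simp add: period_box_def)
  also have "\<dots> = integral (cbox (t *\<^sub>R i) (?B + t *\<^sub>R i) \<inter> {x. x \<bullet> i \<le> 2 * pi}) f
      + integral (cbox (t *\<^sub>R i) (?B + t *\<^sub>R i) \<inter> {x. x \<bullet> i \<ge> 2 * pi}) f"
    by (rule integral_split[OF int i])
  also have "cbox (t *\<^sub>R i) (?B + t *\<^sub>R i) \<inter> {x. x \<bullet> i \<le> 2 * pi} = cbox 0 ?B \<inter> {x. x \<bullet> i \<ge> t}"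
  proof (rule Set.set_eqI)
    fix x :: 'e
    have "(\<forall>j\<in>Basis. t * (i \<bullet> j) \<le> x \<bullet> j \<and> x \<bullet> j \<le> 2 * pi + t * (i \<bullet> j)) \<and> x \<bullet> i \<le> 2 * pi \<longleftrightarrow>
      (\<forall>j\<in>Basis. 0 \<le> x \<bullet> j \<and> x \<bullet> j \<le> 2 * pi) \<and> t \<le> x \<bullet> i"
      unfolding split using t by (auto simp: ij)
    then show "x \<in> cbox (t *\<^sub>R i) (?B + t *\<^sub>R i) \<inter> {x. x \<bullet> i \<le> 2 * pi} \<longleftrightarrow> x \<in> cbox 0 ?B \<inter> {x. x \<bullet> i \<ge> t}"
      by (simp add: mem_box inner_add_left Bj)
  qed
  also have "cbox (t *\<^sub>R i) (?B + t *\<^sub>R i) \<inter> {x. x \<bullet> i \<ge> 2 * pi} = cbox ((2 * pi) *\<^sub>R i) (?B + t *\<^sub>R i)"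
  proof (rule Set.set_eqI)
    fix x :: 'e
    have "(\<forall>j\<in>Basis. t * (i \<bullet> j) \<le> x \<bullet> j \<and> x \<bullet> j \<le> 2 * pi + t * (i \<bullet> j)) \<and> 2 * pi \<le> x \<bullet> i \<longleftrightarrow>
      (\<forall>j\<in>Basis. 2 * pi * (i \<bullet> j) \<le> x \<bullet> j \<and> x \<bullet> j \<le> 2 * pi + t * (i \<bullet> j))"
      unfolding split using t by (auto simp: ij)
    then show "x \<in> cbox (t *\<^sub>R i) (?B + t *\<^sub>R i) \<inter> {x. x \<bullet> i \<ge> 2 * pi} \<longleftrightarrow> x \<in> cbox ((2 * pi) *\<^sub>R i) (?B + t *\<^sub>R i)"
      by (simp add: mem_box inner_add_left Bj)
  qed
  also have "integral (cbox ((2 * pi) *\<^sub>R i) (?B + t *\<^sub>R i)) f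
      = integral (cbox 0 (?B + t *\<^sub>R i - (2 * pi) *\<^sub>R i)) (\<lambda>x. f (x + (2 * pi) *\<^sub>R i))"
    using integral_shift_cbox[of "(2 * pi) *\<^sub>R i" "(2 * pi) *\<^sub>R i" "?B + t *\<^sub>R i" f] by simp
  also have "\<dots> = integral (cbox 0 (?B + t *\<^sub>R i - (2 * pi) *\<^sub>R i)) f"
    using p i by (simp add: periodic_def)
  also have "cbox 0 (?B + t *\<^sub>R i - (2 * pi) *\<^sub>R i) = cbox 0 ?B \<inter> {x. x \<bullet> i \<le> t}"
  proof (rule Set.set_eqI)
    fix x :: 'e
    have "(\<forall>j\<in>Basis. 0 \<le> x \<bullet> j \<and> x \<bullet> j \<le> 2 * pi + t * (i \<bullet> j) - 2 * pi * (i \<bullet> j)) \<longleftrightarrow>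
      (\<forall>j\<in>Basis. 0 \<le> x \<bullet> j \<and> x \<bullet> j \<le> 2 * pi) \<and> x \<bullet> i \<le> t"
      unfolding split using t by (auto simp: ij)
    then show "x \<in> cbox 0 (?B + t *\<^sub>R i - (2 * pi) *\<^sub>R i) \<longleftrightarrow> x \<in> cbox 0 ?B \<inter> {x. x \<bullet> i \<le> t}"
      by (simp add: mem_box inner_add_left inner_diff_left Bj)
  qed
  also have "integral (cbox 0 ?B \<inter> {x. x \<bullet> i \<ge> t}) f + integral (cbox 0 ?B \<inter> {x. x \<bullet> i \<le> t}) f
      = integral period_box f"
    unfolding period_box_def using integral_split[OF int i, of 0 ?B t] by (simp add: add.commute)
  finally show ?thesis .
qed

text \<open>Translation invariance makes the integral of \<open>f (x + t i)\<close> independent of \<open>t\<close>; differentiate at \<open>0\<close>.\<close>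

lemma integral_dd_periodic:
  fixes f :: "'e::euclidean_space \<Rightarrow> complex"
  assumes f: "smooth_on UNIV f" and p: "periodic f" and i: "i \<in> Basis"
  shows "integral period_box (dd i f) = 0"
proof -
  let ?U = "{0..2 * pi}"
  note c = smooth_on_continuous[OF smooth_on_dd[OF f], THEN continuous_on_compose2]
  note c0 = smooth_on_continuous[OF f, THEN continuous_on_compose2]
  have "((\<lambda>t. integral period_box (\<lambda>x. f (x + t *\<^sub>R i))) has_vector_derivative
      integral period_box (\<lambda>x. dd i f (x + 0 *\<^sub>R i))) (at 0 within ?U)"
    unfolding period_box_def
  proof (rule leibniz_rule_vector_derivative)
    show "((\<lambda>t. f (x + t *\<^sub>R i)) has_vector_derivative dd i f (x + t *\<^sub>R i)) (at t within ?U)" for x t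
      by (rule dd_line[OF f])
    show "(\<lambda>x. f (x + t *\<^sub>R i)) integrable_on cbox 0 (\<Sum>i\<in>Basis. (2 * pi) *\<^sub>R i)" for t
      by (rule integrable_continuous) (rule c0, auto intro!: continuous_intros)
    show "continuous_on (?U \<times> cbox 0 (\<Sum>i\<in>Basis. (2 * pi) *\<^sub>R i)) (\<lambda>(t, x). dd i f (x + t *\<^sub>R i))"
      unfolding split_def by (rule c) (auto intro!: continuous_intros)
  qed auto
  moreover have "((\<lambda>t. integral period_box (\<lambda>x. f (x + t *\<^sub>R i))) has_vector_derivative 0) (at 0 within ?U)"
  proof (rule has_vector_derivative_transform)
    show "((\<lambda>t. integral period_box f) has_vector_derivative 0) (at 0 within ?U)" by simp
  qed (use integral_translate_periodic[OF smooth_on_continuous[OF f] p i] in auto)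
  ultimately show ?thesis
    using vector_derivative_unique_within_closed_interval[of 0 "2 * pi" 0] by fastforce
qed

definition ip :: "('e::euclidean_space \<Rightarrow> complex) \<Rightarrow> ('e \<Rightarrow> complex) \<Rightarrow> complex" where
  "ip f g = integral period_box (\<lambda>x. f x * cnj (g x))"

definition smooth_periodic :: "('e::euclidean_space \<Rightarrow> complex) \<Rightarrow> bool" where
  "smooth_periodic f \<longleftrightarrow> smooth_on UNIV f \<and> periodic f"

named_theorems sp_intros

lemma periodic_dd: "smooth_on UNIV f \<Longrightarrow> periodic f \<Longrightarrow> periodic (dd v f)"
  unfolding periodic_def
proof (intro ballI allI)
  fix i x :: 'a assume f: "smooth_on UNIV f" "\<forall>i\<in>Basis. \<forall>x. f (x + (2 * pi) *\<^sub>R i) = f x" "i \<in> Basis"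
  have "((\<lambda>x. f (x + (2 * pi) *\<^sub>R i)) has_derivative (\<lambda>v. dd v f (x + (2 * pi) *\<^sub>R i))) (at x)"
  proof (rule has_derivative_compose[where f = "\<lambda>x. x + (2 * pi) *\<^sub>R i" and f' = "\<lambda>v. v"
        and g = f and g' = "\<lambda>v. dd v f (x + (2 * pi) *\<^sub>R i)"])
    show "((\<lambda>x. x + (2 * pi) *\<^sub>R i) has_derivative (\<lambda>v. v)) (at x)"
      by (rule has_derivative_add_const) (rule has_derivative_ident)
  qed (use smooth_on_has_derivative[OF f(1)] in auto)
  then have "(f has_derivative (\<lambda>v. dd v f (x + (2 * pi) *\<^sub>R i))) (at x)" using f(2,3) by simp
  from dd_eq[OF this] show "dd v f (x + (2 * pi) *\<^sub>R i) = dd v f x" by simp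
qed

lemma sp_dd [sp_intros]: "smooth_periodic f \<Longrightarrow> smooth_periodic (dd v f)"
  by (simp add: smooth_periodic_def smooth_on_dd periodic_dd)

lemma sp_const [sp_intros]: "smooth_periodic (\<lambda>x. c)"
  by (simp add: smooth_periodic_def smooth_on_const periodic_def)

lemma sp_add [sp_intros]: "smooth_periodic f \<Longrightarrow> smooth_periodic g \<Longrightarrow> smooth_periodic (\<lambda>x. f x + g x)"
  and sp_diff [sp_intros]: "smooth_periodic f \<Longrightarrow> smooth_periodic g \<Longrightarrow> smooth_periodic (\<lambda>x. f x - g x)"
  and sp_mult [sp_intros]: "smooth_periodic f \<Longrightarrow> smooth_periodic g \<Longrightarrow> smooth_periodic (\<lambda>x. f x * g x)"
  by (simp_all add: smooth_periodic_def smooth_on_add smooth_on_diff smooth_on_mult periodic_def)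

lemma sp_uminus [sp_intros]: "smooth_periodic f \<Longrightarrow> smooth_periodic (\<lambda>x. - f x)"
  and sp_cnj [sp_intros]: "smooth_periodic f \<Longrightarrow> smooth_periodic (\<lambda>x. cnj (f x))"
  by (simp_all add: smooth_periodic_def smooth_on_uminus smooth_on_cnj periodic_def)

lemma sp_sum [sp_intros]: "(\<And>i. i \<in> I \<Longrightarrow> smooth_periodic (f i)) \<Longrightarrow> smooth_periodic (\<lambda>x. \<Sum>i\<in>I. f i x)"
  by (simp add: smooth_periodic_def smooth_on_sum periodic_def)

lemma sp_integrable: "smooth_periodic f \<Longrightarrow> f integrable_on period_box"
  unfolding period_box_def
  by (rule integrable_continuous) (metis smooth_periodic_def smooth_on_continuous continuous_on_subset subset_UNIV)

lemma ip_integrable: "smooth_periodic f \<Longrightarrow> smooth_periodic g \<Longrightarrow> (\<lambda>x. f x * cnj (g x)) integrable_on period_box"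
  by (intro sp_integrable sp_intros)

lemma ip_add_left: "smooth_periodic f \<Longrightarrow> smooth_periodic f' \<Longrightarrow> smooth_periodic g \<Longrightarrow> ip (\<lambda>x. f x + f' x) g = ip f g + ip f' g"
  and ip_add_right: "smooth_periodic f \<Longrightarrow> smooth_periodic g \<Longrightarrow> smooth_periodic g' \<Longrightarrow> ip f (\<lambda>x. g x + g' x) = ip f g + ip f g'"
  by (simp_all add: ip_def algebra_simps integral_add ip_integrable)

lemma ip_uminus_right: "ip f (\<lambda>x. - g x) = - ip f g"
  by (simp_all add: ip_def)

lemma ip_zero [simp]: "ip (\<lambda>x. 0) g = 0" "ip f (\<lambda>x. 0) = 0"
  by (simp_all add: ip_def)

lemma ip_diff_left: "smooth_periodic f \<Longrightarrow> smooth_periodic f' \<Longrightarrow> smooth_periodic g \<Longrightarrow> ip (\<lambda>x. f x - f' x) g = ip f g - ip f' g"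
  and ip_diff_right: "smooth_periodic f \<Longrightarrow> smooth_periodic g \<Longrightarrow> smooth_periodic g' \<Longrightarrow> ip f (\<lambda>x. g x - g' x) = ip f g - ip f g'"
  by (simp_all add: ip_def algebra_simps integral_diff ip_integrable)

lemma ip_cnj: "cnj (ip f g) = ip g f"
  unfolding ip_def integral_cnj by (simp add: mult.commute)

lemma ip_parts:
  assumes "smooth_periodic f" "smooth_periodic g" "i \<in> Basis"
  shows "ip (dd i f) g = - ip f (dd i g)"
proof -
  have s: "smooth_on UNIV f" "smooth_on UNIV g" using assms by (auto simp: smooth_periodic_def)
  have fg: "smooth_periodic (\<lambda>x. f x * cnj (g x))" by (intro sp_intros assms)
  have "dd i (\<lambda>x. f x * cnj (g x)) = (\<lambda>x. f x * cnj (dd i g x) + dd i f x * cnj (g x))"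
    by (rule ext) (simp add: dd_mult[OF s(1) smooth_on_cnj[OF open_UNIV s(2)]] dd_cnj[OF s(2)])
  moreover have "integral period_box (dd i (\<lambda>x. f x * cnj (g x))) = 0"
    using fg assms(3) by (intro integral_dd_periodic) (auto simp: smooth_periodic_def)
  ultimately have "ip f (dd i g) + ip (dd i f) g = 0"
    by (simp add: ip_def integral_add[symmetric] ip_integrable sp_dd assms)
  then show ?thesis by (simp add: add_eq_0_iff)
qed

definition sqnorm :: "('e::euclidean_space \<Rightarrow> complex) \<Rightarrow> real" where
  "sqnorm f = integral period_box (\<lambda>x. (cmod (f x))\<^sup>2)"

lemma sqnorm_integrable: "smooth_periodic f \<Longrightarrow> (\<lambda>x. (cmod (f x))\<^sup>2) integrable_on period_box"
  unfolding period_box_def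
  by (rule integrable_continuous)
    (auto intro!: continuous_intros intro: continuous_on_subset simp: smooth_periodic_def dest!: smooth_on_continuous)

lemma ip_self: "smooth_periodic f \<Longrightarrow> ip f f = of_real (sqnorm f)"
proof -
  assume f: "smooth_periodic f"
  have "((\<lambda>x. complex_of_real ((cmod (f x))\<^sup>2)) has_integral of_real (sqnorm f)) period_box"
    unfolding sqnorm_def by (intro has_integral_of_real integrable_integral sqnorm_integrable f)
  then show ?thesis by (simp only: ip_def complex_norm_square integral_unique)
qed

lemma sqnorm_nonneg: "smooth_periodic f \<Longrightarrow> sqnorm f \<ge> 0"
  unfolding sqnorm_def by (intro integral_nonneg sqnorm_integrable) auto

lemma period_box_covers:
  fixes x :: "'e::euclidean_space"
  assumes "\<And>i x. P x \<Longrightarrow> i \<in> Basis \<Longrightarrow> P (x + (2 * pi) *\<^sub>R i) \<and> P (x - (2 * pi) *\<^sub>R i)"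
  shows "P x \<Longrightarrow> \<exists>y\<in>period_box. P y"
proof -
  assume P: "P x"
  have ex: "\<exists>y. P y \<and> (\<forall>i\<in>I. 0 \<le> y \<bullet> i \<and> y \<bullet> i \<le> 2 * pi)" if I: "I \<subseteq> Basis" for I :: "'e set"
  proof -
    have "finite I" using finite_subset[OF I] by simp
    then show ?thesis using I
    proof (induction I rule: finite_induct)
      case empty
      then show ?case using P by auto
    next
      case (insert i I)
      then obtain y where y: "P y" "\<forall>i\<in>I. 0 \<le> y \<bullet> i \<and> y \<bullet> i \<le> 2 * pi" by auto
      have iB: "i \<in> Basis" using insert by auto
      have nat: "P (y + of_nat n *\<^sub>R ((2 * pi) *\<^sub>R i)) \<and> P (y - of_nat n *\<^sub>R ((2 * pi) *\<^sub>R i))" for n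
      proof (induction n)
        case (Suc n)
        have "y + of_nat (Suc n) *\<^sub>R ((2 * pi) *\<^sub>R i) = y + of_nat n *\<^sub>R ((2 * pi) *\<^sub>R i) + (2 * pi) *\<^sub>R i"
          "y - of_nat (Suc n) *\<^sub>R ((2 * pi) *\<^sub>R i) = y - of_nat n *\<^sub>R ((2 * pi) *\<^sub>R i) - (2 * pi) *\<^sub>R i"
          by (simp_all add: algebra_simps)
        then show ?case using assms[OF conjunct1[OF Suc] iB] assms[OF conjunct2[OF Suc] iB] by (simp only: simp_thms)
      qed (use y in simp)
      have int: "P (y + of_int m *\<^sub>R ((2 * pi) *\<^sub>R i))" for m :: int
      proof (cases "m \<ge> 0")
        case True
        then show ?thesis using nat[of "nat m"] by simp
      next
        case False
        then show ?thesis using nat[of "nat (- m)"] by simp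
      qed
      obtain k :: int where "of_int k \<le> (y \<bullet> i) / (2 * pi)" "(y \<bullet> i) / (2 * pi) < of_int k + 1"
        using floor_correct[of "(y \<bullet> i) / (2 * pi)"] by (intro that[of "\<lfloor>(y \<bullet> i) / (2 * pi)\<rfloor>"]) auto
      moreover define m where "m = - k"
      ultimately have "0 \<le> y \<bullet> i + of_int m * (2 * pi)" "y \<bullet> i + of_int m * (2 * pi) \<le> 2 * pi"
        by (simp_all add: field_simps)
      then show ?case
        using int[of m] y(2) insert by (intro exI[of _ "y + of_int m *\<^sub>R ((2 * pi) *\<^sub>R i)"])
          (auto simp: inner_add_left inner_Basis iB)
    qed
  qed
  from ex[of Basis] show ?thesis by (auto simp: mem_period_box)
qed

lemma periodic_minus: "periodic f \<Longrightarrow> i \<in> Basis \<Longrightarrow> f (x - (2 * pi) *\<^sub>R i) = f x"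
  unfolding periodic_def by (metis diff_add_cancel)

lemma sqnorm_eq_0:
  assumes "smooth_periodic f" "sqnorm f = 0"
  shows "f x = 0"
proof -
  have c: "continuous_on period_box (\<lambda>x. (cmod (f x))\<^sup>2)"
    using assms(1) by (auto intro!: continuous_intros intro: continuous_on_subset simp: smooth_periodic_def dest!: smooth_on_continuous)
  have z: "f y = 0" if "y \<in> period_box" for y :: 'a
  proof -
    have "(cmod (f y))\<^sup>2 = 0"
    proof (rule has_integral_0_cbox_imp_0[of 0 "\<Sum>i\<in>Basis. (2 * pi) *\<^sub>R i" "\<lambda>x. (cmod (f x))\<^sup>2"])
      show "((\<lambda>x. (cmod (f x))\<^sup>2) has_integral 0) (cbox 0 (\<Sum>i\<in>Basis. (2 * pi) *\<^sub>R i))"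
        using integrable_integral[OF sqnorm_integrable[OF assms(1)]] assms(2)
        by (simp add: sqnorm_def period_box_def)
      show "box 0 (\<Sum>i\<in>Basis. (2 * pi) *\<^sub>R i :: 'a) \<noteq> {}" by (simp add: box_ne_empty)
    qed (use c that in \<open>auto simp: period_box_def\<close>)
    then show ?thesis by simp
  qed
  obtain y where "y \<in> period_box" "f y = f x"
    using period_box_covers[of "\<lambda>y. f y = f x" x] assms(1) periodic_minus[of f]
    by (auto simp: smooth_periodic_def periodic_def)
  then show ?thesis using z by metis
qed

section \<open>The almost Hermitian structure on the universal cover\<close>

text \<open>The coordinates of \<open>\<complex>\<^sup>2\<close> are \<open>w, x, y, z\<close> in the order of \<open>e0, e1, e2, e3\<close>: \<open>w + \<i> z\<close> is the first
  complex coordinate, \<open>x + \<i> y\<close> the second.\<close>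

definition e0 :: "complex^2" where "e0 = axis 1 1"
definition e1 :: "complex^2" where "e1 = axis 2 1"
definition e2 :: "complex^2" where "e2 = axis 2 \<i>"
definition e3 :: "complex^2" where "e3 = axis 1 \<i>"

lemma inner_e: "v \<bullet> e0 = Re (v $ 1)" "v \<bullet> e1 = Re (v $ 2)" "v \<bullet> e2 = Im (v $ 2)" "v \<bullet> e3 = Im (v $ 1)"
  by (simp_all add: e0_def e1_def e2_def e3_def inner_axis inner_complex_def)

lemma e_component:
  "e0 $ 1 = 1" "e0 $ 2 = 0" "e1 $ 1 = 0" "e1 $ 2 = 1" "e2 $ 1 = 0" "e2 $ 2 = \<i>" "e3 $ 1 = \<i>" "e3 $ 2 = 0"
  by (simp_all add: e0_def e1_def e2_def e3_def axis_def)

lemma Basis_complex2: "(Basis :: (complex^2) set) = {e0, e1, e2, e3}"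
  by (auto simp: Basis_vec_def Basis_complex_def UNIV_2 e0_def e1_def e2_def e3_def)

interpretation E: oframe e0 e1 e2 e3
  by unfold_locales (simp_all add: inner_e e_component)

abbreviation "EF \<equiv> subframe e0 e1 e2 e3"

text \<open>The frame \<open>e1, e2\<close> turned by the angle \<open>w\<close>. Both \<open>f1\<close> and \<open>f2\<close> change sign under \<open>w \<mapsto> w + \<pi>\<close>, exactly
  as \<open>e1\<close> and \<open>e2\<close> do under the linear part of the deck transformation; this is why \<open>JJ\<close> descends.\<close>

definition f1 :: "complex^2 \<Rightarrow> complex^2" where "f1 x = cos (x \<bullet> e0) *\<^sub>R e1 + sin (x \<bullet> e0) *\<^sub>R e2"
definition f2 :: "complex^2 \<Rightarrow> complex^2" where "f2 x = - sin (x \<bullet> e0) *\<^sub>R e1 + cos (x \<bullet> e0) *\<^sub>R e2"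

definition JJ :: "complex^2 \<Rightarrow> complex^2 \<Rightarrow> complex^2" where
  "JJ x v = (v \<bullet> e0) *\<^sub>R f1 x - (v \<bullet> f1 x) *\<^sub>R e0 + (v \<bullet> f2 x) *\<^sub>R e3 - (v \<bullet> e3) *\<^sub>R f2 x"

lemma cs: "cos t * cos t + sin t * sin t = (1::real)" "sin t * sin t + cos t * cos t = (1::real)"
  using sin_cos_squared_add[of t] by (simp_all add: power2_eq_square)

interpretation H: hframe e0 "f1 x" "f2 x" e3 "JJ x" for x
proof (intro hframe.intro oframe.intro hframe_axioms.intro)
  have [simp]: "f1 x \<bullet> f1 x = 1" "f2 x \<bullet> f2 x = 1" "f1 x \<bullet> f2 x = 0" "f2 x \<bullet> f1 x = 0"
    "e0 \<bullet> f1 x = 0" "e0 \<bullet> f2 x = 0" "f1 x \<bullet> e3 = 0" "f2 x \<bullet> e3 = 0" "f1 x \<bullet> e0 = 0" "f2 x \<bullet> e0 = 0"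
    "e3 \<bullet> f1 x = 0" "e3 \<bullet> f2 x = 0"
    by (simp_all add: f1_def f2_def inner_simps cs)
  show "f1 x \<bullet> f1 x = 1" "f2 x \<bullet> f2 x = 1" "e0 \<bullet> f1 x = 0" "e0 \<bullet> f2 x = 0" "f1 x \<bullet> f2 x = 0"
    "f1 x \<bullet> e3 = 0" "f2 x \<bullet> e3 = 0" by simp_all
  show "JJ x e0 = f1 x" "JJ x (f1 x) = - e0" "JJ x (f2 x) = e3" "JJ x e3 = - f2 x"
    by (simp_all add: JJ_def)
  show "linear (JJ x)"
    by (rule linearI) (simp_all add: JJ_def inner_add_left algebra_simps)
qed simp_all

lemma JJ_component:
  "JJ x v \<bullet> e0 = - cos (x \<bullet> e0) * (v \<bullet> e1) - sin (x \<bullet> e0) * (v \<bullet> e2)"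
  "JJ x v \<bullet> e1 = cos (x \<bullet> e0) * (v \<bullet> e0) + sin (x \<bullet> e0) * (v \<bullet> e3)"
  "JJ x v \<bullet> e2 = sin (x \<bullet> e0) * (v \<bullet> e0) - cos (x \<bullet> e0) * (v \<bullet> e3)"
  "JJ x v \<bullet> e3 = - sin (x \<bullet> e0) * (v \<bullet> e1) + cos (x \<bullet> e0) * (v \<bullet> e2)"
  by (simp_all add: JJ_def f1_def f2_def inner_simps algebra_simps)

lemma volume_E: "volume_covec inner (JJ x) [e0, e1, e2, e3] = 1"
proof -
  have c: "(cos t)\<^sup>2 + (sin t)\<^sup>2 = (1::complex)" for t
    using sin_cos_squared_add[of t] by (simp add: add.commute)
  show ?thesis
    using c[of "complex_of_real (x \<bullet> e0)"]
    by (simp add: H.volume_eq E.wedge_top fundamental_covec_def JJ_component power2_eq_square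
        cos_of_real sin_of_real add.commute)
qed

lemma star_E: "\<gamma> \<in> exterior \<Longrightarrow> E.star_table \<gamma> (hodge_star inner (JJ x) \<gamma>)"
  using E.hodge_star_table[OF H.exterior_volume volume_E] by blast

lemma herm_frames: "\<alpha> \<in> exterior \<Longrightarrow> \<beta> \<in> exterior \<Longrightarrow> H.herm x \<alpha> \<beta> = E.herm \<alpha> \<beta>"
  using H.inner_covec_eq[of \<alpha> \<beta> x] E.inner_covec_eq[of \<alpha> \<beta>] by simp

section \<open>Periodic forms\<close>

definition pform :: "(complex^2) lform \<Rightarrow> bool" where
  "pform \<alpha> \<longleftrightarrow> (\<forall>x. \<alpha> x \<in> exterior) \<and> (\<forall>vs. smooth_periodic (\<lambda>x. \<alpha> x vs))"

lemma pform_exterior: "pform \<alpha> \<Longrightarrow> \<alpha> x \<in> exterior"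
  and pform_sp: "pform \<alpha> \<Longrightarrow> smooth_periodic (\<lambda>x. \<alpha> x vs)"
  by (simp_all add: pform_def)

lemma pform_smooth: "pform \<alpha> \<Longrightarrow> smooth_on UNIV (\<lambda>x. \<alpha> x vs)"
  by (simp add: pform_def smooth_periodic_def)

lemma pform_frameI:
  assumes "\<And>x. \<alpha> x \<in> exterior" "\<And>vs. vs \<in> EF \<Longrightarrow> smooth_periodic (\<lambda>x. \<alpha> x vs)"
  shows "pform \<alpha>"
proof -
  have "smooth_periodic (\<lambda>x. \<alpha> x vs)" for vs
  proof -
    have "\<alpha> x vs = (\<Sum>I\<in>EF. \<alpha> x I * E.monomial I vs)" for x
      using fun_cong[OF E.exterior_expand[OF assms(1)[of x]], of vs] by (simp add: E.prescribed_def)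
    moreover have "smooth_periodic (\<lambda>x. \<Sum>I\<in>EF. \<alpha> x I * E.monomial I vs)"
      by (intro sp_intros assms)
    ultimately show ?thesis by simp
  qed
  then show ?thesis using assms(1) by (simp add: pform_def)
qed

lemma pform_zero: "pform (\<lambda>x vs. 0)"
  by (simp add: pform_def sp_const)

lemma pform_add: "pform \<alpha> \<Longrightarrow> pform \<beta> \<Longrightarrow> pform (\<lambda>x vs. \<alpha> x vs + \<beta> x vs)"
  and pform_uminus: "pform \<alpha> \<Longrightarrow> pform (\<lambda>x vs. - \<alpha> x vs)"
  and pform_diff: "pform \<alpha> \<Longrightarrow> pform \<beta> \<Longrightarrow> pform (\<lambda>x vs. \<alpha> x vs - \<beta> x vs)"
  unfolding pform_def
  by (auto intro!: exterior_add exterior_scale exterior_uminus exterior_diff sp_intros)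

lemma pform_sum: "(\<And>i. i \<in> I \<Longrightarrow> pform (\<alpha> i)) \<Longrightarrow> pform (\<lambda>x vs. \<Sum>i\<in>I. \<alpha> i x vs)"
  unfolding pform_def by (auto intro!: exterior_sum sp_intros)

lemma ext_d_alternation: "ext_d \<alpha> x = alternation (\<lambda>v ws. dd v (\<lambda>y. \<alpha> y ws) x)"
  by (rule ext) (simp add: ext_d_def alternation_def dd_def)

lemma exterior_ext_d:
  assumes "open S" "x \<in> S" "\<And>y. y \<in> S \<Longrightarrow> \<alpha> y \<in> exterior" "\<And>vs. smooth_on S (\<lambda>y. \<alpha> y vs)"
  shows "ext_d \<alpha> x \<in> exterior"
  unfolding ext_d_alternation
proof (rule exterior_alternation)
  show "linear (\<lambda>v. dd v (\<lambda>y. \<alpha> y ws) x)" for ws by (rule linear_dd[OF assms(4,2)])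
  fix v
  show "(\<lambda>ws. dd v (\<lambda>y. \<alpha> y ws) x) \<in> exterior"
  proof (rule exteriorI)
    fix xs ys and u w :: 'a
    show "linear (\<lambda>w. dd v (\<lambda>y. \<alpha> y (xs @ w # ys)) x)"
    proof (rule linearI)
      fix u w and r :: real
      have "dd v (\<lambda>y. \<alpha> y (xs @ (u + w) # ys)) x = dd v (\<lambda>y. \<alpha> y (xs @ u # ys) + \<alpha> y (xs @ w # ys)) x"
        by (rule dd_cong[OF assms(1,2)]) (rule linear_add[OF exterior_linear[OF assms(3)]])
      then show "dd v (\<lambda>y. \<alpha> y (xs @ (u + w) # ys)) x
          = dd v (\<lambda>y. \<alpha> y (xs @ u # ys)) x + dd v (\<lambda>y. \<alpha> y (xs @ w # ys)) x"
        by (simp add: dd_add[OF assms(4,4,2)])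
      have "dd v (\<lambda>y. \<alpha> y (xs @ (r *\<^sub>R u) # ys)) x = dd v (\<lambda>y. r *\<^sub>R \<alpha> y (xs @ u # ys)) x"
        by (rule dd_cong[OF assms(1,2)]) (rule linear_scale[OF exterior_linear[OF assms(3)]])
      then show "dd v (\<lambda>y. \<alpha> y (xs @ (r *\<^sub>R u) # ys)) x = r *\<^sub>R dd v (\<lambda>y. \<alpha> y (xs @ u # ys)) x"
        by (simp add: dd_linear[OF bounded_linear_scaleR_right assms(4,2)])
    qed
    have "dd v (\<lambda>y. \<alpha> y (xs @ u # w # ys)) x = dd v (\<lambda>y. - \<alpha> y (xs @ w # u # ys)) x"
      by (rule dd_cong[OF assms(1,2)]) (rule exterior_swap[OF assms(3)])
    then show "dd v (\<lambda>y. \<alpha> y (xs @ u # w # ys)) x = - dd v (\<lambda>y. \<alpha> y (xs @ w # u # ys)) x"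
      by (simp add: dd_uminus[OF assms(4,2)])
  qed
qed

lemma ext_d_cong:
  assumes "open S" "x \<in> S" "\<And>y. y \<in> S \<Longrightarrow> \<alpha> y = \<beta> y"
  shows "ext_d \<alpha> x = ext_d \<beta> x"
proof -
  have "dd v (\<lambda>y. \<alpha> y ws) x = dd v (\<lambda>y. \<beta> y ws) x" for v ws
    by (rule dd_cong[OF assms(1,2)]) (simp add: assms(3))
  then show ?thesis by (simp add: ext_d_alternation)
qed

lemma pform_ext_d: "pform \<alpha> \<Longrightarrow> pform (ext_d \<alpha>)"
proof -
  assume \<alpha>: "pform \<alpha>"
  have "smooth_periodic (\<lambda>x. ext_d \<alpha> x vs)" for vs
    unfolding ext_d_alternation alternation_def by (intro sp_intros pform_sp[OF \<alpha>])
  moreover have "ext_d \<alpha> x \<in> exterior" for x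
    by (rule exterior_ext_d[of UNIV]) (auto simp: pform_exterior[OF \<alpha>] pform_smooth[OF \<alpha>])
  ultimately show ?thesis by (simp add: pform_def)
qed

abbreviation "gg \<equiv> (\<lambda>x :: complex^2. (inner :: complex^2 \<Rightarrow> complex^2 \<Rightarrow> real))"

lemma star_form_table:
  assumes "pform \<beta>"
  shows "star gg JJ \<beta> x [] = \<beta> x [e0,e1,e2,e3]" "star gg JJ \<beta> x [e0] = - \<beta> x [e1,e2,e3]"
    "star gg JJ \<beta> x [e1] = \<beta> x [e0,e2,e3]" "star gg JJ \<beta> x [e2] = - \<beta> x [e0,e1,e3]"
    "star gg JJ \<beta> x [e3] = \<beta> x [e0,e1,e2]" "star gg JJ \<beta> x [e0,e1] = \<beta> x [e2,e3]"
    "star gg JJ \<beta> x [e0,e2] = - \<beta> x [e1,e3]" "star gg JJ \<beta> x [e0,e3] = \<beta> x [e1,e2]"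
    "star gg JJ \<beta> x [e1,e2] = \<beta> x [e0,e3]" "star gg JJ \<beta> x [e1,e3] = - \<beta> x [e0,e2]"
    "star gg JJ \<beta> x [e2,e3] = \<beta> x [e0,e1]" "star gg JJ \<beta> x [e1,e2,e3] = \<beta> x [e0]"
    "star gg JJ \<beta> x [e0,e2,e3] = - \<beta> x [e1]" "star gg JJ \<beta> x [e0,e1,e3] = \<beta> x [e2]"
    "star gg JJ \<beta> x [e0,e1,e2] = - \<beta> x [e3]" "star gg JJ \<beta> x [e0,e1,e2,e3] = \<beta> x []"
  using star_E[OF pform_exterior[OF assms, of x], of x] by (simp_all add: star_def E.star_table_def)

lemma pform_star: "pform \<alpha> \<Longrightarrow> pform (star gg JJ \<alpha>)"
proof (rule pform_frameI)
  assume \<alpha>: "pform \<alpha>"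
  show "star gg JJ \<alpha> x \<in> exterior" for x
    by (simp add: star_def H.exterior_star pform_exterior[OF \<alpha>])
  fix vs assume "vs \<in> EF"
  then show "smooth_periodic (\<lambda>x. star gg JJ \<alpha> x vs)"
    by (auto simp: subframe_def star_form_table[OF \<alpha>] intro!: sp_intros pform_sp[OF \<alpha>])
qed

lemma sp_trig [sp_intros]:
  "smooth_periodic (\<lambda>x::complex^2. complex_of_real (cos (x \<bullet> e0)))"
  "smooth_periodic (\<lambda>x::complex^2. complex_of_real (sin (x \<bullet> e0)))"
proof -
  have "cos ((x + (2 * pi) *\<^sub>R i) \<bullet> e0) = cos (x \<bullet> e0) \<and> sin ((x + (2 * pi) *\<^sub>R i) \<bullet> e0) = sin (x \<bullet> e0)"
    if "i \<in> Basis" for i x :: "complex^2"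
    using that unfolding Basis_complex2 by (auto simp: inner_add_left)
  then show "smooth_periodic (\<lambda>x::complex^2. complex_of_real (cos (x \<bullet> e0)))"
    "smooth_periodic (\<lambda>x::complex^2. complex_of_real (sin (x \<bullet> e0)))"
    by (auto simp: smooth_periodic_def periodic_def intro: smooth_on_trig)
qed

lemma sp_JJ:
  assumes "e \<in> {e0, e1, e2, e3}"
  shows "smooth_periodic (\<lambda>x. complex_of_real (JJ x v \<bullet> e))"
  using assms by (auto simp: JJ_component intro!: sp_intros)

lemma pform_jder:
  assumes \<alpha>: "pform \<alpha>"
  shows "pform (\<lambda>x. jder (JJ x) (\<alpha> x))"
proof -
  have "smooth_periodic (\<lambda>x. \<alpha> x (xs @ JJ x v # ys))" for xs v ys
  proof -
    have "\<alpha> x (xs @ JJ x v # ys) = of_real (JJ x v \<bullet> e0) * \<alpha> x (xs @ e0 # ys)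
        + of_real (JJ x v \<bullet> e1) * \<alpha> x (xs @ e1 # ys) + of_real (JJ x v \<bullet> e2) * \<alpha> x (xs @ e2 # ys)
        + of_real (JJ x v \<bullet> e3) * \<alpha> x (xs @ e3 # ys)" for x
    proof -
      note l = exterior_linear[OF pform_exterior[OF \<alpha>, of x], of xs ys]
      show ?thesis
        by (subst E.frame_expand[of "JJ x v"])
          (simp only: linear_add[OF l] linear_scale[OF l] scaleR_conv_of_real[where 'a = complex])
    qed
    then show ?thesis by (simp only:) (intro sp_intros sp_JJ pform_sp[OF \<alpha>]; simp)
  qed
  then have "smooth_periodic (\<lambda>x. jder (JJ x) (\<alpha> x) vs)" for vs
    unfolding jder_def by (intro sp_intros) (simp add: upd_conv_take_nth_drop)
  moreover have "jder (JJ x) (\<alpha> x) \<in> exterior" for x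
    by (rule exterior_jder[OF H.linJ pform_exterior[OF \<alpha>]])
  ultimately show ?thesis by (simp add: pform_def)
qed

definition PP :: "nat \<Rightarrow> nat \<Rightarrow> (complex^2) lform \<Rightarrow> (complex^2) lform" where
  "PP p q \<alpha> x = bidegree_part (JJ x) p q (\<alpha> x)"

lemma PP_vanish: "pform \<alpha> \<Longrightarrow> p > 2 \<or> q > 2 \<Longrightarrow> PP p q \<alpha> = (\<lambda>x vs. 0)"
  by (rule ext) (simp add: PP_def H.bidegree_part_vanish pform_exterior)

lemma pform_PP: "pform \<alpha> \<Longrightarrow> pform (PP p q \<alpha>)"
proof (cases "p \<le> 2 \<and> q \<le> 2")
  case True
  assume \<alpha>: "pform \<alpha>"
  have pq: "p \<le> 2" "q \<le> 2" using True by auto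
  obtain u v w :: complex where c: "\<forall>r s. r \<le> 2 \<longrightarrow> s \<le> 2 \<longrightarrow> r + s = p + q \<longrightarrow>
        u + v * (\<i> * (of_nat r - of_nat s)) + w * (\<i> * (of_nat r - of_nat s))\<^sup>2 = (if r = p then 1 else 0)"
    using interpolation_coefficients[OF pq] by (elim exE)
  note P = H.bidegree_part_polynomial[OF pq c[rule_format]]
  have "smooth_periodic (\<lambda>x. PP p q \<alpha> x vs)" for vs
    by (cases "length vs = p + q")
      (simp_all add: PP_def P pform_exterior[OF \<alpha>] sp_const,
        intro sp_intros pform_sp[OF \<alpha>] pform_sp[OF pform_jder[OF \<alpha>]] pform_sp[OF pform_jder[OF pform_jder[OF \<alpha>]]])
  then show ?thesis
    by (simp add: pform_def PP_def H.exterior_bidegree_part pform_exterior[OF \<alpha>])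
next
  case False
  assume "pform \<alpha>"
  then show ?thesis using PP_vanish[of \<alpha> p q] False pform_zero by (simp add: not_le)
qed

lemma del_eq: "del JJ \<alpha> x vs = (\<Sum>p\<le>2. \<Sum>q\<le>2. PP (Suc p) q (ext_d (PP p q \<alpha>)) x vs)"
  and delbar_eq: "delbar JJ \<alpha> x vs = (\<Sum>p\<le>2. \<Sum>q\<le>2. PP p (Suc q) (ext_d (PP p q \<alpha>)) x vs)"
  by (simp_all add: del_def delbar_def PP_def[abs_def] H.half_dim2)

lemma pform_del: "pform \<alpha> \<Longrightarrow> pform (del JJ \<alpha>)"
  unfolding del_eq[abs_def] by (intro pform_sum pform_PP pform_ext_d)

lemma pform_delbar: "pform \<alpha> \<Longrightarrow> pform (delbar JJ \<alpha>)"
  unfolding delbar_eq[abs_def] by (intro pform_sum pform_PP pform_ext_d)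

lemma uminus_form: "- \<alpha> = (\<lambda>x vs. - \<alpha> x vs)" for \<alpha> :: "'a lform"
  by (simp add: fun_eq_iff)

lemma pform_d_adj: "pform \<alpha> \<Longrightarrow> pform (d_adj gg JJ \<alpha>)"
  unfolding d_adj_def uminus_form by (intro pform_uminus pform_star pform_ext_d)

lemma pform_del_adj: "pform \<alpha> \<Longrightarrow> pform (del_adj gg JJ \<alpha>)"
  unfolding del_adj_def uminus_form by (intro pform_uminus pform_star pform_delbar)

lemma pform_delbar_adj: "pform \<alpha> \<Longrightarrow> pform (delbar_adj gg JJ \<alpha>)"
  unfolding delbar_adj_def uminus_form by (intro pform_uminus pform_star pform_del)

section \<open>Formal adjoints\<close>

definition gip :: "(complex^2) lform \<Rightarrow> (complex^2) lform \<Rightarrow> complex" where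
  "gip \<alpha> \<beta> = (\<Sum>vs\<in>EF. ip (\<lambda>x. \<alpha> x vs) (\<lambda>x. \<beta> x vs))"

lemma gip_herm: "pform \<alpha> \<Longrightarrow> pform \<beta> \<Longrightarrow> gip \<alpha> \<beta> = integral period_box (\<lambda>x. E.herm (\<alpha> x) (\<beta> x))"
  unfolding gip_def ip_def E.herm_def
  by (rule integral_sum[symmetric]) (auto intro!: ip_integrable pform_sp)

lemma gip_cnj: "cnj (gip \<alpha> \<beta>) = gip \<beta> \<alpha>"
  by (simp add: gip_def ip_cnj)

lemma gip_add_left: "pform \<alpha> \<Longrightarrow> pform \<alpha>' \<Longrightarrow> pform \<beta> \<Longrightarrow> gip (\<lambda>x vs. \<alpha> x vs + \<alpha>' x vs) \<beta> = gip \<alpha> \<beta> + gip \<alpha>' \<beta>"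
  by (simp add: gip_def ip_add_left pform_sp sum.distrib)

lemma gip_zero [simp]: "gip (\<lambda>x vs. 0) \<beta> = 0"
  by (simp add: gip_def)

lemma gip_sum_left: "(\<And>i. i \<in> I \<Longrightarrow> pform (\<alpha> i)) \<Longrightarrow> pform \<beta> \<Longrightarrow> gip (\<lambda>x vs. \<Sum>i\<in>I. \<alpha> i x vs) \<beta> = (\<Sum>i\<in>I. gip (\<alpha> i) \<beta>)"
proof (induction I rule: infinite_finite_induct)
  case (insert i I)
  then show ?case by (simp add: gip_add_left pform_sum)
qed simp_all

lemma gip_sum_right:
  assumes "\<And>i. i \<in> I \<Longrightarrow> pform (\<beta> i)" "pform \<alpha>"
  shows "gip \<alpha> (\<lambda>x vs. \<Sum>i\<in>I. \<beta> i x vs) = (\<Sum>i\<in>I. gip \<alpha> (\<beta> i))"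
proof -
  have "gip \<alpha> (\<lambda>x vs. \<Sum>i\<in>I. \<beta> i x vs) = cnj (gip (\<lambda>x vs. \<Sum>i\<in>I. \<beta> i x vs) \<alpha>)"
    by (simp only: gip_cnj)
  also have "\<dots> = cnj (\<Sum>i\<in>I. gip (\<beta> i) \<alpha>)"
    by (simp only: gip_sum_left[OF assms])
  finally show ?thesis by (simp only: cnj_sum gip_cnj)
qed

definition gnorm :: "(complex^2) lform \<Rightarrow> real" where
  "gnorm \<alpha> = (\<Sum>vs\<in>EF. sqnorm (\<lambda>x. \<alpha> x vs))"

lemma gip_self: "pform \<alpha> \<Longrightarrow> gip \<alpha> \<alpha> = of_real (gnorm \<alpha>)"
  by (simp add: gip_def gnorm_def ip_self pform_sp)

lemma gnorm_nonneg: "pform \<alpha> \<Longrightarrow> gnorm \<alpha> \<ge> 0"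
  unfolding gnorm_def by (intro sum_nonneg sqnorm_nonneg pform_sp)

lemma gnorm_eq_0: "pform \<alpha> \<Longrightarrow> gnorm \<alpha> = 0 \<Longrightarrow> \<alpha> = (\<lambda>x vs. 0)"
proof (rule ext)
  fix x assume \<alpha>: "pform \<alpha>" and "gnorm \<alpha> = 0"
  then have "\<forall>vs\<in>EF. sqnorm (\<lambda>x. \<alpha> x vs) = 0"
    unfolding gnorm_def by (subst sum_nonneg_eq_0_iff[symmetric]) (auto intro: sqnorm_nonneg pform_sp)
  then have "\<alpha> x vs = 0" if "vs \<in> EF" for vs
    using sqnorm_eq_0[OF pform_sp[OF \<alpha>]] that by blast
  then show "\<alpha> x = (\<lambda>vs. 0)" by (intro E.exterior_eqI pform_exterior[OF \<alpha>]) auto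
qed

lemma e_Basis: "e0 \<in> Basis" "e1 \<in> Basis" "e2 \<in> Basis" "e3 \<in> Basis"
  by (simp_all add: Basis_complex2)

text \<open>In the constant frame both sides are sums of inner products of a coefficient with a first
  derivative of a coefficient; integrate by parts and compare the signs of the star table.\<close>

lemma d_adj_adjoint:
  assumes \<alpha>: "pform \<alpha>" and \<beta>: "pform \<beta>"
  shows "gip (ext_d \<alpha>) \<beta> = gip \<alpha> (d_adj gg JJ \<beta>)"
proof -
  have a: "smooth_periodic (dd v (\<lambda>y. \<alpha> y I))" "smooth_periodic (dd v (\<lambda>y. \<beta> y I))"
    "smooth_periodic (\<lambda>y. \<alpha> y I)" "smooth_periodic (\<lambda>y. \<beta> y I)" for v I
    by (intro sp_intros pform_sp[OF \<alpha>] pform_sp[OF \<beta>])+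
  have u: "dd v (\<lambda>y. - \<beta> y I) x = - dd v (\<lambda>y. \<beta> y I) x" for v I x
    by (rule dd_uminus[OF pform_smooth[OF \<beta>]]) simp
  have s: "pform (ext_d (star gg JJ \<beta>))" by (intro pform_ext_d pform_star \<beta>)
  have D: "d_adj gg JJ \<beta> x I = - star gg JJ (ext_d (star gg JJ \<beta>)) x I" for x I
    by (simp add: d_adj_def)
  have p: "ip (dd i (\<lambda>y. \<alpha> y I)) (\<lambda>y. \<beta> y I') = - ip (\<lambda>y. \<alpha> y I) (dd i (\<lambda>y. \<beta> y I'))"
    if "i \<in> Basis" for i I I'
    by (rule ip_parts[OF a(3,4) that])
  show ?thesis
    unfolding gip_def E.sum_subframe D star_form_table[OF s]
    by (simp add: ext_d_alternation star_form_table[OF \<beta>] u p e_Basis ip_add_left ip_diff_left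
        ip_add_right ip_diff_right ip_uminus_right a sp_intros)
qed

lemma PP_selfadjoint:
  assumes "pform \<alpha>" "pform \<beta>"
  shows "gip (PP p q \<alpha>) \<beta> = gip \<alpha> (PP p q \<beta>)"
proof -
  have "E.herm (PP p q \<alpha> x) (\<beta> x) = E.herm (\<alpha> x) (PP p q \<beta> x)" for x
    using H.bidegree_part_selfadjoint[OF pform_exterior[OF assms(1), of x] pform_exterior[OF assms(2), of x], where x = x and p = p and q = q]
    by (simp add: PP_def herm_frames pform_exterior assms H.exterior_bidegree_part)
  then show ?thesis by (simp add: gip_herm pform_PP assms)
qed

lemma star_PP:
  assumes "pform \<alpha>" "p \<le> 2" "q \<le> 2"
  shows "star gg JJ (PP p q \<alpha>) = PP (2 - q) (2 - p) (star gg JJ \<alpha>)"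
  by (rule ext) (simp add: star_def PP_def H.star_bidegree_part pform_exterior assms)

lemma star_form_sum:
  "(\<And>i. i \<in> I \<Longrightarrow> pform (\<alpha> i)) \<Longrightarrow> star gg JJ (\<lambda>x vs. \<Sum>i\<in>I. \<alpha> i x vs) x vs = (\<Sum>i\<in>I. star gg JJ (\<alpha> i) x vs)"
  by (simp add: star_def H.star_sum pform_exterior)

lemma PP_uminus: "pform \<alpha> \<Longrightarrow> PP p q (\<lambda>x vs. - \<alpha> x vs) x vs = - PP p q \<alpha> x vs"
proof -
  assume \<alpha>: "pform \<alpha>"
  let ?P = "\<lambda>r s. bidegree_part (JJ x) r s (\<alpha> x)"
  have "bidegree_part (JJ x) p q (\<lambda>vs. - \<alpha> x vs) = (\<lambda>vs. - ?P p q vs)"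
  proof (rule H.bidegree_part_eqI)
    show "of_bidegree (JJ x) r s (\<lambda>vs. - ?P r s vs)" for r s
      using of_bidegree.scale[OF H.of_bidegree_part[OF pform_exterior[OF \<alpha>]], of x r s "-1"] by simp
    show "(\<lambda>vs. - \<alpha> x vs) = (\<lambda>vs. \<Sum>r\<le>2. \<Sum>s\<le>2. - ?P r s vs)"
      using fun_cong[OF H.sum_bidegree_part[OF pform_exterior[OF \<alpha>], of x x]] by (simp add: sum_negf)
  qed
  then show ?thesis by (simp add: PP_def)
qed

lemma d_adj_zero: "d_adj gg JJ (\<lambda>x vs. 0) = (\<lambda>x vs. 0)"
proof -
  have "star gg JJ (\<lambda>x vs. 0) = (\<lambda>x vs. 0)"
    by (rule ext) (simp add: star_def H.star_zero)
  moreover have "ext_d (\<lambda>x vs. 0) = (\<lambda>(x :: complex^2) vs. 0)"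
    by (intro ext) (simp add: ext_d_alternation alternation_def)
  ultimately show ?thesis by (simp add: d_adj_def uminus_form)
qed

lemma PP_zero: "PP p q (\<lambda>x vs. 0) = (\<lambda>x vs. 0)"
  using PP_uminus[OF pform_zero, of p q] by (intro ext) simp

text \<open>The operators \<open>\<partial>\<^sup>*\<close> and \<open>\<partial>'\<^sup>*\<close> are defined through the star; because the star permutes the bidegrees,
  they are the components of \<open>d\<^sup>*\<close>, and adjointness is inherited from \<open>d\<close> and \<open>d\<^sup>*\<close>.\<close>

lemma del_adj_eq:
  assumes \<beta>: "pform \<beta>"
  shows "del_adj gg JJ \<beta> = (\<lambda>x vs. \<Sum>p\<le>2. \<Sum>q\<le>2. PP p q (d_adj gg JJ (PP (Suc p) q \<beta>)) x vs)"
proof (intro ext)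
  fix x vs
  let ?S = "star gg JJ" and ?F = "\<lambda>p q. PP p q (d_adj gg JJ (PP (Suc p) q \<beta>))"
  note pf = pform_PP pform_star pform_ext_d pform_d_adj \<beta>
  have T: "?S (PP p (Suc q) (ext_d (PP p q (?S \<beta>)))) x vs = - ?F (1 - q) (2 - p) x vs"
    if "p \<le> 2" "q \<le> 1" for p q
  proof -
    have "?S (PP (2 - q) (2 - p) \<beta>) = PP p q (?S \<beta>)"
      using star_PP[OF \<beta>, of "2 - q" "2 - p"] that by simp
    then have "?S (PP p (Suc q) (ext_d (PP p q (?S \<beta>)))) = PP (1 - q) (2 - p) (?S (ext_d (?S (PP (2 - q) (2 - p) \<beta>))))"
      using star_PP[of "ext_d (PP p q (?S \<beta>))" p "Suc q"] that by (simp add: pf)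
    also have "?S (ext_d (?S (PP (2 - q) (2 - p) \<beta>))) = (\<lambda>x vs. - d_adj gg JJ (PP (2 - q) (2 - p) \<beta>) x vs)"
      by (simp add: d_adj_def)
    finally have A: "?S (PP p (Suc q) (ext_d (PP p q (?S \<beta>))))
        = PP (1 - q) (2 - p) (\<lambda>x vs. - d_adj gg JJ (PP (2 - q) (2 - p) \<beta>) x vs)" .
    have B: "PP (1 - q) (2 - p) (\<lambda>x vs. - d_adj gg JJ (PP (2 - q) (2 - p) \<beta>) x vs) x vs
        = - PP (1 - q) (2 - p) (d_adj gg JJ (PP (2 - q) (2 - p) \<beta>)) x vs"
      by (rule PP_uminus) (intro pf)
    have "Suc (1 - q) = 2 - q" using that by simp
    then show ?thesis unfolding A B by simp
  qed
  have zz: "?F 2 q = (\<lambda>x vs. 0)" for q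
    using PP_vanish[OF \<beta>, of "Suc 2" q] by (simp add: d_adj_zero PP_zero)
  have "del_adj gg JJ \<beta> x vs = - ?S (delbar JJ (?S \<beta>)) x vs" by (simp add: del_adj_def)
  also have "?S (delbar JJ (?S \<beta>)) x vs
      = (\<Sum>p\<le>2. \<Sum>q\<le>2. ?S (PP p (Suc q) (ext_d (PP p q (?S \<beta>)))) x vs)"
    unfolding delbar_eq[abs_def]
    by (subst star_form_sum, intro pform_sum pf, rule sum.cong[OF refl], subst star_form_sum, intro pf, rule refl)
  also have "\<dots> = - (\<Sum>p\<le>2. \<Sum>q\<le>2. ?F p q x vs)"
  proof -
    define G where "G = (\<lambda>p q. ?S (PP p (Suc q) (ext_d (PP p q (?S \<beta>)))) x vs)"
    define F where "F = (\<lambda>p q. ?F p q x vs)"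
    have GF: "G 0 0 = - F (1) (2)" "G 0 1 = - F (0) (2)" "G 1 0 = - F (1) (1)" "G 1 1 = - F (0) (1)" "G 2 0 = - F (1) (0)" "G 2 1 = - F (0) (0)"
      using T[of 0 0] T[of 0 1] T[of 1 0] T[of 1 1] T[of 2 0] T[of 2 1] unfolding G_def F_def by simp_all
    have "G p 2 = 0" for p
    proof -
      have "PP p (Suc 2) (ext_d (PP p 2 (?S \<beta>))) = (\<lambda>x vs. 0)" by (rule PP_vanish) (intro pf, simp)
      then show ?thesis by (simp add: G_def star_def H.star_zero)
    qed
    moreover have "F 2 q = 0" for q unfolding F_def using zz[of q] by simp
    ultimately have "(\<Sum>p\<le>2. \<Sum>q\<le>2. G p q) = - (\<Sum>p\<le>2. \<Sum>q\<le>2. F p q)"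
      using GF by (simp add: sum_le2)
    then show ?thesis unfolding G_def F_def .
  qed
  finally show "del_adj gg JJ \<beta> x vs = (\<Sum>p\<le>2. \<Sum>q\<le>2. ?F p q x vs)" by simp
qed

lemma delbar_adj_eq:
  assumes \<beta>: "pform \<beta>"
  shows "delbar_adj gg JJ \<beta> = (\<lambda>x vs. \<Sum>p\<le>2. \<Sum>q\<le>2. PP p q (d_adj gg JJ (PP p (Suc q) \<beta>)) x vs)"
proof (intro ext)
  fix x vs
  let ?S = "star gg JJ" and ?F = "\<lambda>p q. PP p q (d_adj gg JJ (PP p (Suc q) \<beta>))"
  note pf = pform_PP pform_star pform_ext_d pform_d_adj \<beta>
  have T: "?S (PP (Suc p) q (ext_d (PP p q (?S \<beta>)))) x vs = - ?F (2 - q) (1 - p) x vs"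
    if "p \<le> 1" "q \<le> 2" for p q
  proof -
    have "?S (PP (2 - q) (2 - p) \<beta>) = PP p q (?S \<beta>)"
      using star_PP[OF \<beta>, of "2 - q" "2 - p"] that by simp
    then have "?S (PP (Suc p) q (ext_d (PP p q (?S \<beta>)))) = PP (2 - q) (1 - p) (?S (ext_d (?S (PP (2 - q) (2 - p) \<beta>))))"
      using star_PP[of "ext_d (PP p q (?S \<beta>))" "Suc p" q] that by (simp add: pf)
    also have "?S (ext_d (?S (PP (2 - q) (2 - p) \<beta>))) = (\<lambda>x vs. - d_adj gg JJ (PP (2 - q) (2 - p) \<beta>) x vs)"
      by (simp add: d_adj_def)
    finally have A: "?S (PP (Suc p) q (ext_d (PP p q (?S \<beta>))))
        = PP (2 - q) (1 - p) (\<lambda>x vs. - d_adj gg JJ (PP (2 - q) (2 - p) \<beta>) x vs)" .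
    have B: "PP (2 - q) (1 - p) (\<lambda>x vs. - d_adj gg JJ (PP (2 - q) (2 - p) \<beta>) x vs) x vs
        = - PP (2 - q) (1 - p) (d_adj gg JJ (PP (2 - q) (2 - p) \<beta>)) x vs"
      by (rule PP_uminus) (intro pf)
    have "Suc (1 - p) = 2 - p" using that by simp
    then show ?thesis unfolding A B by simp
  qed
  have zz: "?F p 2 = (\<lambda>x vs. 0)" for p
    using PP_vanish[OF \<beta>, of p "Suc 2"] by (simp add: d_adj_zero PP_zero)
  have "delbar_adj gg JJ \<beta> x vs = - ?S (del JJ (?S \<beta>)) x vs" by (simp add: delbar_adj_def)
  also have "?S (del JJ (?S \<beta>)) x vs
      = (\<Sum>p\<le>2. \<Sum>q\<le>2. ?S (PP (Suc p) q (ext_d (PP p q (?S \<beta>)))) x vs)"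
    unfolding del_eq[abs_def]
    by (subst star_form_sum, intro pform_sum pf, rule sum.cong[OF refl], subst star_form_sum, intro pf, rule refl)
  also have "\<dots> = - (\<Sum>p\<le>2. \<Sum>q\<le>2. ?F p q x vs)"
  proof -
    define G where "G = (\<lambda>p q. ?S (PP (Suc p) q (ext_d (PP p q (?S \<beta>)))) x vs)"
    define F where "F = (\<lambda>p q. ?F p q x vs)"
    have GF: "G 0 0 = - F (2) (1)" "G 0 1 = - F (1) (1)" "G 0 2 = - F (0) (1)" "G 1 0 = - F (2) (0)" "G 1 1 = - F (1) (0)" "G 1 2 = - F (0) (0)"
      using T[of 0 0] T[of 0 1] T[of 0 2] T[of 1 0] T[of 1 1] T[of 1 2] unfolding G_def F_def by simp_all
    have "G 2 q = 0" for q
    proof -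
      have "PP (Suc 2) q (ext_d (PP 2 q (?S \<beta>))) = (\<lambda>x vs. 0)" by (rule PP_vanish) (intro pf, simp)
      then show ?thesis by (simp add: G_def star_def H.star_zero)
    qed
    moreover have "F p 2 = 0" for p unfolding F_def using zz[of p] by simp
    ultimately have "(\<Sum>p\<le>2. \<Sum>q\<le>2. G p q) = - (\<Sum>p\<le>2. \<Sum>q\<le>2. F p q)"
      using GF by (simp add: sum_le2)
    then show ?thesis unfolding G_def F_def .
  qed
  finally show "delbar_adj gg JJ \<beta> x vs = (\<Sum>p\<le>2. \<Sum>q\<le>2. ?F p q x vs)" by simp
qed

lemma del_adjoint:
  assumes "pform \<alpha>" "pform \<beta>"
  shows "gip (del JJ \<alpha>) \<beta> = gip \<alpha> (del_adj gg JJ \<beta>)"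
proof -
  note pf = pform_PP pform_star pform_ext_d pform_d_adj assms
  have "gip (del JJ \<alpha>) \<beta> = (\<Sum>p\<le>2. \<Sum>q\<le>2. gip (PP (Suc p) q (ext_d (PP p q \<alpha>))) \<beta>)"
    unfolding del_eq[abs_def]
    by (subst gip_sum_left, intro pform_sum pf, intro pf, rule sum.cong[OF refl], subst gip_sum_left, intro pf, intro pf, rule refl)
  also have "\<dots> = (\<Sum>p\<le>2. \<Sum>q\<le>2. gip \<alpha> (PP p q (d_adj gg JJ (PP (Suc p) q \<beta>))))"
    by (simp add: PP_selfadjoint d_adj_adjoint pf)
  also have "\<dots> = gip \<alpha> (del_adj gg JJ \<beta>)"
    unfolding del_adj_eq[OF assms(2)]
    by (subst gip_sum_right, intro pform_sum pf, intro pf, rule sum.cong[OF refl], subst gip_sum_right, intro pf, intro pf, rule refl)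
  finally show ?thesis .
qed

lemma delbar_adjoint:
  assumes "pform \<alpha>" "pform \<beta>"
  shows "gip (delbar JJ \<alpha>) \<beta> = gip \<alpha> (delbar_adj gg JJ \<beta>)"
proof -
  note pf = pform_PP pform_star pform_ext_d pform_d_adj assms
  have "gip (delbar JJ \<alpha>) \<beta> = (\<Sum>p\<le>2. \<Sum>q\<le>2. gip (PP p (Suc q) (ext_d (PP p q \<alpha>))) \<beta>)"
    unfolding delbar_eq[abs_def]
    by (subst gip_sum_left, intro pform_sum pf, intro pf, rule sum.cong[OF refl], subst gip_sum_left, intro pf, intro pf, rule refl)
  also have "\<dots> = (\<Sum>p\<le>2. \<Sum>q\<le>2. gip \<alpha> (PP p q (d_adj gg JJ (PP p (Suc q) \<beta>))))"
    by (simp add: PP_selfadjoint d_adj_adjoint pf)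
  also have "\<dots> = gip \<alpha> (delbar_adj gg JJ \<beta>)"
    unfolding delbar_adj_eq[OF assms(2)]
    by (subst gip_sum_right, intro pform_sum pf, intro pf, rule sum.cong[OF refl], subst gip_sum_right, intro pf, intro pf, rule refl)
  finally show ?thesis .
qed

lemma gip_cnj_eq: "gip \<alpha> \<beta> = gip \<gamma> \<delta> \<Longrightarrow> gip \<beta> \<alpha> = gip \<delta> \<gamma>"
  using gip_cnj by metis

text \<open>By adjointness, the inner product of the Laplacian of a form with the form is a sum of six squared
  norms, which must vanish one by one.\<close>

lemma bott_chern_kernel:
  assumes \<alpha>: "pform \<alpha>" and z: "bott_chern_laplacian gg JJ \<alpha> = (\<lambda>x vs. 0)"
  shows "del JJ \<alpha> = (\<lambda>x vs. 0)" "delbar JJ \<alpha> = (\<lambda>x vs. 0)"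
    "delbar_adj gg JJ (del_adj gg JJ \<alpha>) = (\<lambda>x vs. 0)"
proof -
  let ?a = "del JJ" and ?b = "delbar JJ" and ?s = "del_adj gg JJ" and ?t = "delbar_adj gg JJ"
  note pf = pform_del pform_delbar pform_del_adj pform_delbar_adj \<alpha>
  note as = del_adjoint delbar_adjoint
  have as': "gip (?s \<beta>) \<gamma> = gip \<beta> (?a \<gamma>)" "gip (?t \<beta>) \<gamma> = gip \<beta> (?b \<gamma>)" if "pform \<beta>" "pform \<gamma>" for \<beta> \<gamma>
    by (rule gip_cnj_eq, simp add: as that)+
  have "0 = gip (bott_chern_laplacian gg JJ \<alpha>) \<alpha>" by (simp add: z)
  also have "\<dots> = gip (\<lambda>x vs. ?a (?b (?t (?s \<alpha>))) x vs + ?t (?s (?a (?b \<alpha>))) x vs + ?s (?b (?t (?a \<alpha>))) x vs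
      + ?t (?a (?s (?b \<alpha>))) x vs + ?s (?a \<alpha>) x vs + ?t (?b \<alpha>) x vs) \<alpha>"
    by (simp add: bott_chern_laplacian_def plus_fun_def)
  also have "\<dots> = gip (?a (?b (?t (?s \<alpha>)))) \<alpha> + gip (?t (?s (?a (?b \<alpha>)))) \<alpha> + gip (?s (?b (?t (?a \<alpha>)))) \<alpha>
      + gip (?t (?a (?s (?b \<alpha>)))) \<alpha> + gip (?s (?a \<alpha>)) \<alpha> + gip (?t (?b \<alpha>)) \<alpha>"
    by (simp add: gip_add_left pform_add pf)
  also have "\<dots> = gip (?t (?s \<alpha>)) (?t (?s \<alpha>)) + gip (?a (?b \<alpha>)) (?a (?b \<alpha>)) + gip (?t (?a \<alpha>)) (?t (?a \<alpha>))
      + gip (?s (?b \<alpha>)) (?s (?b \<alpha>)) + gip (?a \<alpha>) (?a \<alpha>) + gip (?b \<alpha>) (?b \<alpha>)"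
    by (simp add: as as' pf)
  also have "\<dots> = of_real (gnorm (?t (?s \<alpha>)) + gnorm (?a (?b \<alpha>)) + gnorm (?t (?a \<alpha>))
      + gnorm (?s (?b \<alpha>)) + gnorm (?a \<alpha>) + gnorm (?b \<alpha>))"
    by (simp add: gip_self pf)
  finally have X: "0 = complex_of_real (gnorm (?t (?s \<alpha>)) + gnorm (?a (?b \<alpha>)) + gnorm (?t (?a \<alpha>))
      + gnorm (?s (?b \<alpha>)) + gnorm (?a \<alpha>) + gnorm (?b \<alpha>))" .
  have "gnorm (?t (?s \<alpha>)) + gnorm (?a (?b \<alpha>)) + gnorm (?t (?a \<alpha>))
      + gnorm (?s (?b \<alpha>)) + gnorm (?a \<alpha>) + gnorm (?b \<alpha>) = 0"
    using X[symmetric] by (simp only: of_real_eq_0_iff)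
  moreover have "gnorm (?t (?s \<alpha>)) \<ge> 0" "gnorm (?a (?b \<alpha>)) \<ge> 0" "gnorm (?t (?a \<alpha>)) \<ge> 0"
      "gnorm (?s (?b \<alpha>)) \<ge> 0" "gnorm (?a \<alpha>) \<ge> 0" "gnorm (?b \<alpha>) \<ge> 0"
    by (intro gnorm_nonneg pf)+
  ultimately have "gnorm (?a \<alpha>) = 0" "gnorm (?b \<alpha>) = 0" "gnorm (?t (?s \<alpha>)) = 0"
    by linarith+
  then show "?a \<alpha> = (\<lambda>x vs. 0)" "?b \<alpha> = (\<lambda>x vs. 0)" "?t (?s \<alpha>) = (\<lambda>x vs. 0)"
    using gnorm_eq_0[OF pform_del[OF \<alpha>]] gnorm_eq_0[OF pform_delbar[OF \<alpha>]]
      gnorm_eq_0[OF pform_delbar_adj[OF pform_del_adj[OF \<alpha>]]] by simp_all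
qed

lemma hodge_kernel:
  assumes \<alpha>: "pform \<alpha>" and z: "hodge_laplacian gg JJ \<alpha> = (\<lambda>x vs. 0)"
  shows "ext_d \<alpha> = (\<lambda>x vs. 0)"
proof -
  let ?d = "ext_d" and ?s = "d_adj gg JJ"
  note pf = pform_ext_d pform_d_adj \<alpha>
  have as': "gip (?s \<beta>) \<gamma> = gip \<beta> (?d \<gamma>)" if "pform \<beta>" "pform \<gamma>" for \<beta> \<gamma>
    by (rule gip_cnj_eq, simp add: d_adj_adjoint that)
  have "0 = gip (hodge_laplacian gg JJ \<alpha>) \<alpha>" by (simp add: z)
  also have "\<dots> = gip (\<lambda>x vs. ?d (?s \<alpha>) x vs + ?s (?d \<alpha>) x vs) \<alpha>"
    by (simp add: hodge_laplacian_def plus_fun_def)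
  also have "\<dots> = gip (?s \<alpha>) (?s \<alpha>) + gip (?d \<alpha>) (?d \<alpha>)"
    by (simp add: gip_add_left d_adj_adjoint as' pf)
  also have "\<dots> = of_real (gnorm (?s \<alpha>) + gnorm (?d \<alpha>))"
    by (simp add: gip_self pf)
  finally have X: "0 = complex_of_real (gnorm (?s \<alpha>) + gnorm (?d \<alpha>))" .
  have "gnorm (?s \<alpha>) + gnorm (?d \<alpha>) = 0"
    using X[symmetric] by (simp only: of_real_eq_0_iff)
  moreover have "gnorm (?s \<alpha>) \<ge> 0" "gnorm (?d \<alpha>) \<ge> 0" by (intro gnorm_nonneg pf)+
  ultimately have "gnorm (?d \<alpha>) = 0" by linarith
  then show ?thesis by (intro gnorm_eq_0 pf)
qed

section \<open>Functions and forms annihilated by the operators\<close>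

abbreviation cw :: "complex^2 \<Rightarrow> complex" where "cw \<equiv> (\<lambda>x. complex_of_real (cos (x \<bullet> e0)))"
abbreviation sw :: "complex^2 \<Rightarrow> complex" where "sw \<equiv> (\<lambda>x. complex_of_real (sin (x \<bullet> e0)))"

lemma cw_sw: "cw x * cw x + sw x * sw x = 1"
  by (simp only: of_real_mult[symmetric] of_real_add[symmetric] cs of_real_1)

lemma dd_cw_sw [simp]:
  "dd e0 cw x = - sw x" "dd e0 sw x = cw x" "dd e1 cw x = 0" "dd e1 sw x = 0"
  "dd e2 cw x = 0" "dd e2 sw x = 0" "dd e3 cw x = 0" "dd e3 sw x = 0"
  by (simp_all add: dd_trig)

lemma sp_smooth: "smooth_periodic f \<Longrightarrow> smooth_on UNIV f"
  by (simp add: smooth_periodic_def)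

lemma spd:
  "smooth_periodic f \<Longrightarrow> smooth_periodic g \<Longrightarrow> dd v (\<lambda>x. f x + g x) x = dd v f x + dd v g x"
  "smooth_periodic f \<Longrightarrow> smooth_periodic g \<Longrightarrow> dd v (\<lambda>x. f x - g x) x = dd v f x - dd v g x"
  "smooth_periodic f \<Longrightarrow> smooth_periodic g \<Longrightarrow> dd v (\<lambda>x. f x * g x) x = f x * dd v g x + dd v f x * g x"
  "smooth_periodic f \<Longrightarrow> dd v (\<lambda>x. - f x) x = - dd v f x"
  by (auto intro!: dd_add dd_diff dd_mult dd_uminus simp: smooth_periodic_def)

lemma constant_if_dd_zero:
  assumes f: "smooth_on UNIV (f :: complex^2 \<Rightarrow> complex)"
    and z: "\<And>x. dd e0 f x = 0" "\<And>x. dd e1 f x = 0" "\<And>x. dd e2 f x = 0" "\<And>x. dd e3 f x = 0"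
  shows "f x = f y"
proof -
  have "dd v f x = 0" for v x
    by (subst E.frame_expand[of v])
      (simp only: linear_add[OF linear_dd[OF f UNIV_I]] linear_scale[OF linear_dd[OF f UNIV_I]] z, simp)
  then have "(f has_derivative (\<lambda>h. 0)) (at x)" for x
    using smooth_on_has_derivative[OF f, of x] by simp
  then have "\<exists>c. \<forall>x\<in>UNIV. f x = c"
    by (intro has_derivative_zero_constant[OF convex_UNIV]) auto
  then show ?thesis by auto
qed

text \<open>Pairing with \<open>f\<close>: the first order term is skew-adjoint, the Laplacian is definite.\<close>

lemma laplace_drift_constant:
  assumes f: "smooth_periodic (f :: complex^2 \<Rightarrow> complex)"
    and eq: "\<And>x. dd e0 (dd e0 f) x + dd e1 (dd e1 f) x + dd e2 (dd e2 f) x + dd e3 (dd e3 f) x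
      = of_real k * dd e3 f x"
  shows "f x = f y"
proof -
  let ?D = "\<lambda>v. dd v f"
  have s: "smooth_periodic (?D v)" "smooth_periodic (dd v (?D v))" for v by (intro sp_intros f)+
  have p: "ip (dd v (?D v)) f = - of_real (sqnorm (?D v))" if "v \<in> Basis" for v
    using ip_parts[OF s(1) f that] ip_self[OF s(1)] by simp
  have "ip (\<lambda>x. dd e0 (?D e0) x + dd e1 (?D e1) x + dd e2 (?D e2) x + dd e3 (?D e3) x) f
      = ip (\<lambda>x. of_real k * ?D e3 x) f" by (simp only: eq)
  also have "ip (\<lambda>x. of_real k * ?D e3 x) f = of_real k * ip (?D e3) f"
    by (simp add: ip_def mult.assoc)
  finally have A: "- of_real (sqnorm (?D e0) + sqnorm (?D e1) + sqnorm (?D e2) + sqnorm (?D e3))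
      = of_real k * ip (?D e3) f"
    by (simp add: ip_add_left s f p e_Basis sp_intros)
  have "ip (?D e3) f = - cnj (ip (?D e3) f)"
    using ip_parts[OF f f e_Basis(4)] by (simp add: ip_cnj)
  then have "Re (ip (?D e3) f) = 0" by (metis add_eq_0_iff complex_cnj(1) uminus_complex.sel(1) double_zero cnj.sel(1) neg_equal_zero)
  with arg_cong[OF A, of Re]
  have "sqnorm (?D e0) + sqnorm (?D e1) + sqnorm (?D e2) + sqnorm (?D e3) = 0" by simp
  moreover have "sqnorm (?D e0) \<ge> 0" "sqnorm (?D e1) \<ge> 0" "sqnorm (?D e2) \<ge> 0" "sqnorm (?D e3) \<ge> 0"
    by (rule sqnorm_nonneg[OF s(1)])+
  ultimately have "sqnorm (?D e0) = 0" "sqnorm (?D e1) = 0" "sqnorm (?D e2) = 0" "sqnorm (?D e3) = 0"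
    by linarith+
  then have "?D e0 x = 0" "?D e1 x = 0" "?D e2 x = 0" "?D e3 x = 0" for x
    using sqnorm_eq_0[OF s(1)] by blast+
  then show ?thesis by (intro constant_if_dd_zero sp_smooth f)
qed

lemma dd_swap:
  assumes "smooth_periodic f"
  shows "dd e1 (dd e0 f) x = dd e0 (dd e1 f) x" "dd e2 (dd e0 f) x = dd e0 (dd e2 f) x"
    "dd e3 (dd e0 f) x = dd e0 (dd e3 f) x" "dd e2 (dd e1 f) x = dd e1 (dd e2 f) x"
    "dd e3 (dd e1 f) x = dd e1 (dd e3 f) x" "dd e3 (dd e2 f) x = dd e2 (dd e3 f) x"
  by (rule dd_commute[OF sp_smooth[OF assms]])+

text \<open>A closed anti-self-dual 2-form has harmonic coefficients: its four first order equations
  are those of a quaternionic Cauchy-Riemann operator.\<close>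

lemma asd_closed_constant:
  assumes \<gamma>: "pform \<gamma>" and d: "ext_d \<gamma> = (\<lambda>x vs. 0)"
    and asd: "\<And>x. \<gamma> x [e2,e3] = - \<gamma> x [e0,e1]" "\<And>x. \<gamma> x [e1,e3] = \<gamma> x [e0,e2]"
      "\<And>x. \<gamma> x [e1,e2] = - \<gamma> x [e0,e3]"
  shows "\<gamma> x [e0,e1] = \<gamma> y [e0,e1]" "\<gamma> x [e0,e2] = \<gamma> y [e0,e2]" "\<gamma> x [e0,e3] = \<gamma> y [e0,e3]"
proof -
  define u v w where "u = (\<lambda>x. \<gamma> x [e0,e1])" and "v = (\<lambda>x. \<gamma> x [e0,e2])" and "w = (\<lambda>x. \<gamma> x [e0,e3])"
  have s: "smooth_periodic u" "smooth_periodic v" "smooth_periodic w"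
    unfolding u_def v_def w_def by (intro pform_sp[OF \<gamma>])+
  have sd: "smooth_periodic (dd a u)" "smooth_periodic (dd a v)" "smooth_periodic (dd a w)" for a
    by (intro sp_intros s)+
  define E1 where "E1 = (\<lambda>x. dd e2 u x - dd e1 v x - dd e0 w x)"
  define E2 where "E2 = (\<lambda>x. dd e3 u x + dd e0 v x - dd e1 w x)"
  define E3 where "E3 = (\<lambda>x. dd e3 v x - dd e0 u x - dd e2 w x)"
  define E4 where "E4 = (\<lambda>x. - dd e1 u x - dd e2 v x - dd e3 w x)"
  have g: "(\<lambda>y. \<gamma> y [e0,e1]) = u" "(\<lambda>y. \<gamma> y [e0,e2]) = v" "(\<lambda>y. \<gamma> y [e0,e3]) = w"
    "(\<lambda>y. \<gamma> y [e2,e3]) = (\<lambda>y. - u y)" "(\<lambda>y. \<gamma> y [e1,e3]) = v" "(\<lambda>y. \<gamma> y [e1,e2]) = (\<lambda>y. - w y)"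
    by (simp_all add: u_def v_def w_def asd)
  have E: "E1 = (\<lambda>x. 0)" "E2 = (\<lambda>x. 0)" "E3 = (\<lambda>x. 0)" "E4 = (\<lambda>x. 0)"
  proof -
    have "ext_d \<gamma> x [e0,e1,e2] = E1 x" "ext_d \<gamma> x [e0,e1,e3] = E2 x"
      "ext_d \<gamma> x [e0,e2,e3] = E3 x" "ext_d \<gamma> x [e1,e2,e3] = E4 x" for x
      by (simp_all add: ext_d_alternation g spd s E1_def E2_def E3_def E4_def)
    then show "E1 = (\<lambda>x. 0)" "E2 = (\<lambda>x. 0)" "E3 = (\<lambda>x. 0)" "E4 = (\<lambda>x. 0)"
      by (simp_all add: fun_eq_iff d)
  qed
  have dE: "dd a E1 x = dd a (dd e2 u) x - dd a (dd e1 v) x - dd a (dd e0 w) x"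
    "dd a E2 x = dd a (dd e3 u) x + dd a (dd e0 v) x - dd a (dd e1 w) x"
    "dd a E3 x = dd a (dd e3 v) x - dd a (dd e0 u) x - dd a (dd e2 w) x"
    "dd a E4 x = - dd a (dd e1 u) x - dd a (dd e2 v) x - dd a (dd e3 w) x" for a x
    unfolding E1_def E2_def E3_def E4_def by (simp_all add: spd sd sp_intros)
  have z: "dd a E1 x = 0" "dd a E2 x = 0" "dd a E3 x = 0" "dd a E4 x = 0" for a x
    unfolding E by simp_all
  have "dd e0 (dd e0 u) x + dd e1 (dd e1 u) x + dd e2 (dd e2 u) x + dd e3 (dd e3 u) x
      = dd e2 E1 x + dd e3 E2 x - dd e0 E3 x - dd e1 E4 x" for x
    unfolding dE by (simp add: dd_swap s)
  then have "u x = u y" by (intro laplace_drift_constant[where k = 0] s) (simp add: z)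
  moreover have "dd e0 (dd e0 v) x + dd e1 (dd e1 v) x + dd e2 (dd e2 v) x + dd e3 (dd e3 v) x
      = dd e0 E2 x - dd e1 E1 x + dd e3 E3 x - dd e2 E4 x" for x
    unfolding dE by (simp add: dd_swap s)
  then have "v x = v y" by (intro laplace_drift_constant[where k = 0] s) (simp add: z)
  moreover have "dd e0 (dd e0 w) x + dd e1 (dd e1 w) x + dd e2 (dd e2 w) x + dd e3 (dd e3 w) x
      = - dd e0 E1 x - dd e1 E2 x - dd e2 E3 x - dd e3 E4 x" for x
    unfolding dE by (simp add: dd_swap s)
  then have "w x = w y" by (intro laplace_drift_constant[where k = 0] s) (simp add: z)
  ultimately show "\<gamma> x [e0,e1] = \<gamma> y [e0,e1]" "\<gamma> x [e0,e2] = \<gamma> y [e0,e2]" "\<gamma> x [e0,e3] = \<gamma> y [e0,e3]"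
    by (simp_all add: u_def v_def w_def)
qed

section \<open>Forms of type (1,1)\<close>

text \<open>The component along the fundamental form \<open>\<omega> = e0 \<and> f1 + f2 \<and> e3\<close>, which has norm \<open>\<surd>2\<close>.\<close>

definition omega_coeff :: "(complex^2) lform \<Rightarrow> complex^2 \<Rightarrow> complex" where
  "omega_coeff \<alpha> x = (cw x * (\<alpha> x [e0,e1] + \<alpha> x [e2,e3]) + sw x * (\<alpha> x [e0,e2] - \<alpha> x [e1,e3])) / 2"

lemma exterior_pair_linear:
  assumes "\<beta> \<in> exterior"
  shows "\<beta> [(r *\<^sub>R a + s *\<^sub>R b), c] = of_real r * \<beta> [a, c] + of_real s * \<beta> [b, c]"
    "\<beta> [c, (r *\<^sub>R a + s *\<^sub>R b)] = of_real r * \<beta> [c, a] + of_real s * \<beta> [c, b]"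
proof -
  note l = exterior_linear_hd[OF assms, of "[c]"] exterior_linear[OF assms, of "[c]" "[]", simplified]
  show "\<beta> [(r *\<^sub>R a + s *\<^sub>R b), c] = of_real r * \<beta> [a, c] + of_real s * \<beta> [b, c]"
    "\<beta> [c, (r *\<^sub>R a + s *\<^sub>R b)] = of_real r * \<beta> [c, a] + of_real s * \<beta> [c, b]"
    using linear_add[OF l(1), of "r *\<^sub>R a" "s *\<^sub>R b"] linear_add[OF l(2), of "r *\<^sub>R a" "s *\<^sub>R b"]
      linear_scale[OF l(1)] linear_scale[OF l(2)] by (simp_all add: scaleR_conv_of_real)
qed

text \<open>In real dimension four a (1,1)-form is a multiple of \<open>\<omega>\<close> plus an anti-self-dual form.\<close>

lemma type11_relations:
  assumes "of_bidegree (JJ x) 1 1 (\<alpha> x)"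
  shows "\<alpha> x [e1,e2] = - \<alpha> x [e0,e3]"
    "\<alpha> x [e2,e3] = 2 * omega_coeff \<alpha> x * cw x - \<alpha> x [e0,e1]"
    "\<alpha> x [e1,e3] = \<alpha> x [e0,e2] - 2 * omega_coeff \<alpha> x * sw x"
proof -
  have e: "eigen_bidegree (JJ x) 1 1 (\<alpha> x)" by (rule of_bidegree_eigen[OF assms])
  then have ext: "\<alpha> x \<in> exterior" and j: "jder (JJ x) (\<alpha> x) vs = 0" for vs
    by (auto simp: eigen_bidegree_def)
  have z: "\<alpha> x [v, v] = 0" for v by (rule exterior_nondistinct[OF ext]) simp
  have sw12: "\<alpha> x [e2, e1] = - \<alpha> x [e1, e2]" by (rule exterior_swap_hd[OF ext])
  have "\<alpha> x [f1 x, f2 x] + \<alpha> x [e0, e3] = 0" "\<alpha> x [f1 x, e3] - \<alpha> x [e0, f2 x] = 0"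
    using j[of "[e0, f2 x]"] j[of "[e0, e3]"] by (simp_all only: H.jder_table[OF ext])
  then have r: "(cw x * cw x + sw x * sw x) * \<alpha> x [e1,e2] + \<alpha> x [e0,e3] = 0"
    "cw x * \<alpha> x [e1,e3] + sw x * \<alpha> x [e2,e3] + sw x * \<alpha> x [e0,e1] - cw x * \<alpha> x [e0,e2] = 0"
    by (simp_all add: f1_def f2_def exterior_pair_linear[OF ext] exterior_pair_linear(2)[OF ext, of _ _ _ _ , of e1 "- sin (x \<bullet> e0)" e1] z sw12 algebra_simps flip: scaleR_minus_left)
  show "\<alpha> x [e1,e2] = - \<alpha> x [e0,e3]" using r(1) by (simp add: cw_sw eq_neg_iff_add_eq_0)
  let ?p = "\<alpha> x [e0,e1] + \<alpha> x [e2,e3]" and ?q = "\<alpha> x [e0,e2] - \<alpha> x [e1,e3]"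
  have pq: "sw x * ?p = cw x * ?q" using r(2) by (simp add: algebra_simps)
  have o: "2 * omega_coeff \<alpha> x = cw x * ?p + sw x * ?q" by (simp add: omega_coeff_def)
  have "2 * omega_coeff \<alpha> x * cw x = cw x * cw x * ?p + sw x * (cw x * ?q)"
    unfolding o by (simp add: algebra_simps)
  also have "\<dots> = (cw x * cw x + sw x * sw x) * ?p" unfolding pq[symmetric] by (simp add: algebra_simps)
  finally show "\<alpha> x [e2,e3] = 2 * omega_coeff \<alpha> x * cw x - \<alpha> x [e0,e1]" by (simp add: cw_sw)
  have "2 * omega_coeff \<alpha> x * sw x = cw x * (sw x * ?p) + sw x * sw x * ?q"
    unfolding o by (simp add: algebra_simps)
  also have "\<dots> = (cw x * cw x + sw x * sw x) * ?q" unfolding pq by (simp add: algebra_simps)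
  finally show "\<alpha> x [e1,e3] = \<alpha> x [e0,e2] - 2 * omega_coeff \<alpha> x * sw x" by (simp add: cw_sw)
qed

lemma sp_omega_coeff: "pform \<alpha> \<Longrightarrow> smooth_periodic (omega_coeff \<alpha>)"
  unfolding omega_coeff_def[abs_def] divide_inverse by (intro sp_intros pform_sp; assumption)

lemma PP_of_bidegree:
  assumes "\<And>x. of_bidegree (JJ x) p q (\<alpha> x)" "p \<le> 2" "q \<le> 2"
  shows "PP r s \<alpha> = (if r = p \<and> s = q then \<alpha> else (\<lambda>x vs. 0))"
  by (rule ext) (simp add: PP_def H.bidegree_part_of_bidegree[OF assms])

lemma PP_of_PP: "pform \<alpha> \<Longrightarrow> p \<le> 2 \<Longrightarrow> q \<le> 2 \<Longrightarrow> PP r s (PP p q \<alpha>) = (if r = p \<and> s = q then PP p q \<alpha> else (\<lambda>x vs. 0))"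
  by (rule PP_of_bidegree) (simp_all add: PP_def H.of_bidegree_part pform_exterior)

lemma ext_d_zero: "ext_d (\<lambda>(x :: complex^2) vs. 0) = (\<lambda>x vs. 0)"
  by (intro ext) (simp add: ext_d_alternation alternation_def)

lemma
  assumes \<alpha>: "pform \<alpha>" and t: "\<And>x. of_bidegree (JJ x) 1 1 (\<alpha> x)"
  shows del_11: "del JJ \<alpha> = PP 2 1 (ext_d \<alpha>)" and delbar_11: "delbar JJ \<alpha> = PP 1 2 (ext_d \<alpha>)"
    and double_adj_11: "delbar_adj gg JJ (del_adj gg JJ \<alpha>) = PP 0 0 (d_adj gg JJ (PP 0 1 (d_adj gg JJ \<alpha>)))"
proof -
  note P = PP_of_bidegree[OF t]
  show "del JJ \<alpha> = PP 2 1 (ext_d \<alpha>)" "delbar JJ \<alpha> = PP 1 2 (ext_d \<alpha>)"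
    by (intro ext; simp add: del_eq delbar_eq sum_le2 P ext_d_zero PP_zero numeral_2_eq_2)+
  have "del_adj gg JJ \<alpha> = PP 0 1 (d_adj gg JJ \<alpha>)"
    by (intro ext) (simp add: del_adj_eq[OF \<alpha>] sum_le2 P d_adj_zero PP_zero)
  moreover have "delbar_adj gg JJ (PP 0 1 (d_adj gg JJ \<alpha>)) = PP 0 0 (d_adj gg JJ (PP 0 1 (d_adj gg JJ \<alpha>)))"
    by (intro ext) (simp add: delbar_adj_eq pform_PP pform_d_adj \<alpha> sum_le2 PP_of_PP d_adj_zero PP_zero)
  ultimately show "delbar_adj gg JJ (del_adj gg JJ \<alpha>) = PP 0 0 (d_adj gg JJ (PP 0 1 (d_adj gg JJ \<alpha>)))"
    by simp
qed

lemma PP_degree: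
  assumes \<alpha>: "pform \<alpha>" and "\<And>x. has_degree k (\<alpha> x)" "r + s \<noteq> k"
  shows "PP r s \<alpha> = (\<lambda>x vs. 0)"
proof (rule ext)
  fix x
  let ?\<beta> = "bidegree_part (JJ x) r s (\<alpha> x)"
  note ext = pform_exterior[OF \<alpha>, of x]
  have b: "of_bidegree (JJ x) r s ?\<beta>" by (rule H.of_bidegree_part[OF ext])
  have e: "eigen_bidegree (JJ x) r s ?\<beta>" by (rule of_bidegree_eigen[OF b])
  show "PP r s \<alpha> x = (\<lambda>vs. 0)"
  proof (cases "r \<le> 2 \<and> s \<le> 2")
    case True
    have "\<alpha> x vs * cnj (?\<beta> vs) = 0" for vs
      using e assms(2)[of x] assms(3) by (cases "length vs = k") (auto simp: eigen_bidegree_def has_degree_def)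
    then have "H.herm x (\<alpha> x) ?\<beta> = 0" unfolding H.herm_def by (intro sum.neutral) blast
    moreover have "bidegree_part (JJ x) r s ?\<beta> = ?\<beta>" using H.bidegree_part_of_bidegree[OF b] True by simp
    ultimately have "H.herm x ?\<beta> ?\<beta> = 0"
      using H.bidegree_part_selfadjoint[OF ext H.exterior_bidegree_part[OF ext, of x r s], of x r s] by simp
    then show ?thesis unfolding PP_def by (intro H.herm_definite H.exterior_bidegree_part ext)
  next
    case False
    then show ?thesis using H.bidegree_part_vanish[OF ext, of r s] by (simp add: PP_def not_le)
  qed
qed

lemma has_degree_ext_d: "(\<And>x. has_degree k (\<alpha> x)) \<Longrightarrow> has_degree (Suc k) (ext_d \<alpha> (x :: complex^2))"
  unfolding has_degree_def ext_d_def by (intro allI impI sum.neutral ballI) (simp add: frechet_derivative_const)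

lemma PP_sum: "pform \<alpha> \<Longrightarrow> \<alpha> x vs = (\<Sum>r\<le>2. \<Sum>s\<le>2. PP r s \<alpha> x vs)"
  using fun_cong[OF H.sum_bidegree_part[OF pform_exterior, of \<alpha> x x], of vs] by (simp add: PP_def)

text \<open>The derivative has degree three, where only the bidegrees \<open>(2,1)\<close> and \<open>(1,2)\<close> occur, and these two
  components are \<open>\<partial>\<alpha>\<close> and \<open>\<partial>' \<alpha>\<close>.\<close>

lemma closed_11:
  assumes \<alpha>: "pform \<alpha>" and t: "\<And>x. of_bidegree (JJ x) 1 1 (\<alpha> x)"
    and z: "del JJ \<alpha> = (\<lambda>x vs. 0)" "delbar JJ \<alpha> = (\<lambda>x vs. 0)"
  shows "ext_d \<alpha> = (\<lambda>x vs. 0)"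
proof (intro ext)
  fix x vs
  have "has_degree 2 (\<alpha> x)" for x using of_bidegree_eigen[OF t[of x]] by (simp add: eigen_bidegree_def numeral_2_eq_2)
  then have "has_degree 3 (ext_d \<alpha> x)" for x using has_degree_ext_d[of 2 \<alpha> x] by (simp add: numeral_3_eq_3 numeral_2_eq_2)
  note d = PP_degree[OF pform_ext_d[OF \<alpha>] this]
  have "PP 2 1 (ext_d \<alpha>) = (\<lambda>x vs. 0)" "PP 1 2 (ext_d \<alpha>) = (\<lambda>x vs. 0)"
    using z by (simp_all add: del_11[OF \<alpha> t] delbar_11[OF \<alpha> t])
  then show "ext_d \<alpha> x vs = 0"
    using PP_sum[OF pform_ext_d[OF \<alpha>], of x vs] by (simp add: sum_le2 d)
qed

lemma PP_00: "pform \<alpha> \<Longrightarrow> PP 0 0 \<alpha> x [] = \<alpha> x []"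
  using H.bidegree_part_polynomial[of 0 0 1 0 0 "\<alpha> x" x "[]"] by (simp add: PP_def pform_exterior)

lemma PP_01: "pform \<alpha> \<Longrightarrow> PP 0 1 \<alpha> x [v] = (\<alpha> x [v] + \<i> * \<alpha> x [JJ x v]) / 2"
proof -
  assume \<alpha>: "pform \<alpha>"
  have "1/2 + \<i>/2 * (\<i> * (of_nat r - of_nat s)) + 0 * (\<i> * (of_nat r - of_nat s))\<^sup>2 = (if r = 0 then 1 else 0)"
    if "r + s = 0 + 1" for r s :: nat
    using that by (cases r) auto
  from H.bidegree_part_polynomial[of 0 1 "1/2" "\<i>/2" 0 "\<alpha> x" x "[v]", OF _ _ this pform_exterior[OF \<alpha>]]
  show ?thesis by (simp add: PP_def add_divide_distrib)
qed

lemma d_adj_1_Nil: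
  assumes \<beta>: "pform \<beta>"
  shows "d_adj gg JJ \<beta> x [] = - (dd e0 (\<lambda>y. \<beta> y [e0]) x + dd e1 (\<lambda>y. \<beta> y [e1]) x
    + dd e2 (\<lambda>y. \<beta> y [e2]) x + dd e3 (\<lambda>y. \<beta> y [e3]) x)"
proof -
  have s: "pform (ext_d (star gg JJ \<beta>))" by (intro pform_ext_d pform_star \<beta>)
  have u: "dd v (\<lambda>y. - \<beta> y I) x = - dd v (\<lambda>y. \<beta> y I) x" for v I
    by (rule dd_uminus[OF pform_smooth[OF \<beta>]]) simp
  have "d_adj gg JJ \<beta> x [] = - ext_d (star gg JJ \<beta>) x [e0,e1,e2,e3]"
    by (simp add: d_adj_def star_form_table[OF s])
  then show ?thesis by (simp add: ext_d_alternation star_form_table[OF \<beta>] u)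
qed

text \<open>For a closed (1,1)-form with \<open>\<omega>\<close>-component \<open>f\<close>, the codifferential is \<open>2 J (df + f \<theta>)\<close> with the
  constant Lee form \<open>\<theta> = - dz\<close>. A second codifferential, applied to its \<open>(0,1)\<close>-part, gives the flat Laplacian
  of \<open>f\<close> with a drift along the Lee field.\<close>

lemma closed_11_double_adj:
  assumes \<alpha>: "pform \<alpha>" and t: "\<And>x. of_bidegree (JJ x) 1 1 (\<alpha> x)" and d: "ext_d \<alpha> = (\<lambda>x vs. 0)"
  shows "delbar_adj gg JJ (del_adj gg JJ \<alpha>) x [] = \<i> *
    (dd e0 (dd e0 (omega_coeff \<alpha>)) x + dd e1 (dd e1 (omega_coeff \<alpha>)) x + dd e2 (dd e2 (omega_coeff \<alpha>)) x
     + dd e3 (dd e3 (omega_coeff \<alpha>)) x - dd e3 (omega_coeff \<alpha>) x)"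
proof -
  let ?f = "omega_coeff \<alpha>" and ?u = "d_adj gg JJ \<alpha>"
  define f where "f = ?f"
  define a where "a = (\<lambda>I x. \<alpha> x I)"
  have sf: "smooth_periodic f" unfolding f_def by (rule sp_omega_coeff[OF \<alpha>])
  have sa: "smooth_periodic (a I)" for I unfolding a_def by (rule pform_sp[OF \<alpha>])
  have sdf: "smooth_periodic (dd v f)" for v by (intro sp_intros sf)
  have trig: "smooth_periodic cw" "smooth_periodic sw" by (rule sp_trig)+
  have two: "smooth_periodic (\<lambda>x. 2)" by (rule sp_const)
  note sm = sf sa sdf trig two sp_add sp_diff sp_mult sp_uminus sp_dd
  define B where "B = star gg JJ \<alpha>"
  have pB: "pform B" unfolding B_def by (rule pform_star[OF \<alpha>])
  note rel = type11_relations[where \<alpha> = \<alpha>, OF t, folded f_def]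
  have Bc: "(\<lambda>y. B y [e0,e1]) = (\<lambda>y. 2 * f y * cw y - a [e0,e1] y)"
    "(\<lambda>y. B y [e0,e2]) = (\<lambda>y. 2 * f y * sw y - a [e0,e2] y)"
    "(\<lambda>y. B y [e0,e3]) = (\<lambda>y. - a [e0,e3] y)" "(\<lambda>y. B y [e1,e2]) = (\<lambda>y. - a [e1,e2] y)"
    "(\<lambda>y. B y [e1,e3]) = (\<lambda>y. - (2 * f y * sw y) - a [e1,e3] y)"
    "(\<lambda>y. B y [e2,e3]) = (\<lambda>y. 2 * f y * cw y - a [e2,e3] y)"
    by (simp_all add: B_def star_form_table[OF \<alpha>] rel a_def)
  have cl: "dd e0 (a [e1,e2]) x - dd e1 (a [e0,e2]) x + dd e2 (a [e0,e1]) x = 0"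
    "dd e0 (a [e1,e3]) x - dd e1 (a [e0,e3]) x + dd e3 (a [e0,e1]) x = 0"
    "dd e0 (a [e2,e3]) x - dd e2 (a [e0,e3]) x + dd e3 (a [e0,e2]) x = 0"
    "dd e1 (a [e2,e3]) x - dd e2 (a [e1,e3]) x + dd e3 (a [e1,e2]) x = 0" for x
    using fun_cong[OF fun_cong[OF d, of x], of "[e0,e1,e2]"] fun_cong[OF fun_cong[OF d, of x], of "[e0,e1,e3]"]
      fun_cong[OF fun_cong[OF d, of x], of "[e0,e2,e3]"] fun_cong[OF fun_cong[OF d, of x], of "[e1,e2,e3]"]
    by (simp_all add: ext_d_alternation a_def)
  have dB: "ext_d B x [e0,e1,e2] = 2 * (cw x * dd e2 f x - sw x * dd e1 f x)"
    "ext_d B x [e0,e1,e3] = 2 * (cw x * dd e3 f x - sw x * dd e0 f x - cw x * f x)"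
    "ext_d B x [e0,e2,e3] = 2 * (cw x * dd e0 f x - sw x * f x + sw x * dd e3 f x)"
    "ext_d B x [e1,e2,e3] = 2 * (cw x * dd e1 f x + sw x * dd e2 f x)" for x
    using cl[of x]
    by (simp_all add: ext_d_alternation Bc spd sm eq_neg_iff_add_eq_0 eq_diff_eq diff_eq_eq algebra_simps)
  note pd = pform_ext_d[OF pB]
  have u: "?u x [e0] = 2 * (cw x * dd e1 f x + sw x * dd e2 f x)"
    "?u x [e1] = - 2 * (cw x * dd e0 f x - sw x * f x + sw x * dd e3 f x)"
    "?u x [e2] = 2 * (cw x * dd e3 f x - sw x * dd e0 f x - cw x * f x)"
    "?u x [e3] = - 2 * (cw x * dd e2 f x - sw x * dd e1 f x)" for x
    unfolding d_adj_def B_def[symmetric] by (simp_all add: star_form_table[OF pd] dB)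
  have pu: "pform ?u" by (rule pform_d_adj[OF \<alpha>])
  have lin: "?u x [JJ x v] = of_real (JJ x v \<bullet> e0) * ?u x [e0] + of_real (JJ x v \<bullet> e1) * ?u x [e1]
      + of_real (JJ x v \<bullet> e2) * ?u x [e2] + of_real (JJ x v \<bullet> e3) * ?u x [e3]" for x v
  proof -
    note l = exterior_linear_hd[OF pform_exterior[OF pu, of x], of "[]"]
    show ?thesis
      by (subst E.frame_expand[of "JJ x v"])
        (simp only: linear_add[OF l] linear_scale[OF l] scaleR_conv_of_real[where 'a = complex])
  qed
  have one: "cw x * (cw x * z) + sw x * (sw x * z) = z" "sw x * (sw x * z) + cw x * (cw x * z) = z"
    "cw x * (cw x * z) + (sw x * (sw x * z) + y) = z + y" for x z y
    using cw_sw[of x] by (metis (no_types, lifting) add.assoc add.commute distrib_right mult.assoc mult_1)+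
  have uJ: "?u x [JJ x e0] = - 2 * ((cw x * cw x + sw x * sw x) * dd e0 f x)"
    "?u x [JJ x e1] = - 2 * ((cw x * cw x + sw x * sw x) * dd e1 f x)"
    "?u x [JJ x e2] = - 2 * ((cw x * cw x + sw x * sw x) * dd e2 f x)"
    "?u x [JJ x e3] = - 2 * ((cw x * cw x + sw x * sw x) * (dd e3 f x - f x))" for x
    by (simp_all add: lin JJ_component u algebra_simps)
  have div: "dd e0 (\<lambda>y. ?u y [e0]) x + dd e1 (\<lambda>y. ?u y [e1]) x + dd e2 (\<lambda>y. ?u y [e2]) x + dd e3 (\<lambda>y. ?u y [e3]) x = 0"
    by (simp add: u spd sm dd_swap)
  define X where "X = PP 0 1 ?u"
  have pX: "pform X" unfolding X_def by (rule pform_PP[OF pu])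
  have su: "smooth_periodic (\<lambda>y. ?u y [v])" for v by (rule pform_sp[OF pu])
  have XJ: "(\<lambda>y. X y [e0]) = (\<lambda>y. 1/2 * ?u y [e0] + (- \<i>) * dd e0 f y)"
    "(\<lambda>y. X y [e1]) = (\<lambda>y. 1/2 * ?u y [e1] + (- \<i>) * dd e1 f y)"
    "(\<lambda>y. X y [e2]) = (\<lambda>y. 1/2 * ?u y [e2] + (- \<i>) * dd e2 f y)"
    "(\<lambda>y. X y [e3]) = (\<lambda>y. 1/2 * ?u y [e3] + (- \<i>) * (dd e3 f y - f y))"
    by (simp_all add: X_def PP_01[OF pu] uJ cw_sw del: One_nat_def)
      (simp_all add: fun_eq_iff field_simps)
  have "delbar_adj gg JJ (del_adj gg JJ \<alpha>) x [] = d_adj gg JJ X x []"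
    by (simp add: double_adj_11[OF \<alpha> t] X_def[symmetric] PP_00 pform_d_adj pX del: One_nat_def)
  also have "\<dots> = - (1/2 * (dd e0 (\<lambda>y. ?u y [e0]) x + dd e1 (\<lambda>y. ?u y [e1]) x + dd e2 (\<lambda>y. ?u y [e2]) x + dd e3 (\<lambda>y. ?u y [e3]) x)
     + (- \<i>) * (dd e0 (dd e0 f) x + dd e1 (dd e1 f) x + dd e2 (dd e2 f) x + dd e3 (dd e3 f) x - dd e3 f x))"
  proof -
    have dX: "dd v (\<lambda>y. 1/2 * ?u y [e] + (- \<i>) * g y) x = 1/2 * dd v (\<lambda>y. ?u y [e]) x + (- \<i>) * dd v g x"
      if "smooth_periodic g" for v e g
      unfolding spd(1)[OF sp_mult[OF sp_const su] sp_mult[OF sp_const that]]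
        spd(3)[OF sp_const su] spd(3)[OF sp_const that] by simp
    have d3: "dd e3 (\<lambda>y. dd e3 f y - f y) x = dd e3 (dd e3 f) x - dd e3 f x"
      by (rule spd(2)[OF sdf sf])
    show ?thesis
      unfolding d_adj_1_Nil[OF pX] XJ dX[OF sdf] dX[OF sp_diff[OF sdf sf]] d3 by (simp add: algebra_simps)
  qed
  also have "\<dots> = \<i> * (dd e0 (dd e0 f) x + dd e1 (dd e1 f) x + dd e2 (dd e2 f) x + dd e3 (dd e3 f) x - dd e3 f x)"
    unfolding div by simp
  finally show ?thesis unfolding f_def .
qed

section \<open>The kernels\<close>

text \<open>\<open>hform 1 0\<close> is \<open>2 dw \<and> f1 = \<omega> + \<gamma>\<close> with \<open>\<gamma>\<close> anti-self-dual, chosen such that the sum is closed although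
  \<open>\<omega>\<close> is not; \<open>hform 0 1\<close> is the parallel anti-self-dual form \<open>dw \<and> dz - dx \<and> dy\<close>.\<close>

definition hform :: "complex \<Rightarrow> complex \<Rightarrow> (complex^2) lform" where
  "hform \<kappa> \<mu> x vs =
     \<kappa> * wedge (cov (\<lambda>v. of_real (v \<bullet> e0))) (cov (\<lambda>v. 2 * of_real (v \<bullet> f1 x))) vs +
     \<mu> * (wedge (cov (\<lambda>v. of_real (v \<bullet> e0))) (cov (\<lambda>v. of_real (v \<bullet> e3))) vs -
          wedge (cov (\<lambda>v. of_real (v \<bullet> e1))) (cov (\<lambda>v. of_real (v \<bullet> e2))) vs)"

lemma linear_dual2: "linear (\<lambda>v. 2 * complex_of_real (v \<bullet> e))" "linear (\<lambda>v. complex_of_real (v \<bullet> e))"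
  by (simp_all add: linear_iff inner_add_left scaleR_conv_of_real algebra_simps)

lemma exterior_hform: "hform \<kappa> \<mu> x \<in> exterior"
  unfolding hform_def[abs_def]
  by (intro exterior_add exterior_scale exterior_diff exterior_wedge exterior_cov linear_dual2)

lemma has_degree_wedge_cov: "has_degree 2 (wedge (cov f) (cov g))"
  using has_degree_wedge_1[OF has_degree_cov(1) has_degree_cov(1), of f g] by (simp add: numeral_2_eq_2)

lemma has_degree_hform: "has_degree 2 (hform \<kappa> \<mu> x)"
  using has_degree_wedge_cov unfolding has_degree_def hform_def by (metis (no_types, lifting) add_0 diff_self mult_zero_right)

lemma hform_pair:
  "hform \<kappa> \<mu> x [u, v] = 2 * \<kappa> * of_real ((u \<bullet> e0) * (v \<bullet> f1 x) - (v \<bullet> e0) * (u \<bullet> f1 x)) +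
    \<mu> * of_real ((u \<bullet> e0) * (v \<bullet> e3) - (v \<bullet> e0) * (u \<bullet> e3) - ((u \<bullet> e1) * (v \<bullet> e2) - (v \<bullet> e1) * (u \<bullet> e2)))"
  by (simp add: hform_def algebra_simps)

lemma f_inner [simp]:
  "f1 x \<bullet> e1 = cos (x \<bullet> e0)" "f1 x \<bullet> e2 = sin (x \<bullet> e0)" "e1 \<bullet> f1 x = cos (x \<bullet> e0)" "e2 \<bullet> f1 x = sin (x \<bullet> e0)"
  "f2 x \<bullet> e1 = - sin (x \<bullet> e0)" "f2 x \<bullet> e2 = cos (x \<bullet> e0)" "e1 \<bullet> f2 x = - sin (x \<bullet> e0)" "e2 \<bullet> f2 x = cos (x \<bullet> e0)"
  by (simp_all add: f1_def f2_def inner_simps)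

lemma hform_E:
  "hform \<kappa> \<mu> x [e0,e1] = 2 * \<kappa> * cw x" "hform \<kappa> \<mu> x [e0,e2] = 2 * \<kappa> * sw x" "hform \<kappa> \<mu> x [e0,e3] = \<mu>"
  "hform \<kappa> \<mu> x [e1,e2] = - \<mu>" "hform \<kappa> \<mu> x [e1,e3] = 0" "hform \<kappa> \<mu> x [e2,e3] = 0"
  by (simp_all add: hform_pair)

lemma hform_other: "length vs \<noteq> 2 \<Longrightarrow> hform \<kappa> \<mu> x vs = 0"
  using has_degree_hform by (simp add: has_degree_def)

lemma pform_hform: "pform (hform \<kappa> \<mu>)"
  by (rule pform_frameI[OF exterior_hform])
    (auto simp: subframe_def hform_E hform_other intro!: sp_intros)

lemma dd_hform:
  "dd v (\<lambda>y. 2 * \<kappa> * cw y) x = 2 * \<kappa> * dd v cw x" "dd v (\<lambda>y. 2 * \<kappa> * sw y) x = 2 * \<kappa> * dd v sw x"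
  by (rule dd_cmult[OF smooth_on_trig(1)[OF open_UNIV]], simp, rule dd_cmult[OF smooth_on_trig(2)[OF open_UNIV]], simp)

lemma closed_hform: "ext_d (hform \<kappa> \<mu>) = (\<lambda>x vs. 0)"
proof (rule ext, rule E.exterior_eqI)
  fix x :: "complex^2" and vs assume vs: "vs \<in> EF"
  show "ext_d (hform \<kappa> \<mu>) x vs = 0"
  proof (cases "length vs = 3")
    case True
    then have "vs \<in> {[e1,e2,e3], [e0,e2,e3], [e0,e1,e3], [e0,e1,e2]}" using vs by (auto simp: subframe_def)
    then show ?thesis
      by (elim insertE emptyE) (simp_all add: ext_d_alternation hform_E dd_hform)
  next
    case False
    then show ?thesis
      using has_degree_ext_d[of 2 "hform \<kappa> \<mu>" x] has_degree_hform
      by (simp add: has_degree_def numeral_3_eq_3 numeral_2_eq_2)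
  qed
qed (simp_all add: pform_exterior[OF pform_ext_d[OF pform_hform]])

lemma type11_hform: "of_bidegree (JJ x) 1 1 (hform \<kappa> \<mu> x)"
proof -
  have "jder (JJ x) (hform \<kappa> \<mu> x) = (\<lambda>vs. 0)"
  proof (rule H.exterior_eqI[of _ _ x])
    fix vs assume vs: "vs \<in> subframe e0 (f1 x) (f2 x) e3"
    show "jder (JJ x) (hform \<kappa> \<mu> x) vs = 0"
    proof (cases "length vs = 2")
      case True
      have "vs \<in> {[e0, f1 x], [e0, f2 x], [e0, e3], [f1 x, f2 x], [f1 x, e3], [f2 x, e3]}"
        using vs True unfolding subframe_def by (elim insertE emptyE) simp_all
      then show ?thesis
        by (elim insertE emptyE)
          (simp_all only: H.jder_table[OF exterior_hform], simp_all add: hform_pair cs flip: of_real_mult of_real_add)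
    next
      case False
      then show ?thesis
        using has_degree_jder[OF has_degree_hform] by (simp add: has_degree_def)
    qed
  qed (simp_all add: exterior_jder[OF H.linJ] exterior_hform)
  then show ?thesis
    using has_degree_hform[of \<kappa> \<mu> x]
    by (simp add: H.of_bidegree_iff eigen_bidegree_def exterior_hform numeral_2_eq_2)
qed

lemma omega_coeff_hform: "omega_coeff (hform \<kappa> \<mu>) = (\<lambda>x. \<kappa>)"
proof
  fix x
  have "omega_coeff (hform \<kappa> \<mu>) x = \<kappa> * (cw x * cw x + sw x * sw x)"
    by (simp add: omega_coeff_def hform_E algebra_simps)
  then show "omega_coeff (hform \<kappa> \<mu>) x = \<kappa>" by (simp add: cw_sw)
qed

lemma star_zero_form: "star gg JJ (\<lambda>x vs. 0) = (\<lambda>x vs. 0)"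
  by (rule ext) (simp add: star_def H.star_zero)

lemma ops_zero:
  "del JJ (\<lambda>x vs. 0) = (\<lambda>x vs. 0)" "delbar JJ (\<lambda>x vs. 0) = (\<lambda>x vs. 0)"
  "del_adj gg JJ (\<lambda>x vs. 0) = (\<lambda>x vs. 0)" "delbar_adj gg JJ (\<lambda>x vs. 0) = (\<lambda>x vs. 0)"
proof -
  show d: "del JJ (\<lambda>x vs. 0) = (\<lambda>x vs. 0)" "delbar JJ (\<lambda>x vs. 0) = (\<lambda>x vs. 0)"
    by (intro ext, simp add: del_eq delbar_eq PP_zero ext_d_zero)+
  show "del_adj gg JJ (\<lambda>x vs. 0) = (\<lambda>x vs. 0)" "delbar_adj gg JJ (\<lambda>x vs. 0) = (\<lambda>x vs. 0)"
    unfolding del_adj_def delbar_adj_def star_zero_form d uminus_form by simp_all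
qed

lemma bott_chern_hform: "bott_chern_laplacian gg JJ (hform \<kappa> \<mu>) = (\<lambda>x vs. 0)"
proof -
  let ?Y = "d_adj gg JJ (PP 0 1 (d_adj gg JJ (hform \<kappa> \<mu>)))"
  have p: "pform ?Y" by (intro pform_d_adj pform_PP pform_hform)
  have d: "del JJ (hform \<kappa> \<mu>) = (\<lambda>x vs. 0)" "delbar JJ (hform \<kappa> \<mu>) = (\<lambda>x vs. 0)"
    by (simp_all only: del_11[OF pform_hform type11_hform] delbar_11[OF pform_hform type11_hform]
        closed_hform PP_zero)
  have "delbar_adj gg JJ (del_adj gg JJ (hform \<kappa> \<mu>)) x vs = 0" for x vs
  proof (cases "vs = []")
    case True
    have c: "dd v (\<lambda>x. \<kappa>) = (\<lambda>x. 0)" for v :: "complex^2" by (rule ext) simp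
    show ?thesis
      unfolding True closed_11_double_adj[OF pform_hform type11_hform closed_hform] omega_coeff_hform
      by (simp add: c)
  next
    case False
    have "of_bidegree (JJ x) 0 0 (PP 0 0 ?Y x)"
      unfolding PP_def[of 0 0] by (rule H.of_bidegree_part[OF pform_exterior[OF p]])
    then show ?thesis
      using False of_bidegree_eigen[of "JJ x" 0 0 "PP 0 0 ?Y x"]
      by (simp add: double_adj_11[OF pform_hform type11_hform] eigen_bidegree_def has_degree_def del: One_nat_def)
  qed
  then have t: "delbar_adj gg JJ (del_adj gg JJ (hform \<kappa> \<mu>)) = (\<lambda>x vs. 0)" by (intro ext)
  show ?thesis by (intro ext) (simp add: bott_chern_laplacian_def d t ops_zero)
qed

lemma star_asd: "star gg JJ (hform 0 \<mu>) = (\<lambda>x vs. - hform 0 \<mu> x vs)"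
proof (rule ext, rule E.exterior_eqI)
  fix x :: "complex^2" and vs assume "vs \<in> EF"
  then show "star gg JJ (hform 0 \<mu>) x vs = - hform 0 \<mu> x vs"
    by (auto simp: subframe_def star_form_table[OF pform_hform] hform_E hform_other)
qed (auto simp: pform_exterior[OF pform_star[OF pform_hform]] exterior_uminus exterior_hform)

lemma hodge_asd: "hodge_laplacian gg JJ (hform 0 \<mu>) = (\<lambda>x vs. 0)"
proof -
  have "star gg JJ (hform 0 \<mu>) = hform 0 (- \<mu>)"
    unfolding star_asd by (simp add: hform_def fun_eq_iff)
  then have "d_adj gg JJ (hform 0 \<mu>) = (\<lambda>x vs. 0)"
    by (simp add: d_adj_def closed_hform star_zero_form uminus_form)
  then show ?thesis by (intro ext) (simp add: hodge_laplacian_def closed_hform ext_d_zero d_adj_zero)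
qed

text \<open>The generator of the bielliptic involution: a half period in the first factor, the inversion in
  the second. Its square is the translation by a full period.\<close>

definition deck :: "complex^2 \<Rightarrow> complex^2" where
  "deck x = (\<chi> i. if i = 1 then x $ 1 + of_real pi else - x $ 2)"

definition flip :: "complex^2 \<Rightarrow> complex^2" where
  "flip v = (\<chi> i. if i = 1 then v $ 1 else - v $ 2)"

lemma deck_flip: "deck x = flip x + pi *\<^sub>R e0"
  by (simp add: deck_def flip_def vec_eq_iff forall_2 e_component scaleR_conv_of_real[where 'a = complex])

lemma flip_inner [simp]:
  "flip v \<bullet> e0 = v \<bullet> e0" "flip v \<bullet> e1 = - (v \<bullet> e1)" "flip v \<bullet> e2 = - (v \<bullet> e2)" "flip v \<bullet> e3 = v \<bullet> e3"
  by (simp_all add: inner_e flip_def)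

lemma flip_e: "flip e0 = e0" "flip e1 = - e1" "flip e2 = - e2" "flip e3 = e3"
  by (simp_all add: flip_def vec_eq_iff forall_2 e_component)

lemma deck_inner: "deck x \<bullet> e0 = x \<bullet> e0 + pi"
  by (simp add: deck_flip inner_add_left)

lemma f1_deck: "f1 (deck x) = - f1 x" and f2_deck: "f2 (deck x) = - f2 x"
  by (simp_all add: f1_def f2_def deck_inner)

definition deck_invariant :: "(complex^2) lform \<Rightarrow> bool" where
  "deck_invariant \<alpha> \<longleftrightarrow> (\<forall>x vs. \<alpha> x vs = \<alpha> (deck x) (map flip vs))"

lemma wedge_map: "wedge \<alpha> \<beta> (map h vs) = wedge (\<lambda>us. \<alpha> (map h us)) (\<lambda>us. \<beta> (map h us)) vs"
  by (simp add: wedge_def nths_map)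

lemma cov_map: "(\<lambda>us. cov f (map h us)) = cov (\<lambda>v. f (h v))"
  by (auto simp: cov_def fun_eq_iff length_Suc_conv)

lemma cov_uminus: "cov (\<lambda>v. - f v) = (\<lambda>us. - cov f us)"
  by (auto simp: cov_def)

lemma flip_f1: "flip v \<bullet> f1 (deck x) = v \<bullet> f1 x"
  unfolding f1_deck by (simp add: f1_def inner_simps)

lemma deck_invariant_hform: "deck_invariant (hform \<kappa> \<mu>)"
  unfolding deck_invariant_def hform_def wedge_map cov_map
  by (simp add: flip_f1 cov_uminus wedge_uminus_left wedge_uminus_right)

text \<open>The deck transformation changes the sign of \<open>e1\<close> and \<open>e2\<close>, hence of the constants along
  \<open>dw \<and> dx\<close> and \<open>dw \<and> dy\<close>. This leaves one anti-self-dual class of the three on the torus.\<close>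

lemma invariant_constant_zero:
  assumes \<alpha>: "\<And>x. \<alpha> x \<in> exterior" and inv: "deck_invariant \<alpha>" and c: "\<And>x y. \<alpha> x [e0, e] = \<alpha> y [e0, e]"
    and e: "flip e = - e"
  shows "\<alpha> x [e0, e] = 0"
proof -
  have "\<alpha> x [e0, e] = \<alpha> (deck x) (map flip [e0, e])"
    using inv unfolding deck_invariant_def by blast
  also have "\<dots> = \<alpha> (deck x) [e0, - e]" by (simp add: flip_e e)
  also have "\<dots> = - \<alpha> (deck x) [e0, e]"
    using linear_neg[OF exterior_linear[OF \<alpha>[of "deck x"], of "[e0]" "[]"]] by simp
  finally show ?thesis using c[of x "deck x"] by simp
qed

lemma form_eq_frame2:
  assumes "pform \<alpha>" "pform \<beta>" "\<And>x. has_degree 2 (\<alpha> x)" "\<And>x. has_degree 2 (\<beta> x)"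
    "\<And>x vs. vs \<in> {[e0,e1], [e0,e2], [e0,e3], [e1,e2], [e1,e3], [e2,e3]} \<Longrightarrow> \<alpha> x vs = \<beta> x vs"
  shows "\<alpha> = \<beta>"
proof (rule ext, rule E.exterior_eqI)
  fix x :: "complex^2" and vs assume vs: "vs \<in> EF"
  show "\<alpha> x vs = \<beta> x vs"
  proof (cases "length vs = 2")
    case True
    then have "vs \<in> {[e0,e1], [e0,e2], [e0,e3], [e1,e2], [e1,e3], [e2,e3]}"
      using vs unfolding subframe_def by (elim insertE emptyE) simp_all
    then show ?thesis by (rule assms(5))
  qed (use assms(3,4) in \<open>simp add: has_degree_def\<close>)
qed (simp_all add: pform_exterior assms(1,2))

theorem asd_harmonic_classification:
  assumes \<alpha>: "pform \<alpha>" and deg: "\<And>x. has_degree 2 (\<alpha> x)" and h: "hodge_laplacian gg JJ \<alpha> = (\<lambda>x vs. 0)"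
    and asd: "star gg JJ \<alpha> = (\<lambda>x vs. - \<alpha> x vs)" and inv: "deck_invariant \<alpha>"
  shows "\<alpha> = hform 0 (\<alpha> 0 [e0,e3])"
proof (rule form_eq_frame2[OF \<alpha> pform_hform deg has_degree_hform])
  have r: "\<alpha> x [e2,e3] = - \<alpha> x [e0,e1]" "\<alpha> x [e1,e3] = \<alpha> x [e0,e2]" "\<alpha> x [e1,e2] = - \<alpha> x [e0,e3]" for x
    using star_form_table[OF \<alpha>, of x] by (simp_all add: asd)
  note c = asd_closed_constant[OF \<alpha> hodge_kernel[OF \<alpha> h] r]
  have z: "\<alpha> x [e0,e1] = 0" "\<alpha> x [e0,e2] = 0" for x
    by (rule invariant_constant_zero[OF pform_exterior[OF \<alpha>] inv c(1)], simp add: flip_e)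
      (rule invariant_constant_zero[OF pform_exterior[OF \<alpha>] inv c(2)], simp add: flip_e)
  fix x vs assume "vs \<in> {[e0,e1], [e0,e2], [e0,e3], [e1,e2], [e1,e3], [e2,e3]}"
  then show "\<alpha> x vs = hform 0 (\<alpha> 0 [e0,e3]) x vs"
    using c(3)[of x 0] by (elim insertE emptyE) (simp_all add: hform_E z r)
qed

text \<open>The \<open>\<omega>\<close>-component is a constant \<open>\<kappa>\<close> by the drift equation. Subtracting \<open>hform \<kappa> 0\<close>, which has the same
  component, leaves a closed anti-self-dual form, hence a constant one.\<close>

theorem bott_chern_classification:
  assumes \<alpha>: "pform \<alpha>" and t: "\<And>x. of_bidegree (JJ x) 1 1 (\<alpha> x)"
    and h: "bott_chern_laplacian gg JJ \<alpha> = (\<lambda>x vs. 0)" and inv: "deck_invariant \<alpha>"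
  shows "\<exists>\<kappa> \<mu>. \<alpha> = hform \<kappa> \<mu>"
proof -
  note k = bott_chern_kernel[OF \<alpha> h]
  have d: "ext_d \<alpha> = (\<lambda>x vs. 0)" by (rule closed_11[OF \<alpha> t k(1,2)])
  let ?f = "omega_coeff \<alpha>"
  have "dd e0 (dd e0 ?f) x + dd e1 (dd e1 ?f) x + dd e2 (dd e2 ?f) x + dd e3 (dd e3 ?f) x = of_real 1 * dd e3 ?f x" for x
    using closed_11_double_adj[OF \<alpha> t d, of x] by (simp add: k(3))
  then have fc: "?f x = ?f y" for x y by (rule laplace_drift_constant[OF sp_omega_coeff[OF \<alpha>]])
  define \<kappa> where "\<kappa> = ?f 0"
  have f: "?f x = \<kappa>" for x unfolding \<kappa>_def by (rule fc)
  define \<gamma> where "\<gamma> = (\<lambda>x vs. \<alpha> x vs - hform \<kappa> 0 x vs)"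
  have \<gamma>: "pform \<gamma>" unfolding \<gamma>_def by (intro pform_diff \<alpha> pform_hform)
  have d\<gamma>: "ext_d \<gamma> = (\<lambda>x vs. 0)"
  proof (intro ext)
    fix x vs
    have "dd v (\<lambda>y. \<gamma> y ws) x = dd v (\<lambda>y. \<alpha> y ws) x - dd v (\<lambda>y. hform \<kappa> 0 y ws) x" for v ws
      unfolding \<gamma>_def by (rule spd(2)[OF pform_sp[OF \<alpha>] pform_sp[OF pform_hform]])
    then have "ext_d \<gamma> x vs = ext_d \<alpha> x vs - ext_d (hform \<kappa> 0) x vs"
      by (simp add: ext_d_alternation alternation_def sum_subtractf right_diff_distrib)
    then show "ext_d \<gamma> x vs = 0" by (simp add: d closed_hform)
  qed
  note rel = type11_relations[where \<alpha> = \<alpha>, OF t, unfolded f]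
  have r: "\<gamma> x [e2,e3] = - \<gamma> x [e0,e1]" "\<gamma> x [e1,e3] = \<gamma> x [e0,e2]" "\<gamma> x [e1,e2] = - \<gamma> x [e0,e3]" for x
    by (simp_all add: \<gamma>_def hform_E rel)
  note c = asd_closed_constant[OF \<gamma> d\<gamma> r]
  have inv\<gamma>: "deck_invariant \<gamma>"
    using inv deck_invariant_hform[of \<kappa> 0] unfolding deck_invariant_def \<gamma>_def by metis
  have z: "\<gamma> x [e0,e1] = 0" "\<gamma> x [e0,e2] = 0" for x
    by (rule invariant_constant_zero[OF pform_exterior[OF \<gamma>] inv\<gamma> c(1)], simp add: flip_e)
      (rule invariant_constant_zero[OF pform_exterior[OF \<gamma>] inv\<gamma> c(2)], simp add: flip_e)
  have deg: "has_degree 2 (\<alpha> x)" for x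
    using of_bidegree_eigen[OF t[of x]] by (simp add: eigen_bidegree_def numeral_2_eq_2)
  have "\<alpha> = hform \<kappa> (\<gamma> 0 [e0,e3])"
  proof (rule form_eq_frame2[OF \<alpha> pform_hform deg has_degree_hform])
    have a: "\<alpha> x vs = \<gamma> x vs + hform \<kappa> 0 x vs" for x vs by (simp add: \<gamma>_def)
    fix x vs assume "vs \<in> {[e0,e1], [e0,e2], [e0,e3], [e1,e2], [e1,e3], [e2,e3]}"
    then show "\<alpha> x vs = hform \<kappa> (\<gamma> 0 [e0,e3]) x vs"
      using c(3)[of x 0] by (elim insertE emptyE) (simp_all only: a r z, simp_all add: hform_E)
  qed
  then show ?thesis by blast
qed

section \<open>Quotients by discrete groups of isometries\<close>

definition quotient_topology :: "('e::euclidean_space \<Rightarrow> 'a) \<Rightarrow> 'a topology" where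
  "quotient_topology q = topology (\<lambda>W. W \<subseteq> range q \<and> open {x. q x \<in> W})"

definition quotient_atlas :: "('e::euclidean_space \<Rightarrow> 'a) \<Rightarrow> ('a, 'e) chart set" where
  "quotient_atlas q = {(U, q) |U. open U \<and> inj_on q U}"

lemma torus_quotient:
  "torus_topology L = quotient_topology (lattice_coset L)"
  "torus_atlas L = quotient_atlas (lattice_coset L)"
  by (simp_all add: torus_topology_def quotient_topology_def torus_atlas_def quotient_atlas_def)

lemma openin_quotient_topology:
  "openin (quotient_topology q) W \<longleftrightarrow> W \<subseteq> range q \<and> open {x. q x \<in> W}"
proof -
  let ?P = "\<lambda>W. W \<subseteq> range q \<and> open {x. q x \<in> W}"
  have "istopology ?P"
    unfolding istopology_def
  proof (intro conjI allI impI)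
    fix S T assume S: "?P S" and T: "?P T"
    then show "S \<inter> T \<subseteq> range q" by blast
    have "open ({x. q x \<in> S} \<inter> {x. q x \<in> T})" using S T by blast
    then show "open {x. q x \<in> S \<inter> T}" by (simp add: Int_def)
  next
    fix K assume K: "\<forall>S\<in>K. ?P S"
    then show "\<Union>K \<subseteq> range q" by blast
    have "open (\<Union>S\<in>K. {x. q x \<in> S})" using K by blast
    moreover have "(\<Union>S\<in>K. {x. q x \<in> S}) = {x. q x \<in> \<Union>K}" by blast
    ultimately show "open {x. q x \<in> \<Union>K}" by simp
  qed
  then show ?thesis by (simp add: quotient_topology_def topology_inverse')
qed

lemma topspace_quotient_topology: "topspace (quotient_topology q) = range q"
proof -
  have "openin (quotient_topology q) (range q)" by (simp add: openin_quotient_topology)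
  then show ?thesis by (metis openin_subset openin_topspace openin_quotient_topology subset_antisym)
qed

definition linear_part :: "('e::real_vector \<Rightarrow> 'e) \<Rightarrow> 'e \<Rightarrow> 'e" where
  "linear_part \<gamma> v = \<gamma> v - \<gamma> 0"

text \<open>The uniform displacement bound in \<open>discrete\<close> makes the action properly discontinuous and, with the
  isometry property, the quotient Hausdorff. Tori and the surface below are both instances.\<close>

locale isometry_quotient =
  fixes q :: "'e::euclidean_space \<Rightarrow> 'a" and S :: "('e \<Rightarrow> 'e) set"
  assumes q_eq: "q x = q y \<longleftrightarrow> (\<exists>\<gamma>\<in>S. y = \<gamma> x)"
    and iso: "\<gamma> \<in> S \<Longrightarrow> dist (\<gamma> x) (\<gamma> y) = dist x y"
    and lin: "\<gamma> \<in> S \<Longrightarrow> bounded_linear (linear_part \<gamma>)"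
    and discrete: "\<exists>r>0. \<forall>\<gamma>\<in>S. \<forall>x. dist (\<gamma> x) x < r \<longrightarrow> \<gamma> x = x"
begin

lemma S_derivative: "\<gamma> \<in> S \<Longrightarrow> (\<gamma> has_derivative linear_part \<gamma>) (at x within T)"
proof -
  assume "\<gamma> \<in> S"
  then have "((\<lambda>x. linear_part \<gamma> x + \<gamma> 0) has_derivative linear_part \<gamma>) (at x within T)"
    by (intro has_derivative_add_const bounded_linear_imp_has_derivative lin)
  then show ?thesis by (simp add: linear_part_def)
qed

lemma S_continuous: "\<gamma> \<in> S \<Longrightarrow> continuous_on T \<gamma>"
  by (meson S_derivative has_derivative_continuous_on)

lemma open_saturation: "open U \<Longrightarrow> open {x. q x \<in> q ` U}"
proof -
  assume "open U"
  have "{x. q x \<in> q ` U} = (\<Union>\<gamma>\<in>S. \<gamma> -` U)" using q_eq by (auto simp: image_iff)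
  then show ?thesis using \<open>open U\<close> S_continuous[of _ UNIV] by (auto intro!: open_vimage)
qed

lemma open_q: "open U \<Longrightarrow> openin (quotient_topology q) (q ` U)"
  by (simp add: openin_quotient_topology open_saturation image_mono)

lemma open_map_q: "open_map euclidean (quotient_topology q) q"
  by (simp add: open_map_def open_q)

lemma continuous_map_q: "continuous_map euclidean (quotient_topology q) q"
  by (auto simp: continuous_map_def topspace_quotient_topology openin_quotient_topology)

lemma injectivity_radius: "\<exists>r>0. \<forall>x. inj_on q (ball x r)"
proof -
  obtain r where r: "r > 0" "\<forall>\<gamma>\<in>S. \<forall>x. dist (\<gamma> x) x < r \<longrightarrow> \<gamma> x = x" using discrete by auto
  have "inj_on q (ball x (r / 2))" for x
  proof (rule inj_onI)
    fix y z assume yz: "y \<in> ball x (r / 2)" "z \<in> ball x (r / 2)" "q y = q z"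
    then obtain \<gamma> where "\<gamma> \<in> S" "z = \<gamma> y" using q_eq by auto
    moreover have "dist z y < r" using yz dist_triangle_half_r[of x z r y] by (simp add: dist_commute)
    ultimately show "y = z" using r by metis
  qed
  then show ?thesis using r by (intro exI[of _ "r / 2"]) auto
qed

lemma chart_around: "\<exists>U. (U, q) \<in> quotient_atlas q \<and> x \<in> U"
proof -
  obtain r where "r > 0" "inj_on q (ball x r)" using injectivity_radius by auto
  then show ?thesis by (intro exI[of _ "ball x r"]) (auto simp: quotient_atlas_def)
qed

lemma topological_atlas_quotient: "topological_atlas (quotient_topology q) (quotient_atlas q)"
  unfolding topological_atlas_def
proof (intro conjI ballI)
  show "(\<Union>c\<in>quotient_atlas q. snd c ` fst c) = topspace (quotient_topology q)"
  proof
    show "topspace (quotient_topology q) \<subseteq> (\<Union>c\<in>quotient_atlas q. snd c ` fst c)"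
    proof
      fix p assume "p \<in> topspace (quotient_topology q)"
      then obtain x where "p = q x" by (auto simp: topspace_quotient_topology)
      moreover obtain U where "(U, q) \<in> quotient_atlas q" "x \<in> U" using chart_around by blast
      ultimately show "p \<in> (\<Union>c\<in>quotient_atlas q. snd c ` fst c)" by force
    qed
  qed (auto simp: quotient_atlas_def topspace_quotient_topology)
  fix c assume "c \<in> quotient_atlas q"
  then obtain U where c: "c = (U, q)" "open U" "inj_on q U" by (auto simp: quotient_atlas_def)
  show "open (fst c)" "openin (quotient_topology q) (snd c ` fst c)" using c open_q by auto
  have "homeomorphic_map (top_of_set U) (subtopology (quotient_topology q) (q ` U)) q"
  proof (rule bijective_open_imp_homeomorphic_map)
    show "continuous_map (top_of_set U) (subtopology (quotient_topology q) (q ` U)) q"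
      by (auto simp: continuous_map_in_subtopology intro: continuous_map_from_subtopology continuous_map_q)
    have "openin (subtopology (quotient_topology q) (q ` U)) (q ` V)" if "open V" "V \<subseteq> U" for V
      using open_q[OF that(1)] that(2) by (auto simp: openin_subtopology intro!: exI[of _ "q ` V"])
    then show "open_map (top_of_set U) (subtopology (quotient_topology q) (q ` U)) q"
      using c(2) by (auto simp: open_map_def openin_open_eq)
  qed (use c open_q[OF c(2)] openin_subset[OF open_q[OF c(2)]] in \<open>auto\<close>)
  then show "homeomorphic_map (top_of_set (fst c)) (subtopology (quotient_topology q) (snd c ` fst c)) (snd c)"
    using c by simp
qed

lemma second_countable_quotient: "second_countable (quotient_topology q)"
proof (rule second_countable_open_map_image[OF continuous_map_q open_map_q])
  show "q ` topspace euclidean = topspace (quotient_topology q)" by (simp add: topspace_quotient_topology)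
  obtain B :: "'e set set" where B: "countable B" "\<And>C. C \<in> B \<Longrightarrow> open C" "\<And>S. open S \<Longrightarrow> \<exists>U. U \<subseteq> B \<and> S = \<Union>U"
    using univ_second_countable by blast
  show "second_countable (euclidean :: 'e topology)"
    unfolding second_countable_def
  proof (intro exI[of _ B] conjI allI impI ballI)
    fix U and x :: 'e assume "openin euclidean U \<and> x \<in> U"
    then obtain K where "K \<subseteq> B" "U = \<Union>K" "x \<in> U" using B(3)[of U] by auto
    then show "\<exists>V\<in>B. x \<in> V \<and> V \<subseteq> U" by auto
  qed (use B in auto)
qed

lemma Hausdorff_quotient: "Hausdorff_space (quotient_topology q)"
  unfolding Hausdorff_space_def
proof (intro allI impI)
  fix p p' assume "p \<in> topspace (quotient_topology q) \<and> p' \<in> topspace (quotient_topology q) \<and> p \<noteq> p'"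
  then obtain x y where xy: "p = q x" "p' = q y" "q x \<noteq> q y" by (auto simp: topspace_quotient_topology)
  let ?O = "{z. q z = q y}"
  obtain r where r: "r > 0" "\<forall>\<gamma>\<in>S. \<forall>x. dist (\<gamma> x) x < r \<longrightarrow> \<gamma> x = x" using discrete by auto
  have "closed ?O"
  proof (rule discrete_imp_closed[OF r(1)], intro ballI impI)
    fix u v assume uv: "u \<in> ?O" "v \<in> ?O" and d: "dist v u < r"
    from uv have "q u = q v" by simp
    then obtain \<gamma> where g: "\<gamma> \<in> S" "v = \<gamma> u" using q_eq by auto
    then show "v = u" using r(2) d by auto
  qed
  then have "open (- ?O)" by (rule open_Compl)
  then obtain e where e0: "e > 0" "ball x e \<subseteq> - ?O"
    by (rule openE[where x = x]) (use xy(3) in auto)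
  then have e: "e > 0" "ball x e \<inter> ?O = {}" by auto
  have "q ` ball x (e/2) \<inter> q ` ball y (e/2) = {}"
  proof (rule ccontr)
    assume "q ` ball x (e/2) \<inter> q ` ball y (e/2) \<noteq> {}"
    then obtain u v where uv: "u \<in> ball x (e/2)" "v \<in> ball y (e/2)" "q v = q u" by (force simp: set_eq_iff)
    then obtain \<gamma> where g: "\<gamma> \<in> S" "u = \<gamma> v" using q_eq by blast
    have "dist (\<gamma> y) u < e / 2" using uv(2) iso[OF g(1), of y v] g(2) by simp
    then have "dist x (\<gamma> y) < e" using uv(1) dist_triangle_half_r[of u x e "\<gamma> y"] by (simp add: dist_commute)
    moreover have "q (\<gamma> y) = q y" using q_eq[of y "\<gamma> y"] g(1) by auto
    ultimately show False using e(2) by auto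
  qed
  then show "\<exists>U V. openin (quotient_topology q) U \<and> openin (quotient_topology q) V \<and> p \<in> U \<and> p' \<in> V \<and> disjnt U V"
    using xy e(1) by (intro exI[of _ "q ` ball x (e/2)"] exI[of _ "q ` ball y (e/2)"]) (auto simp: disjnt_def open_q)
qed

text \<open>Near a point, a chart of the quotient selects one element of the group, by injectivity of the
  chart and continuity of the lift. All regularity and differentials of maps between quotients are read off
  from their lifts in this way.\<close>

lemma local_rep_lift:
  assumes F: "\<And>x. F (q' x) = q (G x)" and G: "continuous_on UNIV G"
    and c: "c \<in> quotient_atlas q'" and d: "d \<in> quotient_atlas q" and x: "x \<in> local_dom c d F"
  shows "\<exists>\<gamma>\<in>S. \<exists>N. open N \<and> x \<in> N \<and> N \<subseteq> local_dom c d F \<and> (\<forall>y\<in>N. local_rep c d F y = \<gamma> (G y))"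
proof -
  obtain U V where c': "c = (U, q')" "open U" and d': "d = (V, q)" "open V" "inj_on q V"
    using c d by (auto simp: quotient_atlas_def)
  have xU: "x \<in> U" "q (G x) \<in> q ` V" using x by (auto simp: local_dom_def c' d' F)
  then obtain v where v: "v \<in> V" "q (G x) = q v" by auto
  then obtain \<gamma> where g: "\<gamma> \<in> S" "v = \<gamma> (G x)" using q_eq by blast
  let ?N = "U \<inter> (\<lambda>y. \<gamma> (G y)) -` V"
  have cont: "continuous_on UNIV (\<lambda>y. \<gamma> (G y))"
    by (rule continuous_on_compose2[OF S_continuous[OF g(1), of UNIV] G]) simp
  have "open ?N" using c'(2) open_vimage[OF d'(2) cont] by auto
  moreover have "x \<in> ?N" using xU v g by simp
  moreover have qg: "q (\<gamma> z) = q z" for z using q_eq[of z "\<gamma> z"] g(1) by auto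
  moreover have "y \<in> local_dom c d F" if "y \<in> ?N" for y
  proof -
    have "q (G y) = q (\<gamma> (G y))" by (simp add: qg)
    then show ?thesis using that by (auto simp: local_dom_def c' d' F)
  qed
  moreover have "local_rep c d F y = \<gamma> (G y)" if "y \<in> ?N" for y
  proof -
    have "local_rep c d F y = inv_into V q (q (\<gamma> (G y)))" by (simp add: local_rep_def c' d' F qg)
    then show ?thesis using that d'(3) by simp
  qed
  ultimately show ?thesis using g(1) by blast
qed

lemma local_rep_lift_derivative:
  assumes F: "\<And>x. F (q' x) = q (G x)" and G: "\<And>x. (G has_derivative G' x) (at x)"
    and c: "c \<in> quotient_atlas q'" and d: "d \<in> quotient_atlas q" and x: "x \<in> local_dom c d F"
  shows "\<exists>\<gamma>\<in>S. (local_rep c d F has_derivative (\<lambda>v. linear_part \<gamma> (G' x v))) (at x)"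
proof -
  have "continuous_on UNIV G" using G by (auto intro!: continuous_at_imp_continuous_on has_derivative_continuous)
  from local_rep_lift[OF F this c d x]
  obtain \<gamma> N where g: "\<gamma> \<in> S" and N: "open N" "x \<in> N" "\<And>y. y \<in> N \<Longrightarrow> local_rep c d F y = \<gamma> (G y)" by blast
  have "((\<lambda>y. \<gamma> (G y)) has_derivative (\<lambda>v. linear_part \<gamma> (G' x v))) (at x)"
    by (rule has_derivative_compose[OF G S_derivative[OF g]])
  then have "(local_rep c d F has_derivative (\<lambda>v. linear_part \<gamma> (G' x v))) (at x)"
    by (rule has_derivative_transform_within_open[OF _ N(1,2)]) (use N(3) in auto)
  then show ?thesis using g by blast
qed

lemma differential_everywhere_lift:
  assumes F: "\<And>x. F (q' x) = q (G x)" and G: "\<And>x. (G has_derivative G' x) (at x)"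
    and P: "\<And>x \<gamma>. \<gamma> \<in> S \<Longrightarrow> P (\<lambda>v. linear_part \<gamma> (G' x v))"
  shows "differential_everywhere P (quotient_atlas q') (quotient_atlas q) F"
  unfolding differential_everywhere_def
proof (intro ballI)
  fix c d x assume "c \<in> quotient_atlas q'" "d \<in> quotient_atlas q" "x \<in> local_dom c d F"
  from local_rep_lift_derivative[OF F G this] obtain \<gamma> where
    "\<gamma> \<in> S" "(local_rep c d F has_derivative (\<lambda>v. linear_part \<gamma> (G' x v))) (at x)" by blast
  then show "P (frechet_derivative (local_rep c d F) (at x))"
    using P frechet_derivative_at by metis
qed

lemma continuous_map_lift:
  assumes F: "\<And>x. F (q' x) = q (G x)" and G: "continuous_on UNIV G"
  shows "continuous_map (quotient_topology q') (quotient_topology q) F"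
  unfolding continuous_map_def
proof (intro conjI allI impI)
  show "F \<in> topspace (quotient_topology q') \<rightarrow> topspace (quotient_topology q)"
    by (auto simp: topspace_quotient_topology F)
  fix W assume "openin (quotient_topology q) W"
  then have "open (G -` {y. q y \<in> W})" by (intro open_vimage[OF _ G]) (simp add: openin_quotient_topology)
  moreover have "G -` {y. q y \<in> W} = {x. q' x \<in> {p \<in> range q'. F p \<in> W}}" by (auto simp: F)
  ultimately show "openin (quotient_topology q') {p \<in> topspace (quotient_topology q'). F p \<in> W}"
    by (auto simp: openin_quotient_topology topspace_quotient_topology)
qed

lemma transition_smooth:
  assumes c: "c \<in> quotient_atlas q" and d: "d \<in> quotient_atlas q"
  shows "smooth_on (local_dom c d (\<lambda>p. p)) (local_rep c d (\<lambda>p. p))"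
proof -
  let ?D = "local_dom c d (\<lambda>p. p)"
  have N: "\<exists>\<gamma>\<in>S. \<exists>N. open N \<and> x \<in> N \<and> N \<subseteq> ?D \<and> (\<forall>y\<in>N. local_rep c d (\<lambda>p. p) y = \<gamma> y)" if "x \<in> ?D" for x
    using local_rep_lift[of "\<lambda>p. p" q "\<lambda>x. x", OF refl continuous_on_id c d that] by simp
  have "open ?D" using N by (subst open_subopen) blast
  then show ?thesis
  proof (rule smooth_on_local)
    fix x assume "x \<in> ?D"
    then obtain \<gamma> N where g: "\<gamma> \<in> S" and N: "open N" "x \<in> N" "\<forall>y\<in>N. local_rep c d (\<lambda>p. p) y = \<gamma> y" using N by blast
    have "smooth_on N (\<lambda>y. linear_part \<gamma> y + \<gamma> 0)" by (rule smooth_on_affine[OF N(1) lin[OF g]])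
    then have "smooth_on N (local_rep c d (\<lambda>p. p))"
      by (rule smooth_on_cong[OF N(1), rotated]) (use N(3) in \<open>simp add: linear_part_def\<close>)
    then show "\<exists>U. open U \<and> x \<in> U \<and> smooth_on U (local_rep c d (\<lambda>p. p))" using N by blast
  qed
qed

lemma smooth_manifold_quotient: "smooth_manifold (quotient_topology q) (quotient_atlas q)"
  by (simp add: smooth_manifold_def Hausdorff_quotient second_countable_quotient topological_atlas_quotient transition_smooth)

end

lemma holomorphic_map_lift:
  fixes q :: "complex^'n \<Rightarrow> 'a" and q' :: "complex^'m \<Rightarrow> 'b"
  assumes "isometry_quotient q S"
    and F: "\<And>x. F (q' x) = q (G x)" and G: "\<And>x. (G has_derivative G' x) (at x)"
    and G': "\<And>x z v. G' x (z *s v) = z *s G' x v"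
    and S: "\<And>\<gamma> z v. \<gamma> \<in> S \<Longrightarrow> linear_part \<gamma> (z *s v) = z *s linear_part \<gamma> v"
  shows "holomorphic_map (quotient_topology q') (quotient_atlas q') (quotient_topology q) (quotient_atlas q) F"
  unfolding holomorphic_map_def cholomorphic_on_def
proof (intro conjI ballI)
  interpret isometry_quotient q S by fact
  show "continuous_map (quotient_topology q') (quotient_topology q) F"
    by (rule continuous_map_lift[where F = F and G = G and q' = q', OF F]) (use G in \<open>auto intro!: continuous_at_imp_continuous_on has_derivative_continuous\<close>)
  fix c d x assume "c \<in> quotient_atlas q'" "d \<in> quotient_atlas q" "x \<in> local_dom c d F"
  from local_rep_lift_derivative[OF F G this] obtain \<gamma> where
    g: "\<gamma> \<in> S" "(local_rep c d F has_derivative (\<lambda>v. linear_part \<gamma> (G' x v))) (at x)" by blast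
  then show "\<exists>f'. (local_rep c d F has_derivative f') (at x) \<and> (\<forall>z v. f' (z *s v) = z *s f' v)"
    using G' S by (intro exI[of _ "\<lambda>v. linear_part \<gamma> (G' x v)"]) auto
qed

lemma complex_manifold_quotient:
  fixes q :: "complex^'n \<Rightarrow> 'a"
  assumes "isometry_quotient q S"
    and S: "\<And>\<gamma> z v. \<gamma> \<in> S \<Longrightarrow> linear_part \<gamma> (z *s v) = z *s linear_part \<gamma> v"
  shows "complex_manifold (quotient_topology q) (quotient_atlas q)"
proof -
  interpret isometry_quotient q S by fact
  have "holomorphic_map (quotient_topology q) (quotient_atlas q) (quotient_topology q) (quotient_atlas q) (\<lambda>p. p)"
    by (rule holomorphic_map_lift[OF assms(1), of "\<lambda>p. p" q "\<lambda>x. x" "\<lambda>x v. v"]) (use S in auto)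
  then show ?thesis
    by (simp add: complex_manifold_def holomorphic_map_def Hausdorff_quotient second_countable_quotient topological_atlas_quotient)
qed

section \<open>Lattices\<close>

lemma full_lattice_group:
  assumes "full_lattice L"
  shows "0 \<in> L" "l \<in> L \<Longrightarrow> - l \<in> L" "l \<in> L \<Longrightarrow> m \<in> L \<Longrightarrow> l + m \<in> L"
proof -
  obtain B where L: "L = {(\<Sum>b\<in>B. of_int (k b) *\<^sub>R b) |k. (k :: 'a \<Rightarrow> int) \<in> UNIV}"
    using assms by (auto simp: full_lattice_def)
  show "0 \<in> L" unfolding L by (auto intro!: exI[of _ "\<lambda>_. 0"])
  show "- l \<in> L" if "l \<in> L"
  proof -
    obtain k :: "'a \<Rightarrow> int" where "l = (\<Sum>b\<in>B. of_int (k b) *\<^sub>R b)"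
      using \<open>l \<in> L\<close> unfolding L by auto
    then have "- l = (\<Sum>b\<in>B. of_int ((\<lambda>b. - k b) b) *\<^sub>R b)" by (simp add: sum_negf)
    then show ?thesis unfolding L mem_Collect_eq by (intro exI[of _ "\<lambda>b. - k b"]) simp
  qed
  show "l + m \<in> L" if lm: "l \<in> L" "m \<in> L"
  proof -
    obtain k k' :: "'a \<Rightarrow> int" where "l = (\<Sum>b\<in>B. of_int (k b) *\<^sub>R b)" "m = (\<Sum>b\<in>B. of_int (k' b) *\<^sub>R b)"
      using lm unfolding L by auto
    then have "l + m = (\<Sum>b\<in>B. of_int ((\<lambda>b. k b + k' b) b) *\<^sub>R b)" by (simp add: sum.distrib scaleR_add_left)
    then show ?thesis unfolding L mem_Collect_eq by (intro exI[of _ "\<lambda>b. k b + k' b"]) simp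
  qed
qed

text \<open>Coordinates in the basis are bounded linear functions, and integers of absolute value below one
  vanish.\<close>

lemma full_lattice_discrete:
  assumes "full_lattice L"
  shows "\<exists>r>0. \<forall>l\<in>L. norm l < r \<longrightarrow> l = 0"
proof -
  obtain B where B: "independent B" "span B = UNIV" and L: "L = {(\<Sum>b\<in>B. of_int (k b) *\<^sub>R b) |k. (k :: 'a \<Rightarrow> int) \<in> UNIV}"
    using assms by (auto simp: full_lattice_def)
  have fin: "finite B" using B(1) independent_imp_finite by blast
  have lin: "bounded_linear (\<lambda>v. representation B v b)" for b
    using B by (intro linear_conv_bounded_linear[THEN iffD1] linearI) (auto simp: representation_add representation_scale)
  have "\<exists>K>0. \<forall>v. \<bar>representation B v b\<bar> \<le> K * norm v" for b
    using bounded_linear.pos_bounded[OF lin[of b]] by (auto simp: mult.commute)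
  then obtain K where K: "\<And>b. K b > 0" "\<And>b v. \<bar>representation B v b\<bar> \<le> K b * norm v" by metis
  define M where "M = 1 + (\<Sum>b\<in>B. K b)"
  have M: "M > 0" "\<And>b. b \<in> B \<Longrightarrow> K b \<le> M"
    using member_le_sum[OF _ _ fin, of _ K] sum_nonneg[of B K] less_imp_le[OF K(1)] unfolding M_def
    by (auto intro: add_pos_nonneg add_increasing)
  show ?thesis
  proof (intro exI[of _ "1 / M"] conjI ballI impI)
    show "1 / M > 0" using M by simp
    fix l assume l: "l \<in> L" "norm l < 1 / M"
    then obtain k :: "'a \<Rightarrow> int" where k: "l = (\<Sum>b\<in>B. of_int (k b) *\<^sub>R b)" unfolding L by auto
    have "k b = 0" if b: "b \<in> B" for b
    proof -
      have "representation B l b = of_int (k b)"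
      proof -
        have "representation B l = (\<lambda>b. if b \<in> B then of_int (k b) else 0)"
        proof (rule representation_eqI[OF B(1)])
          have "{b. (if b \<in> B then real_of_int (k b) else 0) \<noteq> 0} \<subseteq> B" by auto
          then show "finite {b. (if b \<in> B then real_of_int (k b) else 0) \<noteq> 0}" using fin finite_subset by blast
          have "(\<Sum>b | (if b \<in> B then real_of_int (k b) else 0) \<noteq> 0. (if b \<in> B then real_of_int (k b) else 0) *\<^sub>R b) = l"
            unfolding k by (rule sum.mono_neutral_cong_left) (use fin in auto)
          then show "(\<Sum>b | (if b \<in> B then real_of_int (k b) else 0) \<noteq> 0. (if b \<in> B then real_of_int (k b) else 0) *\<^sub>R b) = l" .
        qed (use B in \<open>auto split: if_splits\<close>)
        then show ?thesis using b by simp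
      qed
      then have "\<bar>of_int (k b)\<bar> \<le> K b * norm l" using K(2)[of l b] by simp
      also have "\<dots> \<le> M * norm l" using M(2)[OF b] by (intro mult_right_mono) auto
      also have "\<dots> < 1" using l(2) M(1) by (simp add: field_simps)
      finally show ?thesis by linarith
    qed
    then show "l = 0" by (simp add: k)
  qed
qed

definition translation_group :: "'e::euclidean_space set \<Rightarrow> ('e \<Rightarrow> 'e) set" where
  "translation_group L = (\<lambda>l x. x + l) ` L"

lemma linear_part_translation: "\<gamma> \<in> translation_group L \<Longrightarrow> linear_part \<gamma> = (\<lambda>v. v)"
  by (auto simp: translation_group_def linear_part_def)

definition discrete_subgroup :: "'e::euclidean_space set \<Rightarrow> bool" where
  "discrete_subgroup L \<longleftrightarrow> 0 \<in> L \<and> (\<forall>l\<in>L. - l \<in> L) \<and> (\<forall>l\<in>L. \<forall>m\<in>L. l + m \<in> L) \<and>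
     (\<exists>r>0. \<forall>l\<in>L. norm l < r \<longrightarrow> l = 0)"

lemma full_lattice_discrete_subgroup: "full_lattice L \<Longrightarrow> discrete_subgroup L"
  using full_lattice_group full_lattice_discrete unfolding discrete_subgroup_def by blast

lemma lattice_coset_eq:
  assumes "discrete_subgroup L"
  shows "lattice_coset L x = lattice_coset L y \<longleftrightarrow> y - x \<in> L"
proof
  assume e: "lattice_coset L x = lattice_coset L y"
  have "y + 0 \<in> lattice_coset L y" unfolding lattice_coset_def using assms by (intro imageI) (simp add: discrete_subgroup_def)
  then have "y \<in> lattice_coset L x" using e by simp
  then show "y - x \<in> L" by (auto simp: lattice_coset_def)
next
  assume d: "y - x \<in> L"
  have sub: "lattice_coset L u \<subseteq> lattice_coset L v" if "u - v \<in> L" for u v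
  proof
    fix w assume "w \<in> lattice_coset L u"
    then obtain l where l: "l \<in> L" "w = u + l" by (auto simp: lattice_coset_def)
    then have "(u - v) + l \<in> L" using assms that unfolding discrete_subgroup_def by blast
    moreover have "w = v + ((u - v) + l)" using l by simp
    ultimately show "w \<in> lattice_coset L v" unfolding lattice_coset_def by blast
  qed
  have "x - y \<in> L" using d assms unfolding discrete_subgroup_def by (metis minus_diff_eq)
  then show "lattice_coset L x = lattice_coset L y" using sub d by blast
qed

lemma torus_isometry_quotient:
  assumes "discrete_subgroup L"
  shows "isometry_quotient (lattice_coset L) (translation_group L)"
proof (rule isometry_quotient.intro)
  fix x y :: 'a and \<gamma>
  show "lattice_coset L x = lattice_coset L y \<longleftrightarrow> (\<exists>\<gamma>\<in>translation_group L. y = \<gamma> x)"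
    unfolding lattice_coset_eq[OF assms] translation_group_def
    by (auto intro!: bexI[of _ "y - x"])
  assume g: "\<gamma> \<in> translation_group L"
  show "dist (\<gamma> x) (\<gamma> y) = dist x y" using g by (auto simp: translation_group_def)
  show "bounded_linear (linear_part \<gamma>)" by (simp add: linear_part_translation[OF g] bounded_linear_ident)
next
  obtain r where "r > 0" "\<forall>l\<in>L. norm l < r \<longrightarrow> l = 0" using assms unfolding discrete_subgroup_def by blast
  then show "\<exists>r>0. \<forall>\<gamma>\<in>translation_group L. \<forall>x. dist (\<gamma> x) x < r \<longrightarrow> \<gamma> x = x"
    by (intro exI[of _ r]) (auto simp: translation_group_def dist_norm)
qed

section \<open>The hyperelliptic surface\<close>

definition rect_lattice :: "real \<Rightarrow> real \<Rightarrow> (complex^1) set" where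
  "rect_lattice a b = {v. \<exists>m n :: int. Re (v $ 1) = of_int m * a \<and> Im (v $ 1) = of_int n * b}"

lemma vec1_eq_iff: "v = w \<longleftrightarrow> v $ 1 = w $ 1" for v w :: "'a^1"
  by (simp add: vec_eq_iff forall_1)

lemma full_lattice_rect:
  assumes "a > 0" "b > 0"
  shows "full_lattice (rect_lattice a b)"
proof -
  define u v :: "complex^1" where "u = vec (of_real a)" and "v = vec (\<i> * of_real b)"
  have uv: "u \<noteq> v" using assms by (simp add: u_def v_def vec1_eq_iff complex_eq_iff)
  have ex: "w = (Re (w $ 1) / a) *\<^sub>R u + (Im (w $ 1) / b) *\<^sub>R v" for w
    using assms by (simp add: u_def v_def vec1_eq_iff complex_eq_iff)
  have "w \<in> span {u, v}" for w
    by (subst ex[of w]) (intro span_add span_scale span_base; simp)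
  then have span: "span {u, v} = UNIV" by auto
  have "independent {u, v}"
    by (rule card_le_dim_spanning[of _ UNIV]) (use span uv in auto)
  moreover have "rect_lattice a b = {(\<Sum>b\<in>{u, v}. of_int (k b) *\<^sub>R b) |k. (k :: complex^1 \<Rightarrow> int) \<in> UNIV}"
  proof
    show "rect_lattice a b \<subseteq> {(\<Sum>b\<in>{u, v}. of_int (k b) *\<^sub>R b) |k. (k :: complex^1 \<Rightarrow> int) \<in> UNIV}"
    proof
      fix w assume "w \<in> rect_lattice a b"
      then obtain m n :: int where mn: "Re (w $ 1) = of_int m * a" "Im (w $ 1) = of_int n * b"
        by (auto simp: rect_lattice_def)
      then have "w = (\<Sum>b\<in>{u, v}. of_int ((\<lambda>x. if x = u then m else n) b) *\<^sub>R b)"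
        using uv assms by (subst ex[of w]) simp
      then show "w \<in> {(\<Sum>b\<in>{u, v}. of_int (k b) *\<^sub>R b) |k. (k :: complex^1 \<Rightarrow> int) \<in> UNIV}"
        unfolding mem_Collect_eq by (intro exI[of _ "\<lambda>x. if x = u then m else n"]) simp
    qed
    show "{(\<Sum>b\<in>{u, v}. of_int (k b) *\<^sub>R b) |k. (k :: complex^1 \<Rightarrow> int) \<in> UNIV} \<subseteq> rect_lattice a b"
      using uv by (auto simp: rect_lattice_def u_def v_def)
  qed
  ultimately show ?thesis unfolding full_lattice_def using span by blast
qed

abbreviation (input) L2pi :: "(complex^1) set" where "L2pi \<equiv> rect_lattice (2 * pi) (2 * pi)"

text \<open>The lattice of the covering torus: all four real coordinates are multiples of \<open>2 \<pi>\<close>.\<close>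

definition PL :: "(complex^2) set" where "PL = product_lattice L2pi L2pi"

definition period :: "real \<Rightarrow> bool" where "period t \<longleftrightarrow> (\<exists>n :: int. t = of_int n * (2 * pi))"

lemma period_0: "period 0" and period_add: "period s \<Longrightarrow> period t \<Longrightarrow> period (s + t)"
  and period_uminus: "period t \<Longrightarrow> period (- t)" and period_2pi: "period (2 * pi)"
proof -
  show "period 0" unfolding period_def by (intro exI[of _ 0]) simp
  show "period (2 * pi)" unfolding period_def by (intro exI[of _ 1]) simp
  show "period s \<Longrightarrow> period t \<Longrightarrow> period (s + t)" unfolding period_def by (metis distrib_right of_int_add)
  show "period t \<Longrightarrow> period (- t)" unfolding period_def by (metis mult_minus_left of_int_minus)
qed

lemma period_small: "period t \<Longrightarrow> \<bar>t\<bar> < 2 * pi \<Longrightarrow> t = 0"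
proof -
  assume "period t" "\<bar>t\<bar> < 2 * pi"
  then obtain n :: int where n: "t = of_int n * (2 * pi)" by (auto simp: period_def)
  then have "\<bar>of_int n\<bar> * (2 * pi) < 1 * (2 * pi)" using \<open>\<bar>t\<bar> < 2 * pi\<close> by (simp add: abs_mult)
  then have "\<bar>of_int n :: real\<bar> < 1" using pi_gt_zero by (simp add: mult_less_cancel_right)
  then show "t = 0" using n by auto
qed

lemma not_period_pi: "\<not> period (t + pi)" if "period t"
proof
  assume p: "period (t + pi)"
  have "period ((t + pi) + (- t))" by (rule period_add[OF p period_uminus[OF that]])
  then show False using period_small[of pi] pi_gt_zero by simp
qed

lemma in_PL: "v \<in> PL \<longleftrightarrow> period (v \<bullet> e0) \<and> period (v \<bullet> e1) \<and> period (v \<bullet> e2) \<and> period (v \<bullet> e3)"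
  by (auto simp: PL_def product_lattice_def rect_lattice_def period_def inner_e)

lemma norm_ge_component: "\<bar>v \<bullet> e0\<bar> \<le> norm v" "\<bar>v \<bullet> e1\<bar> \<le> norm v" "\<bar>v \<bullet> e2\<bar> \<le> norm v" "\<bar>v \<bullet> e3\<bar> \<le> norm v"
  by (intro Basis_le_norm e_Basis)+

lemma eq_0_iff_components: "v = 0 \<longleftrightarrow> v \<bullet> e0 = 0 \<and> v \<bullet> e1 = 0 \<and> v \<bullet> e2 = 0 \<and> v \<bullet> e3 = 0"
  by (auto simp: inner_e vec_eq_iff forall_2 complex_eq_iff)

lemma PL_discrete: "l \<in> PL \<Longrightarrow> norm l < 2 * pi \<Longrightarrow> l = 0"
  unfolding in_PL eq_0_iff_components using norm_ge_component[of l] period_small by (meson le_less_trans)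

lemma discrete_subgroup_PL: "discrete_subgroup PL"
  unfolding discrete_subgroup_def
proof (intro conjI ballI exI[of _ "2 * pi"] impI)
  show "0 \<in> PL" by (simp add: in_PL period_0)
  show "l \<in> PL \<Longrightarrow> - l \<in> PL" for l by (simp add: in_PL period_uminus)
  show "l \<in> PL \<Longrightarrow> m \<in> PL \<Longrightarrow> l + m \<in> PL" for l m by (simp add: in_PL period_add inner_add_left)
qed (use PL_discrete in auto)

lemma PL_intros: "0 \<in> PL" "l \<in> PL \<Longrightarrow> - l \<in> PL" "l \<in> PL \<Longrightarrow> m \<in> PL \<Longrightarrow> l + m \<in> PL"
  "l \<in> PL \<Longrightarrow> m \<in> PL \<Longrightarrow> l - m \<in> PL" "l \<in> PL \<Longrightarrow> flip l \<in> PL" "(2 * pi) *\<^sub>R e0 \<in> PL"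
proof -
  show z: "0 \<in> PL" "l \<in> PL \<Longrightarrow> - l \<in> PL" "l \<in> PL \<Longrightarrow> m \<in> PL \<Longrightarrow> l + m \<in> PL" for l m
    using discrete_subgroup_PL by (auto simp: discrete_subgroup_def)
  show "l \<in> PL \<Longrightarrow> m \<in> PL \<Longrightarrow> l - m \<in> PL" using z(3)[OF _ z(2), of l m] by simp
  show "l \<in> PL \<Longrightarrow> flip l \<in> PL" by (auto simp: in_PL intro: period_uminus)
  show "(2 * pi) *\<^sub>R e0 \<in> PL" using period_2pi period_0 by (auto simp: in_PL)
qed

lemma linear_flip: "linear flip"
  by (rule linearI) (simp_all add: flip_def vec_eq_iff forall_2)

lemma flip_flip: "flip (flip v) = v"
  by (simp add: flip_def vec_eq_iff forall_2)

lemma norm_flip: "norm (flip v) = norm v"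
proof -
  have "flip v \<bullet> flip v = v \<bullet> v" by (simp add: inner_vec_def sum_2 flip_def)
  then show ?thesis by (simp add: norm_eq_sqrt_inner)
qed

lemma deck_add: "deck (x + l) = deck x + flip l"
  by (simp add: deck_flip linear_add[OF linear_flip] algebra_simps)

lemma deck_deck: "deck (deck x) = x + (2 * pi) *\<^sub>R e0"
  by (simp add: deck_def vec_eq_iff forall_2 e_component scaleR_conv_of_real[where 'a = complex])

definition orb :: "complex^2 \<Rightarrow> (complex^2) set" where
  "orb x = lattice_coset PL x \<union> lattice_coset PL (deck x)"

definition deck_group :: "(complex^2 \<Rightarrow> complex^2) set" where
  "deck_group = translation_group PL \<union> (\<lambda>l x. deck x + l) ` PL"

lemma mem_coset: "y \<in> lattice_coset PL x \<longleftrightarrow> y - x \<in> PL"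
  by (auto simp: lattice_coset_def image_iff intro: bexI[of _ "y - x"])

lemmas coset_eq = lattice_coset_eq[OF discrete_subgroup_PL]

lemma orb_eq: "orb x = orb y \<longleftrightarrow> y - x \<in> PL \<or> y - deck x \<in> PL"
proof
  assume "orb x = orb y"
  moreover have "y \<in> orb y" by (simp add: orb_def mem_coset PL_intros)
  ultimately show "y - x \<in> PL \<or> y - deck x \<in> PL" by (auto simp: orb_def mem_coset)
next
  have A: "deck y - deck x \<in> PL" if "y - x \<in> PL" for x y
    using PL_intros(5)[OF that] by (simp add: deck_flip linear_diff[OF linear_flip])
  assume "y - x \<in> PL \<or> y - deck x \<in> PL"
  then show "orb x = orb y"
  proof
    assume "y - x \<in> PL"
    then show ?thesis using A[of y x] coset_eq[of x y] coset_eq[of "deck x" "deck y"] by (simp add: orb_def)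
  next
    assume a: "y - deck x \<in> PL"
    \<comment> \<open>The involution only squares to the identity up to a full period.\<close>
    have eq: "deck y - x = (deck y - deck (deck x)) + (2 * pi) *\<^sub>R e0" by (simp add: deck_deck)
    have "deck y - x \<in> PL" unfolding eq by (rule PL_intros(3)[OF A[OF a] PL_intros(6)])
    then show ?thesis using a coset_eq[of "deck x" y] coset_eq[of x "deck y"] by (auto simp: orb_def)
  qed
qed

lemma linear_part_deck_group: "\<gamma> \<in> deck_group \<Longrightarrow> linear_part \<gamma> = (\<lambda>v. v) \<or> linear_part \<gamma> = flip"
  unfolding deck_group_def
  by (auto simp: translation_group_def linear_part_def fun_eq_iff deck_flip linear_0[OF linear_flip])

text \<open>The coordinate \<open>w\<close> is moved by an odd multiple of \<open>\<pi>\<close>, so the action is free.\<close>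

lemma deck_far: "l \<in> PL \<Longrightarrow> pi \<le> dist (deck x + l) x"
proof -
  assume "l \<in> PL"
  then have p: "period (l \<bullet> e0)" by (simp add: in_PL)
  have e: "(deck x + l - x) \<bullet> e0 = l \<bullet> e0 + pi" by (simp add: inner_simps deck_inner)
  have "pi \<le> \<bar>l \<bullet> e0 + pi\<bar>"
  proof (rule ccontr)
    assume "\<not> pi \<le> \<bar>l \<bullet> e0 + pi\<bar>"
    then have "\<bar>l \<bullet> e0\<bar> < 2 * pi" "l \<bullet> e0 \<noteq> 0" using pi_gt_zero by linarith+
    then show False using period_small[OF p] by simp
  qed
  then show ?thesis using norm_ge_component(1)[of "deck x + l - x"] e by (simp add: dist_norm)
qed

lemma orb_quotient: "isometry_quotient orb deck_group"
proof (rule isometry_quotient.intro)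
  fix x y \<gamma>
  have "y - z \<in> PL \<longleftrightarrow> (\<exists>l\<in>PL. y = z + l)" for z by (auto intro!: bexI[of _ "y - z"])
  then show "orb x = orb y \<longleftrightarrow> (\<exists>\<gamma>\<in>deck_group. y = \<gamma> x)"
    by (simp add: orb_eq deck_group_def translation_group_def bex_Un)
  assume g: "\<gamma> \<in> deck_group"
  have "dist (deck x + l) (deck y + l) = dist x y" for l
    using norm_flip[of "x - y"] by (simp add: dist_norm deck_flip linear_diff[OF linear_flip])
  then show "dist (\<gamma> x) (\<gamma> y) = dist x y" using g by (auto simp: deck_group_def translation_group_def)
  show "bounded_linear (linear_part \<gamma>)"
    using linear_part_deck_group[OF g] linear_flip bounded_linear_ident by (auto simp: linear_conv_bounded_linear)
next
  show "\<exists>r>0. \<forall>\<gamma>\<in>deck_group. \<forall>x. dist (\<gamma> x) x < r \<longrightarrow> \<gamma> x = x"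
  proof (intro exI[of _ pi] conjI ballI allI impI)
    fix \<gamma> x assume "\<gamma> \<in> deck_group" and d: "dist (\<gamma> x) x < pi"
    then consider l where "l \<in> PL" "\<gamma> = (\<lambda>x. x + l)" | l where "l \<in> PL" "\<gamma> = (\<lambda>x. deck x + l)"
      by (auto simp: deck_group_def translation_group_def)
    then show "\<gamma> x = x"
    proof cases
      case 1
      then show ?thesis using d PL_discrete[of l] pi_gt_zero by (simp add: dist_norm)
    next
      case 2
      then show ?thesis using d deck_far[of l x] by simp
    qed
  qed simp
qed

interpretation Q: isometry_quotient orb deck_group by (rule orb_quotient)
interpretation T: isometry_quotient "lattice_coset PL" "translation_group PL"
  by (rule torus_isometry_quotient[OF discrete_subgroup_PL])

abbreviation "XX \<equiv> quotient_topology orb"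
abbreviation "AA \<equiv> quotient_atlas orb"

lemma flip_complex: "flip (z *s v) = z *s flip v"
  by (simp add: flip_def vec_eq_iff forall_2)

lemma deck_group_complex: "\<gamma> \<in> deck_group \<Longrightarrow> linear_part \<gamma> (z *s v) = z *s linear_part \<gamma> v"
  using linear_part_deck_group[of \<gamma>] by (auto simp: flip_complex)

lemma complex_manifold_X: "complex_manifold XX AA"
  by (rule complex_manifold_quotient[OF orb_quotient deck_group_complex])

lemma Basis_PL: "i \<in> Basis \<Longrightarrow> (2 * pi) *\<^sub>R i \<in> PL"
  using period_2pi period_0 unfolding Basis_complex2 in_PL by auto

lemma compact_X: "compact_space XX"
proof -
  have P: "orb (y + (2 * pi) *\<^sub>R i) = orb y" "orb (y - (2 * pi) *\<^sub>R i) = orb y" if "i \<in> Basis" for y i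
    using Basis_PL[OF that] PL_intros(2)[OF Basis_PL[OF that]] orb_eq[of y "y + (2 * pi) *\<^sub>R i"]
      orb_eq[of y "y - (2 * pi) *\<^sub>R i"] by simp_all
  have "\<exists>y\<in>period_box. orb y = orb x" for x
    by (rule period_box_covers[of "\<lambda>y. orb y = orb x"]) (simp_all add: P)
  then have "orb ` period_box = topspace XX"
    unfolding topspace_quotient_topology by (auto simp: image_iff) metis
  moreover have "compactin XX (orb ` period_box)"
    by (rule image_compactin[OF _ Q.continuous_map_q]) (simp add: period_box_def compact_cbox)
  ultimately show ?thesis by (simp add: compact_space_def)
qed

section \<open>Quotient of a product of elliptic curves\<close>

definition torus_deck :: "(complex^2) set \<Rightarrow> (complex^2) set" where
  "torus_deck = (\<lambda>t\<in>range (lattice_coset PL). lattice_coset PL (deck (SOME x. lattice_coset PL x = t)))"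

definition torus_id :: "(complex^2) set \<Rightarrow> (complex^2) set" where
  "torus_id = (\<lambda>t\<in>range (lattice_coset PL). t)"

lemma some_coset: "\<exists>l\<in>PL. (SOME y. lattice_coset PL y = lattice_coset PL x) = x + l"
proof -
  have "lattice_coset PL (SOME y. lattice_coset PL y = lattice_coset PL x) = lattice_coset PL x"
    by (rule someI[of _ x]) (rule refl)
  then have "(SOME y. lattice_coset PL y = lattice_coset PL x) - x \<in> PL" using coset_eq by metis
  then show ?thesis by (intro bexI[of _ "(SOME y. lattice_coset PL y = lattice_coset PL x) - x"]) auto
qed

lemma torus_deck: "torus_deck (lattice_coset PL x) = lattice_coset PL (deck x)"
proof -
  obtain l where l: "l \<in> PL" "(SOME y. lattice_coset PL y = lattice_coset PL x) = x + l" using some_coset by blast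
  have "lattice_coset PL (deck x) = lattice_coset PL (deck (x + l))"
    unfolding coset_eq deck_add using PL_intros(5)[OF l(1)] by simp
  then show ?thesis by (simp add: torus_deck_def l(2))
qed

lemma torus_id: "torus_id (lattice_coset PL x) = lattice_coset PL x"
  by (simp add: torus_id_def)

lemma torus_deck_twice: "torus_deck (torus_deck (lattice_coset PL x)) = lattice_coset PL x"
  unfolding torus_deck coset_eq deck_deck using PL_intros(2)[OF PL_intros(6)] by simp

definition torus_proj :: "(complex^2) set \<Rightarrow> (complex^2) set" where
  "torus_proj t = orb (SOME x. lattice_coset PL x = t)"

lemma torus_proj: "torus_proj (lattice_coset PL x) = orb x"
proof -
  obtain l where l: "l \<in> PL" "(SOME y. lattice_coset PL y = lattice_coset PL x) = x + l" using some_coset by blast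
  then show ?thesis unfolding torus_proj_def l(2) using orb_eq[of x "x + l"] by simp
qed

lemma translation_complex: "\<gamma> \<in> translation_group L \<Longrightarrow> linear_part \<gamma> (z *s v) = z *s linear_part \<gamma> v"
  by (simp add: linear_part_translation)

lemma deck_derivative: "(deck has_derivative flip) (at x)"
proof -
  have "((\<lambda>x. flip x + pi *\<^sub>R e0) has_derivative flip) (at x)"
    using linear_flip by (intro has_derivative_add_const bounded_linear_imp_has_derivative) (simp add: linear_conv_bounded_linear)
  then show ?thesis unfolding deck_flip[abs_def] .
qed

lemma free_quotient_X: "free_quotient_of_elliptic_product XX AA"
proof -
  let ?c = "lattice_coset PL" let ?R = "range (lattice_coset PL)" let ?G = "{torus_id, torus_deck}"
  have top: "topspace (torus_topology PL) = ?R" by (rule topspace_torus_topology)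
  have ext: "torus_deck \<in> extensional ?R" "torus_id \<in> extensional ?R" by (simp_all add: torus_deck_def torus_id_def)
  have compI: "compose ?R g f = h" if "h \<in> extensional ?R" "\<And>x. g (f (?c x)) = h (?c x)" for g f h
    by (rule extensionalityI[OF compose_extensional that(1)]) (use that(2) in \<open>auto simp: compose_def\<close>)
  have "bij_betw torus_deck ?R ?R"
    by (rule bij_betw_byWitness[where f' = torus_deck]) (auto simp: torus_deck_twice, auto simp: torus_deck)
  moreover have "bij_betw torus_id ?R ?R"
    by (rule bij_betw_byWitness[where f' = torus_id]) (auto simp: torus_id)
  ultimately have Bij: "torus_deck \<in> Bij ?R" "torus_id \<in> Bij ?R" using ext by (auto simp: Bij_def)
  have comp: "compose ?R torus_deck torus_deck = torus_id" "compose ?R torus_deck torus_id = torus_deck"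
    "compose ?R torus_id torus_deck = torus_deck" "compose ?R torus_id torus_id = torus_id"
    by (rule compI[OF ext(2)], simp only: torus_deck_twice torus_id, (rule compI[OF ext(1)], simp only: torus_deck torus_id)+,
        rule compI[OF ext(2)], simp only: torus_id)
  have grp: "group (BijGroup ?R)" by (rule group_BijGroup)
  have one: "\<one>\<^bsub>BijGroup ?R\<^esub> = torus_id" by (simp add: BijGroup_def torus_id_def)
  have mult: "g \<otimes>\<^bsub>BijGroup ?R\<^esub> f = compose ?R g f" if "g \<in> Bij ?R" "f \<in> Bij ?R" for f g
    using that by (simp add: BijGroup_def)
  have carrier: "carrier (BijGroup ?R) = Bij ?R" by (simp add: BijGroup_def)
  have inv: "inv\<^bsub>BijGroup ?R\<^esub> torus_deck = torus_deck" "inv\<^bsub>BijGroup ?R\<^esub> torus_id = torus_id"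
    by (rule group.inv_equality[OF grp]; simp add: mult Bij comp one carrier)+
  have sub: "subgroup ?G (BijGroup ?R)"
    by (rule group.subgroupI[OF grp]) (auto simp: carrier Bij inv mult comp)
  have hol: "holomorphic_map (torus_topology PL) (torus_atlas PL) (torus_topology PL) (torus_atlas PL) h" if "h \<in> ?G" for h
  proof -
    note hl = holomorphic_map_lift[where q' = ?c and q = ?c and S = "translation_group PL"]
    have "holomorphic_map (torus_topology PL) (torus_atlas PL) (torus_topology PL) (torus_atlas PL) torus_id"
      unfolding torus_quotient
      by (rule hl[where F = torus_id and G = "\<lambda>x. x" and G' = "\<lambda>x v. v"])
        (auto simp: torus_id translation_complex T.isometry_quotient_axioms)
    moreover have "holomorphic_map (torus_topology PL) (torus_atlas PL) (torus_topology PL) (torus_atlas PL) torus_deck"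
      unfolding torus_quotient
      by (rule hl[where F = torus_deck and G = deck and G' = "\<lambda>x. flip"])
        (auto simp: torus_deck translation_complex T.isometry_quotient_axioms deck_derivative flip_complex)
    ultimately show ?thesis using that by auto
  qed
  have free: "\<forall>h\<in>?G. \<forall>t\<in>?R. h t = t \<longrightarrow> h = torus_id"
  proof (intro ballI impI)
    fix h t assume h: "h \<in> ?G" "t \<in> ?R" "h t = t"
    show "h = torus_id"
    proof (rule ccontr)
      assume "h \<noteq> torus_id"
      then have "torus_deck t = t" using h by auto
      then obtain x where "?c (deck x) = ?c x" using h(2) torus_deck by auto
      then have l: "x - deck x \<in> PL" by (simp add: coset_eq)
      show False using deck_far[OF l, of x] pi_gt_zero by simp
    qed
  qed
  have projh: "holomorphic_map (torus_topology PL) (torus_atlas PL) XX AA torus_proj"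
    unfolding torus_quotient
    by (rule holomorphic_map_lift[where F = torus_proj and q' = ?c and G = "\<lambda>x. x" and G' = "\<lambda>x v. v", OF orb_quotient])
      (auto simp: torus_proj deck_group_complex)
  have bij: "differential_everywhere bij (torus_atlas PL) AA torus_proj"
    unfolding torus_quotient
  proof (rule Q.differential_everywhere_lift[where F = torus_proj and q' = ?c and G = "\<lambda>x. x" and G' = "\<lambda>x v. v", OF torus_proj has_derivative_ident])
    fix \<gamma> assume "\<gamma> \<in> deck_group"
    moreover have "bij flip" by (rule o_bij[of flip]) (auto simp: flip_flip)
    ultimately show "bij (\<lambda>v. linear_part \<gamma> v)" using linear_part_deck_group[of \<gamma>] by (auto simp: bij_def)
  qed
  have img: "torus_proj ` ?R = topspace XX" by (auto simp: topspace_quotient_topology torus_proj image_iff)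
  have fib: "\<forall>s\<in>?R. \<forall>t\<in>?R. torus_proj s = torus_proj t \<longleftrightarrow> (\<exists>h\<in>?G. h s = t)"
    by (auto simp: torus_proj orb_eq torus_id torus_deck coset_eq)
  show ?thesis
    unfolding free_quotient_of_elliptic_product_def
    by (rule exI[of _ L2pi], rule exI[of _ L2pi], rule exI[of _ "torus_topology PL"], rule exI[of _ "torus_atlas PL"],
        rule exI[of _ ?G], rule exI[of _ torus_proj])
      (unfold top one PL_def[symmetric], use full_lattice_rect[of "2 * pi" "2 * pi"] sub hol free projh bij img fib in \<open>simp add: one\<close>)
qed

section \<open>The elliptic fibration\<close>

text \<open>The first coordinate is well defined on the surface up to \<open>\<pi>\<close> in \<open>w\<close> and \<open>2 \<pi>\<close> in \<open>z\<close>, whence the lattice of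
  the base; over it, the second coordinate sweeps out the full elliptic curve.\<close>

abbreviation (input) Lbase :: "(complex^1) set" where "Lbase \<equiv> rect_lattice pi (2 * pi)"

lemma Lbase_full: "full_lattice Lbase" and L2pi_full: "full_lattice L2pi"
  by (simp_all add: full_lattice_rect)

lemmas Lbase_eq = lattice_coset_eq[OF full_lattice_discrete_subgroup[OF Lbase_full]]
lemmas L2pi_eq = lattice_coset_eq[OF full_lattice_discrete_subgroup[OF L2pi_full]]

definition fibration :: "(complex^2) set \<Rightarrow> (complex^1) set" where
  "fibration p = lattice_coset Lbase (vec ((SOME x. orb x = p) $ 1))"

lemma PL_Lbase: "l \<in> PL \<Longrightarrow> vec (l $ 1) \<in> Lbase" "l \<in> PL \<Longrightarrow> vec (l $ 1 + of_real pi) \<in> Lbase"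
proof -
  assume "l \<in> PL"
  then obtain m n :: int where mn: "Re (l $ 1) = of_int m * (2 * pi)" "Im (l $ 1) = of_int n * (2 * pi)"
    by (auto simp: in_PL period_def inner_e)
  show "vec (l $ 1) \<in> Lbase" unfolding rect_lattice_def mem_Collect_eq
    by (intro exI[of _ "2 * m"] exI[of _ n]) (simp add: mn)
  show "vec (l $ 1 + of_real pi) \<in> Lbase" unfolding rect_lattice_def mem_Collect_eq
    by (rule exI[of _ "2 * m + 1"], rule exI[of _ n]) (simp add: mn algebra_simps)
qed

lemma vec1_diff: "vec x - vec y = (vec (x - y) :: complex^1)"
  by (simp add: vec1_eq_iff)

lemma fibration: "fibration (orb x) = lattice_coset Lbase (vec (x $ 1))"
proof -
  have "orb (SOME y. orb y = orb x) = orb x" by (rule someI[of _ x]) (rule refl)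
  then have "x - (SOME y. orb y = orb x) \<in> PL \<or> x - deck (SOME y. orb y = orb x) \<in> PL" by (simp add: orb_eq)
  moreover have "(x - deck y) $ 1 + of_real pi = x $ 1 - y $ 1" for y by (simp add: deck_def)
  ultimately have "vec (x $ 1 - (SOME y. orb y = orb x) $ 1) \<in> Lbase"
    using PL_Lbase by (metis vector_minus_component)
  then show ?thesis unfolding fibration_def Lbase_eq vec1_diff .
qed

definition fibre :: "complex \<Rightarrow> (complex^1) set \<Rightarrow> (complex^2) set" where
  "fibre a t = orb (\<chi> i. if i = 1 then a else (SOME b. lattice_coset L2pi b = t) $ 1)"

abbreviation pt :: "complex \<Rightarrow> complex \<Rightarrow> complex^2" where "pt a b \<equiv> (\<chi> i. if i = 1 then a else b)"

lemma fibre: "fibre a (lattice_coset L2pi b) = orb (pt a (b $ 1))"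
proof -
  let ?s = "SOME y. lattice_coset L2pi y = lattice_coset L2pi b"
  have "lattice_coset L2pi ?s = lattice_coset L2pi b" by (rule someI[of _ b]) (rule refl)
  then have "b - ?s \<in> L2pi" by (simp add: L2pi_eq)
  then have "pt a (b $ 1) - pt a (?s $ 1) \<in> PL"
    by (simp add: in_PL inner_e rect_lattice_def period_0) (auto simp: period_def)
  then show ?thesis unfolding fibre_def orb_eq by blast
qed

lemma fibration_X: "elliptic_fibration_over_elliptic_curve XX AA"
proof -
  let ?E = "lattice_coset Lbase" let ?K = "lattice_coset L2pi"
  interpret E: isometry_quotient ?E "translation_group Lbase"
    by (rule torus_isometry_quotient[OF full_lattice_discrete_subgroup[OF Lbase_full]])
  have lin: "linear (\<lambda>x :: complex^2. vec (x $ 1) :: complex^1)"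
    by (rule linearI) (simp_all add: vec1_eq_iff)
  have d: "((\<lambda>x :: complex^2. vec (x $ 1) :: complex^1) has_derivative (\<lambda>v. vec (v $ 1))) (at x)" for x
    using lin by (intro bounded_linear_imp_has_derivative) (simp add: linear_conv_bounded_linear)
  have hol: "holomorphic_map XX AA (torus_topology Lbase) (torus_atlas Lbase) fibration"
    unfolding torus_quotient
    by (rule holomorphic_map_lift[where F = fibration and q' = orb and G = "\<lambda>x :: complex^2. vec (x $ 1)" and G' = "\<lambda>x (v :: complex^2). vec (v $ 1)",
          OF E.isometry_quotient_axioms])
      (simp_all add: fibration d translation_complex vec1_eq_iff)
  have surj: "differential_everywhere surj AA (torus_atlas Lbase) fibration"
    unfolding torus_quotient
  proof (rule E.differential_everywhere_lift[where F = fibration and q' = orb and G = "\<lambda>x :: complex^2. vec (x $ 1)" and G' = "\<lambda>x (v :: complex^2). vec (v $ 1)", OF fibration d])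
    fix \<gamma> assume "\<gamma> \<in> translation_group Lbase"
    moreover have "surj (\<lambda>v :: complex^2. vec (v $ 1) :: complex^1)"
      by (rule surjI[of _ "\<lambda>w :: complex^1. pt (w $ 1) 0"]) (simp add: vec1_eq_iff)
    ultimately show "surj (\<lambda>v :: complex^2. linear_part \<gamma> (vec (v $ 1)))" by (simp add: linear_part_translation)
  qed
  have img: "fibration ` topspace XX = topspace (torus_topology Lbase)"
  proof -
    have "?E w \<in> fibration ` range orb" for w
      using fibration[of "pt (w $ 1) 0"] by (intro image_eqI[of _ _ "orb (pt (w $ 1) 0)"]) (simp_all add: vec1_eq_iff[symmetric])
    then show ?thesis by (auto simp: topspace_quotient_topology topspace_torus_topology fibration)
  qed
  have fibres: "\<exists>(K :: (complex^1) set) j. full_lattice K \<and>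
           holomorphic_map (torus_topology K) (torus_atlas K) XX AA j \<and>
           differential_everywhere inj (torus_atlas K) AA j \<and>
           inj_on j (topspace (torus_topology K)) \<and>
           j ` topspace (torus_topology K) = {p \<in> topspace XX. fibration p = r}"
    if r: "r \<in> topspace (torus_topology Lbase)" for r
  proof -
    obtain w where w: "r = ?E w" using r by (auto simp: topspace_torus_topology)
    let ?a = "w $ 1"
    let ?G = "\<lambda>b :: complex^1. pt ?a (b $ 1)" and ?G' = "\<lambda>b :: complex^1. pt 0 (b $ 1)"
    have "linear ?G'" by (rule linearI) (simp_all add: vec_eq_iff forall_2)
    then have dG': "(?G' has_derivative ?G') (at x)" for x
      by (intro bounded_linear_imp_has_derivative) (simp add: linear_conv_bounded_linear)
    have e: "(\<lambda>b. ?G' b + pt ?a 0) = ?G" by (simp add: fun_eq_iff vec_eq_iff forall_2)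
    have dG: "(?G has_derivative ?G') (at x)" for x
      using has_derivative_add_const[OF dG'[of x], of "pt ?a 0"] unfolding e .
    have h: "holomorphic_map (torus_topology L2pi) (torus_atlas L2pi) XX AA (fibre ?a)"
      unfolding torus_quotient
      by (rule holomorphic_map_lift[where F = "fibre ?a" and q' = ?K and G = ?G and G' = "\<lambda>x. ?G'", OF orb_quotient fibre dG])
        (simp_all add: deck_group_complex, simp add: vec_eq_iff forall_2)
    have i: "differential_everywhere inj (torus_atlas L2pi) AA (fibre ?a)"
      unfolding torus_quotient
    proof (rule Q.differential_everywhere_lift[where F = "fibre ?a" and q' = ?K and G = ?G and G' = "\<lambda>x. ?G'", OF fibre dG])
      fix \<gamma> assume g: "\<gamma> \<in> deck_group"
      have "inj ?G'" by (rule injI) (simp add: vec_eq_iff forall_2)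
      moreover have "inj flip" by (rule inj_on_inverseI[of _ flip]) (simp add: flip_flip)
      ultimately show "inj (\<lambda>v. linear_part \<gamma> (?G' v))"
        using linear_part_deck_group[OF g] inj_compose[of flip ?G'] by (auto simp: comp_def)
    qed
    have inj: "inj_on (fibre ?a) (topspace (torus_topology L2pi))"
    proof (rule inj_onI)
      fix s t assume "s \<in> topspace (torus_topology L2pi)" "t \<in> topspace (torus_topology L2pi)" "fibre ?a s = fibre ?a t"
      then obtain b c where bc: "s = ?K b" "t = ?K c" "orb (?G b) = orb (?G c)"
        by (auto simp: topspace_torus_topology fibre)
      have "\<not> ?G c - deck (?G b) \<in> PL"
      proof
        assume "?G c - deck (?G b) \<in> PL"
        then have "period (- pi)" by (simp add: in_PL inner_e deck_def)
        then show False using not_period_pi[of "- pi"] period_0 by simp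
      qed
      then have "?G c - ?G b \<in> PL" using bc(3) orb_eq by blast
      then have "c - b \<in> L2pi" by (simp add: in_PL inner_e rect_lattice_def) (simp add: period_def)
      then show "s = t" by (simp add: bc(1,2) L2pi_eq)
    qed
    have im: "fibre ?a ` topspace (torus_topology L2pi) = {p \<in> topspace XX. fibration p = r}"
    proof
      show "fibre ?a ` topspace (torus_topology L2pi) \<subseteq> {p \<in> topspace XX. fibration p = r}"
        by (auto simp: topspace_torus_topology topspace_quotient_topology fibre fibration w vec1_eq_iff[symmetric])
      show "{p \<in> topspace XX. fibration p = r} \<subseteq> fibre ?a ` topspace (torus_topology L2pi)"
      proof
        fix p assume "p \<in> {p \<in> topspace XX. fibration p = r}"
        then obtain x :: "complex^2" where x: "p = orb x" "?E (vec (x $ 1)) = ?E w"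
          by (auto simp: topspace_quotient_topology fibration w)
        then have "w - vec (x $ 1) \<in> Lbase" by (simp only: Lbase_eq)
        then obtain m n :: int where mn: "Re (?a - x $ 1) = of_int m * pi" "Im (?a - x $ 1) = of_int n * (2 * pi)"
          by (auto simp: rect_lattice_def)
        have "\<exists>b. orb x = orb (pt ?a b)"
        proof (cases "even m")
          case True
          then obtain k where "m = 2 * k" by (elim evenE)
          then have "pt ?a (x $ 2) - x \<in> PL" using mn period_0 by (auto simp: in_PL inner_e period_def)
          then show ?thesis using orb_eq by blast
        next
          case False
          then obtain k where k: "m = 2 * k + 1" by (elim oddE)
          have "Re (?a - x $ 1) - pi = of_int k * (2 * pi)" using mn(1) k by (simp add: algebra_simps)
          then have "period (Re (?a - x $ 1) - pi)" "period (Im (?a - x $ 1))" using mn(2) by (auto simp: period_def)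
          then have "pt ?a (- x $ 2) - deck x \<in> PL" using period_0 by (simp add: in_PL inner_e deck_def diff_diff_eq)
          then show ?thesis using orb_eq by blast
        qed
        then obtain b where "orb x = orb (pt ?a b)" by blast
        then have "p = fibre ?a (?K (vec b))" by (simp only: x fibre vec_component)
        then show "p \<in> fibre ?a ` topspace (torus_topology L2pi)" by (simp add: topspace_torus_topology)
      qed
    qed
    show ?thesis using L2pi_full h i inj im by blast
  qed
  show ?thesis
    unfolding elliptic_fibration_over_elliptic_curve_def
    by (rule exI[of _ Lbase], rule exI[of _ fibration], intro conjI ballI Lbase_full hol surj img)
      (rule fibres)
qed

section \<open>The surface is not a complex torus\<close>

lemma doubly_periodic_constant:
  assumes h: "g holomorphic_on UNIV" and p: "\<And>z. g (z + 2 * of_real pi) = g z" "\<And>z. g (z + 2 * of_real pi * \<i>) = g z"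
  shows "g z = g w"
proof -
  have P: "g (y + (2 * pi) *\<^sub>R i) = g y \<and> g (y - (2 * pi) *\<^sub>R i) = g y" if "i \<in> Basis" for y i
  proof -
    have "g (y + (2 * pi) *\<^sub>R i) = g y" for y
      using that p by (auto simp: Basis_complex_def scaleR_conv_of_real)
    from this[of y] this[of "y - (2 * pi) *\<^sub>R i"] show ?thesis by simp
  qed
  have "\<exists>y\<in>period_box. g y = g x" for x
    by (rule period_box_covers[of "\<lambda>y. g y = g x"]) (simp_all add: P)
  then have "range g \<subseteq> g ` period_box" by (auto simp: image_iff) metis
  moreover have "compact (g ` period_box)"
    unfolding period_box_def
    by (rule compact_continuous_image[OF continuous_on_subset[OF holomorphic_on_imp_continuous_on[OF h]] compact_cbox]) simp
  ultimately have "bounded (range g)" using compact_imp_bounded bounded_subset by blast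
  from Liouville_theorem[OF h this] show ?thesis by (auto simp: constant_on_def)
qed

locale torus_biholomorphism =
  fixes L :: "(complex^2) set" and f :: "(complex^2) set \<Rightarrow> (complex^2) set"
  assumes L: "full_lattice L"
    and hol: "holomorphic_map XX AA (torus_topology L) (torus_atlas L) f"
    and inj: "inj_on f (range orb)"
begin

abbreviation "cL \<equiv> lattice_coset L"

lemma discL: "discrete_subgroup L"
  by (rule full_lattice_discrete_subgroup[OF L])

sublocale TL: isometry_quotient cL "translation_group L"
  by (rule torus_isometry_quotient[OF discL])

lemma local_lift:
  "\<exists>r>0. \<exists>\<Phi>. inj_on orb (ball p r) \<and> (\<forall>x\<in>ball p r. cL (\<Phi> x) = f (orb x) \<and>
     (\<exists>D. (\<Phi> has_derivative D) (at x) \<and> (\<forall>z v. D (z *s v) = z *s D v)))"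
proof -
  obtain U where U: "(U, orb) \<in> AA" "p \<in> U" using Q.chart_around by blast
  then have oU: "open U" "inj_on orb U" by (auto simp: quotient_atlas_def)
  have cont: "continuous_map XX (torus_topology L) f" using hol by (simp add: holomorphic_map_def)
  then have "f (orb p) \<in> topspace (torus_topology L)"
    by (rule continuous_map_image_subset_topspace[THEN subsetD]) (simp add: topspace_quotient_topology)
  then obtain y where y: "f (orb p) = cL y" by (auto simp: topspace_torus_topology)
  obtain V where V: "(V, cL) \<in> quotient_atlas cL" "y \<in> V" using TL.chart_around by blast
  then have oV: "open V" "inj_on cL V" by (auto simp: quotient_atlas_def)
  let ?D = "local_dom (U, orb) (V, cL) f" and ?\<Phi> = "local_rep (U, orb) (V, cL) f"
  have "openin XX {p \<in> topspace XX. f p \<in> cL ` V}"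
    using openin_continuous_map_preimage[OF cont] TL.open_q[OF oV(1)] by (simp add: torus_quotient)
  then have "open {x. orb x \<in> {p \<in> topspace XX. f p \<in> cL ` V}}" by (simp only: openin_quotient_topology)
  moreover have "?D = U \<inter> {x. orb x \<in> {p \<in> topspace XX. f p \<in> cL ` V}}"
    by (auto simp: local_dom_def topspace_quotient_topology)
  ultimately have "open ?D" using oU by auto
  moreover have "p \<in> ?D" using U y V by (auto simp: local_dom_def)
  ultimately obtain r where r: "r > 0" "ball p r \<subseteq> ?D" by (rule openE)
  have "cholomorphic_on ?D ?\<Phi>" using hol U(1) V(1) unfolding holomorphic_map_def torus_quotient by blast
  then have "\<forall>x\<in>ball p r. cL (?\<Phi> x) = f (orb x) \<and> (\<exists>D. (?\<Phi> has_derivative D) (at x) \<and> (\<forall>z v. D (z *s v) = z *s D v))"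
    using r(2) unfolding cholomorphic_on_def
    by (auto simp: local_rep_def local_dom_def intro!: f_inv_into_f)
  moreover have "inj_on orb (ball p r)"
    by (rule inj_on_subset[OF oU(2)]) (use r(2) in \<open>auto simp: local_dom_def\<close>)
  ultimately show ?thesis using r(1) by blast
qed

definition lift_derivative :: "complex^2 \<Rightarrow> (complex^2 \<Rightarrow> complex^2) \<Rightarrow> bool" where
  "lift_derivative p D \<longleftrightarrow> (\<exists>\<Psi>. \<exists>r>0. (\<forall>x\<in>ball p r. cL (\<Psi> x) = f (orb x)) \<and> (\<Psi> has_derivative D) (at p))"

text \<open>Two local lifts differ by a continuous function with values in the lattice, which is constant
  near the point.\<close>

lemma lift_derivative_unique:
  assumes "lift_derivative p D" "lift_derivative p D'"
  shows "D = D'"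
proof -
  obtain \<Psi> r where 1: "r > 0" "\<forall>x\<in>ball p r. cL (\<Psi> x) = f (orb x)" "(\<Psi> has_derivative D) (at p)"
    using assms(1) by (auto simp: lift_derivative_def)
  obtain \<Psi>' r' where 2: "r' > 0" "\<forall>x\<in>ball p r'. cL (\<Psi>' x) = f (orb x)" "(\<Psi>' has_derivative D') (at p)"
    using assms(2) by (auto simp: lift_derivative_def)
  obtain \<rho> where rho: "\<rho> > 0" "\<forall>l\<in>L. norm l < \<rho> \<longrightarrow> l = 0" using discL by (auto simp: discrete_subgroup_def)
  let ?d = "\<lambda>x. \<Psi> x - \<Psi>' x"
  have "isCont ?d p" using 1(3) 2(3) by (intro continuous_diff has_derivative_continuous)
  then obtain s where s: "s > 0" "\<And>x. dist x p < s \<Longrightarrow> dist (?d x) (?d p) < \<rho>"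
    using rho(1) unfolding continuous_at_eps_delta by blast
  let ?t = "min s (min r r')"
  have inL: "?d x \<in> L" if "x \<in> ball p ?t" for x
    using 1(2) 2(2) that lattice_coset_eq[OF discL, of "\<Psi>' x" "\<Psi> x"] by auto
  have const: "?d x = ?d p" if x: "x \<in> ball p ?t" for x
  proof -
    have "?d x - ?d p \<in> L"
      using inL[OF x] inL[of p] discL s(1) 1(1) 2(1) unfolding discrete_subgroup_def
      by (metis (no_types, lifting) centre_in_ball diff_conv_add_uminus min_less_iff_conj)
    moreover have "norm (?d x - ?d p) < \<rho>" using s(2)[of x] x by (simp add: dist_norm norm_minus_commute)
    ultimately show ?thesis using rho(2) by auto
  qed
  have "((\<lambda>x. \<Psi>' x + ?d p) has_derivative D') (at p)" by (rule has_derivative_add_const[OF 2(3)])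
  then have "(\<Psi> has_derivative D') (at p)"
  proof (rule has_derivative_transform_within_open[where s = "ball p ?t"])
    show "p \<in> ball p ?t" using s 1 2 by simp
    show "\<Psi>' x + ?d p = \<Psi> x" if "x \<in> ball p ?t" for x using const[OF that] by (simp add: algebra_simps)
  qed simp
  then show ?thesis using has_derivative_unique[OF 1(3)] by simp
qed

text \<open>The derivatives of local lifts of \<open>f\<close> agree wherever two lifts are defined, so they form one
  function on the universal cover although \<open>f\<close> itself has not been lifted globally.\<close>

definition MM :: "complex^2 \<Rightarrow> complex^2 \<Rightarrow> complex^2" where "MM p = (THE D. lift_derivative p D)"

lemma MM_eq: "lift_derivative p D \<Longrightarrow> MM p = D"
  unfolding MM_def using lift_derivative_unique by blast

lemma local_lift_MM:
  "\<exists>r>0. \<exists>\<Phi>. inj_on orb (ball p r) \<and> (\<forall>x\<in>ball p r. cL (\<Phi> x) = f (orb x) \<and> (\<Phi> has_derivative MM x) (at x) \<and>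
     (\<forall>z v. MM x (z *s v) = z *s MM x v))"
proof -
  obtain r \<Phi> where r: "r > 0" "inj_on orb (ball p r)" and \<Phi>: "\<forall>x\<in>ball p r. cL (\<Phi> x) = f (orb x) \<and>
     (\<exists>D. (\<Phi> has_derivative D) (at x) \<and> (\<forall>z v. D (z *s v) = z *s D v))"
    using local_lift[of p] by blast
  have "(\<Phi> has_derivative MM x) (at x) \<and> (\<forall>z v. MM x (z *s v) = z *s MM x v)" if x: "x \<in> ball p r" for x
  proof -
    obtain D where D: "(\<Phi> has_derivative D) (at x)" "\<forall>z v. D (z *s v) = z *s D v" using \<Phi> x by blast
    obtain t where t: "t > 0" "ball x t \<subseteq> ball p r" using openE[OF open_ball x] by blast
    have "lift_derivative x D"
      unfolding lift_derivative_def using t \<Phi> D(1) by blast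
    then have "MM x = D" by (rule MM_eq)
    then show ?thesis using D by simp
  qed
  then show ?thesis using r \<Phi> by blast
qed

lemma MM_deck:
  assumes g: "\<gamma> \<in> deck_group"
  shows "MM x v = MM (\<gamma> x) (linear_part \<gamma> v)"
proof -
  obtain r \<Phi> where r: "r > 0" and \<Phi>: "\<forall>y\<in>ball (\<gamma> x) r. cL (\<Phi> y) = f (orb y) \<and> (\<Phi> has_derivative MM y) (at y)"
    using local_lift_MM[of "\<gamma> x"] by blast
  have orbg: "orb (\<gamma> y) = orb y" for y using Q.q_eq[of y "\<gamma> y"] g by auto
  have A: "((\<lambda>y. \<Phi> (\<gamma> y)) has_derivative (\<lambda>v. MM (\<gamma> x) (linear_part \<gamma> v))) (at x)"
    by (rule has_derivative_compose[OF Q.S_derivative[OF g]]) (use \<Phi> r in auto)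
  have B: "\<forall>y\<in>ball x r. cL (\<Phi> (\<gamma> y)) = f (orb y)"
    using \<Phi> Q.iso[OF g, of x] orbg by simp
  have "lift_derivative x (\<lambda>v. MM (\<gamma> x) (linear_part \<gamma> v))"
    unfolding lift_derivative_def
    by (rule exI[of _ "\<lambda>y. \<Phi> (\<gamma> y)"], rule exI[of _ r], intro conjI r A B)
  from MM_eq[OF this] show ?thesis by simp
qed

lemma MM_period: "l \<in> PL \<Longrightarrow> MM (x + l) v = MM x v"
  using MM_deck[of "\<lambda>x. x + l" x v] by (auto simp: deck_group_def translation_group_def linear_part_def)

lemma MM_flip: "MM x v = MM (deck x) (flip v)"
proof -
  have "deck \<in> deck_group" unfolding deck_group_def using PL_intros(1) by (auto intro!: image_eqI[of _ _ 0])
  moreover have "linear_part deck = flip" by (simp add: linear_part_def fun_eq_iff deck_flip linear_0[OF linear_flip])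
  ultimately show ?thesis using MM_deck[of deck x v] by simp
qed

lemma norm_pt: "norm (pt 0 t) = norm t" "norm (pt t 0) = norm t"
  by (simp_all add: norm_vec_def L2_set_def sum_2)

lemma dist_pt: "dist (pt a b) (pt a' b') \<le> dist a a' + dist b b'"
proof -
  have "pt a b - pt a' b' = pt (a - a') 0 + pt 0 (b - b')" by (simp add: vec_eq_iff forall_2)
  then show ?thesis unfolding dist_norm by (metis norm_triangle_ineq norm_pt)
qed

lemma slice_derivative:
  assumes "(\<Phi> has_derivative MM (pt a b)) (at (pt a b))" "\<forall>z v. MM (pt a b) (z *s v) = z *s MM (pt a b) v"
  shows "((\<lambda>t. \<Phi> (pt a t) $ j) has_field_derivative MM (pt a b) (pt 0 1) $ j) (at b)"
    "((\<lambda>t. \<Phi> (pt t b) $ j) has_field_derivative MM (pt a b) (pt 1 0) $ j) (at a)"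
proof -
  have l: "bounded_linear (\<lambda>t. pt 0 t)" "bounded_linear (\<lambda>t. pt t 0)"
    by (intro linear_conv_bounded_linear[THEN iffD1] linearI; simp add: vec_eq_iff forall_2)+
  have d: "((\<lambda>t. pt 0 t + pt a 0) has_derivative (\<lambda>t. pt 0 t)) (at b)" "((\<lambda>t. pt t 0 + pt 0 b) has_derivative (\<lambda>t. pt t 0)) (at a)"
    by (intro has_derivative_add_const bounded_linear_imp_has_derivative l)+
  have e: "pt 0 t + pt a 0 = pt a t" "pt t 0 + pt 0 b = pt t b" for t by (simp_all add: vec_eq_iff forall_2)
  have D1: "((\<lambda>t. \<Phi> (pt a t)) has_derivative (\<lambda>t. MM (pt a b) (pt 0 t))) (at b)"
    by (rule has_derivative_compose[OF d(1)[unfolded e] assms(1)])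
  have D2: "((\<lambda>t. \<Phi> (pt t b)) has_derivative (\<lambda>t. MM (pt a b) (pt t 0))) (at a)"
    by (rule has_derivative_compose[OF d(2)[unfolded e] assms(1)])
  note D = bounded_linear.has_derivative[OF bounded_linear_vec_nth D1, of j]
    bounded_linear.has_derivative[OF bounded_linear_vec_nth D2, of j]
  have s: "pt 0 t = t *s pt 0 1" "pt t 0 = t *s pt 1 0" for t by (simp_all add: vec_eq_iff forall_2)
  have "(\<lambda>t. MM (pt a b) (pt 0 t) $ j) = (*) (MM (pt a b) (pt 0 1) $ j)"
    by (rule ext, subst s(1)) (simp only: assms(2)[rule_format] vector_smult_component mult.commute)
  then show "((\<lambda>t. \<Phi> (pt a t) $ j) has_field_derivative MM (pt a b) (pt 0 1) $ j) (at b)"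
    using D(1) unfolding has_field_derivative_def by simp
  have "(\<lambda>t. MM (pt a b) (pt t 0) $ j) = (*) (MM (pt a b) (pt 1 0) $ j)"
    by (rule ext, subst s(2)) (simp only: assms(2)[rule_format] vector_smult_component mult.commute)
  then show "((\<lambda>t. \<Phi> (pt t b) $ j) has_field_derivative MM (pt a b) (pt 1 0) $ j) (at a)"
    using D(2) unfolding has_field_derivative_def by simp
qed

lemma holomorphic_from_local:
  assumes "\<And>z. \<exists>r>0. \<exists>\<phi>. \<forall>w\<in>ball z r. (\<phi> has_field_derivative g w) (at w)"
  shows "g holomorphic_on UNIV"
proof -
  have "g field_differentiable at z" for z
  proof -
    obtain r \<phi> where r: "r > 0" and d: "\<forall>w\<in>ball z r. (\<phi> has_field_derivative g w) (at w)" using assms by blast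
    have "\<phi> holomorphic_on ball z r" unfolding holomorphic_on_def
      using d field_differentiable_at_within field_differentiable_def by blast
    then have "deriv \<phi> holomorphic_on ball z r" by (intro holomorphic_deriv) auto
    then have "g holomorphic_on ball z r"
      by (rule holomorphic_transform) (rule DERIV_imp_deriv[OF d[rule_format]])
    then show ?thesis using r by (intro holomorphic_on_imp_differentiable_at[of _ "ball z r"]) auto
  qed
  then show ?thesis by (simp add: holomorphic_on_def field_differentiable_at_within)
qed

lemma in_ball_pt: "dist a a' + dist b b' < r \<Longrightarrow> pt a' b' \<in> ball (pt a b) r"
  using dist_pt[of a b a' b'] by simp

lemma pt_period:
  "pt (a + 2 * of_real pi) b = pt a b + (2 * pi) *\<^sub>R e0" "pt (a + 2 * of_real pi * \<i>) b = pt a b + (2 * pi) *\<^sub>R e3"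
  "pt a (b + 2 * of_real pi) = pt a b + (2 * pi) *\<^sub>R e1" "pt a (b + 2 * of_real pi * \<i>) = pt a b + (2 * pi) *\<^sub>R e2"
  by (simp_all add: vec_eq_iff forall_2 e_component scaleR_conv_of_real[where 'a = complex])

text \<open>Along each complex coordinate line the matching column of the derivative is holomorphic and doubly
  periodic, so it is constant by the theorem of Liouville.\<close>

lemma MM_slice:
  "MM (pt a b) (pt 0 1) $ j = MM (pt a b') (pt 0 1) $ j" "MM (pt a b) (pt 1 0) $ j = MM (pt a' b) (pt 1 0) $ j"
proof -
  have P: "(2 * pi) *\<^sub>R e0 \<in> PL" "(2 * pi) *\<^sub>R e1 \<in> PL" "(2 * pi) *\<^sub>R e2 \<in> PL" "(2 * pi) *\<^sub>R e3 \<in> PL"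
    by (intro Basis_PL e_Basis)+
  show "MM (pt a b) (pt 0 1) $ j = MM (pt a b') (pt 0 1) $ j"
  proof (rule doubly_periodic_constant[of "\<lambda>b. MM (pt a b) (pt 0 1) $ j"])
    show "(\<lambda>b. MM (pt a b) (pt 0 1) $ j) holomorphic_on UNIV"
    proof (rule holomorphic_from_local)
      fix b
      obtain r \<Phi> where r: "r > 0" and \<Phi>: "\<forall>x\<in>ball (pt a b) r. (\<Phi> has_derivative MM x) (at x) \<and> (\<forall>z v. MM x (z *s v) = z *s MM x v)"
        using local_lift_MM[of "pt a b"] by blast
      have "((\<lambda>t. \<Phi> (pt a t) $ j) has_field_derivative MM (pt a w) (pt 0 1) $ j) (at w)" if "w \<in> ball b r" for w
        by (rule slice_derivative(1)) (use \<Phi> in_ball_pt[of a a b w r] that in auto)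
      then show "\<exists>r>0. \<exists>\<phi>. \<forall>w\<in>ball b r. (\<phi> has_field_derivative MM (pt a w) (pt 0 1) $ j) (at w)" using r by blast
    qed
  qed (simp_all only: pt_period MM_period[OF P(2)] MM_period[OF P(3)])
  show "MM (pt a b) (pt 1 0) $ j = MM (pt a' b) (pt 1 0) $ j"
  proof (rule doubly_periodic_constant[of "\<lambda>a. MM (pt a b) (pt 1 0) $ j"])
    show "(\<lambda>a. MM (pt a b) (pt 1 0) $ j) holomorphic_on UNIV"
    proof (rule holomorphic_from_local)
      fix a
      obtain r \<Phi> where r: "r > 0" and \<Phi>: "\<forall>x\<in>ball (pt a b) r. (\<Phi> has_derivative MM x) (at x) \<and> (\<forall>z v. MM x (z *s v) = z *s MM x v)"
        using local_lift_MM[of "pt a b"] by blast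
      have "((\<lambda>t. \<Phi> (pt t b) $ j) has_field_derivative MM (pt w b) (pt 1 0) $ j) (at w)" if "w \<in> ball a r" for w
        by (rule slice_derivative(2)) (use \<Phi> in_ball_pt[of a w b b r] that in auto)
      then show "\<exists>r>0. \<exists>\<phi>. \<forall>w\<in>ball a r. (\<phi> has_field_derivative MM (pt w b) (pt 1 0) $ j) (at w)" using r by blast
    qed
  qed (simp_all only: pt_period MM_period[OF P(1)] MM_period[OF P(4)])
qed

lemma constant_derivative:
  assumes "\<And>w. w \<in> ball z r \<Longrightarrow> (\<phi> has_field_derivative k) (at w)" "w \<in> ball z r"
  shows "\<phi> w = \<phi> z + k * (w - z)"
proof -
  have "((\<lambda>w. \<phi> w - k * w) has_field_derivative 0) (at u within ball z r)" if "u \<in> ball z r" for u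
    using DERIV_subset[OF assms(1)[OF that]] by (auto intro!: derivative_eq_intros)
  then obtain c where "\<And>u. u \<in> ball z r \<Longrightarrow> \<phi> u - k * u = c"
    using has_field_derivative_zero_constant[OF convex_ball, of z r "\<lambda>w. \<phi> w - k * w"] by blast
  moreover have "z \<in> ball z r" using assms(2) le_less_trans[OF zero_le_dist[of z w], of r] by simp
  ultimately have "\<phi> w - k * w = \<phi> z - k * z" using assms(2) by metis
  then show ?thesis by (simp add: algebra_simps)
qed

text \<open>Affine dependence on each coordinate separately; the slope may still depend on the other
  coordinate.\<close>

lemma lift_affine:
  assumes \<Phi>: "\<forall>x\<in>ball (pt a b) r. (\<Phi> has_derivative MM x) (at x) \<and> (\<forall>z v. MM x (z *s v) = z *s MM x v)"
  shows "dist a a' + dist b b' < r \<Longrightarrow> \<Phi> (pt a' b') $ j = \<Phi> (pt a' b) $ j + MM (pt a' 0) (pt 0 1) $ j * (b' - b)"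
    "dist a a' + dist b b' < r \<Longrightarrow> \<Phi> (pt a' b') $ j = \<Phi> (pt a b') $ j + MM (pt 0 b') (pt 1 0) $ j * (a' - a)"
proof -
  assume d: "dist a a' + dist b b' < r"
  show "\<Phi> (pt a' b') $ j = \<Phi> (pt a' b) $ j + MM (pt a' 0) (pt 0 1) $ j * (b' - b)"
  proof (rule constant_derivative[where r = "r - dist a a'"])
    fix w assume "w \<in> ball b (r - dist a a')"
    then have "pt a' w \<in> ball (pt a b) r" by (intro in_ball_pt) auto
    then show "((\<lambda>t. \<Phi> (pt a' t) $ j) has_field_derivative MM (pt a' 0) (pt 0 1) $ j) (at w)"
      using slice_derivative(1)[of \<Phi> a' w j] \<Phi> MM_slice(1)[of a' w j 0] by simp
  qed (use d in auto)
  show "\<Phi> (pt a' b') $ j = \<Phi> (pt a b') $ j + MM (pt 0 b') (pt 1 0) $ j * (a' - a)"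
  proof (rule constant_derivative[where r = "r - dist b b'"])
    fix w assume "w \<in> ball a (r - dist b b')"
    then have "pt w b' \<in> ball (pt a b) r" by (intro in_ball_pt) auto
    then show "((\<lambda>t. \<Phi> (pt t b') $ j) has_field_derivative MM (pt 0 b') (pt 1 0) $ j) (at w)"
      using slice_derivative(2)[of \<Phi> w b' j] \<Phi> MM_slice(2)[of w b' j 0] by simp
  qed (use d in auto)
qed

text \<open>The second column depends on the first coordinate only. It is holomorphic there, because a difference
  quotient of the affine lifts computes it, and doubly periodic, hence constant; and the deck
  transformation, which inverts the second coordinate, changes its sign.\<close>

lemma vertical_zero: "MM (pt a b) (pt 0 1) $ j = 0"
proof -
  let ?e = "\<lambda>a. MM (pt a 0) (pt 0 1) $ j"
  have P: "(2 * pi) *\<^sub>R e0 \<in> PL" "(2 * pi) *\<^sub>R e3 \<in> PL" by (intro Basis_PL e_Basis)+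
  have const: "?e a = ?e a'" for a a'
  proof (rule doubly_periodic_constant[of ?e])
    have "?e field_differentiable at a" for a
    proof -
      obtain r \<Phi> where r: "r > 0" and \<Phi>: "\<forall>x\<in>ball (pt a 0) r. (\<Phi> has_derivative MM x) (at x) \<and> (\<forall>z v. MM x (z *s v) = z *s MM x v)"
        using local_lift_MM[of "pt a 0"] by blast
      let ?b = "complex_of_real (r / 2)" and ?n = "\<lambda>b. MM (pt 0 b) (pt 1 0) $ j"
      let ?A = "\<lambda>w. (\<Phi> (pt a ?b) $ j + ?n ?b * (w - a) - (\<Phi> (pt a 0) $ j + ?n 0 * (w - a))) / ?b"
      \<comment> \<open>Both ends of a vertical segment of length \<open>r / 2\<close> move affinely in \<open>w\<close>, and their difference is the slope times the length.\<close>
      have eq: "?A w = ?e w" if "w \<in> ball a (r / 2)" for w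
      proof -
        have d: "dist a w + dist 0 ?b < r" "dist a w + dist 0 (0::complex) < r" using that r by auto
        have "?e w * ?b = \<Phi> (pt w ?b) $ j - \<Phi> (pt w 0) $ j" using lift_affine(1)[OF \<Phi> d(1), of j] by simp
        also have "\<dots> = \<Phi> (pt a ?b) $ j + ?n ?b * (w - a) - (\<Phi> (pt a 0) $ j + ?n 0 * (w - a))"
          using lift_affine(2)[OF \<Phi> d(1), of j] lift_affine(2)[OF \<Phi> d(2), of j] by simp
        finally have "?e w = ?A w" using r by (simp add: nonzero_eq_divide_eq del: of_real_divide)
        then show ?thesis by simp
      qed
      have hA: "?A holomorphic_on ball a (r / 2)" using r by (intro holomorphic_intros) auto
      have "?e holomorphic_on ball a (r / 2)" by (rule holomorphic_transform[OF hA]) (rule eq)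
      then show ?thesis using r by (intro holomorphic_on_imp_differentiable_at[of _ "ball a (r / 2)"]) auto
    qed
    then show "?e holomorphic_on UNIV" by (simp add: holomorphic_on_def field_differentiable_at_within)
  qed (simp_all only: pt_period MM_period[OF P(1)] MM_period[OF P(2)])
  have "deck (pt a 0) = pt (a + of_real pi) 0" "flip (pt 0 1) = (-1) *s pt 0 1"
    by (simp_all add: deck_def flip_def vec_eq_iff forall_2)
  moreover have "MM x ((-1) *s v) = (-1) *s MM x v" for x v using local_lift_MM[of x] by (metis centre_in_ball)
  ultimately have "?e a = - ?e (a + of_real pi)" using MM_flip[of "pt a 0" "pt 0 1"] by simp
  then have "?e a = 0" using const[of a "a + of_real pi"] by simp
  then show ?thesis using MM_slice(1)[of a b j 0] by simp
qed

text \<open>A vanishing vertical derivative makes \<open>f\<close> constant along vertical lines.\<close>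

lemma contradiction: False
proof -
  obtain r \<Phi> where r: "r > 0" "inj_on orb (ball (pt 0 0) r)"
    and \<Phi>: "\<forall>x\<in>ball (pt 0 0) r. cL (\<Phi> x) = f (orb x) \<and> (\<Phi> has_derivative MM x) (at x) \<and> (\<forall>z v. MM x (z *s v) = z *s MM x v)"
    using local_lift_MM[of "pt 0 0"] by blast
  let ?b = "complex_of_real (r / 2)"
  have d: "dist 0 (0::complex) + dist 0 ?b < r" using r by simp
  have "\<Phi> (pt 0 ?b) $ j = \<Phi> (pt 0 0) $ j" for j
  proof -
    have "\<Phi> (pt 0 ?b) $ j = \<Phi> (pt 0 0) $ j + MM (pt 0 0) (pt 0 1) $ j * (?b - 0)"
      by (rule lift_affine(1)[OF _ d]) (use \<Phi> in blast)
    then show ?thesis by (simp only: vertical_zero mult_zero_left add_0_right)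
  qed
  then have "\<Phi> (pt 0 ?b) = \<Phi> (pt 0 0)" by (simp add: vec_eq_iff)
  moreover have m: "pt 0 ?b \<in> ball (pt 0 0) r" "pt 0 0 \<in> ball (pt 0 0) r" using in_ball_pt[OF d] r by auto
  ultimately have "f (orb (pt 0 ?b)) = f (orb (pt 0 0))" using \<Phi> by metis
  then have "orb (pt 0 ?b) = orb (pt 0 0)" using inj by (auto dest: inj_onD)
  then have "pt 0 ?b = pt 0 0" using r(2) m by (auto dest: inj_onD)
  then show False using r(1) by (simp add: vec_eq_iff forall_2)
qed

end

lemma not_torus: "\<not> (\<exists>L :: (complex^2) set. full_lattice L \<and> biholomorphic XX AA (torus_topology L) (torus_atlas L))"
proof
  assume "\<exists>L :: (complex^2) set. full_lattice L \<and> biholomorphic XX AA (torus_topology L) (torus_atlas L)"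
  then obtain L :: "(complex^2) set" where L: "full_lattice L"
    and "biholomorphic XX AA (torus_topology L) (torus_atlas L)" by (elim exE conjE)
  then obtain f h where f: "holomorphic_map XX AA (torus_topology L) (torus_atlas L) f"
    and inv: "\<forall>p\<in>topspace XX. h (f p) = p"
    unfolding biholomorphic_def by (elim exE conjE)
  have "inj_on f (range orb)"
    by (rule inj_on_inverseI[of _ h]) (use inv in \<open>auto simp: topspace_quotient_topology\<close>)
  then have "torus_biholomorphism L f" using L f by (simp add: torus_biholomorphism_def)
  then show False by (rule torus_biholomorphism.contradiction)
qed

lemma hyperelliptic_X: "hyperelliptic_surface XX AA"
  unfolding hyperelliptic_surface_def
  by (intro conjI complex_manifold_X compact_X not_torus free_quotient_X fibration_X)

section \<open>Forms on the surface and invariant forms on the universal cover\<close>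

text \<open>A deck transformation is recovered from its value at one point, so that the transition map between
  two charts singles it out.\<close>

lemma deck_group_free:
  assumes "\<gamma> \<in> deck_group" "\<gamma>' \<in> deck_group" "\<gamma> x = \<gamma>' x"
  shows "\<gamma> = \<gamma>'"
proof -
  have far: False if "l \<in> PL" "m \<in> PL" "x + l = deck x + m" for l m
  proof -
    have "deck x + (m - l) = x" using that(3) by (simp add: algebra_simps)
    moreover have "m - l \<in> PL" using PL_intros that by blast
    ultimately show False using deck_far[of "m - l" x] pi_gt_zero by simp
  qed
  from assms(1) obtain l where l: "l \<in> PL" "\<gamma> = (\<lambda>x. x + l) \<or> \<gamma> = (\<lambda>x. deck x + l)"
    by (auto simp: deck_group_def translation_group_def)
  from assms(2) obtain m where m: "m \<in> PL" "\<gamma>' = (\<lambda>x. x + m) \<or> \<gamma>' = (\<lambda>x. deck x + m)"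
    by (auto simp: deck_group_def translation_group_def)
  show ?thesis using l(2) m(2) assms(3) far[OF l(1) m(1)] far[OF m(1) l(1)] by auto
qed

lemma id_deck_group: "(\<lambda>x. x) \<in> deck_group"
  using PL_intros(1) by (auto simp: deck_group_def translation_group_def intro!: image_eqI[of _ _ 0])

lemma AA_cases: "c \<in> AA \<Longrightarrow> \<exists>U. c = (U, orb) \<and> open U \<and> inj_on orb U"
  by (auto simp: quotient_atlas_def)

lemma AA_open: "c \<in> AA \<Longrightarrow> open (fst c)"
  by (auto simp: quotient_atlas_def)

lemma transition_deck:
  assumes c: "c \<in> AA" and d: "d \<in> AA" and x: "x \<in> overlap c d"
  shows "\<exists>\<gamma>\<in>deck_group. transition c d x = \<gamma> x \<and> Dtransition c d x = linear_part \<gamma>"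
proof -
  obtain \<gamma> N where g: "\<gamma> \<in> deck_group" and N: "open N" "x \<in> N" "\<forall>y\<in>N. transition c d y = \<gamma> y"
    using Q.local_rep_lift[of "\<lambda>p. p" orb "\<lambda>x. x", OF refl continuous_on_id c d x] by auto
  have "(transition c d has_derivative linear_part \<gamma>) (at x)"
    by (rule has_derivative_transform_within_open[OF Q.S_derivative[OF g] N(1,2)]) (use N(3) in auto)
  from frechet_derivative_at[OF this] show ?thesis using g N by auto
qed

lemma transition_orb:
  assumes "c \<in> AA" "d \<in> AA" "x \<in> fst c" "y \<in> fst d" "orb x = orb y"
  shows "x \<in> overlap c d" "transition c d x = y"
  using assms AA_cases[of c] AA_cases[of d] by (auto simp: local_dom_def local_rep_def)

definition invariant_form :: "(complex^2) lform \<Rightarrow> bool" where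
  "invariant_form \<alpha> \<longleftrightarrow> (\<forall>x. \<alpha> x \<in> exterior) \<and> (\<forall>vs. smooth_on UNIV (\<lambda>x. \<alpha> x vs)) \<and>
     (\<forall>\<gamma>\<in>deck_group. \<forall>x vs. \<alpha> x vs = \<alpha> (\<gamma> x) (map (linear_part \<gamma>) vs))"

text \<open>All charts restrict the same projection, so the expressions of a form in different charts agree where
  both are defined and an arbitrary chart may be chosen at each point.\<close>

definition lift_form :: "((complex^2) set, complex^2) form \<Rightarrow> (complex^2) lform" where
  "lift_form \<alpha> x = \<alpha> (SOME c. c \<in> AA \<and> x \<in> fst c) x"

definition descend_form :: "(complex^2) lform \<Rightarrow> ((complex^2) set, complex^2) form" where
  "descend_form \<beta> c x = (if c \<in> AA \<and> x \<in> fst c then \<beta> x else 0)"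

lemma chart_exists: "\<exists>c. c \<in> AA \<and> x \<in> fst c"
  using Q.chart_around[of x] by force

lemma forms_compatible:
  assumes \<alpha>: "\<alpha> \<in> smooth_forms AA" and c: "c \<in> AA" "d \<in> AA" "x \<in> fst c" and g: "\<gamma> \<in> deck_group" "\<gamma> x \<in> fst d"
  shows "\<alpha> c x vs = \<alpha> d (\<gamma> x) (map (linear_part \<gamma>) vs)"
proof -
  have "orb x = orb (\<gamma> x)" using Q.q_eq g by blast
  note t = transition_orb[OF c(1,2,3) g(2) this]
  obtain \<gamma>' where g': "\<gamma>' \<in> deck_group" "transition c d x = \<gamma>' x" "Dtransition c d x = linear_part \<gamma>'"
    using transition_deck[OF c(1,2) t(1)] by (elim bexE conjE)
  have "\<gamma>' = \<gamma>" using deck_group_free[OF g'(1) g(1), of x] g'(2) t(2) by simp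
  moreover have "\<alpha> c x vs = \<alpha> d (transition c d x) (map (Dtransition c d x) vs)"
    using \<alpha> c t(1) by (simp add: smooth_forms_def)
  ultimately show ?thesis using g' by simp
qed

lemma lift_form_eq:
  assumes "\<alpha> \<in> smooth_forms AA" "c \<in> AA" "x \<in> fst c"
  shows "\<alpha> c x = lift_form \<alpha> x"
proof
  fix vs
  let ?d = "SOME c. c \<in> AA \<and> x \<in> fst c"
  have d: "?d \<in> AA \<and> x \<in> fst ?d" by (rule someI_ex[OF chart_exists])
  have l: "linear_part (\<lambda>x. x) = (\<lambda>v :: complex^2. v)" by (simp add: linear_part_def fun_eq_iff)
  show "\<alpha> c x vs = lift_form \<alpha> x vs"
    using forms_compatible[OF assms(1,2) conjunct1[OF d] assms(3) id_deck_group conjunct2[OF d], of vs]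
    by (simp add: lift_form_def l)
qed

lemma invariant_lift_form:
  assumes \<alpha>: "\<alpha> \<in> smooth_forms AA"
  shows "invariant_form (lift_form \<alpha>)"
  unfolding invariant_form_def
proof (intro conjI allI ballI)
  fix x vs
  obtain c where c: "c \<in> AA" "x \<in> fst c" using chart_exists by blast
  have "\<alpha> c x \<in> exterior" using \<alpha> c by (auto simp: smooth_forms_def)
  then show "lift_form \<alpha> x \<in> exterior" by (simp only: lift_form_eq[OF \<alpha> c])
  fix \<gamma> assume g: "\<gamma> \<in> deck_group"
  obtain d where d: "d \<in> AA" "\<gamma> x \<in> fst d" using chart_exists by blast
  show "lift_form \<alpha> x vs = lift_form \<alpha> (\<gamma> x) (map (linear_part \<gamma>) vs)"
    using forms_compatible[OF \<alpha> c(1) d(1) c(2) g d(2)] lift_form_eq[OF \<alpha> c] lift_form_eq[OF \<alpha> d] by simp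
next
  fix vs
  show "smooth_on UNIV (\<lambda>x. lift_form \<alpha> x vs)"
  proof (rule smooth_on_local[OF open_UNIV])
    fix x :: "complex^2"
    obtain c where c: "c \<in> AA" "x \<in> fst c" using chart_exists by blast
    have "smooth_on (fst c) (\<lambda>x. \<alpha> c x vs)" using \<alpha> c by (simp add: smooth_forms_def)
    then have "smooth_on (fst c) (\<lambda>x. lift_form \<alpha> x vs)"
      by (rule smooth_on_cong[OF AA_open[OF c(1)], rotated]) (simp add: lift_form_eq[OF \<alpha> c(1)])
    then show "\<exists>U. open U \<and> x \<in> U \<and> smooth_on U (\<lambda>x. lift_form \<alpha> x vs)" using AA_open c by blast
  qed
qed

lemma descend_smooth:
  assumes \<beta>: "invariant_form \<beta>"
  shows "descend_form \<beta> \<in> smooth_forms AA"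
  unfolding smooth_forms_def mem_Collect_eq
proof (intro conjI ballI allI impI)
  fix c x vs assume c: "c \<in> AA" "x \<in> fst c"
  show "descend_form \<beta> c x \<in> exterior" using \<beta> c by (simp add: descend_form_def invariant_form_def)
next
  fix c vs assume c: "c \<in> AA"
  have "smooth_on (fst c) (\<lambda>x. \<beta> x vs)" using \<beta> smooth_on_subset[of UNIV] by (auto simp: invariant_form_def)
  then show "smooth_on (fst c) (\<lambda>x. descend_form \<beta> c x vs)"
    by (rule smooth_on_cong[OF AA_open[OF c], rotated]) (simp add: descend_form_def c)
next
  fix c d x vs assume c: "c \<in> AA" "d \<in> AA" "x \<in> overlap c d"
  obtain \<gamma> where g: "\<gamma> \<in> deck_group" "transition c d x = \<gamma> x" "Dtransition c d x = linear_part \<gamma>"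
    using transition_deck[OF c] by (elim bexE conjE)
  have x: "x \<in> fst c" "transition c d x \<in> fst d"
    using c(3) inv_into_into[of "snd c x" "snd d" "fst d"] by (simp_all add: local_dom_def local_rep_def)
  have "\<beta> x vs = \<beta> (\<gamma> x) (map (linear_part \<gamma>) vs)"
    using \<beta> g(1) unfolding invariant_form_def by (elim conjE) (drule (1) bspec, elim allE)
  then have "\<beta> x vs = \<beta> (transition c d x) (map (Dtransition c d x) vs)" by (simp only: g(2,3))
  then show "descend_form \<beta> c x vs = descend_form \<beta> d (transition c d x) (map (Dtransition c d x) vs)"
    by (simp only: descend_form_def c(1,2) x simp_thms if_True)
qed (auto simp: descend_form_def)

lemma descend_lift: "\<alpha> \<in> smooth_forms AA \<Longrightarrow> descend_form (lift_form \<alpha>) = \<alpha>"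
proof (intro ext)
  fix c x vs assume \<alpha>: "\<alpha> \<in> smooth_forms AA"
  show "descend_form (lift_form \<alpha>) c x vs = \<alpha> c x vs"
  proof (cases "c \<in> AA \<and> x \<in> fst c")
    case True
    then show ?thesis using lift_form_eq[OF \<alpha>, of c x] by (simp add: descend_form_def)
  next
    case False
    moreover have "\<forall>c x. \<not> (c \<in> AA \<and> x \<in> fst c) \<longrightarrow> \<alpha> c x = 0"
      using \<alpha> unfolding smooth_forms_def by blast
    ultimately have "\<alpha> c x = 0" by blast
    then show ?thesis using False by (auto simp: descend_form_def)
  qed
qed

lemma invariant_pform:
  assumes "invariant_form \<alpha>"
  shows "pform \<alpha>" "deck_invariant \<alpha>"
proof -
  have "\<alpha> (x + (2 * pi) *\<^sub>R i) vs = \<alpha> x vs" if "i \<in> Basis" for x i vs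
  proof -
    have g: "(\<lambda>x. x + (2 * pi) *\<^sub>R i) \<in> deck_group"
      using Basis_PL[OF that] by (auto simp: deck_group_def translation_group_def)
    have "linear_part (\<lambda>x. x + (2 * pi) *\<^sub>R i) = (\<lambda>v. v)" by (simp add: linear_part_def fun_eq_iff)
    moreover have "\<alpha> x vs = \<alpha> (x + (2 * pi) *\<^sub>R i) (map (linear_part (\<lambda>x. x + (2 * pi) *\<^sub>R i)) vs)"
      using assms g unfolding invariant_form_def by (elim conjE) (drule (1) bspec, elim allE)
    ultimately show ?thesis by simp
  qed
  then show "pform \<alpha>" using assms by (simp add: pform_def smooth_periodic_def periodic_def invariant_form_def)
  have "deck \<in> deck_group" unfolding deck_group_def using PL_intros(1) by (auto intro!: image_eqI[of _ _ 0])
  moreover have "linear_part deck = flip" by (simp add: linear_part_def fun_eq_iff deck_flip linear_0[OF linear_flip])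
  ultimately show "deck_invariant \<alpha>" using assms unfolding deck_invariant_def invariant_form_def by metis
qed

text \<open>The operators are local, so they may be computed on the universal cover.\<close>

definition local_operator :: "((complex^2) lform \<Rightarrow> (complex^2) lform) \<Rightarrow> bool" where
  "local_operator P \<longleftrightarrow> (\<forall>U \<alpha> \<beta>. open U \<longrightarrow> (\<forall>x\<in>U. \<alpha> x = \<beta> x) \<longrightarrow> (\<forall>x\<in>U. P \<alpha> x = P \<beta> x))"

lemma local_operatorD: "local_operator P \<Longrightarrow> open U \<Longrightarrow> (\<And>x. x \<in> U \<Longrightarrow> \<alpha> x = \<beta> x) \<Longrightarrow> x \<in> U \<Longrightarrow> P \<alpha> x = P \<beta> x"
  unfolding local_operator_def by blast

lemma local_pointwise: "(\<And>\<alpha> x. P \<alpha> x = h x (\<alpha> x)) \<Longrightarrow> local_operator P"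
  by (simp add: local_operator_def)

lemma local_compose: "local_operator P \<Longrightarrow> local_operator R \<Longrightarrow> local_operator (\<lambda>\<alpha>. P (R \<alpha>))"
  unfolding local_operator_def by blast

lemma local_add: "local_operator P \<Longrightarrow> local_operator R \<Longrightarrow> local_operator (\<lambda>\<alpha>. P \<alpha> + R \<alpha>)"
  and local_uminus: "local_operator P \<Longrightarrow> local_operator (\<lambda>\<alpha>. - P \<alpha>)"
  unfolding local_operator_def by (metis plus_fun_apply, metis uminus_apply)

lemma local_sum: "(\<And>i. i \<in> I \<Longrightarrow> local_operator (P i)) \<Longrightarrow> local_operator (\<lambda>\<alpha> x vs. \<Sum>i\<in>I. P i \<alpha> x vs)"
proof -
  assume a: "\<And>i. i \<in> I \<Longrightarrow> local_operator (P i)"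
  show ?thesis
    unfolding local_operator_def
  proof (intro allI impI ballI ext sum.cong refl)
    fix U and \<alpha> \<beta> :: "(complex^2) lform" and x vs i
    assume h: "open U" "\<forall>x\<in>U. \<alpha> x = \<beta> x" "x \<in> U" "i \<in> I"
    show "P i \<alpha> x vs = P i \<beta> x vs" using local_operatorD[OF a[OF h(4)] h(1) _ h(3), of \<alpha> \<beta>] h(2) by simp
  qed
qed

lemma local_ext_d: "local_operator ext_d"
  unfolding local_operator_def using ext_d_cong by blast

lemma local_star: "local_operator (star gg JJ)"
  by (rule local_pointwise[where h = "\<lambda>x. hodge_star inner (JJ x)"]) (simp add: star_def)

lemma local_PP: "local_operator (PP p q)"
  by (rule local_pointwise[where h = "\<lambda>x. bidegree_part (JJ x) p q"]) (simp add: PP_def)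

lemma local_del: "local_operator (del JJ)"
proof -
  have "local_operator (\<lambda>\<alpha> x vs. \<Sum>p\<le>2. \<Sum>q\<le>2. PP (Suc p) q (ext_d (PP p q \<alpha>)) x vs)"
    by (intro local_sum local_compose[OF local_PP local_compose[OF local_ext_d local_PP]])
  then show ?thesis unfolding del_eq[abs_def, symmetric] .
qed

lemma local_delbar: "local_operator (delbar JJ)"
proof -
  have "local_operator (\<lambda>\<alpha> x vs. \<Sum>p\<le>2. \<Sum>q\<le>2. PP p (Suc q) (ext_d (PP p q \<alpha>)) x vs)"
    by (intro local_sum local_compose[OF local_PP local_compose[OF local_ext_d local_PP]])
  then show ?thesis unfolding delbar_eq[abs_def, symmetric] .
qed

lemma local_adj: "local_operator (d_adj gg JJ)" "local_operator (del_adj gg JJ)" "local_operator (delbar_adj gg JJ)"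
  unfolding d_adj_def[abs_def] del_adj_def[abs_def] delbar_adj_def[abs_def]
  by (intro local_uminus local_compose[OF local_star] local_compose[OF local_ext_d] local_compose[OF local_del]
      local_compose[OF local_delbar] local_star)+

lemma local_bott_chern: "local_operator (bott_chern_laplacian gg JJ)"
  unfolding bott_chern_laplacian_def[abs_def]
  by (intro local_add local_compose[OF local_del] local_compose[OF local_delbar] local_compose[OF local_adj(2)]
      local_compose[OF local_adj(3)] local_del local_delbar local_adj)

lemma local_hodge: "local_operator (hodge_laplacian gg JJ)"
  unfolding hodge_laplacian_def[abs_def]
  by (intro local_add local_compose[OF local_ext_d] local_compose[OF local_adj(1)] local_ext_d local_adj)

lemma local_on_chart:
  assumes "local_operator P" "\<alpha> \<in> smooth_forms AA" "c \<in> AA" "x \<in> fst c"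
  shows "P (\<alpha> c) x = P (lift_form \<alpha>) x"
  by (rule local_operatorD[OF assms(1) AA_open[OF assms(3)] lift_form_eq[OF assms(2,3)] assms(4)])

lemma local_on_chart_descend:
  assumes "local_operator P" "c \<in> AA" "x \<in> fst c"
  shows "P (descend_form \<beta> c) x = P \<beta> x"
  by (rule local_operatorD[OF assms(1) AA_open[OF assms(2)] _ assms(3)]) (simp add: descend_form_def assms(2))

lemma forms_eq_zero_iff:
  assumes "local_operator P" "\<alpha> \<in> smooth_forms AA"
  shows "forms_eq AA (\<lambda>c. P (\<alpha> c)) 0 \<longleftrightarrow> P (lift_form \<alpha>) = (\<lambda>x vs. 0)"
proof
  assume "forms_eq AA (\<lambda>c. P (\<alpha> c)) 0"
  then have "P (lift_form \<alpha>) x = (\<lambda>vs. 0)" for x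
    using chart_exists[of x] local_on_chart[OF assms] unfolding forms_eq_def by (metis zero_fun_def)
  then show "P (lift_form \<alpha>) = (\<lambda>x vs. 0)" by (rule ext)
next
  assume "P (lift_form \<alpha>) = (\<lambda>x vs. 0)"
  then show "forms_eq AA (\<lambda>c. P (\<alpha> c)) 0"
    using local_on_chart[OF assms] unfolding forms_eq_def by (simp add: zero_fun_def)
qed

lemma lift_descend: "invariant_form \<beta> \<Longrightarrow> lift_form (descend_form \<beta>) = \<beta>"
proof
  fix x assume \<beta>: "invariant_form \<beta>"
  obtain c where c: "c \<in> AA" "x \<in> fst c" using chart_exists by blast
  show "lift_form (descend_form \<beta>) x = \<beta> x"
    using lift_form_eq[OF descend_smooth[OF \<beta>] c] c by (simp add: descend_form_def)
qed

section \<open>Invariance of the structures\<close>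

lemma f_period:
  assumes "l \<in> PL"
  shows "f1 (x + l) = f1 x" "f2 (x + l) = f2 x"
proof -
  obtain n :: int where n: "l \<bullet> e0 = of_int n * (2 * pi)" using assms by (auto simp: in_PL period_def)
  have "cos (of_int n * (2 * pi)) = 1" "sin (of_int n * (2 * pi)) = 0"
    using cos_int_2pin[of n] sin_int_2pin[of n] by (simp_all add: mult.commute mult.left_commute)
  then show "f1 (x + l) = f1 x" "f2 (x + l) = f2 x"
    by (simp_all add: f1_def f2_def inner_add_left n cos_add sin_add)
qed

lemma flip_isometry: "flip u \<bullet> flip v = u \<bullet> v"
  by (simp add: inner_vec_def sum_2 flip_def)

lemma flip_f: "flip (f1 x) = - f1 x" "flip (f2 x) = - f2 x"
  by (simp_all add: f1_def f2_def linear_add[OF linear_flip] linear_diff[OF linear_flip] linear_scale[OF linear_flip] flip_e)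

lemma deck_group_frame:
  assumes "\<gamma> \<in> deck_group"
  shows "linear_part \<gamma> u \<bullet> linear_part \<gamma> v = u \<bullet> v"
    "linear_part \<gamma> e0 = e0" "linear_part \<gamma> e3 = e3"
    "linear_part \<gamma> (f1 x) = f1 (\<gamma> x)" "linear_part \<gamma> (f2 x) = f2 (\<gamma> x)"
proof -
  obtain l where l: "l \<in> PL" "\<gamma> = (\<lambda>x. x + l) \<or> \<gamma> = (\<lambda>x. deck x + l)"
    using assms by (auto simp: deck_group_def translation_group_def)
  have "(linear_part \<gamma> = (\<lambda>v. v) \<and> f1 (\<gamma> x) = f1 x \<and> f2 (\<gamma> x) = f2 x) \<or>
    (linear_part \<gamma> = flip \<and> f1 (\<gamma> x) = - f1 x \<and> f2 (\<gamma> x) = - f2 x)" for x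
    using l(2) f_period[OF l(1)]
  proof (elim disjE)
    assume g: "\<gamma> = (\<lambda>x. x + l)"
    show ?thesis by (rule disjI1) (use f_period[OF l(1)] in \<open>simp add: g linear_part_def fun_eq_iff\<close>)
  next
    assume g: "\<gamma> = (\<lambda>x. deck x + l)"
    have "linear_part \<gamma> = flip" by (simp add: g linear_part_def fun_eq_iff deck_flip linear_0[OF linear_flip])
    then show ?thesis using f_period[OF l(1), of "deck x"] by (simp add: g f1_deck f2_deck)
  qed
  from this[of x] show "linear_part \<gamma> u \<bullet> linear_part \<gamma> v = u \<bullet> v"
    "linear_part \<gamma> e0 = e0" "linear_part \<gamma> e3 = e3"
    "linear_part \<gamma> (f1 x) = f1 (\<gamma> x)" "linear_part \<gamma> (f2 x) = f2 (\<gamma> x)"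
    by (auto simp: flip_isometry flip_e flip_f)
qed

lemma deck_group_dual:
  assumes "\<gamma> \<in> deck_group"
  shows "linear_part \<gamma> v \<bullet> e0 = v \<bullet> e0" "linear_part \<gamma> v \<bullet> e3 = v \<bullet> e3"
    "linear_part \<gamma> v \<bullet> f1 (\<gamma> x) = v \<bullet> f1 x" "linear_part \<gamma> v \<bullet> f2 (\<gamma> x) = v \<bullet> f2 x"
  using deck_group_frame[OF assms] by metis+

lemma JJ_equivariant: "\<gamma> \<in> deck_group \<Longrightarrow> linear_part \<gamma> (JJ x v) = JJ (\<gamma> x) (linear_part \<gamma> v)"
proof -
  assume g: "\<gamma> \<in> deck_group"
  have l: "linear (linear_part \<gamma>)" using Q.lin[OF g] by (rule bounded_linear.linear)
  show ?thesis
    unfolding JJ_def linear_add[OF l] linear_diff[OF l] linear_scale[OF l] deck_group_frame[OF g] deck_group_dual[OF g] ..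
qed

lemma smooth_JJ: "smooth_on UNIV (\<lambda>x. JJ x v)"
proof -
  have s: "smooth_on UNIV (\<lambda>x. Re (complex_of_real (JJ x v \<bullet> e)) *\<^sub>R e)" if "e \<in> {e0, e1, e2, e3}" for e
    by (rule smooth_on_linear[OF _ open_UNIV, of "\<lambda>z. Re z *\<^sub>R e"])
      (use sp_JJ[OF that] in \<open>auto intro!: bounded_linear_compose[OF bounded_linear_scaleR_left bounded_linear_Re] simp: smooth_periodic_def\<close>)
  have "smooth_on UNIV (\<lambda>x. Re (complex_of_real (JJ x v \<bullet> e0)) *\<^sub>R e0 + Re (complex_of_real (JJ x v \<bullet> e1)) *\<^sub>R e1
    + Re (complex_of_real (JJ x v \<bullet> e2)) *\<^sub>R e2 + Re (complex_of_real (JJ x v \<bullet> e3)) *\<^sub>R e3)"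
    by (intro smooth_on_add[OF open_UNIV] s) auto
  then show ?thesis using E.frame_expand[of "JJ _ v"] by simp
qed

abbreviation "JF \<equiv> (\<lambda>c :: ((complex^2) set, complex^2) chart. JJ)"
abbreviation "GF \<equiv> (\<lambda>c :: ((complex^2) set, complex^2) chart. gg)"

lemma acs_X: "almost_complex_structure AA JF"
  unfolding almost_complex_structure_def
proof (intro conjI ballI allI)
  fix c d x v assume c: "c \<in> AA" "d \<in> AA" "x \<in> overlap c d"
  show "Dtransition c d x (JJ x v) = JJ (transition c d x) (Dtransition c d x v)"
    using transition_deck[OF c] JJ_equivariant by auto
qed (auto simp: H.linJ H.J_square intro: smooth_on_subset[OF smooth_JJ])

lemma hermitian_X: "almost_hermitian AA JF GF"
  unfolding almost_hermitian_def riemannian_metric_def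
proof (intro conjI ballI allI acs_X)
  fix c d x u v assume c: "c \<in> AA" "d \<in> AA" "x \<in> overlap c d"
  show "u \<bullet> v = Dtransition c d x u \<bullet> Dtransition c d x v"
    using transition_deck[OF c] deck_group_frame(1) by auto
next
  fix c and u v :: "complex^2" assume "c \<in> AA"
  then show "smooth_on (fst c) (\<lambda>x. u \<bullet> v)" by (intro smooth_on_const AA_open)
qed (auto simp: H.J_isometry inner_commute bilinear_def linear_iff inner_simps)

section \<open>Non-integrability and the Lee form\<close>

lemma invariantI:
  assumes "\<And>x. \<alpha> x \<in> exterior" "pform \<alpha>" "\<And>\<gamma> x vs. \<gamma> \<in> deck_group \<Longrightarrow> \<alpha> x vs = \<alpha> (\<gamma> x) (map (linear_part \<gamma>) vs)"
  shows "invariant_form \<alpha>"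
  unfolding invariant_form_def
  by (intro conjI allI ballI) (rule assms pform_smooth[OF assms(2)] | assumption)+

text \<open>The covector \<open>dw + \<i> f1\<close> of type \<open>(1,0)\<close>. It detects the Nijenhuis tensor, since
  \<open>d phi = \<i> dw \<and> f2\<close> has a \<open>(0,2)\<close>-component.\<close>

definition phi :: "(complex^2) lform" where
  "phi x = cov (\<lambda>v. of_real (v \<bullet> e0) + \<i> * of_real (v \<bullet> f1 x))"

lemma phi_single: "phi x [v] = of_real (v \<bullet> e0) + \<i> * (cw x * of_real (v \<bullet> e1) + sw x * of_real (v \<bullet> e2))"
  by (simp add: phi_def f1_def inner_add_right)

lemma linear_complex_dual: "linear (\<lambda>v. complex_of_real (v \<bullet> a) + z * of_real (v \<bullet> b))"
  by (simp add: linear_iff inner_add_left scaleR_conv_of_real algebra_simps)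

lemma pform_phi: "pform phi"
proof (rule pform_frameI)
  show "phi x \<in> exterior" for x unfolding phi_def by (rule exterior_cov[OF linear_complex_dual])
  fix vs assume "vs \<in> EF"
  then show "smooth_periodic (\<lambda>x. phi x vs)"
  proof (cases "length vs = 1")
    case True
    then obtain v where "vs = [v]" by (auto simp: length_Suc_conv)
    then show ?thesis by (auto simp: phi_single intro!: sp_intros)
  next
    case False
    then show ?thesis by (simp add: phi_def cov_def sp_const)
  qed
qed

lemma invariant_phi: "invariant_form phi"
proof (rule invariantI[OF pform_exterior[OF pform_phi] pform_phi])
  fix \<gamma> x vs assume g: "\<gamma> \<in> deck_group"
  show "phi x vs = phi (\<gamma> x) (map (linear_part \<gamma>) vs)"
    by (cases "length vs = 1") (auto simp: phi_def cov_def length_Suc_conv deck_group_dual[OF g])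
qed

lemma type10_phi: "of_bidegree (JJ x) 1 0 (phi x)"
proof -
  have "phi x [JJ x v] = \<i> * phi x [v]" for v
    unfolding phi_def by (simp add: H.J_expand[of x v] inner_simps algebra_simps)
  from of_bidegree.wedge10[OF pform_exterior[OF pform_phi] _ this of_bidegree.unit]
  have "of_bidegree (JJ x) (Suc 0) 0 (wedge (phi x) unit_covec)" by (simp add: phi_def)
  moreover have "wedge (phi x) unit_covec = phi x" by (rule ext) (rule wedge_unit_right)
  ultimately show ?thesis by simp
qed

lemma ext_d_phi: "ext_d phi x [u, v] = \<i> * (of_real (u \<bullet> e0) * of_real (v \<bullet> f2 x) - of_real (v \<bullet> e0) * of_real (u \<bullet> f2 x))"
proof -
  have d: "dd u (\<lambda>y. phi y [v]) x = \<i> * (of_real (u \<bullet> e0) * of_real (v \<bullet> f2 x))" for u v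
  proof -
    have "((\<lambda>y. complex_of_real (v \<bullet> e0) + \<i> * of_real (cos (y \<bullet> e0) * (v \<bullet> e1) + sin (y \<bullet> e0) * (v \<bullet> e2)))
      has_derivative (\<lambda>u. \<i> * of_real ((u \<bullet> e0) * (v \<bullet> f2 x)))) (at x)"
      by (auto intro!: derivative_eq_intros simp: f2_def inner_simps fun_eq_iff algebra_simps)
    from dd_eq[OF this, of u] show ?thesis by (simp add: phi_single)
  qed
  show ?thesis by (simp add: ext_d_alternation d algebra_simps)
qed

lemma not_integrable_X: "\<not> integrable_acs AA JF"
proof
  assume "integrable_acs AA JF"
  moreover have s: "descend_form phi \<in> smooth_forms AA" by (rule descend_smooth[OF invariant_phi])
  ultimately have eq: "forms_eq AA (\<lambda>c. ext_d (descend_form phi c)) (\<lambda>c. del JJ (descend_form phi c) + delbar JJ (descend_form phi c))"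
    unfolding integrable_acs_def by blast
  obtain c where c: "c \<in> AA" "0 \<in> fst c" using chart_exists by blast
  have "ext_d phi 0 = del JJ phi 0 + delbar JJ phi 0"
    using eq c local_on_chart_descend[OF local_ext_d c, of phi] local_on_chart_descend[OF local_del c, of phi]
      local_on_chart_descend[OF local_delbar c, of phi] by (simp add: forms_eq_def)
  moreover note P = PP_of_bidegree[where \<alpha> = phi, OF type10_phi]
  have "del JJ phi 0 = PP 2 0 (ext_d phi) 0" "delbar JJ phi 0 = PP 1 1 (ext_d phi) 0"
    by (intro ext; simp add: del_eq delbar_eq sum_le2 P ext_d_zero PP_zero numeral_2_eq_2)+
  ultimately have d: "ext_d phi 0 = (\<lambda>vs. PP 2 0 (ext_d phi) 0 vs + PP 1 1 (ext_d phi) 0 vs)"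
    by (simp add: fun_eq_iff)
  \<comment> \<open>The product of two covectors of type (0,1): it is orthogonal to the bidegrees (2,0) and (1,1), but not to \<open>d phi\<close>.\<close>
  let ?t1 = "cov (\<lambda>v. complex_of_real (v \<bullet> e0) + (- \<i>) * of_real (v \<bullet> f1 0))"
  let ?t2 = "cov (\<lambda>v. complex_of_real (v \<bullet> f2 0) + (- \<i>) * of_real (v \<bullet> e3))"
  let ?\<psi> = "wedge ?t1 (wedge ?t2 unit_covec)"
  have t: "?t1 [JJ 0 v] = - \<i> * ?t1 [v]" "?t2 [JJ 0 v] = - \<i> * ?t2 [v]" for v
    by (simp_all add: H.J_expand[of 0 v] inner_simps algebra_simps)
  have "of_bidegree (JJ 0) 0 (Suc (Suc 0)) ?\<psi>"
    by (intro of_bidegree.wedge01 exterior_cov linear_complex_dual has_degree_cov(1) t of_bidegree.unit)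
  then have \<psi>: "eigen_bidegree (JJ 0) 0 2 ?\<psi>" by (simp add: of_bidegree_eigen numeral_2_eq_2)
  have e: "eigen_bidegree (JJ 0) p q (PP p q (ext_d phi) 0)" for p q
    unfolding PP_def by (rule of_bidegree_eigen[OF H.of_bidegree_part[OF pform_exterior[OF pform_ext_d[OF pform_phi]]]])
  have o: "H.herm 0 (PP p q (ext_d phi) 0) ?\<psi> = 0" if "(p, q) \<noteq> (0, 2)" for p q
    by (rule H.eigen_orthogonal[OF e \<psi>]) (use that in auto)
  have "H.herm 0 (ext_d phi 0) ?\<psi> = 0"
    unfolding d H.herm_add_left by (subst (1 2) o) auto
  moreover have "has_degree 2 (ext_d phi 0)"
    using has_degree_ext_d[of 1 phi 0] by (simp add: phi_def numeral_2_eq_2)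
  then have "ext_d phi 0 vs = 0" if "length vs \<noteq> 2" for vs using that by (simp add: has_degree_def)
  moreover have "?\<psi> [e0, f2 0] = 1"
    by (simp add: unit_covec_def)
  ultimately show False
    by (simp add: H.herm_def H.sum_subframe ext_d_phi)
qed

definition lee :: "(complex^2) lform" where "lee x = cov (\<lambda>v. - of_real (v \<bullet> e3))"

lemma pform_lee: "pform lee"
proof -
  have "linear (\<lambda>v. - complex_of_real (v \<bullet> e3))"
    by (simp add: linear_iff inner_add_left scaleR_conv_of_real[where 'a = complex])
  then show ?thesis by (simp add: pform_def lee_def exterior_cov sp_const)
qed

lemma invariant_lee: "invariant_form lee"
proof (rule invariantI[OF pform_exterior[OF pform_lee] pform_lee])
  fix \<gamma> x vs assume g: "\<gamma> \<in> deck_group"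
  show "lee x vs = lee (\<gamma> x) (map (linear_part \<gamma>) vs)"
    by (cases "length vs = 1") (auto simp: lee_def cov_def length_Suc_conv deck_group_dual[OF g])
qed

definition omega :: "(complex^2) lform" where "omega x = fundamental_covec inner (JJ x)"

lemma omega_E: "omega x [e0,e1] = cw x" "omega x [e0,e2] = sw x" "omega x [e0,e3] = 0"
  "omega x [e1,e2] = 0" "omega x [e1,e3] = - sw x" "omega x [e2,e3] = cw x"
  by (simp_all add: omega_def fundamental_covec_def JJ_component)

lemma has_degree_omega: "has_degree 2 (omega x)"
  by (simp add: omega_def fundamental_covec_def has_degree_def)

lemma pform_omega: "pform omega"
proof (rule pform_frameI)
  show "omega x \<in> exterior" for x unfolding omega_def by (rule H.exterior_fundamental)
  have z: "omega x vs = 0" if "length vs \<noteq> 2" for x vs using that has_degree_omega by (simp add: has_degree_def)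
  fix vs assume "vs \<in> EF"
  then show "smooth_periodic (\<lambda>x. omega x vs)"
    unfolding subframe_def by (elim insertE emptyE) (simp_all add: omega_E z sp_intros)
qed

text \<open>Since \<open>d f1 = dw \<and> f2\<close> and \<open>d f2 = - dw \<and> f1\<close>, the derivative of \<open>\<omega> = dw \<and> f1 + f2 \<and> dz\<close> is
  \<open>- dw \<and> f1 \<and> dz = - dz \<and> \<omega>\<close>.\<close>

lemma ext_d_omega: "ext_d omega x = wedge (lee x) (omega x)"
proof (rule E.exterior_eqI)
  show "ext_d omega x \<in> exterior" by (rule pform_exterior[OF pform_ext_d[OF pform_omega]])
  show "wedge (lee x) (omega x) \<in> exterior"
    by (intro exterior_wedge pform_exterior[OF pform_lee] pform_exterior[OF pform_omega])
  fix vs assume vs: "vs \<in> EF"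
  show "ext_d omega x vs = wedge (lee x) (omega x) vs"
  proof (cases "length vs = 3")
    case True
    then have "vs \<in> {[e1,e2,e3], [e0,e2,e3], [e0,e1,e3], [e0,e1,e2]}"
      using vs unfolding subframe_def by (elim insertE emptyE) simp_all
    then show ?thesis
      by (elim insertE emptyE) (simp_all add: ext_d_alternation omega_E lee_def spd sp_trig)
  next
    case False
    have "has_degree (Suc 2) (wedge (lee x) (omega x))"
      unfolding lee_def by (rule has_degree_wedge_1[OF has_degree_cov(1) has_degree_omega])
    moreover have "has_degree (Suc 2) (ext_d omega x)"
      by (rule has_degree_ext_d) (rule has_degree_omega)
    ultimately show ?thesis using False by (simp add: has_degree_def)
  qed
qed

lemma ext_d_lee: "ext_d lee = (\<lambda>x vs. 0)"
  by (intro ext) (simp add: ext_d_alternation alternation_def lee_def)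

text \<open>A primitive would be a periodic function which differs from the non-periodic function \<open>- z\<close> by a
  constant.\<close>

lemma lee_not_exact:
  assumes F: "invariant_form F" and d: "ext_d F = lee"
  shows False
proof -
  let ?F = "\<lambda>x. F x []" and ?z = "\<lambda>x :: complex^2. complex_of_real (x \<bullet> e3)"
  have sF: "smooth_on UNIV ?F" using F by (simp add: invariant_form_def)
  have lz: "bounded_linear ?z"
    by (rule bounded_linear_compose[OF bounded_linear_of_real bounded_linear_inner_left])
  have sz: "smooth_on UNIV ?z" using smooth_on_affine[OF open_UNIV lz, of 0] by simp
  have "dd v ?F x = lee x [v]" for v x
    using fun_cong[OF fun_cong[OF d, of x], of "[v]"] by (simp add: ext_d_alternation)
  then have "dd v (\<lambda>x. ?F x + ?z x) x = 0" for v x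
    using dd_add[OF sF sz, of x v] dd_eq[OF bounded_linear_imp_has_derivative[OF lz], of v x] by (simp add: lee_def)
  then have c: "?F x + ?z x = ?F y + ?z y" for x y
    by (intro constant_if_dd_zero smooth_on_add[OF open_UNIV sF sz])
  have "?F (0 + (2 * pi) *\<^sub>R e3) = ?F 0"
    using invariant_pform(1)[OF F] e_Basis(4) unfolding pform_def smooth_periodic_def periodic_def by blast
  then show False using c[of "0 + (2 * pi) *\<^sub>R e3" 0] by simp
qed

lemma lcaK_X: "strictly_lcaK AA JF GF"
  unfolding strictly_lcaK_def
proof (intro conjI hermitian_X bexI[of _ "descend_form lee"])
  have om: "fundamental_form GF JF c = omega" for c
    by (rule ext) (simp add: fundamental_form_def omega_def)
  show "forms_eq AA (\<lambda>c. ext_d (fundamental_form GF JF c))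
      (\<lambda>c x. wedge (descend_form lee c x) (fundamental_form GF JF c x))"
    unfolding forms_eq_def om by (simp add: ext_d_omega descend_form_def)
  show "forms_eq AA (\<lambda>c. ext_d (descend_form lee c)) 0"
    unfolding forms_eq_def by (simp add: local_on_chart_descend[OF local_ext_d] ext_d_lee zero_fun_def)
  show "descend_form lee \<in> real_k_forms AA 1"
    unfolding real_k_forms_def using descend_smooth[OF invariant_lee]
    by (auto simp: descend_form_def lee_def cov_def has_degree_def)
  show "\<not> (\<exists>f\<in>real_k_forms AA 0. forms_eq AA (\<lambda>c. ext_d (f c)) (descend_form lee))"
  proof
    assume "\<exists>f\<in>real_k_forms AA 0. forms_eq AA (\<lambda>c. ext_d (f c)) (descend_form lee)"
    then obtain f where f: "f \<in> smooth_forms AA" and eq: "forms_eq AA (\<lambda>c. ext_d (f c)) (descend_form lee)"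
      by (auto simp: real_k_forms_def)
    have "ext_d (lift_form f) x = lee x" for x
    proof -
      obtain c where c: "c \<in> AA" "x \<in> fst c" using chart_exists by blast
      have "ext_d (f c) x = descend_form lee c x" using eq c by (simp add: forms_eq_def)
      then show ?thesis using local_on_chart[OF local_ext_d f c] c by (simp add: descend_form_def)
    qed
    then show False using lee_not_exact[OF invariant_lift_form[OF f]] by blast
  qed
qed

section \<open>The two dimensions\<close>

lemma invariant_hform: "invariant_form (hform \<kappa> \<mu>)"
proof (rule invariantI[OF exterior_hform pform_hform])
  fix \<gamma> x vs assume g: "\<gamma> \<in> deck_group"
  have l: "linear_part \<gamma> = (\<lambda>v. v) \<or> linear_part \<gamma> = flip" by (rule linear_part_deck_group[OF g])
  have "wedge (cov (\<lambda>v. complex_of_real (linear_part \<gamma> v \<bullet> e1))) (cov (\<lambda>v. complex_of_real (linear_part \<gamma> v \<bullet> e2))) vs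
    = wedge (cov (\<lambda>v. of_real (v \<bullet> e1))) (cov (\<lambda>v. of_real (v \<bullet> e2))) vs"
    using l by (auto simp: cov_uminus wedge_uminus_left wedge_uminus_right)
  then show "hform \<kappa> \<mu> x vs = hform \<kappa> \<mu> (\<gamma> x) (map (linear_part \<gamma>) vs)"
    unfolding hform_def wedge_map cov_map by (simp add: deck_group_dual[OF g])
qed

abbreviation "HF \<kappa> \<mu> \<equiv> descend_form (hform \<kappa> \<mu>)"

lemma bott_chern_set: "bott_chern_harmonic AA JF GF 1 1 = {HF \<kappa> \<mu> | \<kappa> \<mu>. True}"
proof (intro subset_antisym subsetI)
  fix \<alpha> assume "\<alpha> \<in> bott_chern_harmonic AA JF GF 1 1"
  then have \<alpha>: "\<alpha> \<in> smooth_forms AA" and t: "\<forall>c\<in>AA. \<forall>x\<in>fst c. of_bidegree (JJ x) 1 1 (\<alpha> c x)"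
    and z: "forms_eq AA (\<lambda>c. bott_chern_laplacian gg JJ (\<alpha> c)) 0"
    by (auto simp: bott_chern_harmonic_def pq_forms_def)
  note inv = invariant_pform[OF invariant_lift_form[OF \<alpha>]]
  have t': "of_bidegree (JJ x) 1 1 (lift_form \<alpha> x)" for x
  proof -
    obtain c where c: "c \<in> AA" "x \<in> fst c" using chart_exists by blast
    then have "of_bidegree (JJ x) 1 1 (\<alpha> c x)" using t by blast
    then show ?thesis by (simp only: lift_form_eq[OF \<alpha> c])
  qed
  obtain \<kappa> \<mu> where "lift_form \<alpha> = hform \<kappa> \<mu>"
    using bott_chern_classification[OF inv(1) t' _ inv(2)] forms_eq_zero_iff[OF local_bott_chern \<alpha>] z by blast
  then have "\<alpha> = HF \<kappa> \<mu>" using descend_lift[OF \<alpha>] by simp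
  then show "\<alpha> \<in> {HF \<kappa> \<mu> | \<kappa> \<mu>. True}" by blast
next
  fix \<alpha> assume "\<alpha> \<in> {HF \<kappa> \<mu> | \<kappa> \<mu>. True}"
  then obtain \<kappa> \<mu> where \<alpha>: "\<alpha> = HF \<kappa> \<mu>" by blast
  have s: "HF \<kappa> \<mu> \<in> smooth_forms AA" by (rule descend_smooth[OF invariant_hform])
  have "forms_eq AA (\<lambda>c. bott_chern_laplacian gg JJ (HF \<kappa> \<mu> c)) 0"
    unfolding forms_eq_zero_iff[OF local_bott_chern s] lift_descend[OF invariant_hform] by (rule bott_chern_hform)
  moreover have "\<forall>c\<in>AA. \<forall>x\<in>fst c. of_bidegree (JJ x) 1 1 (HF \<kappa> \<mu> c x)"
    using type11_hform[of _ \<kappa> \<mu>] by (simp add: descend_form_def)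
  ultimately show "\<alpha> \<in> bott_chern_harmonic AA JF GF 1 1"
    using s by (simp add: \<alpha> bott_chern_harmonic_def pq_forms_def)
qed

lemma asd_set: "asd_harmonic AA JF GF = {HF 0 (of_real r) | r. True}"
proof (intro subset_antisym subsetI)
  fix \<alpha> assume "\<alpha> \<in> asd_harmonic AA JF GF"
  then have \<alpha>: "\<alpha> \<in> smooth_forms AA" and deg: "\<And>c x. has_degree 2 (\<alpha> c x)" and re: "\<And>c x. range (\<alpha> c x) \<subseteq> \<real>"
    and z: "forms_eq AA (\<lambda>c. hodge_laplacian gg JJ (\<alpha> c)) 0"
    and asd: "forms_eq AA (\<lambda>c. star gg JJ (\<alpha> c)) (- \<alpha>)"
    by (simp_all add: asd_harmonic_def real_k_forms_def split_paired_All[symmetric] del: split_paired_All)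
  note inv = invariant_pform[OF invariant_lift_form[OF \<alpha>]]
  have l: "has_degree 2 (lift_form \<alpha> x)" "range (lift_form \<alpha> x) \<subseteq> \<real>" for x
    using deg re by (simp_all add: lift_form_def)
  have "star gg JJ (lift_form \<alpha>) = (\<lambda>x vs. - lift_form \<alpha> x vs)"
  proof (rule ext)
    fix x
    obtain c where c: "c \<in> AA" "x \<in> fst c" using chart_exists by blast
    then show "star gg JJ (lift_form \<alpha>) x = (\<lambda>vs. - lift_form \<alpha> x vs)"
      using asd local_on_chart[OF local_star \<alpha> c] lift_form_eq[OF \<alpha> c] by (simp add: forms_eq_def fun_eq_iff)
  qed
  from asd_harmonic_classification[OF inv(1) l(1) _ this inv(2)]
  have "lift_form \<alpha> = hform 0 (lift_form \<alpha> 0 [e0,e3])"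
    using forms_eq_zero_iff[OF local_hodge \<alpha>] z by blast
  moreover obtain r where "lift_form \<alpha> 0 [e0,e3] = of_real r" using l(2)[of 0] by (auto elim: Reals_cases)
  ultimately have "\<alpha> = HF 0 (of_real r)" using descend_lift[OF \<alpha>] by simp
  then show "\<alpha> \<in> {HF 0 (of_real r) | r. True}" by blast
next
  fix \<alpha> assume "\<alpha> \<in> {HF 0 (of_real r) | r. True}"
  then obtain r where \<alpha>: "\<alpha> = HF 0 (of_real r)" by blast
  have s: "HF 0 (of_real r) \<in> smooth_forms AA" by (rule descend_smooth[OF invariant_hform])
  have "forms_eq AA (\<lambda>c. hodge_laplacian gg JJ (HF 0 (of_real r) c)) 0"
    unfolding forms_eq_zero_iff[OF local_hodge s] lift_descend[OF invariant_hform] by (rule hodge_asd)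
  moreover have "forms_eq AA (\<lambda>c. star gg JJ (HF 0 (of_real r) c)) (- HF 0 (of_real r))"
    unfolding forms_eq_def
    by (simp add: local_on_chart_descend[OF local_star] star_asd) (simp add: descend_form_def fun_eq_iff)
  moreover have "hform 0 (of_real r) x vs \<in> \<real>" for x vs
  proof -
    have "wedge (cov (\<lambda>v. complex_of_real (v \<bullet> a))) (cov (\<lambda>v. of_real (v \<bullet> b))) vs \<in> \<real>" for a b
      unfolding wedge_def by (intro sum_in_Reals Reals_mult Reals_power) (auto simp: cov_def)
    then show ?thesis by (simp add: hform_def Reals_diff Reals_mult)
  qed
  then have "HF 0 (of_real r) \<in> real_k_forms AA 2"
    using s has_degree_hform[of 0 "of_real r"]
    by (auto simp: real_k_forms_def descend_form_def has_degree_def)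
  ultimately show "\<alpha> \<in> asd_harmonic AA JF GF"
    by (simp add: \<alpha> asd_harmonic_def)
qed

lemma HF_eq_iff: "HF \<kappa> \<mu> = HF \<kappa>' \<mu>' \<longleftrightarrow> \<kappa> = \<kappa>' \<and> \<mu> = \<mu>'"
proof
  assume e: "HF \<kappa> \<mu> = HF \<kappa>' \<mu>'"
  obtain c where c: "c \<in> AA" "0 \<in> fst c" using chart_exists by blast
  have "hform \<kappa> \<mu> 0 = hform \<kappa>' \<mu>' 0"
    using fun_cong[OF fun_cong[OF e, of c], of 0] c by (simp add: descend_form_def)
  then have "hform \<kappa> \<mu> 0 [e0,e1] = hform \<kappa>' \<mu>' 0 [e0,e1]" "hform \<kappa> \<mu> 0 [e0,e3] = hform \<kappa>' \<mu>' 0 [e0,e3]"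
    by simp_all
  then show "\<kappa> = \<kappa>' \<and> \<mu> = \<mu>'" unfolding hform_E by simp
qed auto

lemma HF_linear:
  "HF \<kappa> \<mu> + HF \<kappa>' \<mu>' = HF (\<kappa> + \<kappa>') (\<mu> + \<mu>')" "complex_scale z (HF \<kappa> \<mu>) = HF (z * \<kappa>) (z * \<mu>)"
  "real_scale r (HF \<kappa> \<mu>) = HF (of_real r * \<kappa>) (of_real r * \<mu>)"
  by (auto simp: fun_eq_iff descend_form_def hform_def complex_scale_def real_scale_def algebra_simps)

lemma HF_zero: "HF 0 0 = 0"
  by (auto simp: fun_eq_iff descend_form_def hform_def)

lemma h_BC_X: "h_BC AA JF GF 1 1 = 2"
proof -
  interpret V: vector_space "complex_scale :: complex \<Rightarrow> ((complex^2) set, complex^2) form \<Rightarrow> _"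
    by (rule vector_space_complex_scale)
  have span1: "V.span {HF 0 1} = {HF 0 \<mu> | \<mu>. True}"
    by (auto simp: V.span_singleton HF_linear)
  have ne: "HF 1 0 \<notin> V.span {HF 0 1}" unfolding span1 by (auto simp: HF_eq_iff)
  have "HF 0 1 \<notin> V.span {}" by (simp add: HF_zero[symmetric] HF_eq_iff del: HF_zero)
  then have ind: "V.independent {HF 1 0, HF 0 1}"
    using ne by (simp add: V.independent_insert)
  show ?thesis
    unfolding h_BC_def bott_chern_set
  proof (rule V.dim_unique[OF _ _ ind])
    show "{HF \<kappa> \<mu> |\<kappa> \<mu>. True} \<subseteq> V.span {HF 1 0, HF 0 1}"
    proof
      fix \<alpha> assume "\<alpha> \<in> {HF \<kappa> \<mu> |\<kappa> \<mu>. True}"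
      then obtain \<kappa> \<mu> where "\<alpha> = complex_scale \<kappa> (HF 1 0) + complex_scale \<mu> (HF 0 1)" by (auto simp: HF_linear)
      then show "\<alpha> \<in> V.span {HF 1 0, HF 0 1}" by (simp add: V.span_add V.span_scale V.span_base)
    qed
  qed (auto simp: HF_eq_iff)
qed

lemma b_minus_X: "b_minus AA JF GF = 1"
proof -
  interpret V: vector_space "real_scale :: real \<Rightarrow> ((complex^2) set, complex^2) form \<Rightarrow> _"
    by (rule vector_space_real_scale)
  have "HF 0 1 \<notin> V.span {}" by (simp add: HF_zero[symmetric] HF_eq_iff del: HF_zero)
  then have ind: "V.independent {HF 0 1}" by (simp add: V.independent_insert)
  show ?thesis
    unfolding b_minus_def asd_set
  proof (rule V.dim_unique[OF _ _ ind])
    show "{HF 0 (of_real r) |r. True} \<subseteq> V.span {HF 0 1}"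
      by (auto simp: V.span_singleton HF_linear)
    show "{HF 0 1} \<subseteq> {HF 0 (of_real r) |r. True}" by (auto intro!: exI[of _ 1])
  qed simp
qed

theorem mainTheorem6:
  shows "\<exists>(X :: (complex^2) set topology) (A :: ((complex^2) set, complex^2) chart set) J g.
    hyperelliptic_surface X A \<and> smooth_manifold X A \<and>
    almost_complex_structure A J \<and> \<not> integrable_acs A J \<and>
    strictly_lcaK A J g \<and>
    h_BC A J g 1 1 = b_minus A J g + 1"
  by (rule exI[of _ XX], rule exI[of _ AA], rule exI[of _ JF], rule exI[of _ GF])
    (simp add: hyperelliptic_X Q.smooth_manifold_quotient acs_X not_integrable_X lcaK_X h_BC_X b_minus_X del: One_nat_def)

end
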